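(* Let $n\ge1$ and $1\le k\le n$. Let $\mathbf W,\mathbf I,\mathbf s$ be the cubical Whitney map, cubical integration map and cubical Dupont homotopy of the $n$-cube $\square^n$; let $\overset{\star}{\mathbf W},\overset{\star}{\mathbf I},\overset{\star}{\mathbf s}$ be those of the cubical subdivision $\star_{1,\dots,k}\square^n$; and let $\mathbf i^\star,\mathbf p^\star,\mathbf a^\star$ be the cubical welding inclusion, projection and homotopy on cubical cochains. Then $$\overset{\star}{\mathbf W}\mathbf i^\star:C^\bullet(\square^n)\to\Omega^\bullet(\star_{1,\dots,k}\square^n),\qquad \mathbf p^\star\overset{\star}{\mathbf I}:\Omega^\bullet(\star_{1,\dots,k}\square^n)\to C^\bullet(\square^n),\qquad \overset{\star}{\mathbf s}+\overset{\star}{\mathbf W}\mathbf a^\star\overset{\star}{\mathbf I}$$ (inclusion, projection, homotopy) form a deformation retraction of $\Omega^\bullet(\star_{1,\dots,k}\square^n)$ onto $C^\bullet(\square^n)$. Moreover, with $\Omega^\bullet(\square^n)\subset\Omega^\bullet(\star_{1,\dots,k}\square^n)$: $(\mathbf p^\star\overset{\star}{\mathbf I})|_{\Omega^\bullet(\square^n)}=\mathbf I$; $\overset{\star}{\mathbf W}\mathbf i^\star=\mathbf W$; and $X=(\overset{\star}{\mathbf W}\mathbf a^\star\overset{\star}{\mathbf I}+\overset{\star}{\mathbf s})|_{\Omega^\bullet(\square^n)}-\mathbf s$ is closed, i.e. $dX+Xd=0$.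
   Context: Deformation retraction of a cochain complex $B$ onto $A$: cochain maps $\iota:A\to B$ (inclusion), $\pi:B\to A$ (projection) and a degree $-1$ linear map $\eta:B\to B$ (homotopy) with $\pi\iota=1$ and $d\eta+\eta d=1-\iota\pi$. Tensor products of complexes and of graded maps use the Koszul sign rule. One-dimensional data. $\Delta^1$: vertices $e_0,e_1$, edge $[e_0,e_1]$, $|\Delta^1|=[0,1]$ with coordinate $t$. $\star\Delta^1$: vertices $e_0,e_\star,e_1$, edges $[e_0,e_\star],[e_\star,e_1]$, $|\star\Delta^1|=[0,1]$ with $e_\star$ at $1/2$. $C^\bullet$ denotes real cochains, $d\alpha=\alpha\circ\partial$, $\widehat\sigma$ the cochain dual to $\sigma$. $\Omega^\bullet(|\Delta^1|)$ = smooth forms on $[0,1]$; $\Omega^\bullet(|\star\Delta^1|)$ = forms smooth on $[0,1/2]$ and on $[1/2,1]$ with function parts agreeing at $1/2$. Integration maps $I$, $\overset{\star}I$: $\omega\mapsto\sum_\sigma\widehat\sigma\int_\sigma\omega$. Whitney maps: $W(\widehat e_0)=1-t$, $W(\widehat e_1)=t$, $W(\widehat{[e_0,e_1]})=dt$; $\overset{\star}W(\widehat e_\star)=2t\chi_{[0,1/2]}+(2-2t)\chi_{[1/2,1]}$, $\overset{\star}W(\widehat e_0)=(1-2t)\chi_{[0,1/2]}$, $\overset{\star}W(\widehat e_1)=(2t-1)\chi_{[1/2,1]}$, $\overset{\star}W(\widehat{[e_0,e_\star]})=2\chi_{[0,1/2]}dt$, $\overset{\star}W(\widehat{[e_\star,e_1]})=2\chi_{[1/2,1]}dt$.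 Dupont homotopies vanish on $0$-forms, and $s(g\,dt)=\int_0^tg\,du-t\int_0^1g\,du$, $\overset{\star}s(g\,dt)=[\int_0^tg\,du-2t\int_0^{1/2}g\,du]\chi_{[0,1/2]}+[\int_{1/2}^tg\,du-2(t-\frac12)\int_{1/2}^1g\,du]\chi_{[1/2,1]}$. Welding maps: $i^\star:\widehat e_0\mapsto\widehat e_0+\frac12\widehat e_\star,\ \widehat e_1\mapsto\widehat e_1+\frac12\widehat e_\star,\ \widehat{[e_0,e_1]}\mapsto\frac12(\widehat{[e_0,e_\star]}+\widehat{[e_\star,e_1]})$; $p^\star:\widehat e_0\mapsto\widehat e_0,\ \widehat e_1\mapsto\widehat e_1,\ \widehat e_\star\mapsto0,\ \widehat{[e_0,e_\star]},\widehat{[e_\star,e_1]}\mapsto\widehat{[e_0,e_1]}$; $a^\star:\widehat{[e_0,e_\star]}\mapsto\frac12\widehat e_\star,\ \widehat{[e_\star,e_1]}\mapsto-\frac12\widehat e_\star$, and $0$ on $0$-cochains. Cubes. $\square^n=(\Delta^1)^{\times n}$, $\star_{1,\dots,k}\square^n=(\star\Delta^1)^{\times k}\times(\Delta^1)^{\times(n-k)}$. $C^\bullet(\square^n)=C^\bullet(\Delta^1)^{\otimes n}$, $C^\bullet(\star_{1,\dots,k}\square^n)=C^\bullet(\star\Delta^1)^{\otimes k}\otimes C^\bullet(\Delta^1)^{\otimes(n-k)}$. $\Omega^\bullet(\square^n)=\Omega^\bullet(|\Delta^1|)^{\widehat\otimes n}$ (smooth forms on $[0,1]^n$) and $\Omega^\bullet(\star_{1,\dots,k}\square^n)=\Omega^\bullet(|\star\Delta^1|)^{\widehat\otimes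 k}\widehat\otimes\,\Omega^\bullet(|\Delta^1|)^{\widehat\otimes(n-k)}$ (piecewise smooth forms), where $\widehat\otimes$ is the completed projective tensor product; tensor products of continuous maps extend to it. Cubical maps. $\mathbf W=W^{\otimes n}$, $\mathbf I=I^{\otimes n}$, $\overset{\star}{\mathbf W}=(\overset{\star}W)^{\otimes k}\otimes W^{\otimes(n-k)}$, $\overset{\star}{\mathbf I}=(\overset{\star}I)^{\otimes k}\otimes I^{\otimes(n-k)}$. With $C_{r,n}=r!\,(n-1-r)!$, and $\epsilon=(\epsilon_1,\dots,\epsilon_{n-1})\in\{0,1\}^{n-1}$, $|\epsilon|=\sum\epsilon_i$: $$\mathbf s=\frac1{n!}\sum_\epsilon C_{|\epsilon|,n}\sum_{j=1}^n(WI)^{\epsilon_1}\otimes\dots\otimes(WI)^{\epsilon_{j-1}}\otimes s\otimes(WI)^{\epsilon_j}\otimes\dots\otimes(WI)^{\epsilon_{n-1}},$$ and $\overset{\star}{\mathbf s}$ is given by the same formula except that in each of the first $k$ tensor positions $W,I,s$ are replaced by $\overset{\star}W,\overset{\star}I,\overset{\star}s$. $\mathbf i^\star=(i^\star)^{\otimes k}\otimes1^{\otimes(n-k)}$, $\mathbf p^\star=(p^\star)^{\otimes k}\otimes1^{\otimes(n-k)}$, and $$\mathbf a^\star=\frac1{k!}\sum_{\sigma\in S_k}\tau_\sigma\circ\Big(\sum_{j=1}^k1^{\otimes(j-1)}\otimes a^\star\otimes(i^\star p^\star)^{\otimes(k-j)}\otimes1^{\otimes(n-k)}\Big)\circ\tau_\sigma^{-1},$$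 where $\tau_\sigma$ permutes the first $k$ tensor factors (with Koszul signs). *)

theory Defs
  imports
    "HOL-Analysis.Analysis"
    "HOL-Library.Function_Algebras"
    "HOL-Combinatorics.Permutations"
begin

section \<open>Graded complexes and deformation retractions\<close>

text \<open>Real-valued functions form a real vector space, pointwise.\<close>

instantiation "fun" :: (type, real_vector) real_vector
begin

definition scaleR_fun_def: "c *\<^sub>R f = (\<lambda>x. c *\<^sub>R f x)"

instance
  by standard (simp_all add: scaleR_fun_def fun_eq_iff scaleR_add_right scaleR_add_left)

end

text \<open>A complex is a family of subspaces \<open>grade C p\<close> (\<open>p\<close> an integer) of one ambient vector space
  with direct sum \<open>total_space C\<close>. Maps are functions on the ambient type of which only
  the values on \<open>total_space C\<close> matter.\<close>

record 'v complex_data =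
  grade :: "int \<Rightarrow> 'v set"
  diff :: "'v \<Rightarrow> 'v"

definition total_space :: "'v::real_vector complex_data \<Rightarrow> 'v set" where
  "total_space C = span (\<Union>p. grade C p)"

definition graded_map ::
  "int \<Rightarrow> 'v::real_vector complex_data \<Rightarrow> 'w::real_vector complex_data \<Rightarrow> ('v \<Rightarrow> 'w) \<Rightarrow> bool" where
  "graded_map r A B f \<longleftrightarrow>
     (\<forall>x\<in>total_space A. \<forall>y\<in>total_space A. f (x + y) = f x + f y) \<and>
     (\<forall>c. \<forall>x\<in>total_space A. f (c *\<^sub>R x) = c *\<^sub>R f x) \<and>
     (\<forall>p. f ` grade A p \<subseteq> grade B (p + r))"

definition cochain_complex :: "'v::real_vector complex_data \<Rightarrow> bool" where
  "cochain_complex C \<longleftrightarrow>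
     (\<forall>p. subspace (grade C p)) \<and>
     (\<forall>P x. finite P \<longrightarrow> (\<forall>p\<in>P. x p \<in> grade C p) \<longrightarrow> (\<Sum>p\<in>P. x p) = 0 \<longrightarrow> (\<forall>p\<in>P. x p = 0)) \<and>
     graded_map 1 C C (diff C) \<and>
     (\<forall>x\<in>total_space C. diff C (diff C x) = 0)"

definition cochain_map ::
  "'v::real_vector complex_data \<Rightarrow> 'w::real_vector complex_data \<Rightarrow> ('v \<Rightarrow> 'w) \<Rightarrow> bool" where
  "cochain_map A B f \<longleftrightarrow>
     graded_map 0 A B f \<and> (\<forall>x\<in>total_space A. f (diff A x) = diff B (f x))"

definition deformation_retraction ::
  "'v::real_vector complex_data \<Rightarrow> 'w::real_vector complex_data \<Rightarrow>
     ('v \<Rightarrow> 'w) \<Rightarrow> ('w \<Rightarrow> 'v) \<Rightarrow> ('w \<Rightarrow> 'w) \<Rightarrow> bool" where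
  "deformation_retraction A B \<iota> \<pi> \<eta> \<longleftrightarrow>
     cochain_complex A \<and> cochain_complex B \<and>
     cochain_map A B \<iota> \<and> cochain_map B A \<pi> \<and> graded_map (-1) B B \<eta> \<and>
     (\<forall>x\<in>total_space A. \<pi> (\<iota> x) = x) \<and>
     (\<forall>y\<in>total_space B. diff B (\<eta> y) + \<eta> (diff B y) = y - \<iota> (\<pi> y))"

section \<open>Tensor products of graded maps\<close>

text \<open>A graded space is presented as a space of functions \<open>'a \<Rightarrow> real\<close> on a set of coordinates, each
  coordinate carrying a degree; a function is homogeneous of degree \<open>p\<close> if it is supported on the
  coordinates of degree \<open>p\<close>. For cochains the coordinates are the cells. For forms in one variable
  they are the points together with a tag selecting the function part or the \<open>dt\<close>-coefficient.

  Elements of an \<open>n\<close>-fold (completed) tensor product are functions on lists of \<open>n\<close> coordinates; the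
  elementary tensor \<open>f\<^sub>1 \<otimes> \<dots> \<otimes> f\<^sub>n\<close> is \<open>[x\<^sub>1, \<dots>, x\<^sub>n] \<mapsto> f\<^sub>1 x\<^sub>1 * \<dots> * f\<^sub>n x\<^sub>n\<close>. Thus the value of a
  form at a list of coordinates is a value of one of its coefficients, where the \<open>dt\<^sub>i\<close> are taken in
  increasing order.

  A graded map is given as a pair of its degree and its action. The tensor product of a list of
  graded maps applies each map in its own variable, the other variables being parameters. On the
  spaces of (piecewise) smooth functions used below this is the continuous extension of the
  algebraic tensor product of the maps; see the lemma \<open>tensor_Cons_product\<close> for the sign rule.\<close>

type_synonym ('a, 'b) gmap = "int \<times> (('a \<Rightarrow> real) \<Rightarrow> ('b \<Rightarrow> real))"

fun tensor :: "('a \<Rightarrow> int) \<Rightarrow> ('a, 'b) gmap list \<Rightarrow> ('a list \<Rightarrow> real) \<Rightarrow> ('b list \<Rightarrow> real)" where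
  "tensor dg [] \<phi> [] = \<phi> []"
| "tensor dg ((r, T) # Ts) \<phi> (y # ys) =
     T (\<lambda>x. (-1) powi (sum_list (map fst Ts) * dg x) * tensor dg Ts (\<lambda>xs. \<phi> (x # xs)) ys) y"
| "tensor dg _ \<phi> _ = 0"

text \<open>The Koszul rule \<open>(T \<otimes> R) (f \<otimes> g) = (-1)\<^bsup>|R||f|\<^esup> T f \<otimes> R g\<close>, where \<open>R\<close> is the tensor product of
  the remaining maps.\<close>

lemma tensor_Cons_product:
  assumes "\<And>c. T (\<lambda>x. c * f x) = (\<lambda>y. c * T f y)"
    and "\<And>c. tensor dg Ts (\<lambda>xs. c * g xs) ys = c * tensor dg Ts g ys"
    and "\<And>x. f x \<noteq> 0 \<Longrightarrow> dg x = p"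
  shows "tensor dg ((r, T) # Ts) (\<lambda>xs. f (hd xs) * g (tl xs)) (y # ys) =
    (-1) powi (sum_list (map fst Ts) * p) * (T f y * tensor dg Ts g ys)"
proof -
  let ?c = "(-1) powi (sum_list (map fst Ts) * p) * tensor dg Ts g ys"
  have "(-1) powi (sum_list (map fst Ts) * dg x) * (f x * tensor dg Ts g ys) = ?c * f x" for x
    by (cases "f x = 0") (use assms(3)[of x] in auto)
  then have "tensor dg ((r, T) # Ts) (\<lambda>xs. f (hd xs) * g (tl xs)) (y # ys) = T (\<lambda>x. ?c * f x) y"
    by (simp only: tensor.simps list.sel assms(2))
  also have "\<dots> = ?c * T f y"
    by (simp add: assms(1))
  finally show ?thesis
    by simp
qed

definition tdeg :: "('a \<Rightarrow> int) \<Rightarrow> 'a list \<Rightarrow> int" where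
  "tdeg dg xs = sum_list (map dg xs)"

definition tensor_derivation ::
  "('a \<Rightarrow> int) \<Rightarrow> nat \<Rightarrow> (nat \<Rightarrow> ('a \<Rightarrow> real) \<Rightarrow> ('a \<Rightarrow> real)) \<Rightarrow> ('a list \<Rightarrow> real) \<Rightarrow> ('a list \<Rightarrow> real)" where
  "tensor_derivation dg n D \<phi> =
     (\<Sum>j<n. tensor dg (replicate j (0, id) @ [(1, D j)] @ replicate (n - 1 - j) (0, id)) \<phi>)"

text \<open>\<open>tau dg \<sigma>\<close> moves the tensor factor in position \<open>i\<close> to position \<open>\<sigma> i\<close>, with the Koszul sign
  coming from the pairs of factors whose order is reversed.\<close>

definition koszul_sign :: "('a \<Rightarrow> int) \<Rightarrow> (nat \<Rightarrow> nat) \<Rightarrow> 'a list \<Rightarrow> real" where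
  "koszul_sign dg \<sigma> xs =
     (-1) powi (\<Sum>(i, j)\<in>{(i, j). i < j \<and> j < length xs \<and> \<sigma> j < \<sigma> i}. dg (xs ! i) * dg (xs ! j))"

definition tau :: "('a \<Rightarrow> int) \<Rightarrow> (nat \<Rightarrow> nat) \<Rightarrow> ('a list \<Rightarrow> real) \<Rightarrow> ('a list \<Rightarrow> real)" where
  "tau dg \<sigma> \<phi> ys = koszul_sign dg \<sigma> (permute_list \<sigma> ys) * \<phi> (permute_list \<sigma> ys)"

lemma tau_inv:
  assumes "\<sigma> permutes {..<length ys}"
  shows "tau dg (inv \<sigma>) (tau dg \<sigma> \<phi>) ys = \<phi> ys"
proof -
  let ?n = "length ys"
  define zs where "zs = permute_list (inv \<sigma>) ys"
  have inv: "inv \<sigma> permutes {..<?n}"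
    by (rule permutes_inv[OF assms])
  have len: "length zs = ?n"
    by (simp add: zs_def)
  have zs_nth: "zs ! i = ys ! inv \<sigma> i" if "i < ?n" for i
    unfolding zs_def by (rule permute_list_nth[OF inv that])
  have zs_back: "permute_list \<sigma> zs = ys"
    unfolding zs_def using permute_list_compose[OF assms, of "inv \<sigma>"]
    by (simp add: permutes_inv_o[OF assms])
  have lt: "\<sigma> i < ?n \<longleftrightarrow> i < ?n" "inv \<sigma> i < ?n \<longleftrightarrow> i < ?n" for i
    using permutes_in_image[OF assms, of i] permutes_in_image[OF inv, of i] by simp_all
  have "(\<Sum>(i, j)\<in>{(i, j). i < j \<and> j < ?n \<and> inv \<sigma> j < inv \<sigma> i}. dg (zs ! i) * dg (zs ! j)) =
      (\<Sum>(i, j)\<in>{(i, j). i < j \<and> j < ?n \<and> \<sigma> j < \<sigma> i}. dg (ys ! i) * dg (ys ! j))"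
    by (rule sum.reindex_bij_witness[where i = "\<lambda>(i, j). (\<sigma> j, \<sigma> i)" and j = "\<lambda>(i, j). (inv \<sigma> j, inv \<sigma> i)"])
      (auto simp: lt zs_nth permutes_inverses[OF assms] mult.commute intro: less_trans)
  then have sgn: "koszul_sign dg (inv \<sigma>) zs = koszul_sign dg \<sigma> ys"
    by (simp add: koszul_sign_def len)
  have "koszul_sign dg \<sigma> ys * koszul_sign dg \<sigma> ys = 1"
    by (simp add: koszul_sign_def flip: power_int_add power_int_mult_distrib)
  then show ?thesis
    unfolding tau_def zs_def[symmetric] zs_back sgn by (simp flip: mult.assoc)
qed

section \<open>The interval and its subdivision\<close>

subsection \<open>Cochains\<close>

datatype cell = E0 | E1 | Estar | E01 | E0star | Estar1

fun cell_deg :: "cell \<Rightarrow> int" where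
  "cell_deg E0 = 0"
| "cell_deg E1 = 0"
| "cell_deg Estar = 0"
| "cell_deg E01 = 1"
| "cell_deg E0star = 1"
| "cell_deg Estar1 = 1"

definition cells :: "cell set" where
  "cells = {E0, E1, E01}"

definition cells_star :: "cell set" where
  "cells_star = {E0, Estar, E1, E0star, Estar1}"

fun dC :: "(cell \<Rightarrow> real) \<Rightarrow> (cell \<Rightarrow> real)" where
  "dC \<alpha> E01 = \<alpha> E1 - \<alpha> E0"
| "dC \<alpha> _ = 0"

fun dC_star :: "(cell \<Rightarrow> real) \<Rightarrow> (cell \<Rightarrow> real)" where
  "dC_star \<alpha> E0star = \<alpha> Estar - \<alpha> E0"
| "dC_star \<alpha> Estar1 = \<alpha> E1 - \<alpha> Estar"
| "dC_star \<alpha> _ = 0"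

subsection \<open>Forms\<close>

text \<open>Function parts and \<open>dt\<close>-coefficients of forms are recorded separately on each closed piece; a form on
  the subdivided interval has two values of its \<open>dt\<close>-coefficient at \<open>1/2\<close>, one for each half. Functions on
  \<open>pos\<close> representing forms vanish outside of \<open>pos_plain\<close> or \<open>pos_star\<close>.\<close>

datatype piece = Whole | Left | Right

fun ivl :: "piece \<Rightarrow> real set" where
  "ivl Whole = {0..1}"
| "ivl Left = {0..1/2}"
| "ivl Right = {1/2..1}"

datatype pos = Val piece real | Dt piece real

fun pos_deg :: "pos \<Rightarrow> int" where
  "pos_deg (Val _ _) = 0"
| "pos_deg (Dt _ _) = 1"

definition comps :: "(real \<Rightarrow> pos) set" where
  "comps = {Val Whole, Dt Whole}"

definition comps_star :: "(real \<Rightarrow> pos) set" where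
  "comps_star = {Val Left, Val Right, Dt Left, Dt Right}"

fun in_piece :: "pos \<Rightarrow> bool" where
  "in_piece (Val p t) \<longleftrightarrow> t \<in> ivl p"
| "in_piece (Dt p t) \<longleftrightarrow> t \<in> ivl p"

definition pos_plain :: "pos set" where
  "pos_plain = {c t | c t. c \<in> comps \<and> in_piece (c t)}"

definition pos_star :: "pos set" where
  "pos_star = {c t | c t. c \<in> comps_star \<and> in_piece (c t)}"

fun dF :: "(pos \<Rightarrow> real) \<Rightarrow> (pos \<Rightarrow> real)" where
  "dF \<omega> (Val p t) = 0"
| "dF \<omega> (Dt p t) =
     (if t \<in> ivl p then vector_derivative (\<lambda>u. \<omega> (Val p u)) (at t within ivl p) else 0)"

text \<open>The inclusion of the forms on the interval into those on its subdivision.\<close>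

fun res :: "(pos \<Rightarrow> real) \<Rightarrow> (pos \<Rightarrow> real)" where
  "res \<omega> (Val Whole t) = 0"
| "res \<omega> (Dt Whole t) = 0"
| "res \<omega> (Val p t) = (if t \<in> ivl p then \<omega> (Val Whole t) else 0)"
| "res \<omega> (Dt p t) = (if t \<in> ivl p then \<omega> (Dt Whole t) else 0)"

subsection \<open>Integration, Whitney maps, Dupont homotopies\<close>

fun I_plain :: "(pos \<Rightarrow> real) \<Rightarrow> (cell \<Rightarrow> real)" where
  "I_plain \<omega> E0 = \<omega> (Val Whole 0)"
| "I_plain \<omega> E1 = \<omega> (Val Whole 1)"
| "I_plain \<omega> E01 = integral {0..1} (\<lambda>u. \<omega> (Dt Whole u))"
| "I_plain \<omega> _ = 0"

fun I_star :: "(pos \<Rightarrow> real) \<Rightarrow> (cell \<Rightarrow> real)" where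
  "I_star \<omega> E0 = \<omega> (Val Left 0)"
| "I_star \<omega> Estar = \<omega> (Val Left (1/2))"
| "I_star \<omega> E1 = \<omega> (Val Right 1)"
| "I_star \<omega> E0star = integral {0..1/2} (\<lambda>u. \<omega> (Dt Left u))"
| "I_star \<omega> Estar1 = integral {1/2..1} (\<lambda>u. \<omega> (Dt Right u))"
| "I_star \<omega> E01 = 0"

fun W_plain :: "(cell \<Rightarrow> real) \<Rightarrow> (pos \<Rightarrow> real)" where
  "W_plain \<alpha> (Val Whole t) = (if t \<in> {0..1} then \<alpha> E0 * (1 - t) + \<alpha> E1 * t else 0)"
| "W_plain \<alpha> (Dt Whole t) = (if t \<in> {0..1} then \<alpha> E01 else 0)"
| "W_plain \<alpha> _ = 0"

fun W_star :: "(cell \<Rightarrow> real) \<Rightarrow> (pos \<Rightarrow> real)" where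
  "W_star \<alpha> (Val Left t) = (if t \<in> {0..1/2} then \<alpha> E0 * (1 - 2 * t) + \<alpha> Estar * (2 * t) else 0)"
| "W_star \<alpha> (Val Right t) = (if t \<in> {1/2..1} then \<alpha> Estar * (2 - 2 * t) + \<alpha> E1 * (2 * t - 1) else 0)"
| "W_star \<alpha> (Dt Left t) = (if t \<in> {0..1/2} then \<alpha> E0star * 2 else 0)"
| "W_star \<alpha> (Dt Right t) = (if t \<in> {1/2..1} then \<alpha> Estar1 * 2 else 0)"
| "W_star \<alpha> _ = 0"

fun s_plain :: "(pos \<Rightarrow> real) \<Rightarrow> (pos \<Rightarrow> real)" where
  "s_plain \<omega> (Val Whole t) =
     (if t \<in> {0..1}
      then integral {0..t} (\<lambda>u. \<omega> (Dt Whole u)) - t * integral {0..1} (\<lambda>u. \<omega> (Dt Whole u))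
      else 0)"
| "s_plain \<omega> _ = 0"

fun s_star :: "(pos \<Rightarrow> real) \<Rightarrow> (pos \<Rightarrow> real)" where
  "s_star \<omega> (Val Left t) =
     (if t \<in> {0..1/2}
      then integral {0..t} (\<lambda>u. \<omega> (Dt Left u)) - 2 * t * integral {0..1/2} (\<lambda>u. \<omega> (Dt Left u))
      else 0)"
| "s_star \<omega> (Val Right t) =
     (if t \<in> {1/2..1}
      then integral {1/2..t} (\<lambda>u. \<omega> (Dt Right u))
             - 2 * (t - 1/2) * integral {1/2..1} (\<lambda>u. \<omega> (Dt Right u))
      else 0)"
| "s_star \<omega> _ = 0"

subsection \<open>Welding maps\<close>

text \<open>The formulas give the coefficients of the image cochain, i.e. they are the transposes of the
  values on the dual basis.\<close>

fun i_weld :: "(cell \<Rightarrow> real) \<Rightarrow> (cell \<Rightarrow> real)" where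
  "i_weld \<alpha> E0 = \<alpha> E0"
| "i_weld \<alpha> E1 = \<alpha> E1"
| "i_weld \<alpha> Estar = 1/2 * \<alpha> E0 + 1/2 * \<alpha> E1"
| "i_weld \<alpha> E0star = 1/2 * \<alpha> E01"
| "i_weld \<alpha> Estar1 = 1/2 * \<alpha> E01"
| "i_weld \<alpha> E01 = 0"

fun p_weld :: "(cell \<Rightarrow> real) \<Rightarrow> (cell \<Rightarrow> real)" where
  "p_weld \<alpha> E0 = \<alpha> E0"
| "p_weld \<alpha> E1 = \<alpha> E1"
| "p_weld \<alpha> E01 = \<alpha> E0star + \<alpha> Estar1"
| "p_weld \<alpha> _ = 0"

fun a_weld :: "(cell \<Rightarrow> real) \<Rightarrow> (cell \<Rightarrow> real)" where
  "a_weld \<alpha> Estar = 1/2 * \<alpha> E0star - 1/2 * \<alpha> Estar1"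
| "a_weld \<alpha> _ = 0"

section \<open>Cubes\<close>

text \<open>Everything is defined for the \<open>n\<close>-cube with the first \<open>k\<close> directions (positions \<open>0, \<dots>, k - 1\<close>)
  subdivided. The unsubdivided cube is the case \<open>k = 0\<close>.\<close>

abbreviation at_pos :: "nat \<Rightarrow> 'a \<Rightarrow> 'a \<Rightarrow> nat \<Rightarrow> 'a" where
  "at_pos k star plain i \<equiv> (if i < k then star else plain)"

subsection \<open>Complexes\<close>

definition cochains :: "nat \<Rightarrow> nat \<Rightarrow> (cell list \<Rightarrow> real) set" where
  "cochains n k =
     {\<alpha>. \<forall>xs. \<alpha> xs \<noteq> 0 \<longrightarrow> length xs = n \<and> (\<forall>i<n. xs ! i \<in> at_pos k cells_star cells i)}"

definition C_cube :: "nat \<Rightarrow> nat \<Rightarrow> (cell list \<Rightarrow> real) complex_data" where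
  "C_cube n k =
     \<lparr>grade = (\<lambda>p. {\<alpha> \<in> cochains n k. \<forall>xs. \<alpha> xs \<noteq> 0 \<longrightarrow> tdeg cell_deg xs = p}),
      diff = tensor_derivation cell_deg n (at_pos k dC_star dC)\<rparr>"

text \<open>Smoothness on a closed box: all iterated partial derivatives (one-sided at the boundary) exist and
  are continuous on the box. Only the coordinates \<open>t 0, \<dots>, t (n - 1)\<close> are relevant below.\<close>

definition smooth_on_box :: "nat \<Rightarrow> (nat \<Rightarrow> real set) \<Rightarrow> ((nat \<Rightarrow> real) \<Rightarrow> real) \<Rightarrow> bool" where
  "smooth_on_box n J f \<longleftrightarrow>
     (let B = {t. \<forall>i<n. t i \<in> J i} in
      \<exists>D :: nat list \<Rightarrow> (nat \<Rightarrow> real) \<Rightarrow> real.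
        D [] = f \<and>
        (\<forall>is \<in> lists {..<n}.
           continuous_on B (D is) \<and>
           (\<forall>i<n. \<forall>t\<in>B.
              ((\<lambda>u. D is (t(i := u))) has_real_derivative D (i # is) t) (at (t i) within J i))))"

text \<open>A form assigns to each choice \<open>c\<close> of a piece and of the function part or the \<open>dt\<^sub>i\<close>-part in each
  direction \<open>i\<close> a coefficient which is smooth on the corresponding closed box. In a
  subdivided direction the function parts on the two halves agree at \<open>1/2\<close>. This is the completed
  projective tensor product of the one-dimensional spaces of forms: each is a closed subspace of a
  finite sum of spaces of smooth functions on closed intervals, and those are nuclear.\<close>

definition forms :: "nat \<Rightarrow> nat \<Rightarrow> (pos list \<Rightarrow> real) set" where
  "forms n k =
     {\<omega>. (\<forall>xs. \<omega> xs \<noteq> 0 \<longrightarrow> length xs = n \<and> (\<forall>i<n. xs ! i \<in> at_pos k pos_star pos_plain i)) \<and>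
         (\<forall>c. (\<forall>i<n. c i \<in> at_pos k comps_star comps i) \<longrightarrow>
            smooth_on_box n (\<lambda>i. {t. in_piece (c i t)}) (\<lambda>t. \<omega> (map (\<lambda>i. c i (t i)) [0..<n]))) \<and>
         (\<forall>xs. \<forall>i<k. length xs = n \<longrightarrow> \<omega> (xs[i := Val Left (1/2)]) = \<omega> (xs[i := Val Right (1/2)]))}"

definition Omega_cube :: "nat \<Rightarrow> nat \<Rightarrow> (pos list \<Rightarrow> real) complex_data" where
  "Omega_cube n k =
     \<lparr>grade = (\<lambda>p. {\<omega> \<in> forms n k. \<forall>xs. \<omega> xs \<noteq> 0 \<longrightarrow> tdeg pos_deg xs = p}),
      diff = tensor_derivation pos_deg n (\<lambda>_. dF)\<rparr>"

definition incl_cube :: "nat \<Rightarrow> nat \<Rightarrow> (pos list \<Rightarrow> real) \<Rightarrow> (pos list \<Rightarrow> real)" where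
  "incl_cube n k = tensor pos_deg (replicate k (0, res) @ replicate (n - k) (0, id))"

subsection \<open>Cubical Whitney and integration maps and Dupont homotopy\<close>

definition W_cube :: "nat \<Rightarrow> nat \<Rightarrow> (cell list \<Rightarrow> real) \<Rightarrow> (pos list \<Rightarrow> real)" where
  "W_cube n k = tensor cell_deg (replicate k (0, W_star) @ replicate (n - k) (0, W_plain))"

definition I_cube :: "nat \<Rightarrow> nat \<Rightarrow> (pos list \<Rightarrow> real) \<Rightarrow> (cell list \<Rightarrow> real)" where
  "I_cube n k = tensor pos_deg (replicate k (0, I_star) @ replicate (n - k) (0, I_plain))"

definition C_coeff :: "nat \<Rightarrow> nat \<Rightarrow> real" where
  "C_coeff r n = fact r * fact (n - 1 - r)"

definition s_factor :: "nat \<Rightarrow> nat list \<Rightarrow> nat \<Rightarrow> nat \<Rightarrow> (pos, pos) gmap" where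
  "s_factor k \<epsilon> j i =
     (let WI = at_pos k (W_star \<circ> I_star) (W_plain \<circ> I_plain) i in
      if i < j then (0, WI ^^ (\<epsilon> ! i))
      else if i = j then (-1, at_pos k s_star s_plain i)
      else (0, WI ^^ (\<epsilon> ! (i - 1))))"

definition s_cube :: "nat \<Rightarrow> nat \<Rightarrow> (pos list \<Rightarrow> real) \<Rightarrow> (pos list \<Rightarrow> real)" where
  "s_cube n k \<omega> =
     (1 / fact n) *\<^sub>R
       (\<Sum>\<epsilon>\<in>{\<epsilon>. set \<epsilon> \<subseteq> {0, 1} \<and> length \<epsilon> = n - 1}.
          C_coeff (sum_list \<epsilon>) n *\<^sub>R (\<Sum>j<n. tensor pos_deg (map (s_factor k \<epsilon> j) [0..<n]) \<omega>))"

subsection \<open>Cubical welding maps\<close>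

definition i_cube :: "nat \<Rightarrow> nat \<Rightarrow> (cell list \<Rightarrow> real) \<Rightarrow> (cell list \<Rightarrow> real)" where
  "i_cube n k = tensor cell_deg (replicate k (0, i_weld) @ replicate (n - k) (0, id))"

definition p_cube :: "nat \<Rightarrow> nat \<Rightarrow> (cell list \<Rightarrow> real) \<Rightarrow> (cell list \<Rightarrow> real)" where
  "p_cube n k = tensor cell_deg (replicate k (0, p_weld) @ replicate (n - k) (0, id))"

definition a_cube :: "nat \<Rightarrow> nat \<Rightarrow> (cell list \<Rightarrow> real) \<Rightarrow> (cell list \<Rightarrow> real)" where
  "a_cube n k \<alpha> =
     (1 / fact k) *\<^sub>R
       (\<Sum>\<sigma>\<in>{\<sigma>. \<sigma> permutes {..<k}}.
          tau cell_deg \<sigma>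
            (\<Sum>j<k. tensor cell_deg
                (replicate j (0, id) @ [(-1, a_weld)] @ replicate (k - 1 - j) (0, i_weld \<circ> p_weld)
                   @ replicate (n - k) (0, id))
                (tau cell_deg (inv \<sigma>) \<alpha>)))"

end

theory Submission
  imports Defs
begin

text \<open>Each one-dimensional map is, in every chart of its target, built from evaluations, derivatives,
  integrals and indefinite integrals in one variable by linear combinations and multiplication by the
  coordinate. Two such maps acting in different variables of a smooth form commute: integrals by
  Fubini, and derivatives because integrals do, by the fundamental theorem of calculus. Hence tensor
  products of graded maps compose factor by factor with Koszul signs, and the one-dimensional identities
  pass to the cube: a tensor product with a contraction \<open>h\<close> of one factor, \<open>dh + hd = 1 - \<pi>\<close>, and cochain
  maps in the others has as commutator with \<open>d\<close> the difference of the products with \<open>1\<close> and with \<open>\<pi>\<close> in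
  that factor. For the Dupont homotopy and the welding homotopy these differences telescope to
  \<open>1 - WI\<close> and \<open>1 - ip\<close>, and transporting the latter along \<open>W\<close> and \<open>I\<close> gives
  \<open>(1 - WI) + W(1 - ip)I = 1 - WipI\<close>. The closedness of \<open>X\<close> follows by subtracting the two homotopy identities
  on the forms of the unsubdivided cube.\<close>

section \<open>Smooth functions on a box\<close>

text \<open>Forms are functions on lists of coordinates, so identities are not extended from
  elementary tensors by density: composition of tensor products is proved on every smooth form. A
  tensor product is therefore split into operators acting one slot at a time. Its Koszul sign
  becomes part of each slot operator: the factor in slot \<open>i\<close> is precomposed with the
  sign by which its source coordinate passes the factors to its right.

  Splitting maps between different types produces lists that are partly source and partly target,
  hence a detour through a sum type.

  The weights of the Dupont homotopy come from an average. Fix an order of the \<open>n\<close>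
  slots and replace the identity by \<open>WI\<close> in one slot after another; this gives a
  telescoping homotopy. Exactly \<open>r! (n-1-r)!\<close> orders put \<open>r\<close> prescribed
  slots before slot \<open>j\<close> and the remaining ones after it, so
  \<open>C_coeff r n / fact n\<close> is the frequency of that summand. The welding homotopy is
  symmetrised in the same spirit, with explicit permutations. Every permuted summand is already a
  homotopy from \<open>1\<close> to \<open>ip\<close>, because \<open>ip\<close> has the same factor
  in each subdivided slot; the average inherits this.\<close>

definition bx :: "nat \<Rightarrow> (nat \<Rightarrow> real set) \<Rightarrow> (nat \<Rightarrow> real) set" where
  "bx n J = {t. \<forall>i<n. t i \<in> J i}"

definition has_pd :: "nat \<Rightarrow> (nat \<Rightarrow> real set) \<Rightarrow> nat \<Rightarrow> ((nat \<Rightarrow> real) \<Rightarrow> real) \<Rightarrow> ((nat \<Rightarrow> real) \<Rightarrow> real) \<Rightarrow> bool" where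
  "has_pd n J i f g \<longleftrightarrow>
     (\<forall>t\<in>bx n J. ((\<lambda>u. f (t(i := u))) has_real_derivative g t) (at (t i) within J i))"

text \<open>The greatest fixed point replaces a whole family of iterated derivatives by one
  derivative at a time. A closure property then only requires a class of functions that is stable
  under each partial derivative.\<close>

coinductive smooth :: "nat \<Rightarrow> (nat \<Rightarrow> real set) \<Rightarrow> ((nat \<Rightarrow> real) \<Rightarrow> real) \<Rightarrow> bool"
  for n J where
  "\<lbrakk>continuous_on (bx n J) f; \<forall>i<n. \<exists>g. smooth n J g \<and> has_pd n J i f g\<rbrakk> \<Longrightarrow> smooth n J f"

lemma smooth_continuous: "smooth n J f \<Longrightarrow> continuous_on (bx n J) f"
  by (erule smooth.cases) simp

lemma smooth_pd:
  assumes "smooth n J f" "i < n" obtains g where "smooth n J g" "has_pd n J i f g"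
  using assms by (auto elim: smooth.cases)

text \<open>From a family indexed by words one reads off the coinduction invariant "some member of
  the family". Conversely, a derivative \<open>nx i g\<close> is chosen for every direction, and
  folding these choices along a word gives the family.\<close>

lemma smooth_on_box_iff: "smooth_on_box n J f \<longleftrightarrow> smooth n J f"
proof
  assume "smooth_on_box n J f"
  then obtain D where D0: "D [] = f" and D: "\<And>is. is \<in> lists {..<n} \<Longrightarrow> continuous_on (bx n J) (D is)"
    "\<And>is i. is \<in> lists {..<n} \<Longrightarrow> i < n \<Longrightarrow> has_pd n J i (D is) (D (i # is))"
    unfolding smooth_on_box_def Let_def bx_def has_pd_def by blast
  have "\<exists>is \<in> lists {..<n}. f = D is" using D0 by auto
  then show "smooth n J f"
    by (coinduction arbitrary: f) (auto intro!: D, metis D(2) in_listsI Cons_in_lists_iff in_lists_conv_set lessThan_iff)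
next
  assume f: "smooth n J f"
  define nx where "nx i g = (SOME h. smooth n J h \<and> has_pd n J i g h)" for i g
  have nx: "smooth n J (nx i g) \<and> has_pd n J i g (nx i g)" if g: "smooth n J g" "i < n" for i g
  proof -
    obtain h where "smooth n J h \<and> has_pd n J i g h" using smooth_pd[OF g] by metis
    then show ?thesis unfolding nx_def by (rule someI[where P = "\<lambda>h. smooth n J h \<and> has_pd n J i g h"])
  qed
  have s: "smooth n J (foldr nx is f)" if "is \<in> lists {..<n}" for "is"
    using that by induction (auto simp: f nx)
  show "smooth_on_box n J f"
    unfolding smooth_on_box_def Let_def
  proof (intro exI[of _ "\<lambda>is. foldr nx is f"] conjI ballI allI impI)
    fix "is" assume "is": "is \<in> lists {..<n}"
    show "continuous_on {t. \<forall>i<n. t i \<in> J i} (foldr nx is f)"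
      using smooth_continuous[OF s[OF "is"]] by (simp add: bx_def)
    fix i t assume "i < n" "t \<in> {t. \<forall>i<n. t i \<in> J i}"
    then show "((\<lambda>u. foldr nx is f (t(i := u))) has_real_derivative foldr nx (i # is) f t) (at (t i) within J i)"
      using nx[OF s[OF "is"] \<open>i < n\<close>] by (simp add: bx_def has_pd_def)
  qed simp
qed

text \<open>A derivative may leave the class \<open>P\<close> as soon as it is known to be smooth,
  as happens with the constant zero in \<open>smooth_eval\<close> and with the integrand in
  \<open>smooth_integral_upto\<close>.\<close>

lemma smooth_coinduct:
  assumes "P f" and "\<And>f. P f \<Longrightarrow> continuous_on (bx n J) f"
    and "\<And>f i. P f \<Longrightarrow> i < n \<Longrightarrow> \<exists>g. (P g \<or> smooth n J g) \<and> has_pd n J i f g"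
  shows "smooth n J f"
  using assms(1)
proof (coinduction arbitrary: f)
  case (smooth f)
  then show ?case using assms(2,3) by blast
qed

lemma bx_upd: "t \<in> bx n J \<Longrightarrow> u \<in> J i \<Longrightarrow> t(i := u) \<in> bx n J"
  by (simp add: bx_def)

lemma bx_upd': "t \<in> bx n (J(i := K)) \<Longrightarrow> u \<in> L \<Longrightarrow> t(i := u) \<in> bx n (J(i := L))"
  unfolding bx_def by auto

lemma bx_coord: "t \<in> bx n J \<Longrightarrow> i < n \<Longrightarrow> t i \<in> J i"
  by (simp add: bx_def)

lemma has_pd_D:
  "has_pd n J i f g \<Longrightarrow> t \<in> bx n J \<Longrightarrow> ((\<lambda>u. f (t(i := u))) has_real_derivative g t) (at (t i) within J i)"
  by (simp add: has_pd_def)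

text \<open>The difference quotients at a point of the box only involve points of the box, so values
  elsewhere are free.\<close>

lemma has_pd_cong:
  assumes "has_pd n J i f g" "\<And>t. t \<in> bx n J \<Longrightarrow> f t = f' t" "\<And>t. t \<in> bx n J \<Longrightarrow> g t = g' t" "i < n"
  shows "has_pd n J i f' g'"
  unfolding has_pd_def
proof
  fix t assume t: "t \<in> bx n J"
  have "((\<lambda>u. f' (t(i := u))) has_real_derivative g t) (at (t i) within J i)"
    using has_pd_D[OF assms(1) t] zero_less_one bx_coord[OF t assms(4)]
    by (rule has_field_derivative_transform_within[where g = "\<lambda>u. f' (t(i := u))"])
      (simp add: assms(2) bx_upd t)
  then show "((\<lambda>u. f' (t(i := u))) has_real_derivative g' t) (at (t i) within J i)"
    using assms(3)[OF t] by simp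
qed

lemma smooth_cong:
  assumes "smooth n J f" "\<And>t. t \<in> bx n J \<Longrightarrow> f t = f' t"
  shows "smooth n J f'"
proof (rule smooth_coinduct[where P = "\<lambda>f'. \<exists>f. smooth n J f \<and> (\<forall>t\<in>bx n J. f t = f' t)"])
  show "\<exists>f. smooth n J f \<and> (\<forall>t\<in>bx n J. f t = f' t)" using assms by auto
next
  fix g assume "\<exists>f. smooth n J f \<and> (\<forall>t\<in>bx n J. f t = g t)"
  then obtain f where f: "smooth n J f" "\<forall>t\<in>bx n J. f t = g t" by blast
  then show "continuous_on (bx n J) g"
    using continuous_on_cong[of "bx n J" "bx n J" f g] smooth_continuous[OF f(1)] by simp
next
  fix g i assume "\<exists>f. smooth n J f \<and> (\<forall>t\<in>bx n J. f t = g t)" and i: "i < n"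
  then obtain f where f: "smooth n J f" "\<forall>t\<in>bx n J. f t = g t" by blast
  obtain h where h: "smooth n J h" "has_pd n J i f h" using smooth_pd[OF f(1) i] by metis
  have "has_pd n J i g h"
    using has_pd_cong[OF h(2) _ refl i] f(2) by simp
  with h(1) show "\<exists>h. ((\<exists>f. smooth n J f \<and> (\<forall>t\<in>bx n J. f t = h t)) \<or> smooth n J h) \<and> has_pd n J i g h"
    by auto
qed

lemma has_pd_const: "has_pd n J i (\<lambda>_. c) (\<lambda>_. 0)"
  by (simp add: has_pd_def)

lemma smooth_const: "smooth n J (\<lambda>_. c)"
proof (rule smooth_coinduct[where P = "\<lambda>f. \<exists>c. f = (\<lambda>_. c)"])
  fix f :: "(nat \<Rightarrow> real) \<Rightarrow> real" and i assume "\<exists>c. f = (\<lambda>_. c)"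
  then have "has_pd n J i f (\<lambda>_. 0)" using has_pd_const by auto
  then show "\<exists>g. ((\<exists>c. g = (\<lambda>_. c)) \<or> smooth n J g) \<and> has_pd n J i f g" by blast
qed auto

lemma has_pd_lin:
  assumes "has_pd n J i f f'" "has_pd n J i g g'"
  shows "has_pd n J i (\<lambda>t. a * f t + b * g t) (\<lambda>t. a * f' t + b * g' t)"
  unfolding has_pd_def
  by (intro ballI DERIV_add DERIV_cmult has_pd_D[OF assms(1)] has_pd_D[OF assms(2)])

lemma smooth_lin:
  assumes "smooth n J f" "smooth n J g"
  shows "smooth n J (\<lambda>t. a * f t + b * g t)"
proof (rule smooth_coinduct[where P = "\<lambda>h. \<exists>f g. smooth n J f \<and> smooth n J g \<and> h = (\<lambda>t. a * f t + b * g t)"])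
  fix h assume "\<exists>f g. smooth n J f \<and> smooth n J g \<and> h = (\<lambda>t. a * f t + b * g t)"
  then obtain f g where h: "smooth n J f" "smooth n J g" "h = (\<lambda>t. a * f t + b * g t)" by blast
  show "continuous_on (bx n J) h" unfolding h(3)
    by (intro continuous_on_add continuous_on_mult continuous_on_const smooth_continuous h)
  fix i assume i: "i < n"
  obtain f' where f': "smooth n J f'" "has_pd n J i f f'" using smooth_pd[OF h(1) i] by metis
  obtain g' where g': "smooth n J g'" "has_pd n J i g g'" using smooth_pd[OF h(2) i] by metis
  show "\<exists>k. ((\<exists>f g. smooth n J f \<and> smooth n J g \<and> k = (\<lambda>t. a * f t + b * g t)) \<or> smooth n J k) \<and> has_pd n J i h k"
    using has_pd_lin[OF f'(2) g'(2), of a b] f'(1) g'(1) unfolding h(3) by blast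
qed (use assms in blast)

lemma smooth_add: "smooth n J f \<Longrightarrow> smooth n J g \<Longrightarrow> smooth n J (\<lambda>t. f t + g t)"
  using smooth_lin[of n J f g 1 1] by simp

lemma continuous_coord: "continuous_on S (\<lambda>t :: nat \<Rightarrow> real. t j)"
  by (rule continuous_on_subset[OF continuous_on_product_coordinates]) simp

text \<open>Multiples \<open>t j * f\<close> alone are not stable under differentiation, since the
  product rule in direction \<open>j\<close> adds the summand \<open>f\<close>. With a second smooth
  summand the class is stable.\<close>

lemma smooth_mult_coord_add:
  assumes "smooth n J f" "smooth n J g"
  shows "smooth n J (\<lambda>t. t j * f t + g t)"
proof (rule smooth_coinduct[where P = "\<lambda>h. \<exists>f g. smooth n J f \<and> smooth n J g \<and> h = (\<lambda>t. t j * f t + g t)"])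
  fix h assume "\<exists>f g. smooth n J f \<and> smooth n J g \<and> h = (\<lambda>t. t j * f t + g t)"
  then obtain f g where h: "smooth n J f" "smooth n J g" "h = (\<lambda>t. t j * f t + g t)" by blast
  show "continuous_on (bx n J) h" unfolding h(3)
    by (intro continuous_on_add continuous_on_mult continuous_coord smooth_continuous h)
  fix i assume i: "i < n"
  obtain f' where f': "smooth n J f'" "has_pd n J i f f'" using smooth_pd[OF h(1) i] by metis
  obtain g' where g': "smooth n J g'" "has_pd n J i g g'" using smooth_pd[OF h(2) i] by metis
  show "\<exists>k. ((\<exists>f g. smooth n J f \<and> smooth n J g \<and> k = (\<lambda>t. t j * f t + g t)) \<or> smooth n J k) \<and> has_pd n J i h k"
  proof (cases "i = j")
    case True
    have "has_pd n J i h (\<lambda>t. t j * f' t + (f t + g' t))"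
      unfolding has_pd_def h(3)
    proof
      fix t assume t: "t \<in> bx n J"
      show "((\<lambda>u. (t(i := u)) j * f (t(i := u)) + g (t(i := u))) has_real_derivative
              t j * f' t + (f t + g' t)) (at (t i) within J i)"
        using DERIV_add[OF DERIV_mult[OF DERIV_ident has_pd_D[OF f'(2) t]] has_pd_D[OF g'(2) t]] True
        by (simp add: algebra_simps)
    qed
    then show ?thesis using smooth_add[OF h(1) g'(1)] f'(1) by blast
  next
    case False
    have "has_pd n J i h (\<lambda>t. t j * f' t + g' t)"
      unfolding has_pd_def h(3)
    proof
      fix t assume t: "t \<in> bx n J"
      show "((\<lambda>u. (t(i := u)) j * f (t(i := u)) + g (t(i := u))) has_real_derivative
              t j * f' t + g' t) (at (t i) within J i)"
        using DERIV_add[OF DERIV_cmult[OF has_pd_D[OF f'(2) t], of "t j"] has_pd_D[OF g'(2) t]] False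
        by simp
    qed
    then show ?thesis using g' f'(1) by blast
  qed
qed (use assms in blast)

lemma smooth_mult_coord: "smooth n J f \<Longrightarrow> smooth n J (\<lambda>t. t j * f t)"
  using smooth_mult_coord_add[OF _ smooth_const[of n J 0], of f j] by simp

lemma smooth_subset:
  assumes "smooth n J f" "\<And>i. i < n \<Longrightarrow> J' i \<subseteq> J i"
  shows "smooth n J' f"
proof (rule smooth_coinduct[where P = "smooth n J"])
  have bx: "bx n J' \<subseteq> bx n J" using assms(2) by (auto simp: bx_def)
  fix f assume f: "smooth n J f"
  show "continuous_on (bx n J') f"
    using smooth_continuous[OF f] bx by (rule continuous_on_subset)
  fix i assume i: "i < n"
  obtain g where g: "smooth n J g" "has_pd n J i f g" using smooth_pd[OF f i] by metis
  moreover have "has_pd n J' i f g"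
    using g(2) bx assms(2)[OF i] unfolding has_pd_def by (blast intro: DERIV_subset)
  ultimately show "\<exists>g. (smooth n J g \<or> smooth n J' g) \<and> has_pd n J' i f g" by blast
qed (rule assms)

lemma continuous_upd:
  assumes "continuous_on S F" "continuous_on S g"
  shows "continuous_on S (\<lambda>x. (F x :: nat \<Rightarrow> real)(i := g x))"
proof (rule continuous_on_coordinatewise_then_product)
  fix j
  show "continuous_on S (\<lambda>x. ((F x)(i := g x)) j)"
    using continuous_on_compose2[OF continuous_coord[of UNIV j] assms(1)] assms(2)
    by (cases "j = i") auto
qed

lemma continuous_upd2:
  assumes "continuous_on (bx n (J(i := K))) f"
  shows "continuous_on (bx n (J(i := L)) \<times> K) (\<lambda>(t, u). f (t(i := u)))"
  unfolding split_beta
  by (rule continuous_on_compose2[OF assms continuous_upd[OF continuous_on_fst continuous_on_snd]])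
    (auto intro: bx_upd' simp: continuous_on_id)

lemma continuous_slice:
  assumes "continuous_on (bx n (J(i := K))) f" "t \<in> bx n (J(i := L))"
  shows "continuous_on K (\<lambda>u. f (t(i := u)))"
  by (rule continuous_on_compose2[OF assms(1) continuous_upd[OF continuous_on_const continuous_on_id]])
    (auto intro: bx_upd'[OF assms(2)])

text \<open>The result is constant in direction \<open>i\<close>, so the side \<open>K\<close> of
  the box can be exchanged for any \<open>L\<close>. This is the change of chart that occurs when an
  operator maps one space to another in slot \<open>i\<close>.\<close>

lemma smooth_eval:
  assumes "smooth n (J(i := K)) f" "u \<in> K"
  shows "smooth n (J(i := L)) (\<lambda>t. f (t(i := u)))"
proof (rule smooth_coinduct[where P = "\<lambda>h. \<exists>f. smooth n (J(i := K)) f \<and> h = (\<lambda>t. f (t(i := u)))"])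
  fix h assume "\<exists>f. smooth n (J(i := K)) f \<and> h = (\<lambda>t. f (t(i := u)))"
  then obtain f where f: "smooth n (J(i := K)) f" and h: "h = (\<lambda>t. f (t(i := u)))" by blast
  show "continuous_on (bx n (J(i := L))) h"
    unfolding h
    by (rule continuous_on_compose2[OF smooth_continuous[OF f] continuous_upd[OF continuous_on_id continuous_on_const]])
      (auto intro: bx_upd'[OF _ assms(2)])
  fix j assume j: "j < n"
  show "\<exists>g. ((\<exists>f. smooth n (J(i := K)) f \<and> g = (\<lambda>t. f (t(i := u)))) \<or> smooth n (J(i := L)) g) \<and> has_pd n (J(i := L)) j h g"
  proof (cases "i = j")
    case True
    then have "has_pd n (J(i := L)) j h (\<lambda>t. 0)"
      by (simp add: has_pd_def h)
    then show ?thesis using smooth_const by blast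
  next
    case False
    obtain g where g: "smooth n (J(i := K)) g" "has_pd n (J(i := K)) j f g" using smooth_pd[OF f j] by metis
    have "has_pd n (J(i := L)) j h (\<lambda>t. g (t(i := u)))"
      unfolding has_pd_def
    proof
      fix t assume "t \<in> bx n (J(i := L))"
      then have "t(i := u) \<in> bx n (J(i := K))" by (rule bx_upd'[OF _ assms(2)])
      from has_pd_D[OF g(2) this] False
      show "((\<lambda>v. h (t(j := v))) has_real_derivative g (t(i := u))) (at (t j) within (J(i := L)) j)"
        unfolding h by (simp add: fun_upd_twist[of i j])
    qed
    then show ?thesis using g(1) by blast
  qed
qed (use assms in blast)

text \<open>Leibniz rule with the remaining coordinates fixed; it asks for joint continuity of the
  derivative and for a convex range of the parameter, which is where convexity of all charts
  enters.\<close>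

lemma has_pd_integral:
  assumes f: "smooth n (J(j := L)) f" and g: "smooth n (J(j := L)) g" "has_pd n (J(j := L)) i f g"
    and sub: "{p..q} \<subseteq> L" and "i \<noteq> j" "i < n" "convex (J i)"
  shows "has_pd n (J(j := L')) i (\<lambda>t. integral {p..q} (\<lambda>v. f (t(j := v)))) (\<lambda>t. integral {p..q} (\<lambda>v. g (t(j := v))))"
  unfolding has_pd_def
proof
  fix t assume t: "t \<in> bx n (J(j := L'))"
  have tu: "t(i := u, j := v) \<in> bx n (J(j := L))" if "u \<in> J i" "v \<in> L" for u v
    using t that \<open>i \<noteq> j\<close> by (auto simp: bx_def)
  have cont: "continuous_on (J i \<times> {p..q}) (\<lambda>(u, v). h (t(i := u, j := v)))" if h: "smooth n (J(j := L)) h" for h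
    unfolding split_beta
    by (rule continuous_on_compose2[OF smooth_continuous[OF h]])
      (use sub tu in \<open>auto intro!: continuous_upd continuous_on_fst continuous_on_snd continuous_on_id continuous_on_const\<close>)
  have "((\<lambda>u. integral (cbox p q) (\<lambda>v. f (t(i := u, j := v)))) has_field_derivative integral (cbox p q) (\<lambda>v. g (t(i := t i, j := v)))) (at (t i) within J i)"
  proof (rule leibniz_rule_field_derivative)
    fix u v assume u: "u \<in> J i" and v: "v \<in> cbox p q"
    then have "t(i := u, j := v) \<in> bx n (J(j := L))" using tu sub by auto
    from has_pd_D[OF g(2) this]
    show "((\<lambda>u. f (t(i := u, j := v))) has_real_derivative g (t(i := u, j := v))) (at u within J i)"
      using \<open>i \<noteq> j\<close> by (simp add: fun_upd_twist[of i j])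
  next
    fix u assume u: "u \<in> J i"
    have "continuous_on {p..q} (\<lambda>v. f (t(i := u, j := v)))"
      by (rule continuous_on_compose2[OF smooth_continuous[OF f] continuous_upd[OF continuous_on_const continuous_on_id]])
        (use sub tu[OF u] in auto)
    then show "(\<lambda>v. f (t(i := u, j := v))) integrable_on cbox p q"
      using integrable_continuous_interval by simp
  next
    show "continuous_on (J i \<times> cbox p q) (\<lambda>(u, v). g (t(i := u, j := v)))"
      using cont[OF g(1)] by simp
    show "t i \<in> J i" using bx_coord[OF t \<open>i < n\<close>] \<open>i \<noteq> j\<close> by simp
  qed fact
  then show "((\<lambda>u. integral {p..q} (\<lambda>v. f (t(i := u, j := v)))) has_real_derivative integral {p..q} (\<lambda>v. g (t(j := v)))) (at (t i) within (J(j := L')) i)"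
    using \<open>i \<noteq> j\<close> by simp
qed

lemma smooth_integral:
  assumes "smooth n (J(j := L)) f" and sub: "{p..q} \<subseteq> L" and J: "\<And>i. i < n \<Longrightarrow> convex (J i)"
  shows "smooth n (J(j := L')) (\<lambda>t. integral {p..q} (\<lambda>v. f (t(j := v))))"
proof (rule smooth_coinduct[where P = "\<lambda>h. \<exists>f. smooth n (J(j := L)) f \<and> h = (\<lambda>t. integral {p..q} (\<lambda>v. f (t(j := v))))"])
  fix h assume "\<exists>f. smooth n (J(j := L)) f \<and> h = (\<lambda>t. integral {p..q} (\<lambda>v. f (t(j := v))))"
  then obtain f where f: "smooth n (J(j := L)) f" and h: "h = (\<lambda>t. integral {p..q} (\<lambda>v. f (t(j := v))))" by blast
  have "continuous_on (bx n (J(j := L')) \<times> {p..q}) (\<lambda>(t, u). f (t(j := u)))"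
    by (rule continuous_on_subset[OF continuous_upd2[OF smooth_continuous[OF f], of L']]) (use sub in auto)
  then show "continuous_on (bx n (J(j := L'))) h"
    unfolding h using integral_continuous_on_param[of "bx n (J(j := L'))" p q "\<lambda>t v. f (t(j := v))"] by simp
  fix i assume i: "i < n"
  show "\<exists>g. ((\<exists>f. smooth n (J(j := L)) f \<and> g = (\<lambda>t. integral {p..q} (\<lambda>v. f (t(j := v))))) \<or> smooth n (J(j := L')) g) \<and>
      has_pd n (J(j := L')) i h g"
  proof (cases "i = j")
    case True
    then have "has_pd n (J(j := L')) i h (\<lambda>t. 0)"
      by (simp add: has_pd_def h)
    then show ?thesis using smooth_const by blast
  next
    case False
    obtain g where g: "smooth n (J(j := L)) g" "has_pd n (J(j := L)) i f g" using smooth_pd[OF f i] by metis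
    show ?thesis using has_pd_integral[OF f g sub False i J[OF i]] g(1) unfolding h by blast
  qed
qed (use assms(1) in blast)

text \<open>The substitution \<open>v = p + w * (r - p)\<close> moves the variable endpoint into the
  integrand, so continuity in the endpoint becomes continuity of a parameter integral with fixed
  limits.\<close>

lemma integral_rescale:
  fixes f :: "real \<Rightarrow> real"
  assumes "continuous_on {p..r} f" "p \<le> r"
  shows "integral {p..r} f = (r - p) * integral {0..1} (\<lambda>w. f (p + w * (r - p)))"
proof (cases "r = p")
  case False
  then have pos: "r - p > 0" using assms(2) by auto
  have im: "(\<lambda>x. x / (r - p) + - (p / (r - p))) ` {p..r} = {0..1}"
    using pos by (subst image_affinity_atLeastAtMost_div) (simp_all flip: diff_divide_distrib)
  have "(f has_integral integral {p..r} f) (cbox p r)"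
    using integrable_integral[OF integrable_continuous_interval[OF assms(1)]] by simp
  from has_integral_affinity[OF this, of "r - p" p] pos im
  have "((\<lambda>w. f ((r - p) * w + p)) has_integral (1 / (r - p)) * integral {p..r} f) {0..1}"
    by simp
  then have "integral {0..1} (\<lambda>w. f (p + w * (r - p))) = (1 / (r - p)) * integral {p..r} f"
    by (intro integral_unique) (simp add: algebra_simps)
  then show ?thesis using pos by simp
qed simp

lemma smooth_integral_upto:
  assumes "smooth n (J(j := {p..q})) f" and J: "\<And>i. i < n \<Longrightarrow> convex (J i)"
    and "j < n"
  shows "smooth n (J(j := {p..q})) (\<lambda>t. integral {p..t j} (\<lambda>v. f (t(j := v))))"
proof (rule smooth_coinduct[where P = "\<lambda>h. \<exists>f. smooth n (J(j := {p..q})) f \<and> h = (\<lambda>t. integral {p..t j} (\<lambda>v. f (t(j := v))))"])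
  let ?B = "bx n (J(j := {p..q}))"
  have tj: "t j \<in> {p..q}" if "t \<in> ?B" for t using bx_coord[OF that \<open>j < n\<close>] by simp
  fix h assume "\<exists>f. smooth n (J(j := {p..q})) f \<and> h = (\<lambda>t. integral {p..t j} (\<lambda>v. f (t(j := v))))"
  then obtain f where f: "smooth n (J(j := {p..q})) f" and h: "h = (\<lambda>t. integral {p..t j} (\<lambda>v. f (t(j := v))))" by blast
  have eq: "integral {p..t j} (\<lambda>v. f (t(j := v))) =
      (t j - p) * integral {0..1} (\<lambda>w. f (t(j := p + w * (t j - p))))" if t: "t \<in> ?B" for t
    using tj[OF t]
    by (intro integral_rescale continuous_on_subset[OF continuous_slice[OF smooth_continuous[OF f] t]]) auto
  have fst_j: "continuous_on S (\<lambda>x. fst x j)" for S :: "((nat \<Rightarrow> real) \<times> real) set"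
    using continuous_on_compose2[OF continuous_coord[of UNIV j] continuous_on_fst[OF continuous_on_id, of S]] by simp
  have "(fst x)(j := p + snd x * (fst x j - p)) \<in> ?B" if "x \<in> ?B \<times> {0..1}" for x
  proof -
    have "snd x * (fst x j - p) \<le> fst x j - p" "0 \<le> snd x * (fst x j - p)"
      using that tj[of "fst x"] by (auto intro!: mult_left_le_one_le)
    then have "p + snd x * (fst x j - p) \<in> {p..q}" using that tj[of "fst x"] by auto
    from bx_upd'[OF _ this, of "fst x" n J] show ?thesis using that by auto
  qed
  then have im: "(\<lambda>x. (fst x)(j := p + snd x * (fst x j - p))) ` (?B \<times> {0..1}) \<subseteq> ?B"
    by blast
  have "continuous_on (?B \<times> {0..1}) (\<lambda>x. p + snd x * (fst x j - p))"
    by (intro continuous_on_add continuous_on_mult continuous_on_diff continuous_on_const fst_j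
        continuous_on_snd continuous_on_id)
  then have "continuous_on (?B \<times> {0..1}) (\<lambda>x. f ((fst x)(j := p + snd x * (fst x j - p))))"
    by (rule continuous_on_compose2[OF smooth_continuous[OF f] continuous_upd[OF continuous_on_fst[OF continuous_on_id]] im])
  then have "continuous_on ?B (\<lambda>t. integral {0..1} (\<lambda>w. f (t(j := p + w * (t j - p)))))"
    using integral_continuous_on_param[of ?B 0 1 "\<lambda>t w. f (t(j := p + w * (t j - p)))"]
    by (simp add: split_beta)
  then have "continuous_on ?B (\<lambda>t. (t j - p) * integral {0..1} (\<lambda>w. f (t(j := p + w * (t j - p)))))"
    by (intro continuous_on_mult continuous_on_diff continuous_on_const continuous_coord)
  then show "continuous_on ?B h"
    unfolding h by (rule continuous_on_eq) (simp add: eq)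
  fix i assume i: "i < n"
  show "\<exists>g. ((\<exists>f. smooth n (J(j := {p..q})) f \<and> g = (\<lambda>t. integral {p..t j} (\<lambda>v. f (t(j := v))))) \<or> smooth n (J(j := {p..q})) g) \<and>
      has_pd n (J(j := {p..q})) i h g"
  proof (cases "i = j")
    case True
    \<comment> \<open>Along the direction of integration the fundamental theorem of calculus returns
      \<open>f\<close> itself, which is outside the coinductive class but smooth.\<close>
    have "has_pd n (J(j := {p..q})) i h f"
      unfolding has_pd_def h
    proof
      fix t assume t: "t \<in> ?B"
      show "((\<lambda>u. integral {p..(t(i := u)) j} (\<lambda>v. f (t(i := u, j := v)))) has_real_derivative f t) (at (t i) within (J(j := {p..q})) i)"
        using integral_has_real_derivative[OF continuous_slice[OF smooth_continuous[OF f] t] tj[OF t]] True by simp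
    qed
    then show ?thesis using f by blast
  next
    case False
    obtain g where g: "smooth n (J(j := {p..q})) g" "has_pd n (J(j := {p..q})) i f g" using smooth_pd[OF f i] by metis
    have "has_pd n (J(j := {p..q})) i h (\<lambda>t. integral {p..t j} (\<lambda>v. g (t(j := v))))"
      unfolding has_pd_def h
    proof
      fix t assume t: "t \<in> ?B"
      have "{p..t j} \<subseteq> {p..q}" using tj[OF t] by auto
      from has_pd_D[OF has_pd_integral[OF f g this False i J[OF i], of "{p..q}"] t] False
      show "((\<lambda>u. integral {p..(t(i := u)) j} (\<lambda>v. f (t(i := u, j := v)))) has_real_derivative integral {p..t j} (\<lambda>v. g (t(j := v)))) (at (t i) within (J(j := {p..q})) i)"
        by simp
    qed
    then show ?thesis using g(1) by blast
  qed
qed (use assms(1) in blast)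

text \<open>On a side that is a proper interval the derivative is determined. This connects the
  relation \<open>has_pd\<close> with \<open>vector_derivative\<close>, in terms of which
  \<open>dF\<close> is defined.\<close>

lemma has_pd_unique:
  assumes "has_pd n J i f g" "J i = {p..q}" "p < q" "t \<in> bx n J" "i < n"
  shows "vector_derivative (\<lambda>u. f (t(i := u))) (at (t i) within J i) = g t"
  using vector_derivative_within_cbox[of p q "t i" "\<lambda>u. f (t(i := u))" "g t"] has_pd_D[OF assms(1,4)] bx_coord[OF assms(4,5)] assms(2,3)
  by (simp add: has_real_derivative_iff_has_vector_derivative)

section \<open>Operators in one variable\<close>

text \<open>The coordinates of a graded space are parametrized by charts, each a real set with a map from it. A
  cell is a constant chart, so that cochains are the functions which are smooth in the trivial sense.\<close>

type_synonym 'a charts = "(real set \<times> (real \<Rightarrow> 'a)) set"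

definition csupp :: "'a charts \<Rightarrow> 'a set" where
  "csupp A = {c u | K c u. (K, c) \<in> A \<and> u \<in> K}"

lemma csuppI: "(K, c) \<in> A \<Longrightarrow> u \<in> K \<Longrightarrow> c u \<in> csupp A"
  by (auto simp: csupp_def)

lemma csuppE: assumes "x \<in> csupp A" obtains K c u where "(K, c) \<in> A" "u \<in> K" "x = c u"
  using assms by (auto simp: csupp_def)

text \<open>The regularity of a one-variable slice of a form: enough for the generating operators to
  be linear and local on it.\<close>

definition C1 :: "'a charts \<Rightarrow> ('a \<Rightarrow> real) \<Rightarrow> bool" where
  "C1 A f \<longleftrightarrow> (\<forall>(K, c)\<in>A. \<exists>g. continuous_on K g \<and>
     (\<forall>u\<in>K. ((\<lambda>v. f (c v)) has_real_derivative g u) (at u within K)))"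

text \<open>\<open>\<kappa> t f\<close> is the value at the coordinate \<open>t\<close> in a chart with domain \<open>J\<close> of the image of \<open>f\<close> under an
  operator. The operators considered are generated by the following ones, which makes
  commutation of operators in different variables provable by induction on both of them.\<close>

inductive Ker :: "'a charts \<Rightarrow> real set \<Rightarrow> (real \<Rightarrow> ('a \<Rightarrow> real) \<Rightarrow> real) \<Rightarrow> bool"
  for A :: "'a charts" and J :: "real set" where
  Ker_ev: "(K, c) \<in> A \<Longrightarrow> u \<in> K \<Longrightarrow> Ker A J (\<lambda>t f. f (c u))"
| Ker_int: "(K, c) \<in> A \<Longrightarrow> {p..q} \<subseteq> K \<Longrightarrow> Ker A J (\<lambda>t f. integral {p..q} (\<lambda>u. f (c u)))"
| Ker_id: "(K, c) \<in> A \<Longrightarrow> J \<subseteq> K \<Longrightarrow> Ker A J (\<lambda>t f. f (c t))"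
| Ker_der: "(J, c) \<in> A \<Longrightarrow> J = {p..q} \<Longrightarrow> p < q \<Longrightarrow>
    Ker A J (\<lambda>t f. vector_derivative (\<lambda>u. f (c u)) (at t within J))"
| Ker_upto: "(J, c) \<in> A \<Longrightarrow> J = {p..q} \<Longrightarrow> Ker A J (\<lambda>t f. integral {p..t} (\<lambda>u. f (c u)))"
| Ker_zero: "Ker A J (\<lambda>t f. 0)"
| Ker_lin: "Ker A J \<kappa> \<Longrightarrow> Ker A J \<kappa>' \<Longrightarrow> Ker A J (\<lambda>t f. a * \<kappa> t f + b * \<kappa>' t f)"
| Ker_mult: "Ker A J \<kappa> \<Longrightarrow> Ker A J (\<lambda>t f. t * \<kappa> t f)"
| Ker_cong: "Ker A J \<kappa> \<Longrightarrow> (\<And>t f. t \<in> J \<Longrightarrow> C1 A f \<Longrightarrow> \<kappa>' t f = \<kappa> t f) \<Longrightarrow> Ker A J \<kappa>'"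

lemma C1_local: "C1 A f" if "C1 A g" "\<And>x. x \<in> csupp A \<Longrightarrow> g x = f x"
  unfolding C1_def
proof clarify
  fix K c assume c: "(K, c) \<in> A"
  with that(1) obtain h where h: "continuous_on K h"
    "\<And>u. u \<in> K \<Longrightarrow> ((\<lambda>v. g (c v)) has_real_derivative h u) (at u within K)"
    unfolding C1_def by blast
  have "((\<lambda>v. f (c v)) has_real_derivative h u) (at u within K)" if u: "u \<in> K" for u
    using h(2)[OF u] zero_less_one u
    by (rule has_field_derivative_transform_within) (simp add: \<open>\<And>x. x \<in> csupp A \<Longrightarrow> g x = f x\<close> csuppI[OF c])
  then show "\<exists>h. continuous_on K h \<and> (\<forall>u\<in>K. ((\<lambda>v. f (c v)) has_real_derivative h u) (at u within K))"
    using h(1) by blast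
qed

lemma C1_continuous:
  assumes "C1 A f" "(K, c) \<in> A" shows "continuous_on K (\<lambda>u. f (c u))"
proof -
  obtain h where "\<And>u. u \<in> K \<Longrightarrow> ((\<lambda>v. f (c v)) has_real_derivative h u) (at u within K)"
    using assms unfolding C1_def by blast
  then show ?thesis by (rule DERIV_continuous_on)
qed

lemma C1_vector_derivative:
  assumes "C1 A f" "({p..q}, c) \<in> A" "p < q" "t \<in> {p..q}"
  shows "((\<lambda>u. f (c u)) has_real_derivative vector_derivative (\<lambda>u. f (c u)) (at t within {p..q})) (at t within {p..q})"
proof -
  obtain h where "\<And>u. u \<in> {p..q} \<Longrightarrow> ((\<lambda>v. f (c v)) has_real_derivative h u) (at u within {p..q})"
    using assms(1,2) unfolding C1_def by blast
  from this[OF assms(4)] show ?thesis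
    using vector_derivative_within_cbox[OF assms(3), of t "\<lambda>u. f (c u)" "h t"] assms(4)
    by (simp add: has_real_derivative_iff_has_vector_derivative)
qed

lemma C1_lin:
  assumes "C1 A f" "C1 A g" shows "C1 A (\<lambda>x. a * f x + b * g x)"
  unfolding C1_def
proof clarify
  fix K c assume c: "(K, c) \<in> A"
  obtain h where h: "continuous_on K h" "\<And>u. u \<in> K \<Longrightarrow> ((\<lambda>v. f (c v)) has_real_derivative h u) (at u within K)"
    using assms(1) c unfolding C1_def by blast
  obtain k where k: "continuous_on K k" "\<And>u. u \<in> K \<Longrightarrow> ((\<lambda>v. g (c v)) has_real_derivative k u) (at u within K)"
    using assms(2) c unfolding C1_def by blast
  show "\<exists>h. continuous_on K h \<and> (\<forall>u\<in>K. ((\<lambda>v. a * f (c v) + b * g (c v)) has_real_derivative h u) (at u within K))"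
    by (intro exI[of _ "\<lambda>u. a * h u + b * k u"] conjI ballI continuous_on_add continuous_on_mult continuous_on_const
        DERIV_add DERIV_cmult h k)
qed

lemma C1_zero: "C1 A (\<lambda>_. 0)"
  unfolding C1_def by (auto intro!: exI[of _ "\<lambda>_. 0"])

lemma integral_lin:
  fixes f g :: "real \<Rightarrow> real"
  assumes "continuous_on {p..q} f" "continuous_on {p..q} g"
  shows "integral {p..q} (\<lambda>u. a * f u + b * g u) = a * integral {p..q} f + b * integral {p..q} g"
  by (subst integral_add) (auto intro!: integrable_continuous_interval continuous_on_mult assms continuous_on_const)

text \<open>\<open>integral\<close> and \<open>vector_derivative\<close> are total functions and
  additive only where they are meaningful, hence the regularity assumption on \<open>f\<close> and
  \<open>g\<close>.\<close>

lemma Ker_linear: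
  assumes "Ker A J \<kappa>" "C1 A f" "C1 A g" "t \<in> J"
  shows "\<kappa> t (\<lambda>x. a * f x + b * g x) = a * \<kappa> t f + b * \<kappa> t g"
  using assms(1)
proof induction
  case (Ker_int K c p q)
  then show ?case
    by (intro integral_lin continuous_on_subset[OF C1_continuous[OF assms(2)]] continuous_on_subset[OF C1_continuous[OF assms(3)]])
next
  case (Ker_der c p q)
  have t: "t \<in> {p..q}" using assms(4) Ker_der by simp
  have c: "({p..q}, c) \<in> A" using Ker_der by simp
  show ?case
    using DERIV_add[OF DERIV_cmult[OF C1_vector_derivative[OF assms(2) c Ker_der(3) t], of a]
        DERIV_cmult[OF C1_vector_derivative[OF assms(3) c Ker_der(3) t], of b]]
      vector_derivative_within_cbox[OF Ker_der(3), of t] t Ker_der(2)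
    by (simp add: has_real_derivative_iff_has_vector_derivative)
next
  case (Ker_upto c p q)
  then have "{p..t} \<subseteq> J" using assms(4) by auto
  with Ker_upto show ?case
    by (intro integral_lin continuous_on_subset[OF C1_continuous[OF assms(2)]] continuous_on_subset[OF C1_continuous[OF assms(3)]])
next
  case (Ker_cong \<kappa> \<kappa>')
  then show ?case using C1_lin[OF assms(2,3)] assms by simp
qed (simp_all add: algebra_simps)

text \<open>Every generator reads its argument on the charts only. This permits rewriting under an
  operator with an identity that holds just there, as the fundamental theorem does in
  \<open>Ker_derivative\<close>.\<close>

lemma Ker_local:
  assumes "Ker A J \<kappa>" "C1 A f" "t \<in> J" "\<And>x. x \<in> csupp A \<Longrightarrow> f x = g x"
  shows "\<kappa> t f = \<kappa> t g"
  using assms(1)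
proof induction
  case (Ker_ev K c u)
  then show ?case using assms(4) csuppI by metis
next
  case (Ker_int K c p q)
  then show ?case by (intro integral_cong assms(4) csuppI) auto
next
  case (Ker_id K c)
  then show ?case using assms(3,4) csuppI by blast
next
  case (Ker_der c p q)
  have c: "({p..q}, c) \<in> A" and t: "t \<in> {p..q}" using Ker_der assms(3) by auto
  have "((\<lambda>u. g (c u)) has_real_derivative vector_derivative (\<lambda>u. f (c u)) (at t within {p..q})) (at t within {p..q})"
    using C1_vector_derivative[OF assms(2) c Ker_der(3) t] zero_less_one t
    by (rule has_field_derivative_transform_within) (use assms(4) csuppI c in metis)
  from vector_derivative_within_cbox[OF Ker_der(3) _ this[unfolded has_real_derivative_iff_has_vector_derivative, unfolded cbox_interval[symmetric]]] t
  show ?case using Ker_der(2) by simp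
next
  case (Ker_upto c p q)
  then show ?case by (intro integral_cong assms(4) csuppI[of J]) (use assms(3) in auto)
next
  case (Ker_cong \<kappa> \<kappa>')
  then show ?case using C1_local[OF assms(2,4)] assms by simp
qed simp_all

lemma Ker_zero_fun: "Ker A J \<kappa> \<Longrightarrow> t \<in> J \<Longrightarrow> \<kappa> t (\<lambda>_. 0) = 0"
  using Ker_linear[OF _ C1_zero C1_zero, of A J \<kappa> t 0 0] by simp

text \<open>\<open>\<Psi> t\<close> is a form of several variables regarded as a function of its \<open>i\<close>-th variable, the other ones
  being the parameters \<open>t j\<close>.\<close>

definition sfam :: "nat \<Rightarrow> (nat \<Rightarrow> real set) \<Rightarrow> nat \<Rightarrow> 'a charts \<Rightarrow> ((nat \<Rightarrow> real) \<Rightarrow> 'a \<Rightarrow> real) \<Rightarrow> bool" where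
  "sfam n J i A \<Psi> \<longleftrightarrow> (\<forall>t u. \<Psi> (t(i := u)) = \<Psi> t) \<and>
     (\<forall>(K, c)\<in>A. smooth n (J(i := K)) (\<lambda>t. \<Psi> t (c (t i))))"

lemma sfam_C1:
  assumes "sfam n J i A \<Psi>" "i < n" "t \<in> bx n (J(i := L))"
  shows "C1 A (\<Psi> t)"
  unfolding C1_def
proof clarify
  fix K c assume c: "(K, c) \<in> A"
  have s: "smooth n (J(i := K)) (\<lambda>t. \<Psi> t (c (t i)))" using assms(1) c unfolding sfam_def by blast
  obtain g where g: "smooth n (J(i := K)) g" "has_pd n (J(i := K)) i (\<lambda>t. \<Psi> t (c (t i))) g"
    using smooth_pd[OF s assms(2)] by metis
  have upd: "\<Psi> (t(i := u)) = \<Psi> t" for u using assms(1) unfolding sfam_def by blast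
  show "\<exists>h. continuous_on K h \<and> (\<forall>u\<in>K. ((\<lambda>v. \<Psi> t (c v)) has_real_derivative h u) (at u within K))"
  proof (intro exI conjI ballI)
    show "continuous_on K (\<lambda>u. g (t(i := u)))"
      by (rule continuous_slice[OF smooth_continuous[OF g(1)] assms(3)])
    fix u assume "u \<in> K"
    from has_pd_D[OF g(2) bx_upd'[OF assms(3) this]]
    show "((\<lambda>v. \<Psi> t (c v)) has_real_derivative g (t(i := u))) (at u within K)"
      by (simp add: upd)
  qed
qed

text \<open>Each generator of \<open>Ker\<close> corresponds to one closure property of
  \<open>smooth\<close>. For the derivative, uniqueness on the box identifies the operator with a
  partial derivative, which is smooth by definition.\<close>

lemma smooth_Ker:
  assumes "Ker A L \<kappa>" "sfam n J i A \<Psi>" "i < n" "\<And>i. i < n \<Longrightarrow> convex (J i)"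
  shows "smooth n (J(i := L)) (\<lambda>t. \<kappa> (t i) (\<Psi> t))"
  using assms(1)
proof induction
  have upd: "\<Psi> (t(i := u)) = \<Psi> t" for t u using assms(2) unfolding sfam_def by blast
  have s: "smooth n (J(i := K)) (\<lambda>t. \<Psi> t (c (t i)))" if "(K, c) \<in> A" for K c
    using assms(2) that unfolding sfam_def by blast
  {
    case (Ker_ev K c u)
    from smooth_eval[OF s[OF Ker_ev(1)] Ker_ev(2)] show ?case by (simp only: upd fun_upd_same)
  next
    case (Ker_int K c p q)
    from smooth_integral[OF s[OF Ker_int(1)] Ker_int(2) assms(4)] show ?case by (simp only: upd fun_upd_same)
  next
    case (Ker_id K c)
    show ?case by (rule smooth_subset[OF s[OF Ker_id(1)]]) (use Ker_id(2) in auto)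
  next
    case (Ker_der c p q)
    obtain g where g: "smooth n (J(i := L)) g" "has_pd n (J(i := L)) i (\<lambda>t. \<Psi> t (c (t i))) g"
      using smooth_pd[OF s[OF Ker_der(1)] assms(3)] by metis
    show ?case
    proof (rule smooth_cong[OF g(1)])
      fix t assume "t \<in> bx n (J(i := L))"
      from has_pd_unique[OF g(2) _ Ker_der(3) this assms(3)] Ker_der(2)
      show "g t = vector_derivative (\<lambda>u. \<Psi> t (c u)) (at (t i) within L)"
        by (simp add: upd)
    qed
  next
    case (Ker_upto c p q)
    have "smooth n (J(i := {p..q})) (\<lambda>t. \<Psi> t (c (t i)))" using s Ker_upto by blast
    from smooth_integral_upto[OF this assms(4,3)] show ?case using Ker_upto(2) by (simp only: upd fun_upd_same)
  next
    case Ker_zero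
    show ?case by (rule smooth_const)
  next
    case (Ker_lin \<kappa> \<kappa>' a b)
    from smooth_lin[OF Ker_lin(3,4)] show ?case .
  next
    case (Ker_mult \<kappa>)
    from smooth_mult_coord[OF Ker_mult(2)] show ?case .
  next
    case (Ker_cong \<kappa> \<kappa>')
    show ?case
    proof (rule smooth_cong[OF Ker_cong(3)])
      fix t assume t: "t \<in> bx n (J(i := L))"
      then have "t i \<in> L" using bx_coord[OF t assms(3)] by simp
      then show "\<kappa> (t i) (\<Psi> t) = \<kappa>' (t i) (\<Psi> t)" using Ker_cong(2) sfam_C1[OF assms(2,3) t] by simp
    qed
  }
qed

lemma integral_swap:
  fixes f :: "real \<Rightarrow> real \<Rightarrow> real"
  assumes "continuous_on ({a..b} \<times> {c..d}) (\<lambda>(x, y). f x y)"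
  shows "integral {a..b} (\<lambda>x. integral {c..d} (f x)) = integral {c..d} (\<lambda>y. integral {a..b} (\<lambda>x. f x y))"
  using integral_swap_continuous[of a c b d f] assms by (simp add: cbox_Pair_eq)

lemma sfam_integral:
  assumes "sfam n (J(j := M)) i A \<Psi>" "i \<noteq> j" "\<And>i. i < n \<Longrightarrow> convex (J i)"
    "{p..q} \<subseteq> M" "\<And>K c. (K, c) \<in> A \<Longrightarrow> convex K"
  shows "sfam n (J(j := M')) i A (\<lambda>t x. integral {p..q} (\<lambda>v. \<Psi> (t(j := v)) x))"
  unfolding sfam_def
proof (intro conjI allI ballI, goal_cases)
  case (1 t u)
  have "\<Psi> (t(i := u, j := v)) = \<Psi> (t(j := v))" for v
    using assms(1) fun_upd_twist[OF assms(2), of t u v] unfolding sfam_def by metis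
  then show ?case by simp
next
  case (2 Kc)
  obtain K c where Kc: "Kc = (K, c)" by force
  with 2 have c: "(K, c) \<in> A" by simp
  have s: "smooth n (J(i := K, j := M)) (\<lambda>t. \<Psi> t (c (t i)))"
    using assms(1) c unfolding sfam_def by (auto simp: fun_upd_twist[OF assms(2)])
  have "convex ((J(i := K)) l)" if "l < n" for l
    using assms(3)[OF that] assms(5)[OF c] by simp
  from smooth_integral[OF s assms(4) this, of M'] assms(2)
  have "smooth n (J(i := K, j := M')) (\<lambda>t. integral {p..q} (\<lambda>v. \<Psi> (t(j := v)) (c (t i))))"
    by (simp only: fun_upd_other not_False_eq_True)
  then show ?case unfolding Kc prod.case fun_upd_twist[OF assms(2), of J] .
qed

text \<open>By Fubini if \<open>\<kappa>\<close> is an integral, by differentiation under the integral sign if it is a derivative.\<close>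

lemma Ker_integral:
  assumes "Ker A L \<kappa>" "sfam n (J(j := M)) i A \<Psi>" "i < n" "j < n" "i \<noteq> j" "\<And>i. i < n \<Longrightarrow> convex (J i)" "convex M"
    "{p..q} \<subseteq> M" "t \<in> bx n (J(i := L, j := M'))" "\<And>K c. (K, c) \<in> A \<Longrightarrow> convex K"
  shows "\<kappa> (t i) (\<lambda>x. integral {p..q} (\<lambda>v. \<Psi> (t(j := v)) x)) = integral {p..q} (\<lambda>v. \<kappa> (t i) (\<Psi> (t(j := v))))"
  using assms(1)
proof induction
  have upd: "\<Psi> (t(i := u)) = \<Psi> t" for t u using assms(2) unfolding sfam_def by blast
  have upd2: "\<Psi> (t(i := u, j := v)) = \<Psi> (t(j := v))" for t u v
    using upd[of "t(j := v)" u] fun_upd_twist[OF assms(5), of t u v] by simp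
  have s: "smooth n (J(i := K, j := M)) (\<lambda>t. \<Psi> t (c (t i)))" if "(K, c) \<in> A" for K c
    using assms(2) that unfolding sfam_def by (auto simp: fun_upd_twist[OF assms(5)])
  have ti: "t i \<in> L" using bx_coord[OF assms(9,3)] assms(5) by simp
  have cont2: "continuous_on (K' \<times> {p..q}) (\<lambda>(u, v). \<Psi> (t(j := v)) (c u))" if c: "(K, c) \<in> A" and K': "K' \<subseteq> K" for K K' c
  proof -
    have "continuous_on (K' \<times> {p..q}) (\<lambda>w. t(i := fst w, j := snd w))"
      by (intro continuous_upd continuous_on_const continuous_on_fst continuous_on_snd continuous_on_id)
    moreover have "(\<lambda>w. t(i := fst w, j := snd w)) ` (K' \<times> {p..q}) \<subseteq> bx n (J(i := K, j := M))"
      using assms(8,9) K' by (auto simp: bx_def)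
    ultimately have "continuous_on (K' \<times> {p..q}) (\<lambda>w. (\<lambda>t. \<Psi> t (c (t i))) (t(i := fst w, j := snd w)))"
      by (rule continuous_on_compose2[OF smooth_continuous[OF s[OF c]]])
    then show ?thesis using assms(5) by (simp add: split_beta upd2)
  qed
  have tj: "t(j := v) \<in> bx n (J(j := M, i := L))" if "v \<in> M" for v
    using bx_upd'[OF assms(9) that] by (simp add: fun_upd_twist[OF assms(5)])
  have convex: "\<And>l. l < n \<Longrightarrow> convex ((J(j := M)) l)" using assms(6,7) by simp
  have C1: "C1 A (\<Psi> (t(j := v)))" if "v \<in> M" for v
    by (rule sfam_C1[OF assms(2,3) tj[OF that]])
  have "t \<in> bx n ((J(j := M'))(i := L))" using assms(9) by (simp add: fun_upd_twist[OF assms(5)])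
  from sfam_C1[OF sfam_integral[OF assms(2,5,6,8,10)] assms(3) this]
  have C1': "C1 A (\<lambda>x. integral {p..q} (\<lambda>v. \<Psi> (t(j := v)) x))" .
  have cont: "continuous_on {p..q} (\<lambda>v. \<kappa> (t i) (\<Psi> (t(j := v))))" if \<kappa>: "Ker A L \<kappa>" for \<kappa>
  proof -
    have "smooth n (J(i := L, j := M)) (\<lambda>t. \<kappa> (t i) (\<Psi> t))"
      unfolding fun_upd_twist[OF assms(5), of J] by (rule smooth_Ker[OF \<kappa> assms(2,3) convex])
    from continuous_on_subset[OF continuous_slice[OF smooth_continuous[OF this] assms(9)] assms(8)]
    show ?thesis using assms(5) by simp
  qed
  {
    case (Ker_ev K c u)
    show ?case ..
  next
    case (Ker_int K c a b)
    show ?case by (rule integral_swap[OF cont2[OF Ker_int]])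
  next
    case (Ker_id K c)
    show ?case ..
  next
    case (Ker_der c a b)
    have Li: "(J(i := L, j := M'')) i = {a..b}" for M'' using Ker_der(2) assms(5) by simp
    obtain g where g: "smooth n (J(i := L, j := M)) g" "has_pd n (J(i := L, j := M)) i (\<lambda>t. \<Psi> t (c (t i))) g"
      using smooth_pd[OF s[OF Ker_der(1)] assms(3)] by metis
    have "convex ((J(i := L)) i)" using Ker_der(2) by simp
    from has_pd_unique[OF has_pd_integral[OF s[OF Ker_der(1)] g assms(8,5,3) this] Li Ker_der(3) assms(9,3)] Li[of M'] Ker_der(2)
    have "vector_derivative (\<lambda>u. integral {p..q} (\<lambda>v. \<Psi> (t(j := v)) (c u))) (at (t i) within L) =
      integral {p..q} (\<lambda>v. g (t(j := v)))"
      using assms(5) by (simp add: upd2)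
    also have "\<dots> = integral {p..q} (\<lambda>v. vector_derivative (\<lambda>u. \<Psi> (t(j := v)) (c u)) (at (t i) within L))"
    proof (rule integral_cong)
      fix v assume "v \<in> {p..q}"
      with assms(8) have "v \<in> M" by auto
      from has_pd_unique[OF g(2) Li Ker_der(3) bx_upd'[OF assms(9) this] assms(3)]
      show "g (t(j := v)) = vector_derivative (\<lambda>u. \<Psi> (t(j := v)) (c u)) (at (t i) within L)"
        using assms(5) by (simp add: upd)
    qed
    finally show ?case .
  next
    case (Ker_upto c a b)
    then show ?case by (intro integral_swap[OF cont2[OF Ker_upto(1)]]) (use ti in auto)
  next
    case Ker_zero
    show ?case by simp
  next
    case (Ker_lin \<kappa> \<kappa>' a b)
    then show ?case by (simp only: integral_lin[OF cont[OF Ker_lin(1)] cont[OF Ker_lin(2)]])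
  next
    case (Ker_mult \<kappa>)
    then show ?case by simp
  next
    case (Ker_cong \<kappa> \<kappa>')
    \<comment> \<open>The replacement is made once on the integrated family and once inside the
      integral, so both the integral and each integrand must be \<open>C1\<close>.\<close>
    have "\<kappa>' (t i) (\<lambda>x. integral {p..q} (\<lambda>v. \<Psi> (t(j := v)) x)) = integral {p..q} (\<lambda>v. \<kappa> (t i) (\<Psi> (t(j := v))))"
      unfolding Ker_cong(2)[OF ti C1'] by (rule Ker_cong(3))
    also have "\<dots> = integral {p..q} (\<lambda>v. \<kappa>' (t i) (\<Psi> (t(j := v))))"
      by (rule integral_cong) (use Ker_cong(2)[OF ti C1] assms(8) in auto)
    finally show ?case .
  }
qed

text \<open>Differentiation commutes with \<open>\<kappa>\<close> because integration does: apply \<open>\<kappa>\<close> to the fundamental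
  theorem of calculus and differentiate the result.\<close>

lemma Ker_derivative:
  assumes "Ker A L \<kappa>" "sfam n (J(j := {p..q})) i A \<Psi>" "i < n" "j < n" "i \<noteq> j" "\<And>i. i < n \<Longrightarrow> convex (J i)"
    "p < q" "t \<in> bx n (J(i := L, j := {p..q}))" "\<And>K c. (K, c) \<in> A \<Longrightarrow> convex K"
  shows "\<kappa> (t i) (\<lambda>x. vector_derivative (\<lambda>v. \<Psi> (t(j := v)) x) (at (t j) within {p..q})) =
    vector_derivative (\<lambda>v. \<kappa> (t i) (\<Psi> (t(j := v)))) (at (t j) within {p..q})"
proof -
  let ?J = "J(j := {p..q})"
  define \<Phi> where "\<Phi> t x = vector_derivative (\<lambda>v. \<Psi> (t(j := v)) x) (at (t j) within {p..q})" for t x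
  have upd: "\<Psi> (t(i := u)) = \<Psi> t" for t u using assms(2) unfolding sfam_def by blast
  have upd2: "\<Psi> (t(i := u, j := v)) = \<Psi> (t(j := v))" for t u v
    using upd[of "t(j := v)" u] fun_upd_twist[OF assms(5), of t u v] by simp
  have s: "smooth n (?J(i := K)) (\<lambda>t. \<Psi> t (c (t i)))" if "(K, c) \<in> A" for K c
    using assms(2) that unfolding sfam_def by auto
  have pd: "\<exists>g. smooth n (?J(i := K)) g \<and> has_pd n (?J(i := K)) j (\<lambda>t. \<Psi> t (c (t i))) g \<and>
      (\<forall>t\<in>bx n (?J(i := K)). \<Phi> t (c (t i)) = g t)" if c: "(K, c) \<in> A" for K c
  proof -
    obtain g where g: "smooth n (?J(i := K)) g" "has_pd n (?J(i := K)) j (\<lambda>t. \<Psi> t (c (t i))) g"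
      using smooth_pd[OF s[OF c] assms(4)] by metis
    moreover have "\<Phi> t (c (t i)) = g t" if t: "t \<in> bx n (?J(i := K))" for t
      using has_pd_unique[OF g(2) _ assms(7) t assms(4)] assms(5) by (simp add: \<Phi>_def)
    ultimately show ?thesis by blast
  qed
  have sf: "sfam n ?J i A \<Phi>"
    unfolding sfam_def
  proof (intro conjI allI ballI, goal_cases)
    case (1 t u)
    show ?case using assms(5) by (simp add: \<Phi>_def upd2 fun_eq_iff)
  next
    case (2 Kc)
    obtain K c where Kc: "Kc = (K, c)" by force
    with 2 have c: "(K, c) \<in> A" by simp
    obtain g where g: "smooth n (?J(i := K)) g" "\<And>t. t \<in> bx n (?J(i := K)) \<Longrightarrow> \<Phi> t (c (t i)) = g t"
      using pd[OF c] by blast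
    show ?case unfolding Kc prod.case by (rule smooth_cong[OF g(1)]) (simp only: g(2))
  qed
  have tj: "t j \<in> {p..q}" using bx_coord[OF assms(8,4)] by simp
  have ti: "t i \<in> L" using bx_coord[OF assms(8,3)] assms(5) by simp
  have tji: "t(j := v) \<in> bx n (?J(i := L))" if "v \<in> {p..q}" for v
    using bx_upd'[OF assms(8) that] by (simp add: fun_upd_twist[OF assms(5)])
  have convex: "\<And>l. l < n \<Longrightarrow> convex (?J l)" using assms(6) by simp
  have ftc: "\<Psi> (t(j := v)) x = \<Psi> (t(j := p)) x + integral {p..v} (\<lambda>w. \<Phi> (t(j := w)) x)"
    if x: "x \<in> csupp A" and v: "v \<in> {p..q}" for x v
  proof -
    from x obtain K c u where c: "(K, c) \<in> A" and u: "u \<in> K" "x = c u" by (rule csuppE)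
    obtain g where g: "has_pd n (?J(i := K)) j (\<lambda>t. \<Psi> t (c (t i))) g"
      "\<And>t. t \<in> bx n (?J(i := K)) \<Longrightarrow> \<Phi> t (c (t i)) = g t" using pd[OF c] by blast
    have "((\<lambda>w. \<Phi> (t(j := w)) x) has_integral \<Psi> (t(j := v)) x - \<Psi> (t(j := p)) x) {p..v}"
    proof (rule fundamental_theorem_of_calculus)
      show "p \<le> v" using v by simp
      fix w assume "w \<in> {p..v}"
      with v have w: "w \<in> {p..q}" by auto
      \<comment> \<open>\<open>\<Psi>\<close> ignores coordinate \<open>i\<close>, so that
        coordinate may be moved to \<open>u\<close>, where the chart takes the value
        \<open>x\<close>.\<close>
      have b: "t(i := u, j := w) \<in> bx n (?J(i := K))"
        using assms(5,8) u(1) w by (auto simp: bx_def)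
      have "\<Phi> (t(j := w)) x = g (t(i := u, j := w))"
        using g(2)[OF b] assms(5) by (simp add: u(2) \<Phi>_def upd2)
      with has_pd_D[OF g(1) b] assms(5)
      have "((\<lambda>v. \<Psi> (t(j := v)) x) has_real_derivative \<Phi> (t(j := w)) x) (at w within {p..q})"
        by (simp add: upd2 u(2))
      then have "((\<lambda>v. \<Psi> (t(j := v)) x) has_vector_derivative \<Phi> (t(j := w)) x) (at w within {p..q})"
        by (simp add: has_real_derivative_iff_has_vector_derivative)
      then show "((\<lambda>v. \<Psi> (t(j := v)) x) has_vector_derivative \<Phi> (t(j := w)) x) (at w within {p..v})"
        by (rule has_vector_derivative_within_subset) (use v in auto)
    qed
    then show ?thesis by (simp add: integral_unique)
  qed
  have eq: "\<kappa> (t i) (\<Psi> (t(j := v))) = \<kappa> (t i) (\<Psi> (t(j := p))) + integral {p..v} (\<lambda>w. \<kappa> (t i) (\<Phi> (t(j := w))))"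
    if v: "v \<in> {p..q}" for v
  proof -
    have sub: "{p..v} \<subseteq> {p..q}" and p: "p \<in> {p..q}" using v assms(7) by auto
    have sub': "convex {p..q}" by simp
    have "t \<in> bx n (?J(i := L))" using assms(8) by (simp add: fun_upd_twist[OF assms(5)])
    from sfam_C1[OF sfam_integral[OF sf assms(5,6) sub assms(9)] assms(3) this]
    have C: "C1 A (\<lambda>x. integral {p..v} (\<lambda>w. \<Phi> (t(j := w)) x))" .
    have "\<kappa> (t i) (\<Psi> (t(j := v))) = \<kappa> (t i) (\<lambda>x. 1 * \<Psi> (t(j := p)) x + 1 * integral {p..v} (\<lambda>w. \<Phi> (t(j := w)) x))"
      by (rule Ker_local[OF assms(1) sfam_C1[OF assms(2,3) tji[OF v]] ti]) (simp add: ftc[OF _ v])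
    also have "\<dots> = \<kappa> (t i) (\<Psi> (t(j := p))) + \<kappa> (t i) (\<lambda>x. integral {p..v} (\<lambda>w. \<Phi> (t(j := w)) x))"
      by (subst Ker_linear[OF assms(1) sfam_C1[OF assms(2,3) tji[OF p]] C ti]) simp
    also have "\<kappa> (t i) (\<lambda>x. integral {p..v} (\<lambda>w. \<Phi> (t(j := w)) x)) = integral {p..v} (\<lambda>w. \<kappa> (t i) (\<Phi> (t(j := w))))"
      by (rule Ker_integral[OF assms(1) sf assms(3,4,5,6) sub' sub assms(8,9)])
    finally show ?thesis .
  qed
  have "smooth n (J(i := L, j := {p..q})) (\<lambda>t. \<kappa> (t i) (\<Phi> t))"
    unfolding fun_upd_twist[OF assms(5), of J] by (rule smooth_Ker[OF assms(1) sf assms(3) convex])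
  from continuous_slice[OF smooth_continuous[OF this] assms(8)]
  have "continuous_on {p..q} (\<lambda>v. \<kappa> (t i) (\<Phi> (t(j := v))))" using assms(5) by simp
  from DERIV_add[OF DERIV_const[of "\<kappa> (t i) (\<Psi> (t(j := p)))"] integral_has_real_derivative[OF this tj]]
  have "((\<lambda>v. \<kappa> (t i) (\<Psi> (t(j := p))) + integral {p..v} (\<lambda>w. \<kappa> (t i) (\<Phi> (t(j := w))))) has_real_derivative \<kappa> (t i) (\<Phi> t)) (at (t j) within {p..q})"
    by simp
  then have "((\<lambda>v. \<kappa> (t i) (\<Psi> (t(j := v)))) has_real_derivative \<kappa> (t i) (\<Phi> t)) (at (t j) within {p..q})"
    using zero_less_one tj by (rule has_field_derivative_transform_within) (rule eq[symmetric])
  then show ?thesis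
    using vector_derivative_within_cbox[OF assms(7), of "t j" "\<lambda>v. \<kappa> (t i) (\<Psi> (t(j := v)))"] tj
    unfolding \<Phi>_def by (simp add: has_real_derivative_iff_has_vector_derivative)
qed

text \<open>Induction on \<open>\<mu>\<close> with \<open>\<kappa>\<close> fixed. Integrals and
  derivatives are \<open>Ker_integral\<close> and \<open>Ker_derivative\<close>; linear combinations
  and multiples by the coordinate use linearity of \<open>\<kappa>\<close>, and a replaced operator
  uses its locality.\<close>

lemma Ker_commute:
  fixes A :: "'a charts" and B :: "'b charts"
  assumes "Ker B M \<mu>" "Ker A L \<kappa>"
    and \<Phi>: "\<And>t u. \<Phi> (t(i := u)) = \<Phi> t" "\<And>t u. \<Phi> (t(j := u)) = \<Phi> t"
    and s: "\<And>K c K' d. (K, c) \<in> A \<Longrightarrow> (K', d) \<in> B \<Longrightarrow> smooth n (J(i := K, j := K')) (\<lambda>t. \<Phi> t (c (t i)) (d (t j)))"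
    and ij: "i < n" "j < n" "i \<noteq> j" and J: "\<And>i. i < n \<Longrightarrow> convex (J i)" "convex M" "convex L"
    and t: "t \<in> bx n (J(i := L, j := M))"
    and AB: "\<And>K c. (K, c) \<in> A \<Longrightarrow> convex K" "\<And>K c. (K, c) \<in> B \<Longrightarrow> convex K"
  shows "\<kappa> (t i) (\<lambda>x. \<mu> (t j) (\<Phi> t x)) = \<mu> (t j) (\<lambda>y. \<kappa> (t i) (\<lambda>x. \<Phi> t x y))"
  using assms(1)
proof induction
  have ti: "t i \<in> L" using bx_coord[OF t ij(1)] ij(3) by simp
  have tj: "t j \<in> M" using bx_coord[OF t ij(2)] by simp
  have \<Psi>: "sfam n (J(j := K)) i A (\<lambda>t x. \<Phi> t x (d (t j)))" if d: "(K, d) \<in> B" for K d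
    unfolding sfam_def
    using s[OF _ d] \<Phi> ij(3) by (auto simp: fun_upd_twist[OF ij(3)])
  have \<Psi>': "sfam n (J(i := K)) j B (\<lambda>t. \<Phi> t (c (t i)))" if c: "(K, c) \<in> A" for K c
    unfolding sfam_def
    using s[OF c] \<Phi> ij(3) by auto
  have conv: "convex ((J(i := K)) l)" "convex ((J(j := K)) l)" if "convex K" "l < n" for K l
    using that J(1) by auto
  have sfx: "sfam n (J(j := M')) i A (\<lambda>t x. \<mu> (t j) (\<Phi> t x))" if \<mu>: "Ker B M' \<mu>" for \<mu> M'
    unfolding sfam_def
  proof (intro conjI allI ballI, goal_cases)
    case (1 t u)
    show ?case using ij(3) by (simp add: \<Phi>)
  next
    case (2 Kc)
    obtain K c where Kc: "Kc = (K, c)" by force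
    with 2 have c: "(K, c) \<in> A" by simp
    show ?case
      unfolding Kc prod.case fun_upd_twist[OF ij(3), of J, symmetric]
      by (rule smooth_Ker[OF \<mu> \<Psi>'[OF c] ij(2) conv(1)[OF AB(1)[OF c]]])
  qed
  have sfy: "sfam n (J(i := L')) j B (\<lambda>t y. \<kappa> (t i) (\<lambda>x. \<Phi> t x y))" if \<kappa>: "Ker A L' \<kappa>" for \<kappa> L'
    unfolding sfam_def
  proof (intro conjI allI ballI, goal_cases)
    case (1 t u)
    show ?case using ij(3) by (simp add: \<Phi>)
  next
    case (2 Kd)
    obtain K d where Kd: "Kd = (K, d)" by force
    with 2 have d: "(K, d) \<in> B" by simp
    show ?case
      unfolding Kd prod.case fun_upd_twist[OF ij(3), of J]
      by (rule smooth_Ker[OF \<kappa> \<Psi>[OF d] ij(1) conv(2)[OF AB(2)[OF d]]])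
  qed
  have t': "t \<in> bx n ((J(j := M))(i := L))" using t by (simp add: fun_upd_twist[OF ij(3)])
  have C1y: "C1 B (\<lambda>y. \<kappa> (t i) (\<lambda>x. \<Phi> t x y))"
    by (rule sfam_C1[OF sfy[OF assms(2)] ij(2) t])
  have C1x: "C1 A (\<lambda>x. \<mu> (t j) (\<Phi> t x))" if "Ker B M \<mu>" for \<mu>
    by (rule sfam_C1[OF sfx[OF that] ij(1) t'])
  have C1x': "C1 B (\<Phi> t x)" if "x \<in> csupp A" for x
  proof -
    from that obtain K c u where c: "(K, c) \<in> A" "u \<in> K" "x = c u" by (rule csuppE)
    have "t(i := u) \<in> bx n (J(i := K, j := M))" using t c(2) ij(3) by (auto simp: bx_def)
    from sfam_C1[OF \<Psi>'[OF c(1)] ij(2) this] c(3) show ?thesis by (simp add: \<Phi>)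
  qed
  {
    case (Ker_ev K d v)
    show ?case ..
  next
    case (Ker_int K d p q)
    from Ker_integral[OF assms(2) \<Psi>[OF Ker_int(1)] ij J(1) AB(2)[OF Ker_int(1)] Ker_int(2) t AB(1)]
    show ?case by (simp add: \<Phi>)
  next
    case (Ker_id K d)
    show ?case ..
  next
    case (Ker_der d p q)
    have d: "({p..q}, d) \<in> B" and t'': "t \<in> bx n (J(i := L, j := {p..q}))" using Ker_der t by auto
    from Ker_derivative[OF assms(2) \<Psi>[OF d] ij J(1) Ker_der(3) t'' AB(1)]
    show ?case by (simp add: \<Phi> Ker_der(2))
  next
    case (Ker_upto d p q)
    have d: "({p..q}, d) \<in> B" and p: "{p..t j} \<subseteq> {p..q}" using Ker_upto tj by auto
    \<comment> \<open>At a fixed point \<open>t\<close> the upper limit \<open>t j\<close> is a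
      number, so an indefinite integral is an integral with fixed limits.\<close>
    from Ker_integral[OF assms(2) \<Psi>[OF d] ij J(1) AB(2)[OF d] p t AB(1)]
    show ?case by (simp add: \<Phi>)
  next
    case Ker_zero
    show ?case using Ker_zero_fun[OF assms(2) ti] .
  next
    case (Ker_lin \<mu> \<mu>' a b)
    then show ?case using Ker_linear[OF assms(2) C1x[OF Ker_lin(1)] C1x[OF Ker_lin(2)] ti] by simp
  next
    case (Ker_mult \<mu>)
    then show ?case using Ker_linear[OF assms(2) C1x[OF Ker_mult(1)] C1_zero ti, of "t j" 0] by simp
  next
    case (Ker_cong \<mu> \<mu>')
    have "\<kappa> (t i) (\<lambda>x. \<mu>' (t j) (\<Phi> t x)) = \<kappa> (t i) (\<lambda>x. \<mu> (t j) (\<Phi> t x))"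
      by (rule sym, rule Ker_local[OF assms(2) C1x[OF Ker_cong(1)] ti]) (simp add: Ker_cong(2)[OF tj C1x'])
    with Ker_cong(3) Ker_cong(2)[OF tj C1y] show ?case by simp
  }
qed

section \<open>Operators on tensor products\<close>

text \<open>The second component lists the pairs of coordinates at which functions have to agree.\<close>

type_synonym 'a space = "'a charts \<times> ('a \<times> 'a) set"

definition resp :: "'a space \<Rightarrow> ('a \<Rightarrow> real) \<Rightarrow> bool" where
  "resp A f \<longleftrightarrow> (\<forall>x. f x \<noteq> 0 \<longrightarrow> x \<in> csupp (fst A)) \<and> (\<forall>(a, b)\<in>snd A. f a = f b)"

definition fn :: "'a space \<Rightarrow> ('a \<Rightarrow> real) \<Rightarrow> bool" where
  "fn A f \<longleftrightarrow> resp A f \<and> C1 (fst A) f"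

definition cconv :: "'a space \<Rightarrow> bool" where
  "cconv A \<longleftrightarrow> (\<forall>(K, c)\<in>fst A. convex K)"

definition rop :: "(('a \<Rightarrow> real) \<Rightarrow> ('b \<Rightarrow> real)) \<Rightarrow> 'a space \<Rightarrow> 'b space \<Rightarrow> bool" where
  "rop T A B \<longleftrightarrow> cconv B \<and> (\<forall>(J, c)\<in>fst B. Ker (fst A) J (\<lambda>t f. T f (c t))) \<and> (\<forall>f. resp A f \<longrightarrow> resp B (T f))"

lemma cconvD: "cconv A \<Longrightarrow> (K, c) \<in> fst A \<Longrightarrow> convex K"
  by (auto simp: cconv_def)

lemma rop_Ker: "rop T A B \<Longrightarrow> (J, c) \<in> fst B \<Longrightarrow> Ker (fst A) J (\<lambda>t f. T f (c t))"
  by (auto simp: rop_def)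

lemma rop_resp: "rop T A B \<Longrightarrow> resp A f \<Longrightarrow> resp B (T f)"
  by (simp add: rop_def)

lemma resp_supp: "resp A f \<Longrightarrow> x \<notin> csupp (fst A) \<Longrightarrow> f x = 0"
  by (auto simp: resp_def)

lemma respI:
  "(\<And>x. x \<notin> csupp (fst A) \<Longrightarrow> f x = 0) \<Longrightarrow> (\<And>p q. (p, q) \<in> snd A \<Longrightarrow> f p = f q) \<Longrightarrow> resp A f"
  by (auto simp: resp_def)

lemma resp_glue: "resp A f \<Longrightarrow> (p, q) \<in> snd A \<Longrightarrow> f p = f q"
  by (auto simp: resp_def)

lemma resp_lin: "resp A f \<Longrightarrow> resp A g \<Longrightarrow> resp A (\<lambda>x. a * f x + b * g x)"
  by (rule respI) (simp add: resp_supp, metis resp_glue)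

lemma fn_lin: "fn A f \<Longrightarrow> fn A g \<Longrightarrow> fn A (\<lambda>x. a * f x + b * g x)"
  by (simp add: fn_def resp_lin C1_lin)

lemma fn_zero: "fn A (\<lambda>_. 0)"
  by (auto simp: fn_def resp_def C1_zero)

lemma rop_lin:
  assumes "rop T A B" "fn A f" "fn A g"
  shows "T (\<lambda>x. a * f x + b * g x) y = a * T f y + b * T g y"
proof (cases "y \<in> csupp (fst B)")
  case True
  then obtain K c u where c: "(K, c) \<in> fst B" "u \<in> K" "y = c u" by (rule csuppE)
  show ?thesis unfolding c(3)
    by (rule Ker_linear[OF rop_Ker[OF assms(1) c(1)] _ _ c(2)]) (use assms(2,3) in \<open>simp_all add: fn_def\<close>)
next
  case False
  have "resp A f" "resp A g" using assms(2,3) by (simp_all add: fn_def)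
  then have "T f y = 0" "T g y = 0" "T (\<lambda>x. a * f x + b * g x) y = 0"
    by (auto intro!: resp_supp[OF rop_resp[OF assms(1)] False] resp_lin)
  then show ?thesis by simp
qed

lemma rop_zero: "rop T A B \<Longrightarrow> T (\<lambda>_. 0) y = 0"
  using rop_lin[OF _ fn_zero fn_zero, of T A B 0 0 y] by simp

lemma rop_scale:
  assumes "rop T A B" "fn A f" shows "T (\<lambda>x. a * f x) y = a * T f y"
  using rop_lin[OF assms assms(2), of a 0 y] by simp

abbreviation pt :: "nat \<Rightarrow> (nat \<Rightarrow> real set \<times> (real \<Rightarrow> 'a)) \<Rightarrow> (nat \<Rightarrow> real) \<Rightarrow> 'a list" where
  "pt n c t \<equiv> map (\<lambda>i. snd (c i) (t i)) [0..<n]"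

text \<open>One notion for forms and cochains of a cube (\<open>forms_good\<close>,
  \<open>cochains_good\<close>). The space may vary from slot to slot, so it also describes the
  stages at which only some factors of a tensor product have been applied.\<close>

definition good :: "nat \<Rightarrow> (nat \<Rightarrow> 'a space) \<Rightarrow> ('a list \<Rightarrow> real) \<Rightarrow> bool" where
  "good n V \<phi> \<longleftrightarrow> (\<forall>i<n. cconv (V i)) \<and>
     (\<forall>xs. \<phi> xs \<noteq> 0 \<longrightarrow> length xs = n \<and> (\<forall>i<n. xs ! i \<in> csupp (fst (V i)))) \<and>
     (\<forall>i<n. \<forall>(a, b)\<in>snd (V i). \<forall>xs. length xs = n \<longrightarrow> \<phi> (xs[i := a]) = \<phi> (xs[i := b])) \<and>
     (\<forall>c. (\<forall>i<n. c i \<in> fst (V i)) \<longrightarrow> smooth n (\<lambda>i. fst (c i)) (\<lambda>t. \<phi> (pt n c t)))"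

lemma good_length: "good n V \<phi> \<Longrightarrow> length xs \<noteq> n \<Longrightarrow> \<phi> xs = 0"
  by (auto simp: good_def)

lemma good_supp: "good n V \<phi> \<Longrightarrow> i < n \<Longrightarrow> xs ! i \<notin> csupp (fst (V i)) \<Longrightarrow> \<phi> xs = 0"
  by (auto simp: good_def)

lemma good_cconv: "good n V \<phi> \<Longrightarrow> i < n \<Longrightarrow> cconv (V i)"
  by (simp add: good_def)

lemma good_glue: "good n V \<phi> \<Longrightarrow> i < n \<Longrightarrow> (a, b) \<in> snd (V i) \<Longrightarrow> length xs = n \<Longrightarrow> \<phi> (xs[i := a]) = \<phi> (xs[i := b])"
  unfolding good_def by blast

lemma good_smooth: "good n V \<phi> \<Longrightarrow> (\<And>i. i < n \<Longrightarrow> c i \<in> fst (V i)) \<Longrightarrow> smooth n (\<lambda>i. fst (c i)) (\<lambda>t. \<phi> (pt n c t))"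
  by (simp add: good_def)

lemma good_cong: "good n V \<phi> \<Longrightarrow> (\<And>i. i < n \<Longrightarrow> V i = V' i) \<Longrightarrow> good n V' \<phi>"
  unfolding good_def by simp

lemma good_lin:
  assumes "good n V \<phi>" "good n V \<psi>" shows "good n V (\<lambda>xs. a * \<phi> xs + b * \<psi> xs)"
proof -
  have "smooth n (\<lambda>i. fst (c i)) (\<lambda>t. a * \<phi> (pt n c t) + b * \<psi> (pt n c t))" if c: "\<forall>i<n. c i \<in> fst (V i)" for c
    by (rule smooth_lin) (use assms c in \<open>simp_all add: good_def\<close>)
  moreover have "a * \<phi> (xs[i := p]) + b * \<psi> (xs[i := p]) = a * \<phi> (xs[i := q]) + b * \<psi> (xs[i := q])"
    if "i < n" "(p, q) \<in> snd (V i)" "length xs = n" for i p q xs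
    using good_glue[OF assms(1) that] good_glue[OF assms(2) that] by simp
  moreover have "length xs = n" if "a * \<phi> xs + b * \<psi> xs \<noteq> 0" for xs
    using that good_length[OF assms(1), of xs] good_length[OF assms(2), of xs] by (cases "length xs = n") auto
  moreover have "xs ! i \<in> csupp (fst (V i))" if "a * \<phi> xs + b * \<psi> xs \<noteq> 0" "i < n" for xs i
    using that good_supp[OF assms(1), of i xs] good_supp[OF assms(2), of i xs] by (cases "xs ! i \<in> csupp (fst (V i))") auto
  ultimately show ?thesis using good_cconv[OF assms(1)] unfolding good_def by auto
qed

lemma pt_update: "(pt n c (t(i := u)))[i := x] = (pt n c t)[i := x]"
  by (cases "i < n") (auto intro!: nth_equalityI simp: nth_list_update)

lemma pt_chart: "i < n \<Longrightarrow> pt n (c(i := (K, d))) t = (pt n c t)[i := d (t i)]"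
  by (rule nth_equalityI) (auto simp: nth_list_update)

lemma ex_pt:
  assumes "length xs = n" "\<And>i. i < n \<Longrightarrow> xs ! i \<in> csupp (A i)"
  obtains c t where "\<And>i. i < n \<Longrightarrow> c i \<in> A i" "\<And>i. i < n \<Longrightarrow> t i \<in> fst (c i)" "xs = pt n c t"
proof -
  have "\<forall>i. \<exists>c t. i < n \<longrightarrow> c \<in> A i \<and> t \<in> fst c \<and> xs ! i = snd c t"
    using assms(2) unfolding csupp_def by force
  then obtain c t where "\<And>i. i < n \<Longrightarrow> c i \<in> A i \<and> t i \<in> fst (c i) \<and> xs ! i = snd (c i) (t i)"
    by metis
  moreover from this have "xs = pt n c t"
    by (intro nth_equalityI) (simp_all add: assms(1))
  ultimately show thesis using that by blast
qed

text \<open>With slot \<open>i\<close> left open and the others parametrised by charts, a good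
  function becomes a family to which the results on \<open>Ker\<close> apply.\<close>

lemma good_sfam:
  assumes "good n V \<phi>" "i < n" "\<And>j. j < n \<Longrightarrow> j \<noteq> i \<Longrightarrow> c j \<in> fst (V j)"
  shows "sfam n (\<lambda>j. fst (c j)) i (fst (V i)) (\<lambda>t x. \<phi> ((pt n c t)[i := x]))"
  unfolding sfam_def
proof (intro conjI allI ballI, goal_cases)
  case (1 t u)
  show ?case by (simp only: pt_update)
next
  case (2 Kd)
  obtain K d where Kd: "Kd = (K, d)" by force
  have "smooth n (\<lambda>j. fst ((c(i := (K, d))) j)) (\<lambda>t. \<phi> (pt n (c(i := (K, d))) t))"
    by (rule good_smooth[OF assms(1)]) (use assms(3) 2 Kd in auto)
  also have "(\<lambda>j. fst ((c(i := (K, d))) j)) = (\<lambda>j. fst (c j))(i := K)" by (rule ext) simp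
  finally show ?case unfolding Kd prod.case pt_chart[OF assms(2)] .
qed

lemma good_slice:
  assumes "good n V \<phi>" "i < n" "length xs = n"
  shows "fn (V i) (\<lambda>x. \<phi> (xs[i := x]))"
proof -
  have "C1 (fst (V i)) (\<lambda>x. \<phi> (xs[i := x]))"
  proof (cases "\<forall>j<n. j \<noteq> i \<longrightarrow> xs ! j \<in> csupp (fst (V j))")
    case True
    \<comment> \<open>The entry \<open>xs ! i\<close> will be overwritten and may lie off the charts
      of \<open>V i\<close>; a constant chart through it lets the whole list be given by
      parameters.\<close>
    let ?A = "(\<lambda>j. fst (V j))(i := {(UNIV, \<lambda>_. xs ! i)})"
    have "xs ! j \<in> csupp (?A j)" if "j < n" for j
      using True that by (auto simp: csupp_def)
    then obtain c t where c: "\<And>j. j < n \<Longrightarrow> c j \<in> ?A j" "\<And>j. j < n \<Longrightarrow> t j \<in> fst (c j)" "xs = pt n c t"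
      using ex_pt[OF assms(3), of ?A] by blast
    have "c j \<in> fst (V j)" if "j < n" "j \<noteq> i" for j
      using c(1)[OF that(1)] that(2) by simp
    note sf = good_sfam[OF assms(1,2) this]
    have "t \<in> bx n ((\<lambda>j. fst (c j))(i := UNIV))" using c(2) by (simp add: bx_def)
    from sfam_C1[OF sf assms(2) this] show ?thesis unfolding c(3)[symmetric] by simp
  next
    case False
    then obtain j where "j < n" "j \<noteq> i" "xs ! j \<notin> csupp (fst (V j))" by blast
    then have "\<phi> (xs[i := x]) = 0" for x
      using good_supp[OF assms(1), of j "xs[i := x]"] by simp
    then show ?thesis by (simp add: C1_zero)
  qed
  moreover have "x \<in> csupp (fst (V i))" if "\<phi> (xs[i := x]) \<noteq> 0" for x
    using good_supp[OF assms(1,2), of "xs[i := x]"] that assms(2,3) by auto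
  ultimately show ?thesis
    using good_glue[OF assms(1,2) _ assms(3)] unfolding fn_def resp_def by blast
qed

section \<open>Operators acting in a single slot\<close>

definition act :: "nat \<Rightarrow> (('a \<Rightarrow> real) \<Rightarrow> ('a \<Rightarrow> real)) \<Rightarrow> ('a list \<Rightarrow> real) \<Rightarrow> ('a list \<Rightarrow> real)" where
  "act i T \<phi> xs = (if i < length xs then T (\<lambda>x. \<phi> (xs[i := x])) (xs ! i) else 0)"

lemma good_act:
  assumes g: "good n V \<phi>" and i: "i < n" and T: "rop T (V i) B"
  shows "good n (V(i := B)) (act i T \<phi>)"
  unfolding good_def
proof (intro conjI allI impI ballI, goal_cases)
  case (1 j)
  then show ?case using good_cconv[OF g] T by (simp add: rop_def)
next
  case (2 xs)
  show ?case
  proof (rule ccontr)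
    assume n: "length xs \<noteq> n"
    then have "\<phi> (xs[i := x]) = 0" for x using good_length[OF g] by simp
    with 2 rop_zero[OF T] show False by (simp add: act_def split: if_splits)
  qed
next
  case (3 xs j)
  show ?case
  proof (rule ccontr)
    assume n: "xs ! j \<notin> csupp (fst ((V(i := B)) j))"
    show False
    proof (cases "length xs = n")
      case False
      then have "\<phi> (xs[i := x]) = 0" for x using good_length[OF g] by simp
      with 3 rop_zero[OF T] show False by (simp add: act_def split: if_splits)
    next
      case True
      show False
      proof (cases "i = j")
        case True
        with 3 n show False
          using resp_supp[OF rop_resp[OF T], of "\<lambda>x. \<phi> (xs[i := x])" "xs ! i"] good_slice[OF g i \<open>length xs = n\<close>]
          by (simp add: act_def fn_def split: if_splits)
      next
        case False
        with n have "\<phi> (xs[i := x]) = 0" for x using good_supp[OF g 3(2), of "xs[i := x]"] by simp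
        with 3 rop_zero[OF T] show False by (simp add: act_def split: if_splits)
      qed
    qed
  qed
next
  case (4 j ab)
  obtain a b where ab: "ab = (a, b)" by force
  have "act i T \<phi> (xs[j := a]) = act i T \<phi> (xs[j := b])" if len: "length xs = n" for xs
  proof (cases "i = j")
    case True
    have "resp B (T (\<lambda>x. \<phi> (xs[i := x])))"
      using rop_resp[OF T] good_slice[OF g i len] by (simp add: fn_def)
    with 4 True ab len show ?thesis by (auto simp: act_def resp_def)
  next
    case False
    have "\<phi> (xs[j := a, i := x]) = \<phi> (xs[j := b, i := x])" for x
      using good_glue[OF g 4(1), of a b "xs[i := x]"] 4(2) ab False len
      by (simp add: list_update_swap[of i j])
    then show ?thesis using False by (simp add: act_def)
  qed
  then show ?case using ab by simp
next
  case (5 c)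
  let ?J = "\<lambda>j. fst (c j)"
  have ci: "(fst (c i), snd (c i)) \<in> fst B" using 5 i by auto
  have cj: "c j \<in> fst (V j)" if "j < n" "j \<noteq> i" for j using 5 that by (metis fun_upd_other)
  have "convex (?J j)" if "j < n" for j
    using cconvD[of B "fst (c i)" "snd (c i)"] ci cj[OF that] cconvD[OF good_cconv[OF g that], of "fst (c j)" "snd (c j)"] T
    by (cases "j = i") (auto simp: rop_def)
  note * = smooth_Ker[OF rop_Ker[OF T ci] good_sfam[OF g i cj] i this]
  have eq: "?J(i := fst (c i)) = ?J" by auto
  from * have "smooth n ?J (\<lambda>t. T (\<lambda>x. \<phi> ((pt n c t)[i := x])) (snd (c i) (t i)))"
    unfolding eq .
  then show ?case using i by (simp add: act_def)
qed

lemma act_lin: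
  assumes "good n V \<phi>" "good n V \<psi>" "i < n" "rop T (V i) B"
  shows "act i T (\<lambda>xs. a * \<phi> xs + b * \<psi> xs) = (\<lambda>xs. a * act i T \<phi> xs + b * act i T \<psi> xs)"
proof
  fix xs
  show "act i T (\<lambda>xs. a * \<phi> xs + b * \<psi> xs) xs = a * act i T \<phi> xs + b * act i T \<psi> xs"
  proof (cases "length xs = n")
    case True
    then show ?thesis
      using rop_lin[OF assms(4) good_slice[OF assms(1,3)] good_slice[OF assms(2,3)]] by (simp add: act_def)
  next
    case False
    then have "\<phi> (xs[i := x]) = 0" "\<psi> (xs[i := x]) = 0" for x
      using good_length[OF assms(1)] good_length[OF assms(2)] by simp_all
    then show ?thesis using rop_zero[OF assms(4)] by (simp add: act_def)
  qed
qed

text \<open>On lists of chart points the claim is \<open>Ker_commute\<close>; on all other lists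
  both sides vanish, being good for the same spaces.\<close>

lemma act_commute:
  assumes g: "good n V \<phi>" and ij: "i < n" "j < n" "i \<noteq> j" and T: "rop T (V i) B" and S: "rop S (V j) C"
  shows "act i T (act j S \<phi>) = act j S (act i T \<phi>)"
proof
  fix xs
  let ?V = "V(i := B, j := C)"
  have S': "rop S ((V(i := B)) j) C" and T': "rop T ((V(j := C)) i) B" using S T ij(3) by simp_all
  have gr: "good n ?V (act j S (act i T \<phi>))"
    by (rule good_act[OF good_act[OF g ij(1) T] ij(2) S'])
  have gl: "good n ?V (act i T (act j S \<phi>))"
    unfolding fun_upd_twist[OF ij(3)] by (rule good_act[OF good_act[OF g ij(2) S] ij(1) T'])
  show "act i T (act j S \<phi>) xs = act j S (act i T \<phi>) xs"
  proof (cases "length xs = n \<and> (\<forall>k<n. xs ! k \<in> csupp (fst (?V k)))")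
    case False
    then show ?thesis
      using good_length[OF gl] good_length[OF gr] good_supp[OF gl] good_supp[OF gr] by metis
  next
    case True
    then obtain c t where c: "\<And>k. k < n \<Longrightarrow> c k \<in> fst (?V k)" "\<And>k. k < n \<Longrightarrow> t k \<in> fst (c k)" "xs = pt n c t"
      using ex_pt[of xs n "\<lambda>k. fst (?V k)"] by blast
    let ?J = "\<lambda>k. fst (c k)"
    have ci: "(fst (c i), snd (c i)) \<in> fst B" using c(1)[OF ij(1)] ij(3) by simp
    have cj: "(fst (c j), snd (c j)) \<in> fst C" using c(1)[OF ij(2)] by simp
    have ck: "c k \<in> fst (V k)" if "k < n" "k \<noteq> i" "k \<noteq> j" for k using c(1)[OF that(1)] that by simp
    have conv: "convex (?J k)" if "k < n" for k
      using cconvD[OF good_cconv[OF gl that], of "fst (c k)" "snd (c k)"] c(1)[OF that] by simp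
    have s: "smooth n (?J(i := K, j := K')) (\<lambda>t. \<phi> ((pt n c t)[i := d (t i), j := d' (t j)]))"
      if d: "(K, d) \<in> fst (V i)" "(K', d') \<in> fst (V j)" for K d K' d'
    proof -
      have "smooth n (\<lambda>k. fst ((c(i := (K, d), j := (K', d'))) k)) (\<lambda>t. \<phi> (pt n (c(i := (K, d), j := (K', d'))) t))"
        by (rule good_smooth[OF g]) (use ck d in auto)
      also have "(\<lambda>k. fst ((c(i := (K, d), j := (K', d'))) k)) = ?J(i := K, j := K')" by (rule ext) simp
      finally show ?thesis unfolding pt_chart[OF ij(2)] pt_chart[OF ij(1)] .
    qed
    have upd: "(pt n c (t(i := u)))[i := x, j := y] = (pt n c t)[i := x, j := y]"
        "(pt n c (t(j := u)))[i := x, j := y] = (pt n c t)[i := x, j := y]" for t u x y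
      by (simp_all only: pt_update list_update_swap[OF ij(3)])
    have eq: "?J(i := fst (c i), j := fst (c j)) = ?J" by (rule ext) simp
    have "T (\<lambda>x. S (\<lambda>y. \<phi> ((pt n c t)[i := x, j := y])) (snd (c j) (t j))) (snd (c i) (t i)) =
        S (\<lambda>y. T (\<lambda>x. \<phi> ((pt n c t)[i := x, j := y])) (snd (c i) (t i))) (snd (c j) (t j))"
      by (rule Ker_commute[OF rop_Ker[OF S cj] rop_Ker[OF T ci], where \<Phi> = "\<lambda>t x y. \<phi> ((pt n c t)[i := x, j := y])" and J = ?J])
        (use ij conv s upd eq c(2) cconvD[OF good_cconv[OF g]] in \<open>auto simp: bx_def\<close>)
    then show ?thesis
      using ij c(3) by (simp add: act_def list_update_swap[OF ij(3)])
  qed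
qed

text \<open>The operator in slot \<open>m\<close> is outermost, in accordance with the recursion of
  \<open>tensor\<close>, where the first factor is applied to the result of the others.\<close>

definition acts :: "(nat \<Rightarrow> ('a \<Rightarrow> real) \<Rightarrow> ('a \<Rightarrow> real)) \<Rightarrow> nat \<Rightarrow> nat \<Rightarrow> ('a list \<Rightarrow> real) \<Rightarrow> ('a list \<Rightarrow> real)" where
  "acts T m n \<phi> = foldr (\<lambda>i. act i (T i)) [m..<n] \<phi>"

lemma acts_step: "m < n \<Longrightarrow> acts T m n \<phi> = act m (T m) (acts T (Suc m) n \<phi>)"
  by (simp add: acts_def upt_conv_Cons)

lemma acts_end [simp]: "acts T n n \<phi> = \<phi>"
  by (simp add: acts_def)

lemma acts_cong: "(\<And>i. m \<le> i \<Longrightarrow> i < n \<Longrightarrow> T i = T' i) \<Longrightarrow> acts T m n \<phi> = acts T' m n \<phi>"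
  unfolding acts_def by (rule foldr_cong) auto

lemma good_acts:
  assumes "m \<le> n" "good n V \<phi>" "\<And>i. m \<le> i \<Longrightarrow> i < n \<Longrightarrow> rop (T i) (V i) (W i)"
  shows "good n (\<lambda>i. if m \<le> i then W i else V i) (acts T m n \<phi>)"
  using assms(1,3)
proof (induction m rule: inc_induct)
  case base
  show ?case using good_cong[OF assms(2), of "\<lambda>i. if n \<le> i then W i else V i"] by simp
next
  case (step m)
  have "good n ((\<lambda>i. if Suc m \<le> i then W i else V i)(m := W m)) (act m (T m) (acts T (Suc m) n \<phi>))"
    by (rule good_act[OF step.IH]) (use step in auto)
  also have "(\<lambda>i. if Suc m \<le> i then W i else V i)(m := W m) = (\<lambda>i. if m \<le> i then W i else V i)" by auto
  finally show ?case using acts_step[OF step.hyps(2)] by metis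
qed

lemma good_acts0:
  assumes "good n V \<phi>" "\<And>i. i < n \<Longrightarrow> rop (T i) (V i) (W i)"
  shows "good n W (acts T 0 n \<phi>)"
  using good_acts[of 0 n V \<phi> T W] assms by simp

lemma acts_lin:
  assumes "m \<le> n" "good n V \<phi>" "good n V \<psi>" "\<And>i. m \<le> i \<Longrightarrow> i < n \<Longrightarrow> rop (T i) (V i) (W i)"
  shows "acts T m n (\<lambda>xs. a * \<phi> xs + b * \<psi> xs) = (\<lambda>xs. a * acts T m n \<phi> xs + b * acts T m n \<psi> xs)"
  using assms(1,4)
proof (induction m rule: inc_induct)
  case (step m)
  have T: "\<And>i. Suc m \<le> i \<Longrightarrow> i < n \<Longrightarrow> rop (T i) (V i) (W i)" using step.prems by simp
  have m: "Suc m \<le> n" using step.hyps by simp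
  have eq: "acts T (Suc m) n (\<lambda>xs. a * \<phi> xs + b * \<psi> xs) = (\<lambda>xs. a * acts T (Suc m) n \<phi> xs + b * acts T (Suc m) n \<psi> xs)"
    by (rule step.IH) (use T in auto)
  show ?case unfolding acts_step[OF step.hyps(2)] eq
    by (rule act_lin[OF good_acts[OF m assms(2) T] good_acts[OF m assms(3) T] step.hyps(2)])
      (use step in auto)
qed simp

lemma act_acts_commute:
  assumes "l < m" "m \<le> n" "good n V \<phi>" "\<And>i. m \<le> i \<Longrightarrow> i < n \<Longrightarrow> rop (T i) (V i) (W i)" "rop S (V l) C"
  shows "act l S (acts T m n \<phi>) = acts T m n (act l S \<phi>)"
  using assms(2,1,4)
proof (induction m rule: inc_induct)
  case (step m)
  have T: "\<And>i. Suc m \<le> i \<Longrightarrow> i < n \<Longrightarrow> rop (T i) (V i) (W i)" using step.prems by simp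
  have m: "Suc m \<le> n" using step.hyps by simp
  have "act l S (act m (T m) (acts T (Suc m) n \<phi>)) = act m (T m) (act l S (acts T (Suc m) n \<phi>))"
    by (rule act_commute[OF good_acts[OF m assms(3) T]]) (use step assms(5) in auto)
  then show ?case unfolding acts_step[OF step.hyps(2)] using step.IH[OF _ T] step.prems(1) by simp
qed simp

text \<open>\<open>T m\<close> is moved past the operators \<open>S i\<close> with
  \<open>i > m\<close>, after which it meets \<open>S m\<close> in slot \<open>m\<close>. The
  scalars \<open>\<gamma> i\<close> are room for Koszul signs. The identity for \<open>R\<close> is
  asked for on regular functions only, since relations such as \<open>IW = 1\<close> or
  \<open>dI = Id\<close> hold just there.\<close>

lemma acts_comp:
  assumes "m \<le> n" and g: "good n V \<phi>"
    and T: "\<And>i. i < n \<Longrightarrow> rop (T i) (V i) (V' i)" and S: "\<And>i. i < n \<Longrightarrow> rop (S i) (V' i) (V'' i)"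
    and R: "\<And>i f y. i < n \<Longrightarrow> fn (V i) f \<Longrightarrow> fn (V' i) (T i f) \<Longrightarrow> S i (T i f) y = \<gamma> i * R i f y" and \<gamma>: "\<And>i. i < n \<Longrightarrow> \<gamma> i \<noteq> 0"
  shows "length xs = n \<Longrightarrow> acts S m n (acts T m n \<phi>) xs = (\<Prod>i=m..<n. \<gamma> i) * acts R m n \<phi> xs"
  using assms(1)
proof (induction m arbitrary: xs rule: inc_induct)
  case base
  show ?case by simp
next
  case (step m)
  have m: "Suc m \<le> n" using step.hyps by simp
  let ?T = "acts T (Suc m) n \<phi>"
  let ?V = "\<lambda>i. if Suc m \<le> i then V' i else V i"
  let ?W = "\<lambda>i. if Suc m \<le> i then V'' i else ?V i"
  let ?\<psi> = "acts S (Suc m) n ?T"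
  define \<Gamma> where "\<Gamma> = (\<Prod>i=Suc m..<n. \<gamma> i)"
  have \<Gamma>: "\<Gamma> \<noteq> 0" unfolding \<Gamma>_def using \<gamma> by simp
  have gT: "good n ?V ?T" by (rule good_acts[OF m g]) (use T in auto)
  have g\<psi>: "good n ?W ?\<psi>" by (rule good_acts[OF m gT]) (use S in auto)
  define \<rho> where "\<rho> = (\<lambda>x. acts R (Suc m) n \<phi> (xs[m := x]))"
  have \<psi>: "?\<psi> (xs[m := x]) = \<Gamma> * \<rho> x" for x
    using step.IH[of "xs[m := x]"] step.prems by (simp add: \<Gamma>_def \<rho>_def)
  have sl: "fn (V m) (\<lambda>x. \<Gamma> * \<rho> x)"
    using good_slice[OF g\<psi> step.hyps(2) step.prems] by (simp add: \<psi>)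
  \<comment> \<open>Goodness is known for the composite of the \<open>S\<close> and
    \<open>T\<close>, not for the product of the \<open>R\<close>; dividing by the nonzero
    \<open>\<Gamma>\<close> transfers regularity to the slice \<open>\<rho>\<close>.\<close>
  have \<rho>: "fn (V m) \<rho>"
    using fn_lin[OF sl sl, of "1 / \<Gamma>" 0] \<Gamma> by simp
  have "acts S m n (acts T m n \<phi>) xs = act m (S m) (acts S (Suc m) n (act m (T m) ?T)) xs"
    by (simp add: acts_step[OF step.hyps(2)])
  also have "acts S (Suc m) n (act m (T m) ?T) = act m (T m) ?\<psi>"
    by (rule act_acts_commute[OF _ m gT, symmetric]) (use S T step.hyps in auto)
  also have "act m (S m) (act m (T m) ?\<psi>) xs = S m (T m (\<lambda>x. \<Gamma> * \<rho> x)) (xs ! m)"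
    using step.hyps(2) step.prems by (simp add: act_def \<psi>)
  also have "T m (\<lambda>x. \<Gamma> * \<rho> x) = (\<lambda>x. \<Gamma> * T m \<rho> x)"
    using rop_scale[OF T[OF step.hyps(2)] \<rho>] by blast
  also have "S m (\<lambda>x. \<Gamma> * T m \<rho> x) (xs ! m) = \<Gamma> * (\<gamma> m * R m \<rho> (xs ! m))"
  proof -
    have "rop (T m) (?W m) (V' m)" using T[OF step.hyps(2)] by simp
    from good_slice[OF good_act[OF g\<psi> step.hyps(2) this] step.hyps(2) step.prems]
    have "fn (V' m) (\<lambda>x. T m (\<lambda>x. \<Gamma> * \<rho> x) x)"
      using step.hyps(2) step.prems by (simp add: act_def \<psi>)
    then have sl': "fn (V' m) (\<lambda>x. \<Gamma> * T m \<rho> x)"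
      using rop_scale[OF T[OF step.hyps(2)] \<rho>] by simp
    have T\<rho>: "fn (V' m) (T m \<rho>)"
      using fn_lin[OF sl' sl', of "1 / \<Gamma>" 0] \<Gamma> by simp
    from rop_scale[OF S[OF step.hyps(2)] this] show ?thesis
      using R[OF step.hyps(2) \<rho> T\<rho>] by simp
  qed
  also have "\<dots> = (\<Prod>i=m..<n. \<gamma> i) * acts R m n \<phi> xs"
    using step.hyps(2) step.prems
    by (simp add: acts_step act_def \<rho>_def \<Gamma>_def prod.atLeast_Suc_lessThan)
  finally show ?case .
qed

lemma acts_lin_at:
  assumes "m \<le> j" "j < n" "good n V \<phi>" "\<And>i. i < n \<Longrightarrow> i \<noteq> j \<Longrightarrow> rop (T i) (V i) (W i)"
    and P: "rop P (V j) (W j)" and Q: "rop Q (V j) (W j)"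
  shows "acts (T(j := \<lambda>f y. a * P f y + b * Q f y)) m n \<phi> =
    (\<lambda>xs. a * acts (T(j := P)) m n \<phi> xs + b * acts (T(j := Q)) m n \<phi> xs)"
  using assms(1)
proof (induction m rule: inc_induct)
  case base
  have "acts (T(j := X)) (Suc j) n \<phi> = acts T (Suc j) n \<phi>" for X
    by (rule acts_cong) simp
  then show ?case
    unfolding acts_step[OF assms(2)] by (simp add: act_def fun_eq_iff fun_upd_same del: fun_upd_apply)
next
  case (step m)
  have m: "m < n" "m \<noteq> j" "Suc m \<le> n" using step.hyps assms(2) by auto
  have g: "good n (\<lambda>i. if Suc m \<le> i then W i else V i) (acts (T(j := X)) (Suc m) n \<phi>)" if "rop X (V j) (W j)" for X
    by (rule good_acts[OF m(3) assms(3)]) (use that assms(4) in auto)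
  show ?case
    unfolding acts_step[OF m(1)] step.IH
    using act_lin[OF g[OF P] g[OF Q] m(1), of "T m" "W m" a b] assms(4)[OF m(1,2)] m(2) by simp
qed

section \<open>Tensor products of graded operators\<close>

text \<open>A degree that is constant along charts and equal at glued coordinates makes
  multiplication by a degree-dependent sign preserve smoothness and gluing.\<close>

definition wf_space :: "('a \<Rightarrow> int) \<Rightarrow> 'a space \<Rightarrow> bool" where
  "wf_space dg A \<longleftrightarrow> cconv A \<and> (\<forall>(K, c)\<in>fst A. \<forall>u\<in>K. \<forall>v\<in>K. dg (c u) = dg (c v)) \<and> (\<forall>(a, b)\<in>snd A. dg a = dg b)"

text \<open>The last clause is homogeneity of degree \<open>r\<close> in terms of coordinates: the
  value at \<open>y\<close> depends only on the part of \<open>f\<close> in degree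
  \<open>dg' y - r\<close>.\<close>

definition gop :: "('a \<Rightarrow> int) \<Rightarrow> ('b \<Rightarrow> int) \<Rightarrow> int \<Rightarrow> (('a \<Rightarrow> real) \<Rightarrow> ('b \<Rightarrow> real)) \<Rightarrow> 'a space \<Rightarrow> 'b space \<Rightarrow> bool" where
  "gop dg dg' r T A B \<longleftrightarrow> rop T A B \<and> wf_space dg A \<and> wf_space dg' B \<and>
     (\<forall>f g y. (\<forall>x. dg' y = dg x + r \<longrightarrow> f x = g x) \<longrightarrow> T f y = T g y)"

definition sgn1 :: "int \<Rightarrow> real" where "sgn1 m = (-1) powi m"

lemma sgn1_add: "sgn1 (a + b) = sgn1 a * sgn1 b"
  by (simp add: sgn1_def power_int_minus_left)

lemma sgn1_0 [simp]: "sgn1 0 = 1" and sgn1_1 [simp]: "sgn1 1 = -1" and sgn1_m1 [simp]: "sgn1 (-1) = -1"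
  by (simp_all add: sgn1_def)

lemma sgn1_sq [simp]: "sgn1 a * sgn1 a = 1" "sgn1 a * (sgn1 a * x) = x"
  by (simp_all add: sgn1_def power_int_minus_left)

lemma sgn1_nz [simp]: "sgn1 a \<noteq> 0"
  by (simp add: sgn1_def)

lemma sgn1_even_odd: "sgn1 a = (if even a then 1 else -1)"
  by (simp add: sgn1_def power_int_minus_left)

text \<open>The slotwise Koszul sign. Later \<open>m\<close> is the total degree of the factors to
  the right (\<open>rest\<close>), which are carried past the source coordinate
  \<open>x\<close>.\<close>

definition twist :: "('a \<Rightarrow> int) \<Rightarrow> int \<Rightarrow> (('a \<Rightarrow> real) \<Rightarrow> ('b \<Rightarrow> real)) \<Rightarrow> (('a \<Rightarrow> real) \<Rightarrow> ('b \<Rightarrow> real))" where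
  "twist dg m T f = T (\<lambda>x. sgn1 (m * dg x) * f x)"

lemma gop_rop: "gop dg dg' r T A B \<Longrightarrow> rop T A B"
  by (simp add: gop_def)

lemma gop_local: "gop dg dg' r T A B \<Longrightarrow> (\<And>x. dg' y = dg x + r \<Longrightarrow> f x = g x) \<Longrightarrow> T f y = T g y"
  by (simp add: gop_def)

lemma C1_chartwise_scale:
  assumes "C1 A f" "\<And>K c. (K, c) \<in> A \<Longrightarrow> \<exists>a. \<forall>u\<in>K. s (c u) = a"
  shows "C1 A (\<lambda>x. s x * f x)"
  unfolding C1_def
proof clarify
  fix K c assume c: "(K, c) \<in> A"
  obtain a where a: "\<And>u. u \<in> K \<Longrightarrow> s (c u) = a" using assms(2)[OF c] by blast
  obtain h where h: "continuous_on K h" "\<And>u. u \<in> K \<Longrightarrow> ((\<lambda>v. f (c v)) has_real_derivative h u) (at u within K)"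
    using assms(1) c unfolding C1_def by blast
  have "((\<lambda>v. s (c v) * f (c v)) has_real_derivative a * h u) (at u within K)" if u: "u \<in> K" for u
    using DERIV_cmult[OF h(2)[OF u]] zero_less_one u
    by (rule has_field_derivative_transform_within) (simp add: a)
  then show "\<exists>h. continuous_on K h \<and> (\<forall>u\<in>K. ((\<lambda>v. s (c v) * f (c v)) has_real_derivative h u) (at u within K))"
    using h(1) by (intro exI[of _ "\<lambda>u. a * h u"]) (auto intro!: continuous_on_mult continuous_on_const)
qed

lemma resp_twist:
  assumes "wf_space dg A" "resp A f" shows "resp A (\<lambda>x. sgn1 (m * dg x) * f x)"
proof (rule respI)
  fix p q assume pq: "(p, q) \<in> snd A"
  with assms(1) have "dg p = dg q" unfolding wf_space_def by blast
  with resp_glue[OF assms(2) pq] show "sgn1 (m * dg p) * f p = sgn1 (m * dg q) * f q" by simp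
qed (simp add: resp_supp[OF assms(2)])

lemma fn_twist:
  assumes "wf_space dg A" "fn A f" shows "fn A (\<lambda>x. sgn1 (m * dg x) * f x)"
proof -
  have "C1 (fst A) (\<lambda>x. sgn1 (m * dg x) * f x)"
  proof (rule C1_chartwise_scale)
    fix K c assume "(K, c) \<in> fst A"
    with assms(1) have "\<forall>u\<in>K. \<forall>v\<in>K. dg (c u) = dg (c v)" unfolding wf_space_def by blast
    then show "\<exists>a. \<forall>u\<in>K. sgn1 (m * dg (c u)) = a" by metis
  qed (use assms(2) in \<open>simp add: fn_def\<close>)
  moreover have "resp A (\<lambda>x. sgn1 (m * dg x) * f x)"
    using resp_twist[OF assms(1)] assms(2) by (simp add: fn_def)
  ultimately show ?thesis by (simp add: fn_def)
qed

text \<open>For the value at \<open>y\<close> only coordinates of degree \<open>dg' y - r\<close>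
  count; on them the sign is a constant, which splits into the two factors because signs are their
  own inverses.\<close>

lemma gop_twist:
  assumes "gop dg dg' r T A B" "fn A f"
  shows "T (\<lambda>x. sgn1 (m * dg x) * f x) y = sgn1 (m * dg' y) * (sgn1 (m * r) * T f y)"
proof -
  have "T (\<lambda>x. sgn1 (m * dg x) * f x) y = T (\<lambda>x. (sgn1 (m * dg' y) * sgn1 (m * r)) * f x) y"
    by (rule gop_local[OF assms(1)]) (simp add: distrib_left sgn1_add)
  then show ?thesis using rop_scale[OF gop_rop[OF assms(1)] assms(2)] by simp
qed

lemma rop_twist:
  assumes T: "gop dg dg' r T A B"
  shows "rop (twist dg m T) A B"
  unfolding rop_def
proof (intro conjI ballI allI impI, goal_cases)
  case 1
  show ?case using gop_rop[OF T] by (simp add: rop_def)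
next
  case (2 Jc)
  obtain J c where Jc: "Jc = (J, c)" by force
  with 2 have c: "(J, c) \<in> fst B" by simp
  note K = rop_Ker[OF gop_rop[OF T] c]
  have dgc: "dg' (c u) = dg' (c v)" if "u \<in> J" "v \<in> J" for u v
    using T c that unfolding gop_def wf_space_def by blast
  \<comment> \<open>Any point of \<open>J\<close> serves, since the degree is constant along the
    chart and the sign is thus a scalar. For empty \<open>J\<close> the condition of
    \<open>Ker_cong\<close> is vacuous.\<close>
  define v where "v = (SOME v. v \<in> J)"
  have v: "v \<in> J" if "t \<in> J" for t unfolding v_def using that by (rule someI)
  let ?a = "sgn1 (m * dg' (c v)) * sgn1 (m * r)"
  have "Ker (fst A) J (\<lambda>t f. ?a * T f (c t) + 0 * T f (c t))" by (rule Ker_lin[OF K K])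
  then have "Ker (fst A) J (\<lambda>t f. twist dg m T f (c t))"
  proof (rule Ker_cong)
    fix t f assume t: "t \<in> J" and f: "C1 (fst A) f"
    have "twist dg m T f (c t) = T (\<lambda>x. ?a * f x + 0 * f x) (c t)"
      unfolding twist_def dgc[OF v[OF t] t]
      by (rule gop_local[OF T]) (simp add: distrib_left sgn1_add)
    also have "\<dots> = ?a * T f (c t) + 0 * T f (c t)" by (rule Ker_linear[OF K f f t])
    finally show "twist dg m T f (c t) = ?a * T f (c t) + 0 * T f (c t)" .
  qed
  then show ?case unfolding Jc by simp
next
  case (3 f)
  then show ?case unfolding twist_def using T
    by (intro rop_resp[OF gop_rop[OF T]] resp_twist) (simp_all add: gop_def)
qed

lemma gop_zero: "gop dg dg' r T A B \<Longrightarrow> T (\<lambda>_. 0) y = 0"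
  by (rule rop_zero[OF gop_rop])

definition tens :: "('a \<Rightarrow> int) \<Rightarrow> nat \<Rightarrow> (nat \<Rightarrow> int) \<Rightarrow> (nat \<Rightarrow> ('a \<Rightarrow> real) \<Rightarrow> ('b \<Rightarrow> real)) \<Rightarrow> ('a list \<Rightarrow> real) \<Rightarrow> ('b list \<Rightarrow> real)" where
  "tens dg n r T = tensor dg (map (\<lambda>i. (r i, T i)) [0..<n])"

definition rest :: "(nat \<Rightarrow> int) \<Rightarrow> nat \<Rightarrow> nat \<Rightarrow> int" where
  "rest r n i = (\<Sum>j=Suc i..<n. r j)"

lemma tensor_zero:
  assumes "\<And>p y. p \<in> set Ts \<Longrightarrow> snd p (\<lambda>_. 0) y = 0"
  shows "length ys \<noteq> length Ts \<Longrightarrow> tensor dg Ts \<phi> ys = 0"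
  using assms
proof (induction Ts arbitrary: \<phi> ys)
  case Nil
  then show ?case by (cases ys) auto
next
  case (Cons p Ts)
  obtain r T where p: "p = (r, T)" by force
  show ?case
  proof (cases ys)
    case (Cons y ys')
    have "tensor dg Ts (\<lambda>xs. \<phi> (x # xs)) ys' = 0" for x
      by (rule Cons.IH) (use Cons.prems \<open>ys = y # ys'\<close> in auto)
    then show ?thesis using Cons.prems(2)[of p y] p \<open>ys = y # ys'\<close> by simp
  qed simp
qed

lemma tens_zero:
  assumes "\<And>i y. i < n \<Longrightarrow> T i (\<lambda>_. 0) y = 0" "length ys \<noteq> n"
  shows "tens dg n r T \<phi> ys = 0"
  unfolding tens_def by (rule tensor_zero) (use assms in auto)

text \<open>The prefix \<open>pre\<close> holds the entries already consumed: \<open>tensor\<close>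
  recurses along the list, whereas \<open>acts\<close> addresses slots by position. The sign inside
  \<open>tensor\<close> is taken at the source coordinate, exactly as in
  \<open>twist\<close>.\<close>

lemma tensor_acts:
  assumes "m \<le> n" "length pre = m" "length ys = n - m"
  shows "tensor dg (map (\<lambda>i. (r i, T i)) [m..<n]) (\<lambda>xs. \<phi> (pre @ xs)) ys =
    acts (\<lambda>i. twist dg (rest r n i) (T i)) m n \<phi> (pre @ ys)"
  using assms
proof (induction m arbitrary: pre ys rule: inc_induct)
  case (step m)
  then obtain y ys' where ys: "ys = y # ys'" "length ys' = n - Suc m"
    by (cases ys) auto
  have u: "(pre @ y # ys')[m := x] = (pre @ [x]) @ ys'" "(pre @ y # ys') ! m = y" for x
    using step.prems(1) by (simp_all add: list_update_append nth_append)
  have IH: "tensor dg (map (\<lambda>i. (r i, T i)) [Suc m..<n]) (\<lambda>xs. \<phi> (pre @ x # xs)) ys' =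
      acts (\<lambda>i. twist dg (rest r n i) (T i)) (Suc m) n \<phi> ((pre @ [x]) @ ys')" for x
    using step.IH[of "pre @ [x]" ys'] step.prems(1) ys(2) by simp
  have sl: "sum_list (map fst (map (\<lambda>i. (r i, T i)) [Suc m..<n])) = rest r n m"
    by (simp add: rest_def comp_def interv_sum_list_conv_sum_set_nat)
  show ?case
    unfolding upt_conv_Cons[OF step.hyps(2)] list.map ys(1) tensor.simps sl IH acts_step[OF step.hyps(2)]
    using step.hyps(2) step.prems(1) ys(2) by (simp add: act_def twist_def sgn1_def u)
qed simp

lemma tens_acts:
  assumes "good n V \<phi>" "\<And>i. i < n \<Longrightarrow> gop dg dg (r i) (T i) (V i) (W i)"
  shows "tens dg n r T \<phi> = acts (\<lambda>i. twist dg (rest r n i) (T i)) 0 n \<phi>"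
proof
  fix ys
  show "tens dg n r T \<phi> ys = acts (\<lambda>i. twist dg (rest r n i) (T i)) 0 n \<phi> ys"
  proof (cases "length ys = n")
    case True
    then show ?thesis using tensor_acts[of 0 n "[]" ys dg r T \<phi>] by (simp add: tens_def)
  next
    case False
    have "good n W (acts (\<lambda>i. twist dg (rest r n i) (T i)) 0 n \<phi>)"
      by (rule good_acts0[OF assms(1)]) (rule rop_twist[OF assms(2)])
    from good_length[OF this False] tens_zero[OF _ False, of T] gop_zero[OF assms(2)] show ?thesis by simp
  qed
qed

text \<open>A tensor product of maps between different types is factored into maps acting in one position each
  by embedding both types into one type \<open>'u\<close>; intermediate lists have entries of both types.\<close>

definition lift :: "('a \<Rightarrow> 'u) \<Rightarrow> ('b \<Rightarrow> 'u) \<Rightarrow> (('a \<Rightarrow> real) \<Rightarrow> ('b \<Rightarrow> real)) \<Rightarrow> (('u \<Rightarrow> real) \<Rightarrow> ('u \<Rightarrow> real))" where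
  "lift e e' T f u = (if u \<in> range e' then T (\<lambda>x. f (e x)) (inv e' u) else 0)"

definition push :: "('a \<Rightarrow> 'u) \<Rightarrow> 'a space \<Rightarrow> 'u space" where
  "push e A = ((\<lambda>(K, c). (K, e \<circ> c)) ` fst A, (\<lambda>(a, b). (e a, e b)) ` snd A)"

definition ext_list :: "('a \<Rightarrow> 'u) \<Rightarrow> ('a list \<Rightarrow> real) \<Rightarrow> ('u list \<Rightarrow> real)" where
  "ext_list e \<phi> us = (if set us \<subseteq> range e then \<phi> (map (inv e) us) else 0)"

lemma ext_list_map: "inj e \<Longrightarrow> ext_list e \<phi> (map e xs) = \<phi> xs"
  by (auto simp: ext_list_def comp_def)

lemma lift_apply: "inj e' \<Longrightarrow> lift e e' T f (e' y) = T (\<lambda>x. f (e x)) y"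
  by (simp add: lift_def)

lemma csupp_push: "csupp (fst (push e A)) = e ` csupp (fst A)"
proof (rule set_eqI, rule iffI)
  fix y assume "y \<in> csupp (fst (push e A))"
  then obtain K c u where "(K, c) \<in> fst A" "u \<in> K" "y = e (c u)" by (auto simp: csupp_def push_def)
  then show "y \<in> e ` csupp (fst A)" using csuppI by fast
next
  fix y assume "y \<in> e ` csupp (fst A)"
  then obtain K c u where c: "(K, c) \<in> fst A" "u \<in> K" "y = e (c u)" by (auto simp: csupp_def)
  have "(K, e \<circ> c) \<in> fst (push e A)" using c(1) image_eqI[of "(K, e \<circ> c)" "\<lambda>(K, c). (K, e \<circ> c)" "(K, c)"] by (simp add: push_def)
  from csuppI[OF this c(2)] show "y \<in> csupp (fst (push e A))" by (simp add: c(3))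
qed

lemma C1_push: "C1 (fst (push e A)) f \<longleftrightarrow> C1 (fst A) (\<lambda>x. f (e x))"
  by (simp add: C1_def push_def split_beta)

lemma resp_push:
  assumes "inj e" "resp (push e A) f" shows "resp A (\<lambda>x. f (e x))"
proof (rule respI)
  fix x assume "x \<notin> csupp (fst A)"
  then have "e x \<notin> csupp (fst (push e A))" using assms(1) by (simp add: csupp_push inj_image_mem_iff)
  then show "f (e x) = 0" by (rule resp_supp[OF assms(2)])
next
  fix p q assume "(p, q) \<in> snd A"
  then have "(e p, e q) \<in> snd (push e A)" by (force simp: push_def)
  then show "f (e p) = f (e q)" by (rule resp_glue[OF assms(2)])
qed

lemma fn_push: "inj e \<Longrightarrow> fn (push e A) f \<Longrightarrow> fn A (\<lambda>x. f (e x))"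
  by (simp add: fn_def resp_push C1_push)

lemma Ker_push: "Ker (fst A) J \<kappa> \<Longrightarrow> Ker (fst (push e A)) J (\<lambda>t f. \<kappa> t (\<lambda>x. f (e x)))"
proof (induction rule: Ker.induct)
  have c: "(K, e \<circ> c) \<in> fst (push e A)" if "(K, c) \<in> fst A" for K c
    using that image_eqI[of "(K, e \<circ> c)" "\<lambda>(K, c). (K, e \<circ> c)" "(K, c)"] by (simp add: push_def)
  {
    case (Ker_ev K c u)
    from Ker.Ker_ev[OF c[OF Ker_ev(1)] Ker_ev(2)] show ?case by (simp only: comp_apply)
  next
    case (Ker_int K c p q)
    from Ker.Ker_int[OF c[OF Ker_int(1)] Ker_int(2)] show ?case by (simp only: comp_apply)
  next
    case (Ker_id K c)
    from Ker.Ker_id[OF c[OF Ker_id(1)] Ker_id(2)] show ?case by (simp only: comp_apply)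
  next
    case (Ker_der d p q)
    from Ker.Ker_der[OF c[OF Ker_der(1)] Ker_der(2,3)] show ?case by (simp only: comp_apply)
  next
    case (Ker_upto d p q)
    from Ker.Ker_upto[OF c[OF Ker_upto(1)] Ker_upto(2)] show ?case by (simp only: comp_apply)
  next
    case Ker_zero
    show ?case by (rule Ker.Ker_zero)
  next
    case (Ker_lin \<kappa> \<kappa>' a b)
    from Ker.Ker_lin[OF Ker_lin(3,4)] show ?case .
  next
    case (Ker_mult \<kappa>)
    from Ker.Ker_mult[OF Ker_mult(2)] show ?case .
  next
    case (Ker_cong \<kappa> \<kappa>')
    show ?case by (rule Ker.Ker_cong[OF Ker_cong(3)]) (simp add: Ker_cong(2) C1_push)
  }
qed

lemma cconv_push: "cconv (push e A) \<longleftrightarrow> cconv A"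
  by (simp add: cconv_def push_def split_beta)

lemma rop_lift:
  assumes "inj e" "inj e'" "rop T A B"
  shows "rop (lift e e' T) (push e A) (push e' B)"
  unfolding rop_def
proof (intro conjI ballI allI impI, goal_cases)
  case 1
  show ?case using assms(3) by (simp add: rop_def cconv_push)
next
  case (2 Jc)
  then obtain J c where Jc: "Jc = (J, e' \<circ> c)" "(J, c) \<in> fst B" by (auto simp: push_def)
  from Ker_push[OF rop_Ker[OF assms(3) Jc(2)]] show ?case
    unfolding Jc prod.case comp_apply lift_apply[OF assms(2)] .
next
  case (3 f)
  note r = rop_resp[OF assms(3) resp_push[OF assms(1) 3]]
  show ?case
  proof (rule respI)
    fix u assume "u \<notin> csupp (fst (push e' B))"
    then show "lift e e' T f u = 0"
      using resp_supp[OF r] by (auto simp: csupp_push lift_def inj_image_mem_iff[OF assms(2)] assms(2))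
  next
    fix p q assume "(p, q) \<in> snd (push e' B)"
    then obtain p' q' where "p = e' p'" "q = e' q'" "(p', q') \<in> snd B" by (auto simp: push_def)
    then show "lift e e' T f p = lift e e' T f q" using resp_glue[OF r] assms(2) by (simp add: lift_apply)
  qed
qed

lemma wf_space_push: "(\<And>x. dgu (e x) = dg x) \<Longrightarrow> wf_space dgu (push e A) \<longleftrightarrow> wf_space dg A"
  unfolding wf_space_def cconv_push by (simp add: push_def split_beta)

lemma gop_lift:
  fixes e :: "'a \<Rightarrow> 'u" and e' :: "'b \<Rightarrow> 'u"
  assumes "inj e" "inj e'" "gop dg dg' r T A B" "\<And>x. dgu (e x) = dg x" "\<And>x. dgu (e' x) = dg' x"
  shows "gop dgu dgu r (lift e e' T) (push e A) (push e' B)"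
  unfolding gop_def
proof (intro conjI allI impI)
  show "rop (lift e e' T) (push e A) (push e' B)" using rop_lift[OF assms(1,2) gop_rop[OF assms(3)]] .
  show "wf_space dgu (push e A)" "wf_space dgu (push e' B)"
    using assms(3) wf_space_push[of dgu e dg A] wf_space_push[of dgu e' dg' B] assms(4,5) by (auto simp: gop_def)
  fix f g :: "'u \<Rightarrow> real" and y assume fg: "\<forall>x. dgu y = dgu x + r \<longrightarrow> f x = g x"
  show "lift e e' T f y = lift e e' T g y"
  proof (cases "y \<in> range e'")
    case True
    then obtain y' where y: "y = e' y'" by blast
    show ?thesis unfolding y lift_apply[OF assms(2)]
      by (rule gop_local[OF assms(3)]) (use fg assms(4,5) y in auto)
  qed (simp add: lift_def)
qed

lemma good_ext:
  assumes e: "inj e" and g: "good n V \<phi>"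
  shows "good n (\<lambda>i. push e (V i)) (ext_list e \<phi>)"
  unfolding good_def
proof (intro conjI allI impI ballI, goal_cases)
  case (1 i)
  then show ?case using good_cconv[OF g] by (simp add: cconv_push)
next
  case (2 xs)
  then show ?case using good_length[OF g, of "map (inv e) xs"] by (auto simp: ext_list_def split: if_splits)
next
  case (3 xs i)
  then have xs: "set xs \<subseteq> range e" "\<phi> (map (inv e) xs) \<noteq> 0" by (auto simp: ext_list_def split: if_splits)
  then have n: "length xs = n" using good_length[OF g, of "map (inv e) xs"] by auto
  have "xs ! i \<in> range e" using xs(1) n 3(2) nth_mem[of i xs] by blast
  then have "xs ! i = e (inv e (xs ! i))" by (rule f_inv_into_f[symmetric])
  moreover have "inv e (xs ! i) \<in> csupp (fst (V i))"
    using xs(2) good_supp[OF g 3(2), of "map (inv e) xs"] n 3(2) by auto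
  ultimately show ?case unfolding csupp_push by blast
next
  case (4 i pq)
  then obtain p q where pq: "pq = (e p, e q)" "(p, q) \<in> snd (V i)" by (auto simp: push_def)
  have s: "set (xs[i := e x]) \<subseteq> range e \<longleftrightarrow> (\<forall>j<length xs. j \<noteq> i \<longrightarrow> xs ! j \<in> range e)" for x xs
    by (simp only: subset_eq all_set_conv_all_nth) (metis nth_list_update_eq nth_list_update_neq length_list_update rangeI)
  have "ext_list e \<phi> (xs[i := e p]) = ext_list e \<phi> (xs[i := e q])" if "length xs = n" for xs
    using good_glue[OF g 4(1) pq(2), of "map (inv e) xs"] that e
    by (auto simp: ext_list_def s map_update)
  then show ?case unfolding pq by simp
next
  case (5 c)
  have "\<exists>d. i < n \<longrightarrow> d \<in> fst (V i) \<and> c i = (fst d, e \<circ> snd d)" for i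
  proof (cases "i < n")
    case True
    with 5 have "c i \<in> fst (push e (V i))" by blast
    then obtain K d where "(K, d) \<in> fst (V i)" "c i = (K, e \<circ> d)" by (auto simp: push_def)
    then show ?thesis by (intro exI[of _ "(K, d)"]) simp
  qed simp
  then obtain d where d: "\<And>i. i < n \<Longrightarrow> d i \<in> fst (V i)" "\<And>i. i < n \<Longrightarrow> c i = (fst (d i), e \<circ> snd (d i))" by metis
  have "smooth n (\<lambda>i. fst (d i)) (\<lambda>t. \<phi> (pt n d t))" by (rule good_smooth[OF g d(1)])
  moreover have "ext_list e \<phi> (pt n c t) = \<phi> (pt n d t)" for t
  proof -
    have "pt n c t = map e (pt n d t)" using d(2) by simp
    then show ?thesis by (simp only: ext_list_map[OF e])
  qed
  ultimately have "smooth n (\<lambda>i. fst (d i)) (\<lambda>t. ext_list e \<phi> (pt n c t))" by simp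
  then show ?case by (rule smooth_subset) (simp add: d(2))
qed

lemma good_pull:
  assumes e: "inj e" and g: "good n (\<lambda>i. push e (V i)) \<Psi>"
  shows "good n V (\<lambda>xs. \<Psi> (map e xs))"
  unfolding good_def
proof (intro conjI allI impI ballI, goal_cases)
  case (1 i)
  then show ?case using good_cconv[OF g] by (simp add: cconv_push)
next
  case (2 xs)
  then show ?case using good_length[OF g, of "map e xs"] by auto
next
  case (3 xs i)
  then have "length xs = n" using good_length[OF g, of "map e xs"] by auto
  then show ?case using good_supp[OF g 3(2), of "map e xs"] 3 e by (auto simp: csupp_push inj_image_mem_iff)
next
  case (4 i pq)
  obtain p q where pq: "pq = (p, q)" by force
  with 4 have "(e p, e q) \<in> snd (push e (V i))" by (force simp: push_def)
  from good_glue[OF g 4(1) this] show ?case by (auto simp: pq map_update)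
next
  case (5 c)
  let ?c = "\<lambda>i. (fst (c i), e \<circ> snd (c i))"
  have "smooth n (\<lambda>i. fst (?c i)) (\<lambda>t. \<Psi> (pt n ?c t))"
  proof (rule good_smooth[OF g])
    fix i assume "i < n"
    with 5 have "c i \<in> fst (V i)" by simp
    then show "?c i \<in> fst (push e (V i))"
      using image_eqI[of "?c i" "\<lambda>(K, c). (K, e \<circ> c)" "c i"] by (simp add: push_def split_beta)
  qed
  then show ?case by (simp add: comp_def)
qed

lemma tensor_lift:
  assumes "inj e'" "\<And>x. dgu (e x) = dg x"
  shows "tensor dgu (map (\<lambda>(r, T). (r, lift e e' T)) Ts) \<Phi> (map e' ys) = tensor dg Ts (\<lambda>xs. \<Phi> (map e xs)) ys"
proof (induction Ts arbitrary: \<Phi> ys)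
  case Nil
  then show ?case by (cases ys) auto
next
  case (Cons p Ts)
  obtain r T where p: "p = (r, T)" by force
  have "map fst (map (\<lambda>(r, T). (r, lift e e' T)) Ts) = map fst Ts" by auto
  then show ?case using Cons assms p
    by (cases ys) (simp_all only: list.map prod.case tensor.simps lift_apply)
qed

lemma tens_lift:
  assumes "inj e'" "\<And>x. dgu (e x) = dg x"
  shows "tens dgu n r (\<lambda>i. lift e e' (T i)) \<Phi> (map e' ys) = tens dg n r T (\<lambda>xs. \<Phi> (map e xs)) ys"
  using tensor_lift[where e = e and e' = e' and dgu = dgu and dg = dg, OF assms, where Ts = "map (\<lambda>i. (r i, T i)) [0..<n]" and \<Phi> = \<Phi> and ys = ys]
  by (simp add: tens_def comp_def)

section \<open>Composition and linearity of tensor products, first within one type and then between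
  types\<close>

lemma good_tens_same:
  assumes "good n V \<phi>" "\<And>i. i < n \<Longrightarrow> gop dg dg (r i) (T i) (V i) (W i)"
  shows "good n W (tens dg n r T \<phi>)"
proof -
  have "good n W (acts (\<lambda>i. twist dg (rest r n i) (T i)) 0 n \<phi>)"
    by (rule good_acts0[OF assms(1)]) (rule rop_twist[OF assms(2)])
  then show ?thesis using tens_acts[of n V \<phi> dg r T W, OF assms] by simp
qed

text \<open>The Koszul rule for \<open>n\<close> factors: \<open>T i\<close>, of degree
  \<open>t i\<close>, is carried past the factors \<open>S j\<close> with \<open>j > i\<close>, of
  total degree \<open>rest s n i\<close>. Slotwise this is \<open>gop_twist\<close>, which pulls the
  sign of \<open>S\<close> through \<open>T i\<close>. The scalars \<open>c i\<close> allow
  relations up to sign, such as a differential passing an odd map.\<close>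

lemma tens_comp_same:
  assumes g: "good n V \<phi>"
    and T: "\<And>i. i < n \<Longrightarrow> gop dg dg (t i) (T i) (V i) (V' i)"
    and S: "\<And>i. i < n \<Longrightarrow> gop dg dg (s i) (S i) (V' i) (V'' i)"
    and R: "\<And>i f y. i < n \<Longrightarrow> fn (V i) f \<Longrightarrow> fn (V' i) (T i f) \<Longrightarrow> S i (T i f) y = c i * R i f y"
    and c: "\<And>i. i < n \<Longrightarrow> c i \<noteq> 0"
    and zs: "length zs = n"
  shows "tens dg n s S (tens dg n t T \<phi>) zs = (\<Prod>i<n. sgn1 (rest s n i * t i) * c i) * tens dg n (\<lambda>i. s i + t i) R \<phi> zs"
proof -
  have "tens dg n s S (tens dg n t T \<phi>) zs =
      acts (\<lambda>i. twist dg (rest s n i) (S i)) 0 n (acts (\<lambda>i. twist dg (rest t n i) (T i)) 0 n \<phi>) zs"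
    using tens_acts[of n V' "tens dg n t T \<phi>" dg s S V'', OF good_tens_same[OF g T] S]
      tens_acts[of n V \<phi> dg t T V', OF g T] by simp
  also have "\<dots> = (\<Prod>i=0..<n. sgn1 (rest s n i * t i) * c i) *
      acts (\<lambda>i. twist dg (rest (\<lambda>i. s i + t i) n i) (R i)) 0 n \<phi> zs"
  proof (rule acts_comp[where V' = V' and V'' = V'', OF _ g _ _ _ _ zs])
    fix i f y assume i: "i < n" and f: "fn (V i) f" and Tf: "fn (V' i) (twist dg (rest t n i) (T i) f)"
    let ?\<sigma> = "rest s n i" and ?\<tau> = "rest t n i"
    let ?f = "\<lambda>x. sgn1 (?\<tau> * dg x) * f x"
    let ?g = "\<lambda>x. sgn1 (?\<sigma> * dg x) * ?f x"
    have wf: "wf_space dg (V i)" "wf_space dg (V' i)" using T[OF i] by (simp_all add: gop_def)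
    have ff: "fn (V i) ?f" by (rule fn_twist[OF wf(1) f])
    have gg: "fn (V i) ?g" by (rule fn_twist[OF wf(1) ff])
    have Tg: "sgn1 (?\<sigma> * dg x) * T i ?f x = sgn1 (?\<sigma> * t i) * T i ?g x" for x
      using gop_twist[OF T[OF i] ff, of ?\<sigma> x] by simp
    have "fn (V' i) (\<lambda>x. sgn1 (?\<sigma> * dg x) * T i ?f x)"
      by (rule fn_twist[OF wf(2)]) (use Tf in \<open>simp add: twist_def\<close>)
    then have h: "fn (V' i) (\<lambda>x. sgn1 (?\<sigma> * t i) * T i ?g x)" by (simp only: Tg)
    have Tgg: "fn (V' i) (T i ?g)" using fn_lin[OF h h, of "sgn1 (?\<sigma> * t i)" 0] by simp
    have "twist dg ?\<sigma> (S i) (twist dg ?\<tau> (T i) f) y = S i (\<lambda>x. sgn1 (?\<sigma> * t i) * T i ?g x) y"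
      by (simp only: twist_def Tg)
    also have "\<dots> = sgn1 (?\<sigma> * t i) * (c i * R i ?g y)"
      using rop_scale[OF gop_rop[OF S[OF i]] Tgg] R[OF i gg Tgg] by simp
    also have "?g = (\<lambda>x. sgn1 (rest (\<lambda>i. s i + t i) n i * dg x) * f x)"
      by (simp add: rest_def sum.distrib distrib_right sgn1_add mult.assoc)
    finally show "twist dg ?\<sigma> (S i) (twist dg ?\<tau> (T i) f) y =
        (sgn1 (?\<sigma> * t i) * c i) * twist dg (rest (\<lambda>i. s i + t i) n i) (R i) f y"
      by (simp add: twist_def)
  qed (use rop_twist[OF T] rop_twist[OF S] c in auto)
  also have "acts (\<lambda>i. twist dg (rest (\<lambda>i. s i + t i) n i) (R i)) 0 n \<phi> zs = tens dg n (\<lambda>i. s i + t i) R \<phi> zs"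
    using tensor_acts[of 0 n "[]" zs dg "\<lambda>i. s i + t i" R \<phi>] zs by (simp add: tens_def)
  finally show ?thesis by (simp add: atLeast0LessThan)
qed

theorem good_tens:
  fixes dg :: "'a \<Rightarrow> int" and dg' :: "'b \<Rightarrow> int"
  assumes g: "good n V \<phi>" and T: "\<And>i. i < n \<Longrightarrow> gop dg dg' (r i) (T i) (V i) (W i)"
  shows "good n W (tens dg n r T \<phi>)"
proof -
  let ?a = "Inl :: 'a \<Rightarrow> 'a + 'b" and ?b = "Inr :: 'b \<Rightarrow> 'a + 'b"
  let ?d = "case_sum dg dg'"
  have "good n (\<lambda>i. push ?b (W i)) (tens ?d n r (\<lambda>i. lift ?a ?b (T i)) (ext_list ?a \<phi>))"
    by (rule good_tens_same[OF good_ext[OF _ g]]) (use T in \<open>auto intro!: gop_lift\<close>)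
  from good_pull[OF _ this] show ?thesis
    by (simp add: tens_lift[where dg = dg] ext_list_map)
qed

theorem tens_lin:
  fixes dg :: "'a \<Rightarrow> int" and dg' :: "'b \<Rightarrow> int"
  assumes g: "good n V \<phi>" "good n V \<psi>" and T: "\<And>i. i < n \<Longrightarrow> gop dg dg' (r i) (T i) (V i) (W i)"
  shows "tens dg n r T (\<lambda>xs. a * \<phi> xs + b * \<psi> xs) = (\<lambda>ys. a * tens dg n r T \<phi> ys + b * tens dg n r T \<psi> ys)"
proof
  fix ys
  let ?a = "Inl :: 'a \<Rightarrow> 'a + 'b" and ?b = "Inr :: 'b \<Rightarrow> 'a + 'b"
  let ?d = "case_sum dg dg'"
  let ?T = "\<lambda>i. lift ?a ?b (T i)"
  let ?V = "\<lambda>i. push ?a (V i)" and ?W = "\<lambda>i. push ?b (W i)"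
  have T': "gop ?d ?d (r i) (?T i) (?V i) (?W i)" if "i < n" for i
    using T[OF that] by (auto intro!: gop_lift)
  have e: "tens dg n r T \<theta> ys = tens ?d n r ?T (ext_list ?a \<theta>) (map ?b ys)" for \<theta>
    by (simp add: tens_lift[where dg = dg] ext_list_map)
  have x: "ext_list ?a (\<lambda>xs. a * \<phi> xs + b * \<psi> xs) = (\<lambda>xs. a * ext_list ?a \<phi> xs + b * ext_list ?a \<psi> xs)"
    by (auto simp: ext_list_def)
  note g' = good_ext[OF inj_Inl g(1)] good_ext[OF inj_Inl g(2)]
  have E: "tens ?d n r ?T \<theta> = acts (\<lambda>i. twist ?d (rest r n i) (?T i)) 0 n \<theta>" if "good n ?V \<theta>" for \<theta>
    using tens_acts[of n ?V \<theta> ?d r ?T ?W, OF that T'] .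
  have L: "acts (\<lambda>i. twist ?d (rest r n i) (?T i)) 0 n (\<lambda>xs. a * ext_list ?a \<phi> xs + b * ext_list ?a \<psi> xs) =
     (\<lambda>xs. a * acts (\<lambda>i. twist ?d (rest r n i) (?T i)) 0 n (ext_list ?a \<phi>) xs + b * acts (\<lambda>i. twist ?d (rest r n i) (?T i)) 0 n (ext_list ?a \<psi>) xs)"
    by (rule acts_lin[OF _ g', where W = ?W]) (auto intro: rop_twist[OF T'])
  show "tens dg n r T (\<lambda>xs. a * \<phi> xs + b * \<psi> xs) ys = a * tens dg n r T \<phi> ys + b * tens dg n r T \<psi> ys"
    unfolding e x E[OF g'(1)] E[OF g'(2)] E[OF good_lin[OF g']] L ..
qed

text \<open>Multilinearity in one factor. It serves to expand the factor \<open>1 - \<pi>\<close> of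
  a tensor product in two ways, by degree and as a difference, in
  \<open>homotopy_tens\<close>.\<close>

theorem tens_lin_at:
  fixes dg :: "'a \<Rightarrow> int" and dg' :: "'b \<Rightarrow> int"
  assumes g: "good n V \<phi>" and j: "j < n" and T: "\<And>i. i < n \<Longrightarrow> i \<noteq> j \<Longrightarrow> gop dg dg' (r i) (T i) (V i) (W i)"
    and P: "gop dg dg' (r j) P (V j) (W j)" and Q: "gop dg dg' (r j) Q (V j) (W j)"
    and X: "\<And>f y. X f y = a * P f y + b * Q f y"
  shows "tens dg n r (T(j := X)) \<phi> = (\<lambda>ys. a * tens dg n r (T(j := P)) \<phi> ys + b * tens dg n r (T(j := Q)) \<phi> ys)"
proof
  fix ys
  let ?a = "Inl :: 'a \<Rightarrow> 'a + 'b" and ?b = "Inr :: 'b \<Rightarrow> 'a + 'b"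
  let ?d = "case_sum dg dg'"
  let ?T = "\<lambda>i. twist ?d (rest r n i) (lift ?a ?b (T i))"
  let ?L = "\<lambda>X. twist ?d (rest r n j) (lift ?a ?b X)"
  let ?V = "\<lambda>i. push ?a (V i)" and ?W = "\<lambda>i. push ?b (W i)"
  have lift: "gop ?d ?d q (lift ?a ?b Y) (push ?a A) (push ?b B)" if "gop dg dg' q Y A B" for q Y A B
    using that by (auto intro!: gop_lift)
  show "tens dg n r (T(j := X)) \<phi> ys = a * tens dg n r (T(j := P)) \<phi> ys + b * tens dg n r (T(j := Q)) \<phi> ys"
  proof (cases "length ys = n")
    case True
    have e: "tens dg n r (T(j := Y)) \<phi> ys = acts (?T(j := ?L Y)) 0 n (ext_list ?a \<phi>) (map ?b ys)" for Y
    proof -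
      have "tens dg n r (T(j := Y)) \<phi> ys = tens ?d n r (\<lambda>i. lift ?a ?b ((T(j := Y)) i)) (ext_list ?a \<phi>) (map ?b ys)"
        by (subst tens_lift[where dg = dg]) (simp_all add: ext_list_map)
      also have "\<dots> = acts (\<lambda>i. twist ?d (rest r n i) (lift ?a ?b ((T(j := Y)) i))) 0 n (ext_list ?a \<phi>) (map ?b ys)"
        using tensor_acts[of 0 n "[]" "map ?b ys"] True by (simp add: tens_def)
      also have "(\<lambda>i. twist ?d (rest r n i) (lift ?a ?b ((T(j := Y)) i))) = ?T(j := ?L Y)" by (rule ext) simp
      finally show ?thesis .
    qed
    have LX: "?L X = (\<lambda>f y. a * ?L P f y + b * ?L Q f y)"
      by (auto simp: twist_def lift_def X fun_eq_iff)
    have "acts (?T(j := \<lambda>f y. a * ?L P f y + b * ?L Q f y)) 0 n (ext_list ?a \<phi>) =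
      (\<lambda>xs. a * acts (?T(j := ?L P)) 0 n (ext_list ?a \<phi>) xs + b * acts (?T(j := ?L Q)) 0 n (ext_list ?a \<phi>) xs)"
      by (rule acts_lin_at[OF _ j good_ext[OF inj_Inl g], where W = ?W])
        (auto intro: rop_twist[OF lift[OF T]] rop_twist[OF lift[OF P]] rop_twist[OF lift[OF Q]])
    then show ?thesis unfolding e LX by simp
  next
    case False
    have "X (\<lambda>_. 0) y = 0" for y using X gop_zero[OF P] gop_zero[OF Q] by simp
    then have "(T(j := Y)) i (\<lambda>_. 0) y = 0" if "i < n" "Y \<in> {X, P, Q}" for i Y y
      using gop_zero[OF T[OF that(1)]] gop_zero[OF P] gop_zero[OF Q] that by (cases "i = j") auto
    then have "tens dg n r (T(j := Y)) \<phi> ys = 0" if "Y \<in> {X, P, Q}" for Y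
      by (intro tens_zero[OF _ False]) (use that in blast)
    then show ?thesis by simp
  qed
qed

theorem tens_comp:
  fixes dg :: "'a \<Rightarrow> int" and dg' :: "'b \<Rightarrow> int" and dg'' :: "'c \<Rightarrow> int"
  assumes g: "good n V \<phi>"
    and T: "\<And>i. i < n \<Longrightarrow> gop dg dg' (t i) (T i) (V i) (V' i)"
    and S: "\<And>i. i < n \<Longrightarrow> gop dg' dg'' (s i) (S i) (V' i) (V'' i)"
    and R: "\<And>i f y. i < n \<Longrightarrow> fn (V i) f \<Longrightarrow> fn (V' i) (T i f) \<Longrightarrow> S i (T i f) y = c i * R i f y"
    and c: "\<And>i. i < n \<Longrightarrow> c i \<noteq> 0"
  shows "tens dg' n s S (tens dg n t T \<phi>) = (\<lambda>zs. (\<Prod>i<n. sgn1 (rest s n i * t i) * c i) * tens dg n (\<lambda>i. s i + t i) R \<phi> zs)"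
proof
  fix zs
  \<comment> \<open>Source, intermediate and target coordinates are placed in one nested sum type,
    so that both products act on lists of the same type.\<close>
  let ?a = "Inl :: 'a \<Rightarrow> 'a + ('b + 'c)" and ?b = "(\<lambda>x. Inr (Inl x)) :: 'b \<Rightarrow> 'a + ('b + 'c)"
    and ?c = "(\<lambda>x. Inr (Inr x)) :: 'c \<Rightarrow> 'a + ('b + 'c)"
  let ?d = "case_sum dg (case_sum dg' dg'')"
  have inj: "inj ?a" "inj ?b" "inj ?c" by (auto intro: injI)
  let ?T = "\<lambda>i. lift ?a ?b (T i)" and ?S = "\<lambda>i. lift ?b ?c (S i)" and ?R = "\<lambda>i. lift ?a ?c (R i)"
  show "tens dg' n s S (tens dg n t T \<phi>) zs = (\<Prod>i<n. sgn1 (rest s n i * t i) * c i) * tens dg n (\<lambda>i. s i + t i) R \<phi> zs"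
  proof (cases "length zs = n")
    case True
    have "tens ?d n s ?S (tens ?d n t ?T (ext_list ?a \<phi>)) (map ?c zs) =
      (\<Prod>i<n. sgn1 (rest s n i * t i) * c i) * tens ?d n (\<lambda>i. s i + t i) ?R (ext_list ?a \<phi>) (map ?c zs)"
    proof (rule tens_comp_same[OF good_ext[OF inj(1) g]])
      show "gop ?d ?d (t i) (?T i) (push ?a (V i)) (push ?b (V' i))" if "i < n" for i
        by (rule gop_lift[OF inj(1,2) T[OF that]]) auto
      show "gop ?d ?d (s i) (?S i) (push ?b (V' i)) (push ?c (V'' i))" if "i < n" for i
        by (rule gop_lift[OF inj(2,3) S[OF that]]) auto
      fix i f y assume i: "i < n" and f: "fn (push ?a (V i)) f" and Tf: "fn (push ?b (V' i)) (?T i f)"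
      have "fn (V' i) (T i (\<lambda>x. f (?a x)))"
        using fn_push[OF inj(2) Tf] by (simp add: lift_apply[OF inj(2)])
      from R[OF i fn_push[OF inj(1) f] this]
      show "?S i (?T i f) y = c i * ?R i f y"
        by (simp add: lift_def[of ?b ?c] lift_def[of ?a ?c] lift_apply[OF inj(2)])
    qed (use c True in auto)
    moreover have "tens ?d n s ?S (tens ?d n t ?T (ext_list ?a \<phi>)) (map ?c zs) = tens dg' n s S (tens dg n t T \<phi>) zs"
    proof -
      have 1: "(\<lambda>ys. tens ?d n t ?T (ext_list ?a \<phi>) (map ?b ys)) = tens dg n t T \<phi>"
        by (subst tens_lift[OF inj(2), where dg = dg]) (simp_all add: ext_list_map)
      show ?thesis
        by (subst tens_lift[OF inj(3), where dg = dg']) (simp_all add: 1)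
    qed
    moreover have "tens ?d n (\<lambda>i. s i + t i) ?R (ext_list ?a \<phi>) (map ?c zs) = tens dg n (\<lambda>i. s i + t i) R \<phi> zs"
      by (subst tens_lift[OF inj(3), where dg = dg]) (simp_all add: ext_list_map)
    ultimately show ?thesis by simp
  next
    case False
    have T0: "T i (\<lambda>_. 0) = (\<lambda>_. 0)" if "i < n" for i using gop_zero[OF T[OF that]] by auto
    \<comment> \<open>About \<open>R i\<close> only its relation to \<open>S i\<close> after
      \<open>T i\<close> is known; since \<open>c i\<close> is nonzero, that relation makes
      \<open>R i\<close> kill the zero function.\<close>
    have "R i (\<lambda>_. 0) y = 0" if i: "i < n" for i y
      using R[OF i fn_zero, of y] T0[OF i] gop_zero[OF S[OF i]] c[OF i] by (simp add: fn_zero)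
    then have "tens dg n (\<lambda>i. s i + t i) R \<phi> zs = 0" by (rule tens_zero[OF _ False])
    moreover have "tens dg' n s S (tens dg n t T \<phi>) zs = 0" by (rule tens_zero[OF _ False]) (rule gop_zero[OF S])
    ultimately show ?thesis by simp
  qed
qed

section \<open>The one-dimensional maps\<close>

definition P0 :: "pos space" where
  "P0 = ({(ivl Whole, Val Whole), (ivl Whole, Dt Whole)}, {})"

text \<open>Only the function part is glued at 1/2; the two \<open>Dt\<close> coefficients at that
  point are independent of each other.\<close>

definition P1 :: "pos space" where
  "P1 = ({(ivl Left, Val Left), (ivl Right, Val Right), (ivl Left, Dt Left), (ivl Right, Dt Right)},
     {(Val Left (1/2), Val Right (1/2))})"

definition cell_space :: "cell set \<Rightarrow> cell space" where
  "cell_space cs = ((\<lambda>c. (UNIV, \<lambda>_. c)) ` cs, {})"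

abbreviation "CS0 \<equiv> cell_space cells"
abbreviation "CS1 \<equiv> cell_space cells_star"

lemma gopI:
  assumes "wf_space dg A" "wf_space dg' B"
    "\<And>J c. (J, c) \<in> fst B \<Longrightarrow> Ker (fst A) J (\<lambda>t f. T f (c t))"
    "\<And>f y. resp A f \<Longrightarrow> y \<notin> csupp (fst B) \<Longrightarrow> T f y = 0"
    "\<And>f p q. resp A f \<Longrightarrow> (p, q) \<in> snd B \<Longrightarrow> T f p = T f q"
    "\<And>f g y. (\<And>x. dg' y = dg x + r \<Longrightarrow> f x = g x) \<Longrightarrow> T f y = T g y"
  shows "gop dg dg' r T A B"
proof -
  have "resp B (T f)" if "resp A f" for f
    by (rule respI) (rule assms(4)[OF that] assms(5)[OF that], assumption)+
  moreover have "cconv B" using assms(2) by (simp add: wf_space_def)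
  moreover have "\<forall>(J, c)\<in>fst B. Ker (fst A) J (\<lambda>t f. T f (c t))" using assms(3) by blast
  moreover have "T f y = T g y" if "\<forall>x. dg' y = dg x + r \<longrightarrow> f x = g x" for f g y
    by (rule assms(6)) (use that in blast)
  ultimately show ?thesis using assms(1,2) unfolding gop_def rop_def by blast
qed

lemma Ker_add: "Ker A J \<kappa> \<Longrightarrow> Ker A J \<kappa>' \<Longrightarrow> Ker A J (\<lambda>t f. \<kappa> t f + \<kappa>' t f)"
  using Ker_lin[of A J \<kappa> \<kappa>' 1 1] by simp

lemma Ker_diff: "Ker A J \<kappa> \<Longrightarrow> Ker A J \<kappa>' \<Longrightarrow> Ker A J (\<lambda>t f. \<kappa> t f - \<kappa>' t f)"
  using Ker_lin[of A J \<kappa> \<kappa>' 1 "-1"] by simp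

lemma Ker_cmult: "Ker A J \<kappa> \<Longrightarrow> Ker A J (\<lambda>t f. a * \<kappa> t f)"
  using Ker_lin[of A J \<kappa> \<kappa> a 0] by simp

lemma wf_P0: "wf_space pos_deg P0" and wf_P1: "wf_space pos_deg P1"
  by (auto simp: wf_space_def P0_def P1_def cconv_def)

lemma wf_cell: "wf_space cell_deg (cell_space cs)"
  by (auto simp: wf_space_def cell_space_def cconv_def)

lemma csupp_P0: "y \<in> csupp (fst P0) \<longleftrightarrow> (\<exists>t\<in>{0..1}. y = Val Whole t \<or> y = Dt Whole t)"
  unfolding csupp_def P0_def by auto

lemma csupp_P1: "y \<in> csupp (fst P1) \<longleftrightarrow>
    (\<exists>t\<in>{0..1/2}. y = Val Left t \<or> y = Dt Left t) \<or> (\<exists>t\<in>{1/2..1}. y = Val Right t \<or> y = Dt Right t)"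
  unfolding csupp_def P1_def by auto

lemma csupp_cell: "csupp (fst (cell_space cs)) = cs"
proof (rule set_eqI, rule iffI)
  fix x assume "x \<in> cs"
  then have "(UNIV, \<lambda>_. x) \<in> fst (cell_space cs)" by (simp add: cell_space_def)
  then show "x \<in> csupp (fst (cell_space cs))" using csuppI[of UNIV "\<lambda>_. x" _ 0] by simp
qed (auto simp: csupp_def cell_space_def)

lemma resp_P0: "resp P0 f \<longleftrightarrow> (\<forall>y. y \<notin> csupp (fst P0) \<longrightarrow> f y = 0)"
  by (auto simp: resp_def P0_def)

lemma resp_P1: "resp P1 f \<longleftrightarrow> (\<forall>y. y \<notin> csupp (fst P1) \<longrightarrow> f y = 0) \<and> f (Val Left (1/2)) = f (Val Right (1/2))"
  by (auto simp: resp_def P1_def)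

lemma resp_cell: "resp (cell_space cs) f \<longleftrightarrow> (\<forall>c. c \<notin> cs \<longrightarrow> f c = 0)"
  by (auto simp: resp_def csupp_cell) (auto simp: cell_space_def)

lemma C1_cell: "C1 (fst (cell_space cs)) f"
  unfolding C1_def cell_space_def by (auto intro!: exI[of _ "\<lambda>_. 0"])

lemma fn_cell: "fn (cell_space cs) f \<longleftrightarrow> (\<forall>c. c \<notin> cs \<longrightarrow> f c = 0)"
  by (simp add: fn_def resp_cell C1_cell)

lemma Ker_cell: "c \<in> cs \<Longrightarrow> Ker (fst (cell_space cs)) J (\<lambda>t f. f c)"
  using Ker_ev[of UNIV "\<lambda>_. c" "fst (cell_space cs)" undefined J] by (simp add: cell_space_def)

lemma cells_cases: "x \<in> cells \<Longrightarrow> (x = E0 \<Longrightarrow> P) \<Longrightarrow> (x = E1 \<Longrightarrow> P) \<Longrightarrow> (x = E01 \<Longrightarrow> P) \<Longrightarrow> P"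
  by (auto simp: cells_def)

lemma cells_star_cases:
  "x \<in> cells_star \<Longrightarrow> (x = E0 \<Longrightarrow> P) \<Longrightarrow> (x = Estar \<Longrightarrow> P) \<Longrightarrow> (x = E1 \<Longrightarrow> P) \<Longrightarrow>
    (x = E0star \<Longrightarrow> P) \<Longrightarrow> (x = Estar1 \<Longrightarrow> P) \<Longrightarrow> P"
  by (auto simp: cells_star_def)

lemma Ker_cells:
  "Ker (fst CS0) J (\<lambda>t f. f E0)" "Ker (fst CS0) J (\<lambda>t f. f E1)" "Ker (fst CS0) J (\<lambda>t f. f E01)"
  "Ker (fst CS1) J (\<lambda>t f. f E0)" "Ker (fst CS1) J (\<lambda>t f. f Estar)" "Ker (fst CS1) J (\<lambda>t f. f E1)"
  "Ker (fst CS1) J (\<lambda>t f. f E0star)" "Ker (fst CS1) J (\<lambda>t f. f Estar1)"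
  by (rule Ker_cell; simp add: cells_def cells_star_def)+

lemma Ker_P:
  shows Ker_P_Whole: "0 \<le> u \<Longrightarrow> u \<le> 1 \<Longrightarrow> Ker (fst P0) J (\<lambda>t f. f (Val Whole u))"
  and Ker_P_Left: "0 \<le> u \<Longrightarrow> u \<le> 1/2 \<Longrightarrow> Ker (fst P1) J (\<lambda>t f. f (Val Left u))"
  and Ker_P_Right: "1/2 \<le> u \<Longrightarrow> u \<le> 1 \<Longrightarrow> Ker (fst P1) J (\<lambda>t f. f (Val Right u))"
  and Ker_P_int: "Ker (fst P0) J (\<lambda>t f. integral {0..1} (\<lambda>u. f (Dt Whole u)))"
  "Ker (fst P1) J (\<lambda>t f. integral {0..1/2} (\<lambda>u. f (Dt Left u)))"
  "Ker (fst P1) J (\<lambda>t f. integral {1/2..1} (\<lambda>u. f (Dt Right u)))"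
proof -
  show "0 \<le> u \<Longrightarrow> u \<le> 1 \<Longrightarrow> Ker (fst P0) J (\<lambda>t f. f (Val Whole u))"
    by (rule Ker_ev[of "{0..1}"]) (simp_all add: P0_def)
  show "0 \<le> u \<Longrightarrow> u \<le> 1/2 \<Longrightarrow> Ker (fst P1) J (\<lambda>t f. f (Val Left u))"
    by (rule Ker_ev[of "{0..1/2}"]) (simp_all add: P1_def)
  show "1/2 \<le> u \<Longrightarrow> u \<le> 1 \<Longrightarrow> Ker (fst P1) J (\<lambda>t f. f (Val Right u))"
    by (rule Ker_ev[of "{1/2..1}"]) (simp_all add: P1_def)
  show "Ker (fst P0) J (\<lambda>t f. integral {0..1} (\<lambda>u. f (Dt Whole u)))"
    by (rule Ker_int[of "{0..1}"]) (simp_all add: P0_def)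
  show "Ker (fst P1) J (\<lambda>t f. integral {0..1/2} (\<lambda>u. f (Dt Left u)))"
    by (rule Ker_int[of "{0..1/2}"]) (simp_all add: P1_def)
  show "Ker (fst P1) J (\<lambda>t f. integral {1/2..1} (\<lambda>u. f (Dt Right u)))"
    by (rule Ker_int[of "{1/2..1}"]) (simp_all add: P1_def)
qed

lemma Ker_P_end:
  "Ker (fst P0) J (\<lambda>t f. f (Val Whole 0))" "Ker (fst P0) J (\<lambda>t f. f (Val Whole 1))"
  "Ker (fst P1) J (\<lambda>t f. f (Val Left 0))" "Ker (fst P1) J (\<lambda>t f. f (Val Left (1/2)))"
  "Ker (fst P1) J (\<lambda>t f. f (Val Right 1))"
  by (rule Ker_P_Whole Ker_P_Left Ker_P_Right; simp)+

lemmas Ker_intros = Ker_cells Ker_P_end Ker_P_int Ker_add Ker_diff Ker_cmult Ker_zero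

lemma fst_cell_space: "(J, c) \<in> fst (cell_space cs) \<longleftrightarrow> J = UNIV \<and> (\<exists>x\<in>cs. c = (\<lambda>_. x))"
  by (auto simp: cell_space_def)

lemma Ker_to_cells:
  assumes "(J, c) \<in> fst (cell_space cs)" "\<And>x. x \<in> cs \<Longrightarrow> Ker A UNIV (\<lambda>t f. T f x)"
  shows "Ker A J (\<lambda>t f. T f (c t))"
  using assms unfolding fst_cell_space by blast

lemma fst_P0: "(J, c) \<in> fst P0 \<longleftrightarrow> J = {0..1} \<and> (c = Val Whole \<or> c = Dt Whole)"
  by (auto simp: P0_def)

lemma fst_P1: "(J, c) \<in> fst P1 \<longleftrightarrow> J = {0..1/2} \<and> (c = Val Left \<or> c = Dt Left) \<or> J = {1/2..1} \<and> (c = Val Right \<or> c = Dt Right)"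
  by (auto simp: P1_def)

lemma gop_id: "wf_space dg A \<Longrightarrow> gop dg dg 0 id A A"
  by (rule gopI) (auto intro: Ker_id simp: resp_def)

text \<open>The operator \<open>1 - T\<close> cut off to the degrees selected by \<open>P\<close>.
  For a contraction, \<open>dh\<close> and \<open>hd\<close> are separately of this kind, with the
  cut-offs to nonzero and to zero degree.\<close>

lemma gop_part:
  fixes dg :: "'a \<Rightarrow> int"
  assumes "gop dg dg 0 T A A"
  shows "gop dg dg 0 (\<lambda>f y. if P (dg y) then f y - T f y else 0) A A"
proof (rule gopI)
  show wf: "wf_space dg A" "wf_space dg A" using assms by (auto simp: gop_def)
  note r = gop_rop[OF assms]
  {
    fix J c assume c: "(J, c) \<in> fst A"
    have "P (dg (c u)) \<longleftrightarrow> P (dg (c v))" if "u \<in> J" "v \<in> J" for u v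
      using wf(1) c that unfolding wf_space_def by fastforce
    then consider "\<forall>u\<in>J. P (dg (c u))" | "\<forall>u\<in>J. \<not> P (dg (c u))" by blast
    then show "Ker (fst A) J (\<lambda>t f. if P (dg (c t)) then f (c t) - T f (c t) else 0)"
    proof cases
      case 1
      show ?thesis by (rule Ker_cong[OF Ker_diff[OF Ker_id[OF c order_refl] rop_Ker[OF r c]]]) (use 1 in simp)
    next
      case 2
      show ?thesis by (rule Ker_cong[OF Ker_zero]) (use 2 in simp)
    qed
  next
    fix f :: "'a \<Rightarrow> real" and y assume "resp A f" "y \<notin> csupp (fst A)"
    then show "(if P (dg y) then f y - T f y else 0) = 0"
      using resp_supp[OF rop_resp[OF r], of f y] resp_supp[of A f y] by simp
  next
    fix f :: "'a \<Rightarrow> real" and p q assume f: "resp A f" and pq: "(p, q) \<in> snd A"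
    have "dg p = dg q" using wf(1) pq unfolding wf_space_def by blast
    then show "(if P (dg p) then f p - T f p else 0) = (if P (dg q) then f q - T f q else 0)"
      using resp_glue[OF f pq] resp_glue[OF rop_resp[OF r f] pq] by simp
  next
    fix f g :: "'a \<Rightarrow> real" and y assume fg: "\<And>x. dg y = dg x + 0 \<Longrightarrow> f x = g x"
    have "T f y = T g y" by (rule gop_local[OF assms]) (use fg in simp)
    then show "(if P (dg y) then f y - T f y else 0) = (if P (dg y) then g y - T g y else 0)"
      using fg[of y] by simp
  }
qed

lemma gop_dC: "gop cell_deg cell_deg 1 dC CS0 CS0"
proof (rule gopI[OF wf_cell wf_cell], goal_cases)
  case (1 J c)
  show ?case
    by (rule Ker_to_cells[OF 1], erule cells_cases; hypsubst; simp only: dC.simps; intro Ker_intros)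
next
  case (2 f y) then show ?case by (cases y) (auto simp: csupp_cell cells_def)
next
  case (3 f p q) then show ?case by (simp add: cell_space_def)
next
  case (4 f g y) then show ?case by (cases y) auto
qed

lemma gop_dC_star: "gop cell_deg cell_deg 1 dC_star CS1 CS1"
proof (rule gopI[OF wf_cell wf_cell], goal_cases)
  case (1 J c)
  show ?case
    by (rule Ker_to_cells[OF 1], erule cells_star_cases; hypsubst; simp only: dC_star.simps; intro Ker_intros)
next
  case (2 f y) then show ?case by (cases y) (auto simp: csupp_cell cells_star_def)
next
  case (3 f p q) then show ?case by (simp add: cell_space_def)
next
  case (4 f g y) then show ?case by (cases y) auto
qed

lemma gop_i_weld: "gop cell_deg cell_deg 0 i_weld CS0 CS1"
proof (rule gopI[OF wf_cell wf_cell], goal_cases)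
  case (1 J c)
  show ?case
    by (rule Ker_to_cells[OF 1], erule cells_star_cases; hypsubst; simp only: i_weld.simps; intro Ker_intros)
next
  case (2 f y) then show ?case by (cases y) (auto simp: csupp_cell cells_star_def)
next
  case (3 f p q) then show ?case by (simp add: cell_space_def)
next
  case (4 f g y) then show ?case by (cases y) auto
qed

lemma gop_p_weld: "gop cell_deg cell_deg 0 p_weld CS1 CS0"
proof (rule gopI[OF wf_cell wf_cell], goal_cases)
  case (1 J c)
  show ?case
    by (rule Ker_to_cells[OF 1], erule cells_cases; hypsubst; simp only: p_weld.simps; intro Ker_intros)
next
  case (2 f y) then show ?case by (cases y) (auto simp: csupp_cell cells_def)
next
  case (3 f p q) then show ?case by (simp add: cell_space_def)
next
  case (4 f g y) then show ?case by (cases y) auto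
qed

text \<open>Composition is not among the rules that generate \<open>Ker\<close>, so a composite is
  unfolded into the generators.\<close>

lemma gop_ip_weld: "gop cell_deg cell_deg 0 (i_weld \<circ> p_weld) CS1 CS1"
proof (rule gopI[OF wf_cell wf_cell], goal_cases)
  case (1 J c)
  show ?case
    by (rule Ker_to_cells[OF 1], erule cells_star_cases; hypsubst; simp only: comp_apply i_weld.simps p_weld.simps; intro Ker_intros)
next
  case (2 f y) then show ?case by (cases y) (auto simp: csupp_cell cells_star_def)
next
  case (3 f p q) then show ?case by (simp add: cell_space_def)
next
  case (4 f g y) then show ?case by (cases y) auto
qed

lemma gop_a_weld: "gop cell_deg cell_deg (-1) a_weld CS1 CS1"
proof (rule gopI[OF wf_cell wf_cell], goal_cases)
  case (1 J c)
  show ?case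
    by (rule Ker_to_cells[OF 1], erule cells_star_cases; hypsubst; simp only: a_weld.simps; intro Ker_intros)
next
  case (2 f y) then show ?case by (cases y) (auto simp: csupp_cell cells_star_def)
next
  case (3 f p q) then show ?case by (simp add: cell_space_def)
next
  case (4 f g y) then show ?case by (cases y) auto
qed

lemma gop_I_plain: "gop pos_deg cell_deg 0 I_plain P0 CS0"
proof (rule gopI[OF wf_P0 wf_cell], goal_cases)
  case (1 J c)
  show ?case
    by (rule Ker_to_cells[OF 1], erule cells_cases; hypsubst; simp only: I_plain.simps; intro Ker_intros)
next
  case (2 f y) then show ?case by (cases y) (auto simp: csupp_cell cells_def)
next
  case (3 f p q) then show ?case by (simp add: cell_space_def)
next
  case (4 f g y) then show ?case by (cases y) auto
qed

lemma gop_I_star: "gop pos_deg cell_deg 0 I_star P1 CS1"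
proof (rule gopI[OF wf_P1 wf_cell], goal_cases)
  case (1 J c)
  show ?case
    by (rule Ker_to_cells[OF 1], erule cells_star_cases; hypsubst; simp only: I_star.simps; intro Ker_intros)
next
  case (2 f y) then show ?case by (cases y) (auto simp: csupp_cell cells_star_def)
next
  case (3 f p q) then show ?case by (simp add: cell_space_def)
next
  case (4 f g y) then show ?case by (cases y) auto
qed

text \<open>The cochain is allowed to depend on the argument through \<open>F\<close>: with the
  identity this treats \<open>W_plain\<close>, with \<open>I_plain\<close> it treats the composite
  \<open>WI\<close>.\<close>

lemma Ker_W_plain:
  assumes e: "\<And>J. Ker A J (\<lambda>t f. e0 f)" "\<And>J. Ker A J (\<lambda>t f. e1 f)" "\<And>J. Ker A J (\<lambda>t f. e01 f)"
    and m: "\<And>f. F f E0 = e0 f" "\<And>f. F f E1 = e1 f" "\<And>f. F f E01 = e01 f"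
    and "(J, c) \<in> fst P0"
  shows "Ker A J (\<lambda>t f. W_plain (F f) (c t))"
proof -
  consider "J = {0..1}" "c = Val Whole" | "J = {0..1}" "c = Dt Whole" using assms(7) by (auto simp: fst_P0)
  then show ?thesis
  proof cases
    case 1
    have "Ker A {0..1} (\<lambda>t f. (e0 f - t * e0 f) + t * e1 f)" by (intro Ker_add Ker_diff Ker_mult e)
    then show ?thesis unfolding 1 by (rule Ker_cong) (simp add: m algebra_simps)
  next
    case 2
    show ?thesis unfolding 2 by (rule Ker_cong[OF e(3)]) (simp add: m)
  qed
qed

lemma Ker_W_star:
  assumes e: "\<And>J. Ker A J (\<lambda>t f. e0 f)" "\<And>J. Ker A J (\<lambda>t f. e1 f)" "\<And>J. Ker A J (\<lambda>t f. es f)"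
      "\<And>J. Ker A J (\<lambda>t f. e0s f)" "\<And>J. Ker A J (\<lambda>t f. es1 f)"
    and m: "\<And>f. F f E0 = e0 f" "\<And>f. F f E1 = e1 f" "\<And>f. F f Estar = es f" "\<And>f. F f E0star = e0s f" "\<And>f. F f Estar1 = es1 f"
    and "(J, c) \<in> fst P1"
  shows "Ker A J (\<lambda>t f. W_star (F f) (c t))"
proof -
  consider "J = {0..1/2}" "c = Val Left" | "J = {0..1/2}" "c = Dt Left" | "J = {1/2..1}" "c = Val Right" | "J = {1/2..1}" "c = Dt Right"
    using assms(11) by (auto simp: fst_P1)
  then show ?thesis
  proof cases
    case 1
    have "Ker A {0..1/2} (\<lambda>t f. (e0 f - 2 * (t * e0 f)) + 2 * (t * es f))" by (intro Ker_add Ker_diff Ker_mult Ker_cmult e)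
    then show ?thesis unfolding 1 by (rule Ker_cong) (simp add: m algebra_simps)
  next
    case 2
    have "Ker A {0..1/2} (\<lambda>t f. 2 * e0s f)" by (intro Ker_cmult e)
    then show ?thesis unfolding 2 by (rule Ker_cong) (simp add: m)
  next
    case 3
    have "Ker A {1/2..1} (\<lambda>t f. (2 * es f - 2 * (t * es f)) + (2 * (t * e1 f) - e1 f))" by (intro Ker_add Ker_diff Ker_mult Ker_cmult e)
    then show ?thesis unfolding 3 by (rule Ker_cong) (simp add: m algebra_simps)
  next
    case 4
    have "Ker A {1/2..1} (\<lambda>t f. 2 * es1 f)" by (intro Ker_cmult e)
    then show ?thesis unfolding 4 by (rule Ker_cong) (simp add: m)
  qed
qed

lemma W_plain_supp: "y \<notin> csupp (fst P0) \<Longrightarrow> W_plain \<alpha> y = 0"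
  by (cases "(\<alpha>, y)" rule: W_plain.cases) (auto simp: csupp_P0)

lemma W_star_supp: "y \<notin> csupp (fst P1) \<Longrightarrow> W_star \<alpha> y = 0"
  by (cases "(\<alpha>, y)" rule: W_star.cases) (auto simp: csupp_P1)

lemma W_plain_local: "(\<And>x. pos_deg y = cell_deg x \<Longrightarrow> \<alpha> x = \<beta> x) \<Longrightarrow> W_plain \<alpha> y = W_plain \<beta> y"
  by (cases "(\<alpha>, y)" rule: W_plain.cases) auto

lemma W_star_local: "(\<And>x. pos_deg y = cell_deg x \<Longrightarrow> \<alpha> x = \<beta> x) \<Longrightarrow> W_star \<alpha> y = W_star \<beta> y"
  by (cases "(\<alpha>, y)" rule: W_star.cases) auto

lemma gop_W_plain: "gop cell_deg pos_deg 0 W_plain CS0 P0"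
proof (rule gopI[OF wf_cell wf_P0], goal_cases)
  case (1 J c)
  then show ?case by (intro Ker_W_plain[where F = "\<lambda>f. f"]) (rule Ker_cells refl 1)+
next
  case (2 f y) then show ?case by (simp add: W_plain_supp)
next
  case (3 f p q) then show ?case by (simp add: P0_def)
next
  case (4 f g y) then show ?case by (intro W_plain_local) simp
qed

lemma gop_W_star: "gop cell_deg pos_deg 0 W_star CS1 P1"
proof (rule gopI[OF wf_cell wf_P1], goal_cases)
  case (1 J c)
  then show ?case by (intro Ker_W_star[where F = "\<lambda>f. f"]) (rule Ker_cells refl 1)+
next
  case (2 f y) then show ?case by (simp add: W_star_supp)
next
  case (3 f p q) then show ?case by (simp add: P1_def)
next
  case (4 f g y) then show ?case by (intro W_star_local) simp
qed

lemma gop_WI_plain: "gop pos_deg pos_deg 0 (W_plain \<circ> I_plain) P0 P0"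
proof (rule gopI[OF wf_P0 wf_P0], goal_cases)
  case (1 J c)
  have e: "Ker (fst P0) J (\<lambda>t f. I_plain f E0)" "Ker (fst P0) J (\<lambda>t f. I_plain f E1)" "Ker (fst P0) J (\<lambda>t f. I_plain f E01)" for J
    unfolding I_plain.simps by (rule Ker_intros)+
  show ?case unfolding comp_def by (rule Ker_W_plain[where F = I_plain, OF e refl refl refl 1])
next
  case (2 f y) then show ?case by (simp add: W_plain_supp)
next
  case (3 f p q) then show ?case by (simp add: P0_def)
next
  case (4 f g y)
  then show ?case unfolding comp_def
    by (intro W_plain_local gop_local[OF gop_I_plain]) simp
qed

lemma gop_WI_star: "gop pos_deg pos_deg 0 (W_star \<circ> I_star) P1 P1"
proof (rule gopI[OF wf_P1 wf_P1], goal_cases)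
  case (1 J c)
  have e: "Ker (fst P1) J (\<lambda>t f. I_star f E0)" "Ker (fst P1) J (\<lambda>t f. I_star f E1)" "Ker (fst P1) J (\<lambda>t f. I_star f Estar)"
      "Ker (fst P1) J (\<lambda>t f. I_star f E0star)" "Ker (fst P1) J (\<lambda>t f. I_star f Estar1)" for J
    unfolding I_star.simps by (rule Ker_intros)+
  show ?case unfolding comp_def by (rule Ker_W_star[where F = I_star, OF e refl refl refl refl refl 1])
next
  case (2 f y) then show ?case by (simp add: W_star_supp)
next
  case (3 f p q) then show ?case by (simp add: P1_def)
next
  case (4 f g y)
  then show ?case unfolding comp_def
    by (intro W_star_local gop_local[OF gop_I_star]) simp
qed

lemma vector_derivative_zero: "t \<in> ivl p \<Longrightarrow> vector_derivative (\<lambda>u. 0 :: real) (at t within ivl p) = 0"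
  by (cases p) (auto intro!: vector_derivative_within_cbox[unfolded cbox_interval])

lemma dF_local: "(\<And>x. pos_deg y = pos_deg x + 1 \<Longrightarrow> f x = g x) \<Longrightarrow> dF f y = dF g y"
  by (cases y) auto

lemma gop_dF0: "gop pos_deg pos_deg 1 dF P0 P0"
proof (rule gopI[OF wf_P0 wf_P0], goal_cases)
  case (1 J c)
  then consider "J = {0..1}" "c = Val Whole" | "J = {0..1}" "c = Dt Whole" by (auto simp: fst_P0)
  then show ?case
  proof cases
    case 2
    have "Ker (fst P0) {0..1} (\<lambda>t f. vector_derivative (\<lambda>u. f (Val Whole u)) (at t within {0..1}))"
      by (rule Ker_der[where p = 0 and q = 1]) (simp_all add: fst_P0)
    then show ?thesis unfolding 2 by (rule Ker_cong) simp
  qed (simp add: Ker_zero)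
next
  case (2 f y)
  \<comment> \<open>\<open>dF\<close> is defined on all pieces at once, so on \<open>Left\<close>
    and \<open>Right\<close> it has to be seen to vanish, as the derivative of zero.\<close>
  have "f (Val p u) = 0" if "p \<noteq> Whole" for p u using 2(1) that by (auto simp: resp_P0 csupp_P0)
  with 2(2) show ?case
    by (cases y; cases "case y of Val p t \<Rightarrow> p | Dt p t \<Rightarrow> p") (auto simp: csupp_P0 vector_derivative_zero[of _ Left, simplified] vector_derivative_zero[of _ Right, simplified])
next
  case (3 f p q) then show ?case by (simp add: P0_def)
next
  case (4 f g y) then show ?case by (intro dF_local)
qed

lemma gop_dF1: "gop pos_deg pos_deg 1 dF P1 P1"
proof (rule gopI[OF wf_P1 wf_P1], goal_cases)
  case (1 J c)
  then consider "J = {0..1/2}" "c = Dt Left" | "J = {1/2..1}" "c = Dt Right" | "c = Val Left \<or> c = Val Right" by (auto simp: fst_P1)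
  then show ?case
  proof cases
    case 1
    have "Ker (fst P1) {0..1/2} (\<lambda>t f. vector_derivative (\<lambda>u. f (Val Left u)) (at t within {0..1/2}))"
      by (rule Ker_der[where p = 0 and q = "1/2"]) (simp_all add: fst_P1)
    then show ?thesis unfolding 1 by (rule Ker_cong) simp
  next
    case 2
    have "Ker (fst P1) {1/2..1} (\<lambda>t f. vector_derivative (\<lambda>u. f (Val Right u)) (at t within {1/2..1}))"
      by (rule Ker_der[where p = "1/2" and q = 1]) (simp_all add: fst_P1)
    then show ?thesis unfolding 2 by (rule Ker_cong) simp
  qed (auto simp: Ker_zero)
next
  case (2 f y)
  have "f (Val Whole u) = 0" for u using 2(1) by (auto simp: resp_P1 csupp_P1)
  with 2(2) show ?case
    by (cases y; cases "case y of Val p t \<Rightarrow> p | Dt p t \<Rightarrow> p") (auto simp: csupp_P1 vector_derivative_zero[of _ Whole, simplified])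
next
  case (3 f p q) then show ?case by (simp add: P1_def)
next
  case (4 f g y) then show ?case by (intro dF_local)
qed

lemma gop_res: "gop pos_deg pos_deg 0 res P0 P1"
proof (rule gopI[OF wf_P0 wf_P1], goal_cases)
  case (1 J c)
  have k: "Ker (fst P0) J (\<lambda>t f. f (Val Whole t))" "Ker (fst P0) J (\<lambda>t f. f (Dt Whole t))" if "J \<subseteq> {0..1}"
    by (rule Ker_id[OF _ that]; simp add: fst_P0)+
  from 1 consider "J = {0..1/2}" "c = Val Left" | "J = {0..1/2}" "c = Dt Left" | "J = {1/2..1}" "c = Val Right" | "J = {1/2..1}" "c = Dt Right"
    by (auto simp: fst_P1)
  then show ?case
  proof cases
    case 1
    show ?thesis unfolding 1(2) by (rule Ker_cong[OF k(1)]) (simp_all add: 1(1))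
  next
    case 2
    show ?thesis unfolding 2(2) by (rule Ker_cong[OF k(2)]) (simp_all add: 2(1))
  next
    case 3
    show ?thesis unfolding 3(2) by (rule Ker_cong[OF k(1)]) (simp_all add: 3(1))
  next
    case 4
    show ?thesis unfolding 4(2) by (rule Ker_cong[OF k(2)]) (simp_all add: 4(1))
  qed
next
  case (2 f y) then show ?case by (cases "(f, y)" rule: res.cases) (auto simp: csupp_P1)
next
  case (3 f p q) then show ?case by (simp add: P1_def)
next
  case (4 f g y) then show ?case by (cases "(f, y)" rule: res.cases) auto
qed

lemma gop_s_plain: "gop pos_deg pos_deg (-1) s_plain P0 P0"
proof (rule gopI[OF wf_P0 wf_P0], goal_cases)
  case (1 J c)
  then consider "J = {0..1}" "c = Val Whole" | "J = {0..1}" "c = Dt Whole" by (auto simp: fst_P0)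
  then show ?case
  proof cases
    case 1
    have "Ker (fst P0) {0..1} (\<lambda>t f. integral {0..t} (\<lambda>u. f (Dt Whole u)) - t * integral {0..1} (\<lambda>u. f (Dt Whole u)))"
      by (intro Ker_diff Ker_mult Ker_P_int Ker_upto[where q = 1]) (simp_all add: fst_P0)
    then show ?thesis unfolding 1 by (rule Ker_cong) simp
  qed (simp add: Ker_zero)
next
  case (2 f y) then show ?case by (cases "(f, y)" rule: s_plain.cases) (auto simp: csupp_P0)
next
  case (3 f p q) then show ?case by (simp add: P0_def)
next
  case (4 f g y) then show ?case by (cases "(f, y)" rule: s_plain.cases) auto
qed

lemma gop_s_star: "gop pos_deg pos_deg (-1) s_star P1 P1"
proof (rule gopI[OF wf_P1 wf_P1], goal_cases)
  case (1 J c)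
  then consider "J = {0..1/2}" "c = Val Left" | "J = {1/2..1}" "c = Val Right" | "c = Dt Left \<or> c = Dt Right" by (auto simp: fst_P1)
  then show ?case
  proof cases
    case 1
    have "Ker (fst P1) {0..1/2} (\<lambda>t f. integral {0..t} (\<lambda>u. f (Dt Left u)) - 2 * (t * integral {0..1/2} (\<lambda>u. f (Dt Left u))))"
      by (intro Ker_diff Ker_cmult Ker_mult Ker_P_int Ker_upto[where q = "1/2"]) (simp_all add: fst_P1)
    then show ?thesis unfolding 1 by (rule Ker_cong) simp
  next
    case 2
    have "Ker (fst P1) {1/2..1} (\<lambda>t f. (integral {1/2..t} (\<lambda>u. f (Dt Right u)) - 2 * (t * integral {1/2..1} (\<lambda>u. f (Dt Right u)))) + integral {1/2..1} (\<lambda>u. f (Dt Right u)))"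
      by (intro Ker_add Ker_diff Ker_cmult Ker_mult Ker_P_int Ker_upto[where q = 1]) (simp_all add: fst_P1)
    then show ?thesis unfolding 2 by (rule Ker_cong) (simp add: algebra_simps)
  qed (auto simp: Ker_zero)
next
  case (2 f y) then show ?case by (cases "(f, y)" rule: s_star.cases) (auto simp: csupp_P1)
next
  \<comment> \<open>Gluing at 1/2: both one-sided values are zero, on the left because the two
    integrals over the half cancel, on the right because the interval of integration is a
    point.\<close>
  case (3 f p q) then show ?case by (simp add: P1_def)
next
  case (4 f g y) then show ?case by (cases "(f, y)" rule: s_star.cases) auto
qed

section \<open>The one-dimensional identities\<close>

lemmas vd_zero = vector_derivative_zero vector_derivative_zero[of _ Left, simplified]
  vector_derivative_zero[of _ Right, simplified] vector_derivative_zero[of _ Whole, simplified]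

lemma has_vd:
  assumes "t \<in> ivl p" "((f :: real \<Rightarrow> real) has_vector_derivative d) (at t within ivl p)"
  shows "vector_derivative f (at t within ivl p) = d"
  using assms by (cases p) (auto intro!: vector_derivative_within_cbox[unfolded cbox_interval])

lemma fn_P1_glue: "fn P1 f \<Longrightarrow> f (Val Left (1/2)) = f (Val Right (1/2))"
  by (simp add: fn_def resp_P1)

lemma fn_cont:
  "fn P0 f \<Longrightarrow> continuous_on {0..1} (\<lambda>u. f (Dt Whole u))"
  "fn P1 f \<Longrightarrow> continuous_on {0..1/2} (\<lambda>u. f (Dt Left u))"
  "fn P1 f \<Longrightarrow> continuous_on {1/2..1} (\<lambda>u. f (Dt Right u))"
  by (auto simp: fn_def fst_P0 fst_P1 intro: C1_continuous)

lemma fn_deriv: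
  "fn P0 f \<Longrightarrow> t \<in> {0..1} \<Longrightarrow> ((\<lambda>u. f (Val Whole u)) has_vector_derivative dF f (Dt Whole t)) (at t within {0..1})"
  "fn P1 f \<Longrightarrow> t \<in> {0..1/2} \<Longrightarrow> ((\<lambda>u. f (Val Left u)) has_vector_derivative dF f (Dt Left t)) (at t within {0..1/2})"
  "fn P1 f \<Longrightarrow> t \<in> {1/2..1} \<Longrightarrow> ((\<lambda>u. f (Val Right u)) has_vector_derivative dF f (Dt Right t)) (at t within {1/2..1})"
  using C1_vector_derivative[of "fst P0" f 0 1 "Val Whole" t] C1_vector_derivative[of "fst P1" f 0 "1/2" "Val Left" t]
    C1_vector_derivative[of "fst P1" f "1/2" 1 "Val Right" t]
  by (auto simp: fn_def fst_P0 fst_P1 has_real_derivative_iff_has_vector_derivative)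

lemma integral_dF_Whole: "fn P0 f \<Longrightarrow> 0 \<le> b \<Longrightarrow> b \<le> 1 \<Longrightarrow> integral {0..b} (\<lambda>u. dF f (Dt Whole u)) = f (Val Whole b) - f (Val Whole 0)"
  by (rule integral_unique[OF fundamental_theorem_of_calculus])
    (auto intro: has_vector_derivative_within_subset[OF fn_deriv(1)] simp del: dF.simps)

lemma integral_dF_Left: "fn P1 f \<Longrightarrow> 0 \<le> b \<Longrightarrow> b \<le> 1/2 \<Longrightarrow> integral {0..b} (\<lambda>u. dF f (Dt Left u)) = f (Val Left b) - f (Val Left 0)"
  by (rule integral_unique[OF fundamental_theorem_of_calculus])
    (auto intro: has_vector_derivative_within_subset[OF fn_deriv(2)] simp del: dF.simps)

lemma integral_dF_Right: "fn P1 f \<Longrightarrow> 1/2 \<le> b \<Longrightarrow> b \<le> 1 \<Longrightarrow> integral {1/2..b} (\<lambda>u. dF f (Dt Right u)) = f (Val Right b) - f (Val Right (1/2))"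
  by (rule integral_unique[OF fundamental_theorem_of_calculus])
    (auto intro: has_vector_derivative_within_subset[OF fn_deriv(3)] simp del: dF.simps)

lemma dF_dF: "dF (dF f) y = 0"
  by (cases y) (auto simp: vector_derivative_zero)

lemma dC_dC: "dC (dC \<alpha>) y = 0" and dC_star_dC_star: "dC_star (dC_star \<alpha>) y = 0"
  by (cases y; simp)+

lemma dF_DtI:
  assumes "t \<in> ivl p" "\<And>u. u \<in> ivl p \<Longrightarrow> \<omega> (Val p u) = F u" "(F has_vector_derivative d) (at t within ivl p)"
  shows "dF \<omega> (Dt p t) = d"
proof -
  have "((\<lambda>u. \<omega> (Val p u)) has_vector_derivative d) (at t within ivl p)"
    by (rule has_vector_derivative_transform[OF assms(1) _ assms(3)]) (simp add: assms(2))
  with assms(1) show ?thesis by (simp add: has_vd)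
qed

lemma has_vd_affine: "((\<lambda>u. a + b * u :: real) has_vector_derivative b) (at t within S)"
  unfolding has_real_derivative_iff_has_vector_derivative[symmetric] by (auto intro!: derivative_eq_intros)

lemma dF_W_plain: "dF (W_plain \<alpha>) y = W_plain (dC \<alpha>) y"
proof (cases "(\<alpha>, y)" rule: W_plain.cases)
  case (2 \<beta> t)
  have "dF (W_plain \<alpha>) (Dt Whole t) = \<alpha> E1 - \<alpha> E0" if "t \<in> {0..1}"
    by (rule dF_DtI[where F = "\<lambda>u. \<alpha> E0 + (\<alpha> E1 - \<alpha> E0) * u", OF _ _ has_vd_affine])
      (use that in \<open>auto simp: algebra_simps\<close>)
  with 2 show ?thesis by (cases "t \<in> {0..1}") auto
qed (auto simp: vd_zero)

lemma dF_W_star: "dF (W_star \<alpha>) y = W_star (dC_star \<alpha>) y"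
proof (cases "(\<alpha>, y)" rule: W_star.cases)
  case (3 \<beta> t)
  have "dF (W_star \<alpha>) (Dt Left t) = 2 * (\<alpha> Estar - \<alpha> E0)" if "t \<in> {0..1/2}"
    by (rule dF_DtI[where F = "\<lambda>u. \<alpha> E0 + 2 * (\<alpha> Estar - \<alpha> E0) * u", OF _ _ has_vd_affine])
      (use that in \<open>auto simp: algebra_simps\<close>)
  with 3 show ?thesis by (cases "t \<in> {0..1/2}") auto
next
  case (4 \<beta> t)
  have "dF (W_star \<alpha>) (Dt Right t) = 2 * (\<alpha> E1 - \<alpha> Estar)" if "t \<in> {1/2..1}"
    by (rule dF_DtI[where F = "\<lambda>u. (2 * \<alpha> Estar - \<alpha> E1) + 2 * (\<alpha> E1 - \<alpha> Estar) * u", OF _ _ has_vd_affine])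
      (use that in \<open>auto simp: algebra_simps\<close>)
  with 4 show ?thesis by (cases "t \<in> {1/2..1}") auto
qed (auto simp: vd_zero)

lemma dC_I_plain: "fn P0 f \<Longrightarrow> dC (I_plain f) y = I_plain (dF f) y"
  using integral_dF_Whole[of f 1] by (cases y) (simp_all del: dF.simps(2))

text \<open>Stokes on each half. \<open>I_star\<close> reads the midpoint value from the left half,
  so the right edge uses the gluing at 1/2.\<close>

lemma dC_I_star: "fn P1 f \<Longrightarrow> dC_star (I_star f) y = I_star (dF f) y"
  using integral_dF_Left[of f "1/2"] integral_dF_Right[of f 1] fn_P1_glue[of f]
  by (cases y) (simp_all del: dF.simps(2))

lemma dC_i_weld: "dC_star (i_weld \<alpha>) y = i_weld (dC \<alpha>) y"
  by (cases y) (simp_all add: field_simps)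

lemma dC_p_weld: "dC (p_weld \<alpha>) y = p_weld (dC_star \<alpha>) y"
  by (cases y) simp_all

lemma dC_ip_weld: "dC_star ((i_weld \<circ> p_weld) \<alpha>) y = (i_weld \<circ> p_weld) (dC_star \<alpha>) y"
  by (cases y) (simp_all add: field_simps)

lemma P0_eqI:
  assumes "resp P0 F" "resp P0 G"
    and "\<And>t. t \<in> {0..1} \<Longrightarrow> F (Val Whole t) = G (Val Whole t)" "\<And>t. t \<in> {0..1} \<Longrightarrow> F (Dt Whole t) = G (Dt Whole t)"
  shows "F y = G y"
  using assms by (cases "y \<in> csupp (fst P0)") (auto simp: csupp_P0 resp_P0)

lemma P1_eqI:
  assumes "resp P1 F" "resp P1 G"
    and "\<And>t. t \<in> {0..1/2} \<Longrightarrow> F (Val Left t) = G (Val Left t)" "\<And>t. t \<in> {0..1/2} \<Longrightarrow> F (Dt Left t) = G (Dt Left t)"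
    and "\<And>t. t \<in> {1/2..1} \<Longrightarrow> F (Val Right t) = G (Val Right t)" "\<And>t. t \<in> {1/2..1} \<Longrightarrow> F (Dt Right t) = G (Dt Right t)"
  shows "F y = G y"
proof (cases "y \<in> csupp (fst P1)")
  case True
  then consider t where "t \<in> {0..1/2}" "y = Val Left t \<or> y = Dt Left t" | t where "t \<in> {1/2..1}" "y = Val Right t \<or> y = Dt Right t"
    unfolding csupp_P1 by blast
  then show ?thesis using assms(3-6) by cases auto
qed (use assms(1,2) in \<open>auto simp: resp_P1\<close>)

lemma gop_resp: "gop dg dg' r T A B \<Longrightarrow> resp A f \<Longrightarrow> resp B (T f)"
  by (rule rop_resp[OF gop_rop])

lemma dF_res: "fn P0 f \<Longrightarrow> dF (res f) y = res (dF f) y"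
proof (rule P1_eqI)
  assume f: "fn P0 f"
  then have r: "resp P0 f" by (simp add: fn_def)
  show "resp P1 (dF (res f))" by (rule gop_resp[OF gop_dF1 gop_resp[OF gop_res r]])
  show "resp P1 (res (dF f))" by (rule gop_resp[OF gop_res gop_resp[OF gop_dF0 r]])
  fix t :: real
  show "dF (res f) (Val Left t) = res (dF f) (Val Left t)" "dF (res f) (Val Right t) = res (dF f) (Val Right t)" by simp_all
  note d = has_vector_derivative_within_subset[OF fn_deriv(1)[OF f]]
  { assume t: "t \<in> {0..1/2}"
    have "dF (res f) (Dt Left t) = dF f (Dt Whole t)"
      by (rule dF_DtI[where F = "\<lambda>u. f (Val Whole u)"], use t in simp, simp, rule d) (use t in auto)
    then show "dF (res f) (Dt Left t) = res (dF f) (Dt Left t)" using t by (simp del: dF.simps) }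
  { assume t: "t \<in> {1/2..1}"
    have "dF (res f) (Dt Right t) = dF f (Dt Whole t)"
      by (rule dF_DtI[where F = "\<lambda>u. f (Val Whole u)"], use t in simp, simp, rule d) (use t in auto)
    then show "dF (res f) (Dt Right t) = res (dF f) (Dt Right t)" using t by (simp del: dF.simps) }
qed

lemma dF_WI_plain: "fn P0 f \<Longrightarrow> dF ((W_plain \<circ> I_plain) f) y = (W_plain \<circ> I_plain) (dF f) y"
proof -
  assume "fn P0 f"
  then have "dC (I_plain f) = I_plain (dF f)" using dC_I_plain by blast
  then show ?thesis by (simp only: comp_apply dF_W_plain)
qed

lemma dF_WI_star: "fn P1 f \<Longrightarrow> dF ((W_star \<circ> I_star) f) y = (W_star \<circ> I_star) (dF f) y"
proof -
  assume "fn P1 f"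
  then have "dC_star (I_star f) = I_star (dF f)" using dC_I_star by blast
  then show ?thesis by (simp only: comp_apply dF_W_star)
qed

lemma I_W_plain: "fn CS0 \<alpha> \<Longrightarrow> I_plain (W_plain \<alpha>) y = \<alpha> y"
proof -
  assume "fn CS0 \<alpha>"
  moreover have "integral {0..1} (\<lambda>u. W_plain \<alpha> (Dt Whole u)) = integral {0..1} (\<lambda>u::real. \<alpha> E01)"
    by (rule integral_cong) simp
  ultimately show ?thesis by (cases y) (auto simp: fn_cell cells_def)
qed

lemma I_W_star: "fn CS1 \<alpha> \<Longrightarrow> I_star (W_star \<alpha>) y = \<alpha> y"
proof -
  assume "fn CS1 \<alpha>"
  moreover have "integral {0..1/2} (\<lambda>u. W_star \<alpha> (Dt Left u)) = integral {0..1/2} (\<lambda>u::real. \<alpha> E0star * 2)"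
     "integral {1/2..1} (\<lambda>u. W_star \<alpha> (Dt Right u)) = integral {1/2..1} (\<lambda>u::real. \<alpha> Estar1 * 2)"
    by (rule integral_cong; simp)+
  ultimately show ?thesis by (cases y) (auto simp: fn_cell cells_star_def)
qed

lemma p_i_weld: "fn CS0 \<alpha> \<Longrightarrow> p_weld (i_weld \<alpha>) y = \<alpha> y"
  by (cases y) (auto simp: fn_cell cells_def)

text \<open>An affine function takes its mean value at the midpoint and is affine on both halves,
  and \<open>dt\<close> has integral 1/2 over each half; these are the coefficients of
  \<open>i_weld\<close>.\<close>

lemma W_i_weld: "W_star (i_weld \<alpha>) y = res (W_plain \<alpha>) y"
  by (cases "(\<alpha>, y)" rule: W_star.cases) (auto simp: algebra_simps)

text \<open>\<open>p_weld\<close> drops the midpoint and adds the two edges, so the integrals over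
  the halves recombine to the one over the whole interval.\<close>

lemma p_I_res: "fn P0 f \<Longrightarrow> p_weld (I_star (res f)) y = I_plain f y"
proof -
  assume f: "fn P0 f"
  have "integral {0..1/2} (\<lambda>u. res f (Dt Left u)) + integral {1/2..1} (\<lambda>u. res f (Dt Right u)) =
      integral {0..1/2} (\<lambda>u. f (Dt Whole u)) + integral {1/2..1} (\<lambda>u. f (Dt Whole u))"
    by (intro arg_cong2[where f = "(+)"] integral_cong) auto
  also have "\<dots> = integral {0..1} (\<lambda>u. f (Dt Whole u))"
    by (rule Henstock_Kurzweil_Integration.integral_combine) (auto intro!: integrable_continuous_interval fn_cont f)
  finally show ?thesis by (cases y) auto
qed

text \<open>The two halves of \<open>dh + hd = 1 - \<pi>\<close>, separated by degree.\<close>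

definition contraction :: "('a \<Rightarrow> int) \<Rightarrow> 'a space \<Rightarrow> (('a \<Rightarrow> real) \<Rightarrow> ('a \<Rightarrow> real)) \<Rightarrow> (('a \<Rightarrow> real) \<Rightarrow> ('a \<Rightarrow> real)) \<Rightarrow> (('a \<Rightarrow> real) \<Rightarrow> ('a \<Rightarrow> real)) \<Rightarrow> bool" where
  "contraction dg A d h \<pi> \<longleftrightarrow> (\<forall>f y. fn A f \<longrightarrow>
     d (h f) y = (if dg y \<noteq> 0 then f y - \<pi> f y else 0) \<and> h (d f) y = (if dg y = 0 then f y - \<pi> f y else 0))"

text \<open>At the midpoint, half of \<open>f Estar - f E0\<close> minus half of
  \<open>f E1 - f Estar\<close> is the deviation of \<open>f Estar\<close> from the mean of the end
  values. On an edge, both sides are half the difference of the two edge values.\<close>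

lemma contraction_a: "contraction cell_deg CS1 dC_star a_weld (i_weld \<circ> p_weld)"
  unfolding contraction_def
proof (intro allI impI)
  fix f y assume "fn CS1 f"
  then show "dC_star (a_weld f) y = (if cell_deg y \<noteq> 0 then f y - (i_weld \<circ> p_weld) f y else 0) \<and>
      a_weld (dC_star f) y = (if cell_deg y = 0 then f y - (i_weld \<circ> p_weld) f y else 0)"
    by (cases y) (auto simp: fn_cell cells_star_def field_simps)
qed

lemma has_vd_upto:
  assumes "continuous_on {a..b} f" "t \<in> {a..b}"
  shows "((\<lambda>u. (integral {a..u} f + (c + d * u)) :: real) has_vector_derivative (f t + d)) (at t within {a..b})"
  by (intro has_vector_derivative_add integral_has_vector_derivative[OF assms] has_vd_affine)

text \<open>In degree 1 the derivative of \<open>s\<close> subtracts from the coefficient its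
  integral, which is the coefficient of \<open>WI\<close>. In degree 0 the fundamental theorem turns
  \<open>sd\<close> into \<open>f\<close> minus its affine interpolation between the end
  values.\<close>

lemma contraction_s_plain: "contraction pos_deg P0 dF s_plain (W_plain \<circ> I_plain)"
  unfolding contraction_def
proof (intro allI impI conjI)
  fix f y assume f: "fn P0 f"
  then have r: "resp P0 f" by (simp add: fn_def)
  let ?I = "integral {0..1} (\<lambda>u. f (Dt Whole u))"
  have d: "dF (s_plain f) (Dt Whole t) = f (Dt Whole t) + - ?I" if t: "t \<in> {0..1}" for t
  proof (rule dF_DtI)
    show "((\<lambda>u. integral {0..u} (\<lambda>u. f (Dt Whole u)) + (0 + - ?I * u)) has_vector_derivative f (Dt Whole t) + - ?I) (at t within ivl Whole)"
      unfolding ivl.simps by (rule has_vd_upto[OF fn_cont(1)[OF f] t])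
  qed (use t in simp_all)
  note rr = gop_resp[OF gop_part[OF gop_WI_plain] r]
  show "dF (s_plain f) y = (if pos_deg y \<noteq> 0 then f y - (W_plain \<circ> I_plain) f y else 0)"
    by (rule P0_eqI[OF gop_resp[OF gop_dF0 gop_resp[OF gop_s_plain r]] rr[of "\<lambda>d. d \<noteq> 0"], of y])
      (use d in \<open>simp_all del: dF.simps(2)\<close>)
  have e: "s_plain (dF f) (Val Whole t) = (f (Val Whole t) - f (Val Whole 0)) - t * (f (Val Whole 1) - f (Val Whole 0))"
    if "t \<in> {0..1}" for t
    using that integral_dF_Whole[OF f, of t] integral_dF_Whole[OF f, of 1] by (simp del: dF.simps(2))
  show "s_plain (dF f) y = (if pos_deg y = 0 then f y - (W_plain \<circ> I_plain) f y else 0)"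
    by (rule P0_eqI[OF gop_resp[OF gop_s_plain gop_resp[OF gop_dF0 r]] rr[of "\<lambda>d. d = 0"], of y])
      (use e in \<open>simp_all del: dF.simps(2) s_plain.simps(1) add: algebra_simps\<close>)
qed

lemma contraction_s_star: "contraction pos_deg P1 dF s_star (W_star \<circ> I_star)"
  unfolding contraction_def
proof (intro allI impI conjI)
  fix f y assume f: "fn P1 f"
  then have r: "resp P1 f" by (simp add: fn_def)
  let ?I = "integral {0..1/2} (\<lambda>u. f (Dt Left u))" and ?J = "integral {1/2..1} (\<lambda>u. f (Dt Right u))"
  have d: "dF (s_star f) (Dt Left t) = f (Dt Left t) + - 2 * ?I" if t: "t \<in> {0..1/2}" for t
  proof (rule dF_DtI)
    show "((\<lambda>u. integral {0..u} (\<lambda>u. f (Dt Left u)) + (0 + - 2 * ?I * u)) has_vector_derivative f (Dt Left t) + - 2 * ?I) (at t within ivl Left)"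
      unfolding ivl.simps by (rule has_vd_upto[OF fn_cont(2)[OF f] t])
  qed (use t in simp_all)
  have d': "dF (s_star f) (Dt Right t) = f (Dt Right t) + - 2 * ?J" if t: "t \<in> {1/2..1}" for t
  proof (rule dF_DtI)
    \<comment> \<open>The affine part is \<open>- 2 * (u - 1/2) * ?J\<close> expanded, whence the
      constant term \<open>?J\<close>; on the left half it is zero.\<close>
    show "((\<lambda>u. integral {1/2..u} (\<lambda>u. f (Dt Right u)) + (?J + - 2 * ?J * u)) has_vector_derivative f (Dt Right t) + - 2 * ?J) (at t within ivl Right)"
      unfolding ivl.simps by (rule has_vd_upto[OF fn_cont(3)[OF f] t])
  qed (use t in \<open>simp_all add: algebra_simps\<close>)
  note rr = gop_resp[OF gop_part[OF gop_WI_star] r]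
  show "dF (s_star f) y = (if pos_deg y \<noteq> 0 then f y - (W_star \<circ> I_star) f y else 0)"
    by (rule P1_eqI[OF gop_resp[OF gop_dF1 gop_resp[OF gop_s_star r]] rr[of "\<lambda>d. d \<noteq> 0"], of y])
      (use d d' in \<open>simp_all del: dF.simps(2)\<close>)
  have e: "s_star (dF f) (Val Left t) = (f (Val Left t) - f (Val Left 0)) - 2 * t * (f (Val Left (1/2)) - f (Val Left 0))"
    if "t \<in> {0..1/2}" for t
    using that integral_dF_Left[OF f, of t] integral_dF_Left[OF f, of "1/2"] by (simp del: dF.simps(2))
  have e': "s_star (dF f) (Val Right t) = (f (Val Right t) - f (Val Left (1/2))) - 2 * (t - 1/2) * (f (Val Right 1) - f (Val Left (1/2)))"
    if "t \<in> {1/2..1}" for t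
    using that integral_dF_Right[OF f, of t] integral_dF_Right[OF f, of 1] fn_P1_glue[OF f] by (simp del: dF.simps(2))
  show "s_star (dF f) y = (if pos_deg y = 0 then f y - (W_star \<circ> I_star) f y else 0)"
    by (rule P1_eqI[OF gop_resp[OF gop_s_star gop_resp[OF gop_dF1 r]] rr[of "\<lambda>d. d = 0"], of y])
      (use e e' in \<open>simp_all del: dF.simps(2) s_star.simps(1,2) add: algebra_simps\<close>)
qed

section \<open>The differential of a tensor product\<close>

lemma sum_fun_apply: "(\<Sum>a\<in>A. F a) x = (\<Sum>a\<in>A. F a x)" for F :: "'a \<Rightarrow> 'b \<Rightarrow> 'c::comm_monoid_add"
  by (induction A rule: infinite_finite_induct) auto

lemma good_zero: "(\<And>i. i < n \<Longrightarrow> cconv (V i)) \<Longrightarrow> good n V (\<lambda>_. 0)"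
  by (simp add: good_def smooth_const)

lemma good_sum:
  assumes "finite A" "\<And>i. i < n \<Longrightarrow> cconv (V i)" "\<And>a. a \<in> A \<Longrightarrow> good n V (\<phi> a)"
  shows "good n V (\<lambda>xs. \<Sum>a\<in>A. c a * \<phi> a xs)"
  using assms(1,3)
proof (induction A rule: finite_induct)
  case (insert a A)
  then show ?case using good_lin[of n V "\<phi> a" "\<lambda>xs. \<Sum>a\<in>A. c a * \<phi> a xs" "c a" 1] by simp
qed (simp add: good_zero assms(2))

lemma tens_zero_fun:
  assumes "\<And>i. i < n \<Longrightarrow> gop dg dg' (r i) (T i) (V i) (W i)"
  shows "tens dg n r T (\<lambda>_. 0) = (\<lambda>_. 0)"
proof -
  have "good n V (\<lambda>_. 0)"
    by (rule good_zero) (use assms in \<open>auto simp: gop_def wf_space_def\<close>)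
  from tens_lin[of n V _ _ dg dg' r T W 0 0, OF this this assms] show ?thesis by simp
qed

lemma tens_sum:
  assumes "finite A" "\<And>a. a \<in> A \<Longrightarrow> good n V (\<phi> a)"
    and T: "\<And>i. i < n \<Longrightarrow> gop dg dg' (r i) (T i) (V i) (W i)"
  shows "tens dg n r T (\<lambda>xs. \<Sum>a\<in>A. c a * \<phi> a xs) = (\<lambda>ys. \<Sum>a\<in>A. c a * tens dg n r T (\<phi> a) ys)"
  using assms(1,2)
proof (induction A rule: finite_induct)
  case empty
  show ?case using tens_zero_fun[of n dg dg' r T V W, OF T] by simp
next
  case (insert a A)
  have cc: "cconv (V i)" if "i < n" for i using T[OF that] by (simp add: gop_def wf_space_def)
  have g: "good n V (\<lambda>xs. \<Sum>a\<in>A. c a * \<phi> a xs)"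
    by (rule good_sum) (use insert cc in auto)
  have "good n V (\<phi> a)" using insert by simp
  from tens_lin[of n V _ _ dg dg' r T W "c a" 1, OF this g T] show ?case
    using insert by simp
qed

definition dd :: "('a \<Rightarrow> int) \<Rightarrow> nat \<Rightarrow> (nat \<Rightarrow> ('a \<Rightarrow> real) \<Rightarrow> ('a \<Rightarrow> real)) \<Rightarrow> nat \<Rightarrow> ('a list \<Rightarrow> real) \<Rightarrow> ('a list \<Rightarrow> real)" where
  "dd dg n D j = tens dg n ((\<lambda>_. 0)(j := 1)) ((\<lambda>_. id)(j := D j))"

lemma list_single:
  "j < n \<Longrightarrow> replicate j (0, id) @ [(r, X)] @ replicate (n - 1 - j) (0, id) =
    map (\<lambda>i. (((\<lambda>_. 0)(j := r)) i, ((\<lambda>_. id)(j := X)) i)) [0..<n]"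
  by (rule nth_equalityI) (auto simp: nth_append nth_Cons')

lemma tensor_derivation_eq: "tensor_derivation dg n D \<phi> = (\<lambda>xs. \<Sum>j<n. dd dg n D j \<phi> xs)"
proof
  fix xs
  show "tensor_derivation dg n D \<phi> xs = (\<Sum>j<n. dd dg n D j \<phi> xs)"
    unfolding tensor_derivation_def sum_fun_apply dd_def tens_def
    by (rule sum.cong) (simp_all only: list_single[symmetric] lessThan_iff)
qed

lemma gop_single:
  assumes "j < n" "gop dg dg r X (V j) (V j)" "\<And>i. i < n \<Longrightarrow> wf_space dg (V i)" "i < n"
  shows "gop dg dg (((\<lambda>_. 0)(j := r)) i) (((\<lambda>_. id)(j := X)) i) (V i) (V i)"
  using assms by (auto intro: gop_id)

lemma good_dd:
  assumes "j < n" "good n V \<phi>" "gop dg dg 1 (D j) (V j) (V j)" "\<And>i. i < n \<Longrightarrow> wf_space dg (V i)"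
  shows "good n V (dd dg n D j \<phi>)"
  unfolding dd_def by (rule good_tens[OF assms(2)]) (rule gop_single[where V = V, OF assms(1,3,4)])

lemma prod_sgn1: "(\<Prod>i\<in>A. sgn1 (a i)) = sgn1 (\<Sum>i\<in>A. a i)"
  by (induction A rule: infinite_finite_induct) (auto simp: sgn1_add)

lemma rest_single: "j < n \<Longrightarrow> rest ((\<lambda>_. 0)(j := r)) n i = (if i < j then r else 0)"
  unfolding rest_def by (simp add: fun_upd_def sum.delta)

text \<open>On the left the differential passes the factors before \<open>j\<close> and then
  \<open>T j\<close>; on the right the factors after \<open>j\<close> pass the differential.
  Together this is the total degree of the product. Compatibility is asked for in slot
  \<open>j\<close> alone, so a product with one exceptional factor can be treated in its other
  slots.\<close>

lemma dd_tens:
  assumes j: "j < n" and g: "good n V \<phi>"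
    and T: "\<And>i. i < n \<Longrightarrow> gop dg dg' (t i) (T i) (V i) (W i)"
    and d: "gop dg dg 1 (d j) (V j) (V j)" and d': "gop dg' dg' 1 (d' j) (W j) (W j)"
    and comm: "\<And>f y. fn (V j) f \<Longrightarrow> d' j (T j f) y = sgn1 (t j) * T j (d j f) y"
  shows "dd dg' n d' j (tens dg n t T \<phi>) = (\<lambda>zs. sgn1 (\<Sum>i<n. t i) * tens dg n t T (dd dg n d j \<phi>) zs)"
proof -
  let ?\<delta> = "(\<lambda>_. 0 :: int)(j := 1)"
  let ?R = "T(j := \<lambda>f. T j (d j f))"
  let ?c = "(\<lambda>_. 1 :: real)(j := sgn1 (t j))"
  have wf: "wf_space dg (V i)" "wf_space dg' (W i)" if "i < n" for i using T[OF that] by (auto simp: gop_def)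
  have split: "(\<Sum>i<n. t i) = (\<Sum>i<j. t i) + (t j + rest t n j)"
  proof -
    have "{..<n} = {..<j} \<union> {j..<n}" using j by auto
    then have "(\<Sum>i<n. t i) = (\<Sum>i<j. t i) + (\<Sum>i=j..<n. t i)"
      by (simp add: sum.union_disjoint ivl_disj_int)
    then show ?thesis using j by (simp add: rest_def sum.atLeast_Suc_lessThan)
  qed
  have "dd dg' n d' j (tens dg n t T \<phi>) = (\<lambda>zs. (\<Prod>i<n. sgn1 (rest ?\<delta> n i * t i) * ?c i) * tens dg n (\<lambda>i. ?\<delta> i + t i) ?R \<phi> zs)"
    unfolding dd_def
    by (rule tens_comp[OF g T gop_single[where V = W, OF j d' wf(2)]]) (use comm in auto)
  also have "(\<Prod>i<n. sgn1 (rest ?\<delta> n i * t i) * ?c i) = sgn1 (\<Sum>i<j. t i) * sgn1 (t j)"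
  proof -
    have "(\<Prod>i<n. ?c i) = sgn1 (t j)" using j by (simp add: fun_upd_def prod.delta)
    moreover have "(\<Sum>i<n. rest ?\<delta> n i * t i) = (\<Sum>i<j. t i)"
      unfolding rest_single[OF j] by (rule sum.mono_neutral_cong_right) (use j in auto)
    ultimately show ?thesis by (simp only: prod.distrib prod_sgn1)
  qed
  finally have 1: "dd dg' n d' j (tens dg n t T \<phi>) = (\<lambda>zs. sgn1 (\<Sum>i<j. t i) * sgn1 (t j) * tens dg n (\<lambda>i. ?\<delta> i + t i) ?R \<phi> zs)" .
  have "tens dg n t T (dd dg n d j \<phi>) = (\<lambda>zs. (\<Prod>i<n. sgn1 (rest t n i * ?\<delta> i) * 1) * tens dg n (\<lambda>i. t i + ?\<delta> i) ?R \<phi> zs)"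
    unfolding dd_def
    by (rule tens_comp[OF g gop_single[where V = V, OF j d wf(1)] T]) auto
  also have "(\<Prod>i<n. sgn1 (rest t n i * ?\<delta> i) * 1) = sgn1 (rest t n j)"
  proof -
    have "(\<Sum>i<n. rest t n i * ?\<delta> i) = (\<Sum>i<n. if i = j then rest t n i else 0)" by (rule sum.cong) auto
    also have "\<dots> = rest t n j" using j by (simp add: sum.delta)
    finally show ?thesis by (simp only: prod_sgn1 mult_1_right)
  qed
  finally have 2: "tens dg n t T (dd dg n d j \<phi>) = (\<lambda>zs. sgn1 (rest t n j) * tens dg n (\<lambda>i. ?\<delta> i + t i) ?R \<phi> zs)"
    by (simp only: add.commute)
  show ?thesis unfolding 1 2 split by (simp only: sgn1_add mult.assoc sgn1_sq)
qed

lemma derivation_tens: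
  assumes g: "good n V \<phi>"
    and T: "\<And>i. i < n \<Longrightarrow> gop dg dg' 0 (T i) (V i) (W i)"
    and d: "\<And>i. i < n \<Longrightarrow> gop dg dg 1 (d i) (V i) (V i)" and d': "\<And>i. i < n \<Longrightarrow> gop dg' dg' 1 (d' i) (W i) (W i)"
    and comm: "\<And>i f y. i < n \<Longrightarrow> fn (V i) f \<Longrightarrow> d' i (T i f) y = T i (d i f) y"
  shows "tensor_derivation dg' n d' (tens dg n (\<lambda>_. 0) T \<phi>) = tens dg n (\<lambda>_. 0) T (tensor_derivation dg n d \<phi>)"
proof -
  have wf: "wf_space dg (V i)" if "i < n" for i using T[OF that] by (auto simp: gop_def)
  have "dd dg' n d' j (tens dg n (\<lambda>_. 0) T \<phi>) = tens dg n (\<lambda>_. 0) T (dd dg n d j \<phi>)" if j: "j < n" for j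
    using dd_tens[of j n V \<phi> dg dg' "\<lambda>_. 0" T W d d', OF j g T d[OF j] d'[OF j]] comm[OF j] by simp
  moreover have "tens dg n (\<lambda>_. 0) T (\<lambda>xs. \<Sum>j<n. 1 * dd dg n d j \<phi> xs) = (\<lambda>ys. \<Sum>j<n. 1 * tens dg n (\<lambda>_. 0) T (dd dg n d j \<phi>) ys)"
    by (rule tens_sum[OF _ _ T]) (auto intro: good_dd[OF _ g] d wf)
  ultimately show ?thesis unfolding tensor_derivation_eq by (simp add: fun_eq_iff)
qed

lemma good_derivation:
  assumes g: "good n V \<phi>" and d: "\<And>i. i < n \<Longrightarrow> gop dg dg 1 (d i) (V i) (V i)"
  shows "good n V (tensor_derivation dg n d \<phi>)"
proof -
  have wf: "wf_space dg (V i)" if "i < n" for i using d[OF that] by (auto simp: gop_def)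
  have "good n V (\<lambda>xs. \<Sum>j<n. 1 * dd dg n d j \<phi> xs)"
    by (rule good_sum) (auto intro: good_dd[OF _ g] d wf simp: wf_space_def[of dg, THEN iffD1, OF wf])
  then show ?thesis unfolding tensor_derivation_eq by simp
qed

lemma derivation_sum:
  assumes "finite A" "\<And>a. a \<in> A \<Longrightarrow> good n V (\<phi> a)" and d: "\<And>i. i < n \<Longrightarrow> gop dg dg 1 (d i) (V i) (V i)"
  shows "tensor_derivation dg n d (\<lambda>xs. \<Sum>a\<in>A. c a * \<phi> a xs) = (\<lambda>ys. \<Sum>a\<in>A. c a * tensor_derivation dg n d (\<phi> a) ys)"
proof -
  have wf: "wf_space dg (V i)" if "i < n" for i using d[OF that] by (auto simp: gop_def)
  have "dd dg n d j (\<lambda>xs. \<Sum>a\<in>A. c a * \<phi> a xs) = (\<lambda>ys. \<Sum>a\<in>A. c a * dd dg n d j (\<phi> a) ys)" if j: "j < n" for j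
    unfolding dd_def by (rule tens_sum[OF assms(1,2) gop_single[where V = V, OF j d[OF j] wf]])
  then have "tensor_derivation dg n d (\<lambda>xs. \<Sum>a\<in>A. c a * \<phi> a xs) = (\<lambda>ys. \<Sum>j<n. \<Sum>a\<in>A. c a * dd dg n d j (\<phi> a) ys)"
    unfolding tensor_derivation_eq by simp
  also have "\<dots> = (\<lambda>ys. \<Sum>a\<in>A. c a * tensor_derivation dg n d (\<phi> a) ys)"
    unfolding tensor_derivation_eq by (simp add: sum_distrib_left fun_eq_iff sum.swap[of _ A])
  finally show ?thesis .
qed

text \<open>A differential in slot \<open>j\<close> is itself a tensor product of total degree 1, so
  \<open>dd_tens\<close> gives anticommutation for every pair of slots; on the diagonal it holds
  because \<open>d j\<close> squares to zero. The double sum is therefore equal to its own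
  negative.\<close>

lemma derivation_derivation:
  assumes g: "good n V \<phi>" and d: "\<And>i. i < n \<Longrightarrow> gop dg dg 1 (d i) (V i) (V i)"
    and sq: "\<And>i f y. i < n \<Longrightarrow> d i (d i f) y = 0"
  shows "tensor_derivation dg n d (tensor_derivation dg n d \<phi>) = (\<lambda>_. 0)"
proof
  fix xs
  have wf: "wf_space dg (V i)" if "i < n" for i using d[OF that] by (auto simp: gop_def)
  have anti: "dd dg n d k (dd dg n d j \<phi>) xs = - dd dg n d j (dd dg n d k \<phi>) xs" if j: "j < n" and k: "k < n" for j k
  proof -
    have "d k (((\<lambda>_. id)(j := d j)) k f) y = sgn1 (((\<lambda>_. 0)(j := 1)) k) * ((\<lambda>_. id)(j := d j)) k (d k f) y" for f y
      using sq[OF j] by auto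
    from fun_cong[OF dd_tens[where d = d and d' = d and V = V and W = V and T = "(\<lambda>_. id)(j := d j)" and t = "(\<lambda>_. 0)(j := 1)", OF k g gop_single[where V = V, OF j d[OF j] wf] d[OF k] d[OF k] this], of xs]
    have "dd dg n d k (dd dg n d j \<phi>) xs = sgn1 (\<Sum>i<n. ((\<lambda>_. 0)(j := 1)) i) * dd dg n d j (dd dg n d k \<phi>) xs"
      unfolding dd_def[of dg n d j] .
    also have "(\<Sum>i<n. ((\<lambda>_. 0 :: int)(j := 1)) i) = 1" using j by (simp add: fun_upd_def sum.delta)
    finally show ?thesis by simp
  qed
  have "tensor_derivation dg n d (tensor_derivation dg n d \<phi>) xs = tensor_derivation dg n d (\<lambda>xs. \<Sum>j<n. 1 * dd dg n d j \<phi> xs) xs"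
    unfolding tensor_derivation_eq by simp
  also have "\<dots> = (\<Sum>j<n. 1 * tensor_derivation dg n d (dd dg n d j \<phi>) xs)"
    by (subst derivation_sum[OF _ _ d]) (auto intro: good_dd[OF _ g] d wf)
  finally have S: "tensor_derivation dg n d (tensor_derivation dg n d \<phi>) xs = (\<Sum>j<n. \<Sum>k<n. dd dg n d k (dd dg n d j \<phi>) xs)"
    (is "?L = ?S") unfolding tensor_derivation_eq by simp
  also have "?S = (\<Sum>j<n. \<Sum>k<n. - dd dg n d j (dd dg n d k \<phi>) xs)"
    by (intro sum.cong refl anti) auto
  also have "\<dots> = - (\<Sum>k<n. \<Sum>j<n. dd dg n d j (dd dg n d k \<phi>) xs)"
    by (simp add: sum_negf) (rule sum.swap)
  finally show "?L = 0" using S by simp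
qed

lemma tens_cong: "(\<And>i. i < n \<Longrightarrow> r i = r' i) \<Longrightarrow> (\<And>i. i < n \<Longrightarrow> T i = T' i) \<Longrightarrow> tens dg n r T = tens dg n r' T'"
  unfolding tens_def by (rule arg_cong[where f = "tensor dg"]) simp

text \<open>The product has total degree -1, so the differential in a slot other than
  \<open>j\<close> anticommutes with it and contributes nothing. What remains is slot
  \<open>j\<close>, where \<open>dh\<close> and \<open>hd\<close> appear as factors and add up to
  \<open>1 - \<pi>\<close>.\<close>

lemma homotopy_tens:
  assumes j: "j < n" and g: "good n V \<phi>"
    and T: "\<And>i. i < n \<Longrightarrow> i \<noteq> j \<Longrightarrow> gop dg dg 0 (T i) (V i) (V i)"
    and h: "gop dg dg (-1) h (V j) (V j)" and \<pi>: "gop dg dg 0 \<pi> (V j) (V j)"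
    and d: "\<And>i. i < n \<Longrightarrow> gop dg dg 1 (d i) (V i) (V i)"
    and comm: "\<And>i f y. i < n \<Longrightarrow> i \<noteq> j \<Longrightarrow> fn (V i) f \<Longrightarrow> d i (T i f) y = T i (d i f) y"
    and con: "contraction dg (V j) (d j) h \<pi>"
  shows "tensor_derivation dg n d (tens dg n ((\<lambda>_. 0)(j := -1)) (T(j := h)) \<phi>) xs +
      tens dg n ((\<lambda>_. 0)(j := -1)) (T(j := h)) (tensor_derivation dg n d \<phi>) xs =
    tens dg n (\<lambda>_. 0) (T(j := id)) \<phi> xs - tens dg n (\<lambda>_. 0) (T(j := \<pi>)) \<phi> xs"
proof -
  let ?t = "(\<lambda>_. 0 :: int)(j := -1)" and ?\<delta> = "(\<lambda>_. 0 :: int)(j := 1)" and ?T = "T(j := h)"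
  let ?H = "tens dg n ?t ?T"
  have wf: "wf_space dg (V i)" if "i < n" for i using d[OF that] by (auto simp: gop_def)
  have gT: "gop dg dg (?t i) (?T i) (V i) (V i)" if "i < n" for i using T[OF that] h by auto
  have sumt: "(\<Sum>i<n. ?t i) = -1" using j by (simp add: fun_upd_def sum.delta)
  have off: "dd dg n d k (?H \<phi>) xs + ?H (dd dg n d k \<phi>) xs = 0" if k: "k < n" "k \<noteq> j" for k
  proof -
    have "d k (?T k f) y = sgn1 (?t k) * ?T k (d k f) y" if "fn (V k) f" for f y
      using comm[OF k that] k(2) by simp
    from fun_cong[OF dd_tens[where d = d and d' = d and V = V and W = V and T = ?T and t = ?t, OF k(1) g gT d[OF k(1)] d[OF k(1)] this], of xs] show ?thesis
      unfolding sumt by simp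
  qed
  \<comment> \<open>\<open>tens_comp\<close> needs an operator for \<open>dh\<close> and for
    \<open>hd\<close> individually; by the contraction these are the parts of
    \<open>1 - \<pi>\<close> in nonzero and in zero degree.\<close>
  define r1 where "r1 = (\<lambda>f y. if dg y \<noteq> 0 then f y - \<pi> f y else 0)"
  define r2 where "r2 = (\<lambda>f y. if dg y = 0 then f y - \<pi> f y else 0)"
  have zero: "(\<lambda>i. ?\<delta> i + ?t i) = (\<lambda>_. 0)" "(\<lambda>i. ?t i + ?\<delta> i) = (\<lambda>_. 0)" by auto
  have 1: "dd dg n d j (?H \<phi>) = tens dg n (\<lambda>_. 0) (T(j := r1)) \<phi>"
  proof -
    have "dd dg n d j (?H \<phi>) = (\<lambda>zs. (\<Prod>i<n. sgn1 (rest ?\<delta> n i * ?t i) * 1) * tens dg n (\<lambda>i. ?\<delta> i + ?t i) (T(j := r1)) \<phi> zs)"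
      unfolding dd_def
      by (rule tens_comp[OF g gT gop_single[where V = V, OF j d[OF j] wf]]) (use con in \<open>auto simp: contraction_def r1_def\<close>)
    also have "(\<Prod>i<n. sgn1 (rest ?\<delta> n i * ?t i) * 1) = 1"
      unfolding rest_single[OF j] by (rule prod.neutral) auto
    finally show ?thesis by (simp only: zero mult_1_left)
  qed
  have 2: "?H (dd dg n d j \<phi>) = tens dg n (\<lambda>_. 0) (T(j := r2)) \<phi>"
  proof -
    have "?H (dd dg n d j \<phi>) = (\<lambda>zs. (\<Prod>i<n. sgn1 (rest ?t n i * ?\<delta> i) * 1) * tens dg n (\<lambda>i. ?t i + ?\<delta> i) (T(j := r2)) \<phi> zs)"
      unfolding dd_def
      by (rule tens_comp[OF g gop_single[where V = V, OF j d[OF j] wf] gT]) (use con in \<open>auto simp: contraction_def r2_def\<close>)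
    also have "(\<Prod>i<n. sgn1 (rest ?t n i * ?\<delta> i) * 1) = 1"
      unfolding rest_single[OF j] by (rule prod.neutral) auto
    finally show ?thesis by (simp only: zero mult_1_left)
  qed
  let ?X = "\<lambda>f y. f y - \<pi> f y"
  have g0: "gop dg dg ((\<lambda>_. 0) i) (T i) (V i) (V i)" if "i < n" "i \<noteq> j" for i using T[OF that] by simp
  have g1: "gop dg dg 0 r1 (V j) (V j)" and g2: "gop dg dg 0 r2 (V j) (V j)"
    unfolding r1_def r2_def by (rule gop_part[OF \<pi>])+
  have X1: "tens dg n (\<lambda>_. 0) (T(j := ?X)) \<phi> = (\<lambda>ys. 1 * tens dg n (\<lambda>_. 0) (T(j := r1)) \<phi> ys + 1 * tens dg n (\<lambda>_. 0) (T(j := r2)) \<phi> ys)"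
    by (rule tens_lin_at[where r = "\<lambda>_. 0", OF g j g0 g1 g2]) (auto simp: r1_def r2_def)
  have X2: "tens dg n (\<lambda>_. 0) (T(j := ?X)) \<phi> = (\<lambda>ys. 1 * tens dg n (\<lambda>_. 0) (T(j := id)) \<phi> ys + - 1 * tens dg n (\<lambda>_. 0) (T(j := \<pi>)) \<phi> ys)"
    by (rule tens_lin_at[where r = "\<lambda>_. 0", OF g j g0 gop_id[OF wf[OF j]] \<pi>]) auto
  have "?H (\<lambda>xs. \<Sum>k<n. 1 * dd dg n d k \<phi> xs) = (\<lambda>ys. \<Sum>k<n. 1 * ?H (dd dg n d k \<phi>) ys)"
    by (rule tens_sum[OF _ _ gT]) (auto intro: good_dd[OF _ g] d wf)
  then have "tensor_derivation dg n d (?H \<phi>) xs + ?H (tensor_derivation dg n d \<phi>) xs =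
      (\<Sum>k<n. dd dg n d k (?H \<phi>) xs + ?H (dd dg n d k \<phi>) xs)"
    unfolding tensor_derivation_eq by (simp add: sum.distrib)
  also have "\<dots> = (\<Sum>k\<in>{j}. dd dg n d k (?H \<phi>) xs + ?H (dd dg n d k \<phi>) xs)"
    by (rule sum.mono_neutral_right) (use j off in auto)
  also have "\<dots> = dd dg n d j (?H \<phi>) xs + ?H (dd dg n d j \<phi>) xs" by simp
  also have "\<dots> = tens dg n (\<lambda>_. 0) (T(j := ?X)) \<phi> xs" unfolding 1 2 X1 by simp
  also have "\<dots> = tens dg n (\<lambda>_. 0) (T(j := id)) \<phi> xs - tens dg n (\<lambda>_. 0) (T(j := \<pi>)) \<phi> xs"
    unfolding X2 by simp
  finally show ?thesis .
qed

lemma tens_id: "length xs = n \<Longrightarrow> tens dg n (\<lambda>_. 0) (\<lambda>_. id) \<phi> xs = \<phi> xs"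
proof -
  have "tensor dg (replicate (length xs) (0, id)) \<phi> xs = \<phi> xs"
    by (induction xs arbitrary: \<phi>) (simp_all add: sum_list_replicate)
  then show "length xs = n \<Longrightarrow> tens dg n (\<lambda>_. 0) (\<lambda>_. id) \<phi> xs = \<phi> xs"
    unfolding tens_def map_replicate_const by auto
qed

lemma tens_id_good:
  assumes "good n V \<phi>" shows "tens dg n (\<lambda>_. 0) (\<lambda>_. id) \<phi> = \<phi>"
proof
  fix xs
  show "tens dg n (\<lambda>_. 0) (\<lambda>_. id) \<phi> xs = \<phi> xs"
  proof (cases "length xs = n")
    case True
    then show ?thesis by (rule tens_id)
  next
    case False
    then show ?thesis using good_length[OF assms False] tens_zero[of n "\<lambda>_. id" xs dg "\<lambda>_. 0" \<phi>] by simp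
  qed
qed

lemma tens_comp0:
  fixes dg :: "'a \<Rightarrow> int" and dg' :: "'b \<Rightarrow> int" and dg'' :: "'c \<Rightarrow> int"
  assumes g: "good n V \<phi>"
    and T: "\<And>i. i < n \<Longrightarrow> gop dg dg' 0 (T i) (V i) (V' i)"
    and S: "\<And>i. i < n \<Longrightarrow> gop dg' dg'' 0 (S i) (V' i) (V'' i)"
    and R: "\<And>i f y. i < n \<Longrightarrow> fn (V i) f \<Longrightarrow> fn (V' i) (T i f) \<Longrightarrow> S i (T i f) y = R i f y"
  shows "tens dg' n (\<lambda>_. 0) S (tens dg n (\<lambda>_. 0) T \<phi>) = tens dg n (\<lambda>_. 0) R \<phi>"
  using tens_comp[of n V \<phi> dg dg' "\<lambda>_. 0" T V' dg'' "\<lambda>_. 0" S V'' "\<lambda>_. 1" R, OF g T S] R by simp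

section \<open>Degrees of tensor products\<close>

definition homog :: "('a \<Rightarrow> int) \<Rightarrow> int \<Rightarrow> ('a list \<Rightarrow> real) \<Rightarrow> bool" where
  "homog dg p \<phi> \<longleftrightarrow> (\<forall>xs. \<phi> xs \<noteq> 0 \<longrightarrow> tdeg dg xs = p)"

lemma tensor_support:
  assumes "\<And>p f y. p \<in> set Ts \<Longrightarrow> snd p f y \<noteq> 0 \<Longrightarrow> \<exists>x. f x \<noteq> 0 \<and> dg' y = dg x + fst p"
  shows "tensor dg Ts \<phi> ys \<noteq> 0 \<Longrightarrow> \<exists>xs. \<phi> xs \<noteq> 0 \<and> tdeg dg' ys = tdeg dg xs + sum_list (map fst Ts)"
  using assms
proof (induction Ts arbitrary: \<phi> ys)
  case Nil
  then show ?case by (cases ys) (auto simp: tdeg_def intro!: exI[of _ "[]"])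
next
  case (Cons p Ts)
  obtain r T where p: "p = (r, T)" by force
  from Cons.prems(1) p obtain y ys' where ys: "ys = y # ys'" by (cases ys) auto
  from Cons.prems(2)[of p] Cons.prems(1) p ys obtain x where
    x: "tensor dg Ts (\<lambda>xs. \<phi> (x # xs)) ys' \<noteq> 0" "dg' y = dg x + r" by fastforce
  from Cons.IH[OF x(1)] Cons.prems(2) obtain xs where "\<phi> (x # xs) \<noteq> 0" "tdeg dg' ys' = tdeg dg xs + sum_list (map fst Ts)" by auto
  then show ?case using x(2) p ys by (intro exI[of _ "x # xs"]) (simp add: tdeg_def)
qed

lemma gop_support:
  assumes "gop dg dg' r T A B" "T f y \<noteq> 0" shows "\<exists>x. f x \<noteq> 0 \<and> dg' y = dg x + r"
proof (rule ccontr)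
  assume "\<nexists>x. f x \<noteq> 0 \<and> dg' y = dg x + r"
  then have "T f y = T (\<lambda>_. 0) y" by (intro gop_local[OF assms(1)]) auto
  then show False using assms gop_zero[OF assms(1)] by simp
qed

lemma homog_tens:
  assumes "homog dg p \<phi>" "\<And>i. i < n \<Longrightarrow> gop dg dg' (r i) (T i) (V i) (W i)"
  shows "homog dg' (p + (\<Sum>i<n. r i)) (tens dg n r T \<phi>)"
  unfolding homog_def
proof (intro allI impI)
  fix ys assume "tens dg n r T \<phi> ys \<noteq> 0"
  then have "\<exists>xs. \<phi> xs \<noteq> 0 \<and> tdeg dg' ys = tdeg dg xs + sum_list (map fst (map (\<lambda>i. (r i, T i)) [0..<n]))"
    unfolding tens_def by (rule tensor_support[rotated]) (use gop_support[OF assms(2)] in auto)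
  moreover have "sum_list (map fst (map (\<lambda>i. (r i, T i)) [0..<n])) = (\<Sum>i<n. r i)"
    by (simp add: comp_def interv_sum_list_conv_sum_set_nat atLeast0LessThan)
  ultimately show "tdeg dg' ys = p + (\<Sum>i<n. r i)" using assms(1) unfolding homog_def by auto
qed

lemma homog_sum: "(\<And>a. a \<in> A \<Longrightarrow> homog dg p (\<phi> a)) \<Longrightarrow> homog dg p (\<lambda>xs. \<Sum>a\<in>A. c a * \<phi> a xs)"
  proof (unfold homog_def, intro allI impI)
  fix xs assume a: "\<And>a. a \<in> A \<Longrightarrow> \<forall>xs. \<phi> a xs \<noteq> 0 \<longrightarrow> tdeg dg xs = p" and "(\<Sum>a\<in>A. c a * \<phi> a xs) \<noteq> 0"
  then obtain a where "a \<in> A" "c a * \<phi> a xs \<noteq> 0" using sum.not_neutral_contains_not_neutral by blast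
  then show "tdeg dg xs = p" using a by auto
qed

lemma homog_derivation:
  assumes "homog dg p \<phi>" and d: "\<And>i. i < n \<Longrightarrow> gop dg dg 1 (d i) (V i) (V i)"
  shows "homog dg (p + 1) (tensor_derivation dg n d \<phi>)"
proof -
  have wf: "wf_space dg (V i)" if "i < n" for i using d[OF that] by (auto simp: gop_def)
  have "homog dg (p + 1) (dd dg n d j \<phi>)" if j: "j < n" for j
  proof -
    have "homog dg (p + (\<Sum>i<n. ((\<lambda>_. 0)(j := 1)) i)) (dd dg n d j \<phi>)"
      unfolding dd_def by (rule homog_tens[OF assms(1) gop_single[where V = V, OF j d[OF j] wf]])
    moreover have "(\<Sum>i<n. ((\<lambda>_. 0 :: int)(j := 1)) i) = 1" using j by (simp add: fun_upd_def sum.delta)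
    ultimately show ?thesis by simp
  qed
  then have "homog dg (p + 1) (\<lambda>xs. \<Sum>j<n. 1 * dd dg n d j \<phi> xs)" by (intro homog_sum) auto
  then show ?thesis unfolding tensor_derivation_eq by simp
qed

section \<open>The complexes of the cube\<close>

abbreviation pos_spaces :: "nat \<Rightarrow> nat \<Rightarrow> pos space" where "pos_spaces k \<equiv> at_pos k P1 P0"
abbreviation cell_spaces :: "nat \<Rightarrow> nat \<Rightarrow> cell space" where "cell_spaces k \<equiv> at_pos k CS1 CS0"

definition tensor_complex ::
  "nat \<Rightarrow> (nat \<Rightarrow> 'a space) \<Rightarrow> ('a \<Rightarrow> int) \<Rightarrow> (nat \<Rightarrow> ('a \<Rightarrow> real) \<Rightarrow> ('a \<Rightarrow> real)) \<Rightarrow> ('a list \<Rightarrow> real) complex_data" where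
  "tensor_complex n V dg d = \<lparr>grade = (\<lambda>p. {\<phi>. good n V \<phi> \<and> homog dg p \<phi>}), diff = tensor_derivation dg n d\<rparr>"

lemma subspace_good:
  assumes "\<And>i. i < n \<Longrightarrow> cconv (V i)" shows "subspace {\<phi>. good n V \<phi>}"
proof (rule subspaceI)
  show "0 \<in> {\<phi>. good n V \<phi>}" using good_zero[of n V] assms by (simp add: zero_fun_def)
  show "x + y \<in> {\<phi>. good n V \<phi>}" if "x \<in> {\<phi>. good n V \<phi>}" "y \<in> {\<phi>. good n V \<phi>}" for x y
    using good_lin[of n V x y 1 1] that by (simp add: plus_fun_def)
  show "c *\<^sub>R x \<in> {\<phi>. good n V \<phi>}" if "x \<in> {\<phi>. good n V \<phi>}" for c x
    using good_lin[of n V x x c 0] that by (simp add: scaleR_fun_def)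
qed

lemma subspace_homog: "subspace {\<phi>. homog dg p \<phi>}"
proof (rule subspaceI)
  show "0 \<in> {\<phi>. homog dg p \<phi>}" by (simp add: homog_def)
  show "x + y \<in> {\<phi>. homog dg p \<phi>}" if "x \<in> {\<phi>. homog dg p \<phi>}" "y \<in> {\<phi>. homog dg p \<phi>}" for x y
  proof -
    have "tdeg dg xs = p" if "x xs + y xs \<noteq> 0" for xs
      using \<open>x \<in> _\<close> \<open>y \<in> _\<close> that by (cases "x xs = 0") (auto simp: homog_def)
    then show ?thesis by (simp add: homog_def)
  qed
  show "c *\<^sub>R x \<in> {\<phi>. homog dg p \<phi>}" if "x \<in> {\<phi>. homog dg p \<phi>}" for c x
    using that by (simp add: homog_def scaleR_fun_def)
qed

lemma total_space_good:
  assumes "\<And>i. i < n \<Longrightarrow> cconv (V i)" "\<phi> \<in> total_space (tensor_complex n V dg d)"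
  shows "good n V \<phi>"
proof -
  have "span (\<Union>p. {\<phi>. good n V \<phi> \<and> homog dg p \<phi>}) \<subseteq> {\<phi>. good n V \<phi>}"
    by (rule span_minimal[OF _ subspace_good]) (use assms(1) in auto)
  then show ?thesis using assms(2) by (auto simp: total_space_def tensor_complex_def)
qed

text \<open>The total space of a complex consists of good functions
  (\<open>total_space_good\<close>), and all identities are proved for good functions. A graded map
  is accordingly recorded by its behaviour on them, which avoids decomposing into homogeneous
  parts.\<close>

definition good_map ::
  "nat \<Rightarrow> (nat \<Rightarrow> 'a space) \<Rightarrow> ('a \<Rightarrow> int) \<Rightarrow> (nat \<Rightarrow> 'b space) \<Rightarrow> ('b \<Rightarrow> int) \<Rightarrow> int \<Rightarrow> (('a list \<Rightarrow> real) \<Rightarrow> ('b list \<Rightarrow> real)) \<Rightarrow> bool" where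
  "good_map n V dg V' dg' r F \<longleftrightarrow>
     (\<forall>\<phi> \<psi> a b. good n V \<phi> \<longrightarrow> good n V \<psi> \<longrightarrow> F (\<lambda>xs. a * \<phi> xs + b * \<psi> xs) = (\<lambda>ys. a * F \<phi> ys + b * F \<psi> ys)) \<and>
     (\<forall>\<phi>. good n V \<phi> \<longrightarrow> good n V' (F \<phi>)) \<and>
     (\<forall>\<phi> p. good n V \<phi> \<longrightarrow> homog dg p \<phi> \<longrightarrow> homog dg' (p + r) (F \<phi>))"

lemma good_map_lin: "good_map n V dg V' dg' r F \<Longrightarrow> good n V \<phi> \<Longrightarrow> good n V \<psi> \<Longrightarrow>
    F (\<lambda>xs. a * \<phi> xs + b * \<psi> xs) = (\<lambda>ys. a * F \<phi> ys + b * F \<psi> ys)"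
  unfolding good_map_def by blast

lemma good_map_good: "good_map n V dg V' dg' r F \<Longrightarrow> good n V \<phi> \<Longrightarrow> good n V' (F \<phi>)"
  unfolding good_map_def by blast

lemma good_map_homog: "good_map n V dg V' dg' r F \<Longrightarrow> good n V \<phi> \<Longrightarrow> homog dg p \<phi> \<Longrightarrow> homog dg' (p + r) (F \<phi>)"
  unfolding good_map_def by blast

lemma graded_map_tensor_complex:
  assumes F: "good_map n V dg V' dg' r F" and V: "\<And>i. i < n \<Longrightarrow> cconv (V i)"
  shows "graded_map r (tensor_complex n V dg d) (tensor_complex n V' dg' d') F"
  unfolding graded_map_def
proof (intro conjI ballI allI)
  fix x y c assume x: "x \<in> total_space (tensor_complex n V dg d)" and y: "y \<in> total_space (tensor_complex n V dg d)"
  note gx = total_space_good[OF V x] and gy = total_space_good[OF V y]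
  show "F (x + y) = F x + F y" using good_map_lin[OF F gx gy, of 1 1] by (simp add: plus_fun_def)
next
  fix x c assume x: "x \<in> total_space (tensor_complex n V dg d)"
  note gx = total_space_good[OF V x]
  show "F (c *\<^sub>R x) = c *\<^sub>R F x" using good_map_lin[OF F gx gx, of c 0] by (simp add: scaleR_fun_def)
next
  fix p
  show "F ` grade (tensor_complex n V dg d) p \<subseteq> grade (tensor_complex n V' dg' d') (p + r)"
    using good_map_good[OF F] good_map_homog[OF F] by (auto simp: tensor_complex_def)
qed

lemma good_map_tens:
  assumes "\<And>i. i < n \<Longrightarrow> gop dg dg' (r i) (T i) (V i) (W i)" "R = (\<Sum>i<n. r i)"
  shows "good_map n V dg W dg' R (tens dg n r T)"
  unfolding good_map_def assms(2)
proof (intro conjI allI impI)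
  fix \<phi> \<psi> a b assume "good n V \<phi>" "good n V \<psi>"
  then show "tens dg n r T (\<lambda>xs. a * \<phi> xs + b * \<psi> xs) = (\<lambda>ys. a * tens dg n r T \<phi> ys + b * tens dg n r T \<psi> ys)"
    by (rule tens_lin) (rule assms(1))
next
  fix \<phi> assume "good n V \<phi>"
  then show "good n W (tens dg n r T \<phi>)" by (rule good_tens) (rule assms(1))
next
  fix \<phi> p assume "homog dg p \<phi>"
  then show "homog dg' (p + (\<Sum>i<n. r i)) (tens dg n r T \<phi>)" by (rule homog_tens) (rule assms(1))
qed

lemma good_map_comp:
  assumes "good_map n V dg V' dg' r F" "good_map n V' dg' V'' dg'' s G" "q = r + s"
  shows "good_map n V dg V'' dg'' q (\<lambda>\<phi>. G (F \<phi>))"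
  unfolding good_map_def
proof (intro conjI allI impI)
  fix \<phi> \<psi> a b assume g: "good n V \<phi>" "good n V \<psi>"
  show "G (F (\<lambda>xs. a * \<phi> xs + b * \<psi> xs)) = (\<lambda>ys. a * G (F \<phi>) ys + b * G (F \<psi>) ys)"
    unfolding good_map_lin[OF assms(1) g]
    by (rule good_map_lin[OF assms(2) good_map_good[OF assms(1) g(1)] good_map_good[OF assms(1) g(2)]])
next
  fix \<phi> p assume g: "good n V \<phi>"
  show "good n V'' (G (F \<phi>))" by (rule good_map_good[OF assms(2) good_map_good[OF assms(1) g]])
  assume "homog dg p \<phi>"
  from good_map_homog[OF assms(2) good_map_good[OF assms(1) g] good_map_homog[OF assms(1) g this]]
  show "homog dg'' (p + q) (G (F \<phi>))" by (simp add: assms(3) add.assoc)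
qed

lemma good_map_sum:
  assumes "finite A" "\<And>a. a \<in> A \<Longrightarrow> good_map n V dg V' dg' r (F a)" "\<And>i. i < n \<Longrightarrow> cconv (V' i)"
    "\<And>\<phi> xs. G \<phi> xs = (\<Sum>a\<in>A. c a * F a \<phi> xs)"
  shows "good_map n V dg V' dg' r G"
  unfolding good_map_def
proof (intro conjI allI impI)
  have G: "G \<phi> = (\<lambda>xs. \<Sum>a\<in>A. c a * F a \<phi> xs)" for \<phi> using assms(4) by blast
  {
    fix \<phi> \<psi> a b assume g: "good n V \<phi>" "good n V \<psi>"
    have "F e (\<lambda>xs. a * \<phi> xs + b * \<psi> xs) = (\<lambda>ys. a * F e \<phi> ys + b * F e \<psi> ys)" if "e \<in> A" for e
      by (rule good_map_lin[OF assms(2)[OF that] g])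
    then show "G (\<lambda>xs. a * \<phi> xs + b * \<psi> xs) = (\<lambda>ys. a * G \<phi> ys + b * G \<psi> ys)"
      unfolding G by (simp add: sum_distrib_left sum.distrib[symmetric] algebra_simps)
  next
    fix \<phi> assume g: "good n V \<phi>"
    show "good n V' (G \<phi>)" unfolding G
      by (rule good_sum[OF assms(1,3)]) (auto intro: good_map_good[OF assms(2) g])
  next
    fix \<phi> p assume g: "good n V \<phi>" and h: "homog dg p \<phi>"
    show "homog dg' (p + r) (G \<phi>)" unfolding G
      by (rule homog_sum) (rule good_map_homog[OF assms(2) g h])
  }
qed

lemma good_map_derivation:
  assumes d: "\<And>i. i < n \<Longrightarrow> gop dg dg 1 (d i) (V i) (V i)"
  shows "good_map n V dg V dg 1 (tensor_derivation dg n d)"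
proof (rule good_map_sum[where A = "{..<n}" and F = "dd dg n d" and c = "\<lambda>_. 1"])
  have wf: "wf_space dg (V i)" if "i < n" for i using d[OF that] by (auto simp: gop_def)
  then show "cconv (V i)" if "i < n" for i using that by (auto simp: wf_space_def)
  fix j assume "j \<in> {..<n}"
  then have j: "j < n" by simp
  show "good_map n V dg V dg 1 (dd dg n d j)" unfolding dd_def
    by (rule good_map_tens[OF gop_single[where V = V, OF j d[OF j] wf]]) (use j in \<open>simp_all add: fun_upd_def sum.delta\<close>)
qed (simp_all add: tensor_derivation_eq)

lemma cochain_complex_tensor:
  assumes d: "\<And>i. i < n \<Longrightarrow> gop dg dg 1 (d i) (V i) (V i)" and sq: "\<And>i f y. i < n \<Longrightarrow> d i (d i f) y = 0"
  shows "cochain_complex (tensor_complex n V dg d)"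
  unfolding cochain_complex_def
proof (intro conjI allI impI ballI)
  have cc: "cconv (V i)" if "i < n" for i using d[OF that] by (auto simp: gop_def wf_space_def)
  fix p
  have "grade (tensor_complex n V dg d) p = {\<phi>. good n V \<phi>} \<inter> {\<phi>. homog dg p \<phi>}" by (auto simp: tensor_complex_def)
  then show "subspace (grade (tensor_complex n V dg d) p)"
    using subspace_inter[OF subspace_good[OF cc] subspace_homog] by simp
next
  fix P x p assume P: "finite P" "\<forall>p\<in>P. x p \<in> grade (tensor_complex n V dg d) p" "(\<Sum>p\<in>P. x p) = 0" and p: "p \<in> P"
  show "x p = 0"
  proof (rule ccontr)
    assume "x p \<noteq> 0"
    then obtain xs where xs: "x p xs \<noteq> 0" by (auto simp: fun_eq_iff)
    have h: "homog dg q (x q)" if "q \<in> P" for q using P(2) that by (auto simp: tensor_complex_def)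
    \<comment> \<open>Components of different degrees have disjoint supports, so at a point of the
      support of \<open>x p\<close> the whole sum is \<open>x p xs\<close>.\<close>
    have "x q xs = 0" if "q \<in> P - {p}" for q
      using h[OF p] h[of q] xs that by (auto simp: homog_def)
    then have "(\<Sum>q\<in>P. x q xs) = x p xs"
      using sum.mono_neutral_right[OF P(1), of "{p}" "\<lambda>q. x q xs"] p by auto
    moreover have "(\<Sum>q\<in>P. x q xs) = 0" using fun_cong[OF P(3), of xs] by (simp add: sum_fun_apply)
    ultimately show False using xs by simp
  qed
next
  have cc: "cconv (V i)" if "i < n" for i using d[OF that] by (auto simp: gop_def wf_space_def)
  show "graded_map 1 (tensor_complex n V dg d) (tensor_complex n V dg d) (diff (tensor_complex n V dg d))"
    using graded_map_tensor_complex[where d = d and d' = d, OF good_map_derivation[OF d] cc] by (simp add: tensor_complex_def)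
  fix x assume "x \<in> total_space (tensor_complex n V dg d)"
  from derivation_derivation[OF total_space_good[OF cc this] d sq]
  show "diff (tensor_complex n V dg d) (diff (tensor_complex n V dg d) x) = 0"
    by (simp add: tensor_complex_def zero_fun_def)
qed

section \<open>Forms and cochains of the cube as good functions, and the maps between them\<close>

lemma fst_P0_comps: "fst P0 = (\<lambda>c. ({t. in_piece (c t)}, c)) ` comps"
  by (simp add: P0_def comps_def del: ivl.simps)

lemma fst_P1_comps: "fst P1 = (\<lambda>c. ({t. in_piece (c t)}, c)) ` comps_star"
  by (simp add: P1_def comps_star_def insert_commute del: ivl.simps)

lemma pos_plain_csupp: "pos_plain = csupp (fst P0)"
  unfolding pos_plain_def csupp_def fst_P0_comps
  by (rule Collect_cong) (simp only: image_iff prod.inject Bex_def mem_Collect_eq, blast)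

lemma pos_star_csupp: "pos_star = csupp (fst P1)"
  unfolding pos_star_def csupp_def fst_P1_comps
  by (rule Collect_cong) (simp only: image_iff prod.inject Bex_def mem_Collect_eq, blast)

lemma cconv_spaces [simp]: "cconv P0" "cconv P1" "cconv (cell_space cs)"
  using wf_P0 wf_P1 wf_cell[of cs] by (auto simp: wf_space_def)

lemma forms_good:
  assumes "k \<le> n" shows "forms n k = {\<omega>. good n (pos_spaces k) \<omega>}"
proof (intro set_eqI iffI)
  fix \<omega> assume w: "\<omega> \<in> forms n k"
  have "good n (pos_spaces k) \<omega>"
    unfolding good_def
  proof (intro conjI allI impI, goal_cases)
    case (2 xs)
    then show ?case using w by (auto simp: forms_def)
  next
    case (3 xs i)
    then have "xs ! i \<in> at_pos k pos_star pos_plain i" using w unfolding forms_def by blast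
    then show ?case by (cases "i < k") (simp_all add: pos_star_csupp pos_plain_csupp)
  next
    case (4 i)
    have "\<omega> (xs[i := Val Left (1/2)]) = \<omega> (xs[i := Val Right (1/2)])" if "i < k" "length xs = n" for xs
      using w that unfolding forms_def by blast
    then show ?case by (cases "i < k") (simp_all add: P0_def P1_def)
  next
    case (5 c)
    have c: "fst (c i) = {t. in_piece (snd (c i) t)} \<and> snd (c i) \<in> at_pos k comps_star comps i" if "i < n" for i
      using 5[rule_format, OF that] by (auto simp: fst_P0_comps fst_P1_comps split: if_splits)
    have "smooth_on_box n (\<lambda>i. {t. in_piece (snd (c i) t)}) (\<lambda>t. \<omega> (map (\<lambda>i. snd (c i) (t i)) [0..<n]))"
      using w c unfolding forms_def mem_Collect_eq by (elim conjE allE[of _ "\<lambda>i. snd (c i)"]) simp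
    then show ?case unfolding smooth_on_box_iff by (rule smooth_subset) (simp add: c)
  qed simp
  then show "\<omega> \<in> {\<omega>. good n (pos_spaces k) \<omega>}" by simp
next
  fix \<omega> assume "\<omega> \<in> {\<omega>. good n (pos_spaces k) \<omega>}"
  then have g: "good n (pos_spaces k) \<omega>" by simp
  show "\<omega> \<in> forms n k"
    unfolding forms_def mem_Collect_eq
  proof (intro conjI allI impI, goal_cases)
    case (1 xs)
    then show ?case using good_length[OF g] by blast
  next
    case (2 xs i)
    then have "xs ! i \<in> csupp (fst (pos_spaces k i))" using good_supp[OF g] by blast
    then show ?case by (cases "i < k") (simp_all add: pos_star_csupp pos_plain_csupp)
  next
    case (3 c)
    have "smooth n (\<lambda>i. fst ({t. in_piece (c i t)}, c i)) (\<lambda>t. \<omega> (pt n (\<lambda>i. ({t. in_piece (c i t)}, c i)) t))"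
    proof (rule good_smooth[OF g])
      fix i assume i: "i < n"
      show "({t. in_piece (c i t)}, c i) \<in> fst (pos_spaces k i)"
        using 3 i by (cases "i < k") (auto simp: fst_P0_comps fst_P1_comps simp del: in_piece.simps intro: image_eqI)
    qed
    then show ?case by (simp add: smooth_on_box_iff)
  next
    case (4 xs i)
    have "(Val Left (1/2), Val Right (1/2)) \<in> snd (pos_spaces k i)" using 4(1) by (simp add: P1_def)
    from good_glue[OF g _ this 4(2)] 4(1) assms show ?case by linarith
  qed
qed

text \<open>Charts of cells are constant, so a cochain composed with them is constant in the
  parameters and smooth; what remains of \<open>good\<close> is the condition on the
  support.\<close>

lemma cochains_good: "cochains n k = {\<alpha>. good n (cell_spaces k) \<alpha>}"
proof (intro set_eqI iffI)
  fix \<alpha> assume a: "\<alpha> \<in> cochains n k"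
  have "good n (cell_spaces k) \<alpha>"
    unfolding good_def
  proof (intro conjI allI impI, goal_cases)
    case (2 xs)
    then show ?case using a by (auto simp: cochains_def)
  next
    case (3 xs i)
    then have "xs ! i \<in> at_pos k cells_star cells i" using a unfolding cochains_def by blast
    then show ?case by (cases "i < k") (simp_all add: csupp_cell)
  next
    case (4 i)
    show ?case by (simp add: cell_space_def)
  next
    case (5 c)
    have c: "snd (c i) t = snd (c i) 0" if "i < n" for i t
    proof -
      have "(fst (c i), snd (c i)) \<in> fst (cell_spaces k i)" using 5 that by simp
      then have "\<exists>x. snd (c i) = (\<lambda>_. x)" by (cases "i < k") (auto simp only: fst_cell_space if_True if_False)
      then obtain x where "snd (c i) = (\<lambda>_. x)" by blast
      then show ?thesis by simp
    qed
    have "pt n c t = pt n c (\<lambda>_. 0)" for t by (intro map_cong refl c) simp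
    then have "\<alpha> (pt n c t) = \<alpha> (pt n c (\<lambda>_. 0))" for t by (rule arg_cong)
    then show ?case by (intro smooth_cong[OF smooth_const]) (rule sym)
  qed simp
  then show "\<alpha> \<in> {\<alpha>. good n (cell_spaces k) \<alpha>}" by simp
next
  fix \<alpha> assume "\<alpha> \<in> {\<alpha>. good n (cell_spaces k) \<alpha>}"
  then have g: "good n (cell_spaces k) \<alpha>" by simp
  have "length xs = n \<and> (\<forall>i<n. xs ! i \<in> at_pos k cells_star cells i)" if "\<alpha> xs \<noteq> 0" for xs
  proof (intro conjI allI impI)
    show "length xs = n" using that good_length[OF g] by blast
    fix i assume "i < n"
    then have "xs ! i \<in> csupp (fst (cell_spaces k i))" using that good_supp[OF g] by blast
    then show "xs ! i \<in> at_pos k cells_star cells i" by (cases "i < k") (simp_all add: csupp_cell)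
  qed
  then show "\<alpha> \<in> cochains n k" by (simp add: cochains_def)
qed

abbreviation cell_diff :: "nat \<Rightarrow> nat \<Rightarrow> (cell \<Rightarrow> real) \<Rightarrow> (cell \<Rightarrow> real)" where "cell_diff k \<equiv> at_pos k dC_star dC"

lemma C_cube_eq: "C_cube n k = tensor_complex n (cell_spaces k) cell_deg (cell_diff k)"
  unfolding C_cube_def tensor_complex_def cochains_good homog_def by simp

lemma Omega_cube_eq: "k \<le> n \<Longrightarrow> Omega_cube n k = tensor_complex n (pos_spaces k) pos_deg (\<lambda>_. dF)"
  unfolding Omega_cube_def tensor_complex_def homog_def by (simp add: forms_good)

lemma gop_cell_diff: "gop cell_deg cell_deg 1 (cell_diff k i) (cell_spaces k i) (cell_spaces k i)"
  by (simp add: gop_dC gop_dC_star)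

lemma gop_dF: "gop pos_deg pos_deg 1 dF (pos_spaces k i) (pos_spaces k i)"
  by (simp add: gop_dF0 gop_dF1)

lemma cochain_complex_C_cube: "cochain_complex (C_cube n k)"
  unfolding C_cube_eq by (rule cochain_complex_tensor[OF gop_cell_diff]) (simp add: dC_dC dC_star_dC_star)

lemma cochain_complex_Omega_cube: "k \<le> n \<Longrightarrow> cochain_complex (Omega_cube n k)"
  unfolding Omega_cube_eq by (rule cochain_complex_tensor[OF gop_dF]) (simp add: dF_dF)

lemma list_at: "k \<le> n \<Longrightarrow> replicate k (0, x) @ replicate (n - k) (0, y) = map (\<lambda>i. (0, at_pos k x y i)) [0..<n]"
  by (rule nth_equalityI) (auto simp: nth_append)

lemma cube_tens:
  assumes "k \<le> n"
  shows "W_cube n k = tens cell_deg n (\<lambda>_. 0) (at_pos k W_star W_plain)"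
    and "I_cube n k = tens pos_deg n (\<lambda>_. 0) (at_pos k I_star I_plain)"
    and "i_cube n k = tens cell_deg n (\<lambda>_. 0) (at_pos k i_weld id)"
    and "p_cube n k = tens cell_deg n (\<lambda>_. 0) (at_pos k p_weld id)"
    and "incl_cube n k = tens pos_deg n (\<lambda>_. 0) (at_pos k res id)"
  unfolding W_cube_def I_cube_def i_cube_def p_cube_def incl_cube_def tens_def list_at[OF assms] by simp_all

lemma gop_cube:
  shows gop_W: "gop cell_deg pos_deg 0 (at_pos k W_star W_plain i) (cell_spaces k i) (pos_spaces k i)"
    and gop_I: "gop pos_deg cell_deg 0 (at_pos k I_star I_plain i) (pos_spaces k i) (cell_spaces k i)"
    and gop_i: "gop cell_deg cell_deg 0 (at_pos k i_weld id i) (cell_spaces 0 i) (cell_spaces k i)"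
    and gop_p: "gop cell_deg cell_deg 0 (at_pos k p_weld id i) (cell_spaces k i) (cell_spaces 0 i)"
    and gop_incl: "gop pos_deg pos_deg 0 (at_pos k res id i) (pos_spaces 0 i) (pos_spaces k i)"
  by (simp_all add: gop_W_star gop_W_plain gop_I_star gop_I_plain gop_i_weld gop_p_weld gop_res gop_id wf_cell wf_P0)

lemma good_map_cube:
  assumes "k \<le> n"
  shows good_map_W: "good_map n (cell_spaces k) cell_deg (pos_spaces k) pos_deg 0 (W_cube n k)"
    and good_map_I: "good_map n (pos_spaces k) pos_deg (cell_spaces k) cell_deg 0 (I_cube n k)"
    and good_map_i: "good_map n (cell_spaces 0) cell_deg (cell_spaces k) cell_deg 0 (i_cube n k)"
    and good_map_p: "good_map n (cell_spaces k) cell_deg (cell_spaces 0) cell_deg 0 (p_cube n k)"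
    and good_map_incl: "good_map n (pos_spaces 0) pos_deg (pos_spaces k) pos_deg 0 (incl_cube n k)"
  unfolding cube_tens[OF assms]
  by (rule good_map_tens, rule gop_cube, simp)+

lemma W_cochain:
  assumes "k \<le> n" "good n (cell_spaces k) \<alpha>"
  shows "tensor_derivation pos_deg n (\<lambda>_. dF) (W_cube n k \<alpha>) = W_cube n k (tensor_derivation cell_deg n (cell_diff k) \<alpha>)"
  unfolding cube_tens[OF assms(1)]
  by (rule derivation_tens[OF assms(2) gop_W gop_cell_diff gop_dF]) (simp add: dF_W_star dF_W_plain)

lemma I_cochain:
  assumes "k \<le> n" "good n (pos_spaces k) \<omega>"
  shows "tensor_derivation cell_deg n (cell_diff k) (I_cube n k \<omega>) = I_cube n k (tensor_derivation pos_deg n (\<lambda>_. dF) \<omega>)"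
  unfolding cube_tens[OF assms(1)]
  by (rule derivation_tens[OF assms(2) gop_I gop_dF gop_cell_diff]) (simp add: dC_I_star dC_I_plain split: if_splits)

lemma i_cochain:
  assumes "k \<le> n" "good n (cell_spaces 0) \<alpha>"
  shows "tensor_derivation cell_deg n (cell_diff k) (i_cube n k \<alpha>) = i_cube n k (tensor_derivation cell_deg n (cell_diff 0) \<alpha>)"
  unfolding cube_tens[OF assms(1)]
  by (rule derivation_tens[OF assms(2) gop_i gop_cell_diff gop_cell_diff]) (simp add: dC_i_weld)

lemma p_cochain:
  assumes "k \<le> n" "good n (cell_spaces k) \<alpha>"
  shows "tensor_derivation cell_deg n (cell_diff 0) (p_cube n k \<alpha>) = p_cube n k (tensor_derivation cell_deg n (cell_diff k) \<alpha>)"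
  unfolding cube_tens[OF assms(1)]
  by (rule derivation_tens[OF assms(2) gop_p gop_cell_diff gop_cell_diff]) (simp add: dC_p_weld)

lemma incl_cochain:
  assumes "k \<le> n" "good n (pos_spaces 0) \<omega>"
  shows "tensor_derivation pos_deg n (\<lambda>_. dF) (incl_cube n k \<omega>) = incl_cube n k (tensor_derivation pos_deg n (\<lambda>_. dF) \<omega>)"
  unfolding cube_tens[OF assms(1)]
  by (rule derivation_tens[OF assms(2) gop_incl gop_dF gop_dF]) (simp add: dF_res)

lemma I_W_cube:
  assumes "k \<le> n" "good n (cell_spaces k) \<alpha>" shows "I_cube n k (W_cube n k \<alpha>) = \<alpha>"
proof -
  have "I_cube n k (W_cube n k \<alpha>) = tens cell_deg n (\<lambda>_. 0) (\<lambda>_. id) \<alpha>"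
    unfolding cube_tens[OF assms(1)]
    by (rule tens_comp0[OF assms(2) gop_W gop_I]) (auto simp: I_W_star I_W_plain split: if_splits)
  then show ?thesis using tens_id_good[OF assms(2)] by simp
qed

lemma p_i_cube:
  assumes "k \<le> n" "good n (cell_spaces 0) \<alpha>" shows "p_cube n k (i_cube n k \<alpha>) = \<alpha>"
proof -
  have "p_cube n k (i_cube n k \<alpha>) = tens cell_deg n (\<lambda>_. 0) (\<lambda>_. id) \<alpha>"
    unfolding cube_tens[OF assms(1)]
    by (rule tens_comp0[OF assms(2) gop_i gop_p]) (auto simp: p_i_weld)
  then show ?thesis using tens_id_good[OF assms(2)] by simp
qed

lemma W_I_cube:
  assumes "k \<le> n" "good n (pos_spaces k) \<omega>"
  shows "W_cube n k (I_cube n k \<omega>) = tens pos_deg n (\<lambda>_. 0) (at_pos k (W_star \<circ> I_star) (W_plain \<circ> I_plain)) \<omega>"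
  unfolding cube_tens[OF assms(1)]
  by (rule tens_comp0[OF assms(2) gop_I gop_W]) auto

lemma i_p_cube:
  assumes "k \<le> n" "good n (cell_spaces k) \<alpha>"
  shows "i_cube n k (p_cube n k \<alpha>) = tens cell_deg n (\<lambda>_. 0) (at_pos k (i_weld \<circ> p_weld) id) \<alpha>"
  unfolding cube_tens[OF assms(1)]
  by (rule tens_comp0[OF assms(2) gop_p gop_i]) auto

lemma W_i_cube:
  assumes "k \<le> n" "good n (cell_spaces 0) \<alpha>"
  shows "W_cube n k (i_cube n k \<alpha>) = incl_cube n k (W_cube n 0 \<alpha>)"
proof -
  let ?R = "at_pos k (\<lambda>\<alpha>. W_star (i_weld \<alpha>)) W_plain"
  have "W_cube n k (i_cube n k \<alpha>) = tens cell_deg n (\<lambda>_. 0) ?R \<alpha>"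
    unfolding cube_tens[OF assms(1)] by (rule tens_comp0[OF assms(2) gop_i gop_W]) auto
  moreover have "incl_cube n k (W_cube n 0 \<alpha>) = tens cell_deg n (\<lambda>_. 0) ?R \<alpha>"
    unfolding cube_tens[OF assms(1)] cube_tens(1)[OF le0]
    by (rule tens_comp0[OF assms(2) gop_W gop_incl]) (auto simp: W_i_weld)
  ultimately show ?thesis by simp
qed

lemma gop_p_I: "gop pos_deg cell_deg 0 (\<lambda>f. p_weld (I_star f)) P1 CS0"
proof (rule gopI[OF wf_P1 wf_cell], goal_cases)
  case (1 J c)
  show ?case by (rule Ker_to_cells[OF 1], erule cells_cases; hypsubst; simp only: p_weld.simps I_star.simps; intro Ker_intros)
next
  case (2 f y) then show ?case by (cases y) (auto simp: csupp_cell cells_def)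
next
  case (3 f p q) then show ?case by (simp add: cell_space_def)
next
  case (4 f g y) then show ?case by (cases y) auto
qed

lemma p_I_incl_cube:
  assumes "k \<le> n" "good n (pos_spaces 0) \<omega>"
  shows "p_cube n k (I_cube n k (incl_cube n k \<omega>)) = I_cube n 0 \<omega>"
proof -
  \<comment> \<open>Three products are composed in two steps: projection and integration are first
    merged into one operator per slot, and this is then composed with the restriction.\<close>
  let ?R = "at_pos k (\<lambda>f. p_weld (I_star f)) I_plain"
  have R: "gop pos_deg cell_deg 0 (?R i) (pos_spaces k i) (cell_spaces 0 i)" for i
    by (simp add: gop_p_I gop_I_plain)
  have "p_cube n k (I_cube n k (incl_cube n k \<omega>)) = tens pos_deg n (\<lambda>_. 0) ?R (incl_cube n k \<omega>)"
    unfolding cube_tens[OF assms(1)]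
    by (rule tens_comp0[OF good_tens[OF assms(2) gop_incl] gop_I gop_p]) auto
  also have "\<dots> = I_cube n 0 \<omega>"
    unfolding cube_tens[OF assms(1)] cube_tens(2)[OF le0]
    by (rule tens_comp0[OF assms(2) gop_incl R]) (auto simp: p_I_res)
  finally show ?thesis .
qed

section \<open>The Dupont homotopy\<close>

text \<open>The words \<open>\<epsilon>\<close> in the Dupont homotopy skip slot \<open>j\<close>.
  Inserting a letter there gives exponents of \<open>WI\<close> for all slots, 0 standing for the
  identity.\<close>

definition ins :: "nat \<Rightarrow> 'a \<Rightarrow> 'a list \<Rightarrow> 'a list" where
  "ins j b \<epsilon> = take j \<epsilon> @ b # drop j \<epsilon>"

definition bits :: "nat \<Rightarrow> nat list set" where
  "bits m = {\<epsilon>. set \<epsilon> \<subseteq> {0, 1} \<and> length \<epsilon> = m}"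

lemma finite_bits: "finite (bits m)"
  unfolding bits_def by (rule finite_lists_length_eq) simp

lemma ins_nth:
  assumes "j \<le> length \<epsilon>"
  shows "ins j b \<epsilon> ! i = (if i < j then \<epsilon> ! i else if i = j then b else \<epsilon> ! (i - 1))"
proof (cases i j rule: linorder_cases)
  case greater
  then obtain m where m: "i = Suc (j + m)" using less_imp_Suc_add by blast
  have "ins j b \<epsilon> ! i = (b # drop j \<epsilon>) ! (i - length (take j \<epsilon>))"
    unfolding ins_def by (subst nth_append) (use greater in simp)
  also have "\<dots> = drop j \<epsilon> ! m" using assms by (simp add: m min_absorb2)
  also have "\<dots> = \<epsilon> ! (j + m)" by (rule nth_drop[OF assms])
  finally show ?thesis by (simp add: m)
qed (use assms in \<open>simp_all add: ins_def nth_append\<close>)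

text \<open>A shorter word with an insertion position is the same as a word of length
  \<open>n\<close> with a marked occurrence of \<open>b\<close>, so each long word is counted once
  for every \<open>b\<close> in it.\<close>

lemma sum_ins:
  fixes Q :: "nat list \<Rightarrow> real" and w :: "nat \<Rightarrow> real"
  assumes n: "1 \<le> n" and b: "b \<in> {0, 1}"
  shows "(\<Sum>\<epsilon>\<in>bits (n - 1). \<Sum>j<n. w (sum_list \<epsilon>) * Q (ins j b \<epsilon>)) =
    (\<Sum>\<delta>\<in>bits n. real (card {j. j < n \<and> \<delta> ! j = b}) * (w (sum_list \<delta> - b) * Q \<delta>))"
proof -
  have "(\<Sum>\<epsilon>\<in>bits (n - 1). \<Sum>j<n. w (sum_list \<epsilon>) * Q (ins j b \<epsilon>)) =
      (\<Sum>(\<epsilon>, j)\<in>bits (n - 1) \<times> {..<n}. w (sum_list \<epsilon>) * Q (ins j b \<epsilon>))"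
    by (rule sum.cartesian_product)
  also have "\<dots> = (\<Sum>(\<delta>, j)\<in>(SIGMA \<delta>:bits n. {j. j < n \<and> \<delta> ! j = b}). w (sum_list \<delta> - b) * Q \<delta>)"
  proof (rule sum.reindex_bij_witness[where i = "\<lambda>(\<delta>, j). (take j \<delta> @ drop (Suc j) \<delta>, j)" and j = "\<lambda>(\<epsilon>, j). (ins j b \<epsilon>, j)"])
    fix a assume "a \<in> bits (n - 1) \<times> {..<n}"
    then obtain \<epsilon> j where a: "a = (\<epsilon>, j)" "\<epsilon> \<in> bits (n - 1)" "j < n" by auto
    then have len: "length \<epsilon> = n - 1" "j \<le> length \<epsilon>" by (auto simp: bits_def)
    show "(case case a of (\<epsilon>, j) \<Rightarrow> (ins j b \<epsilon>, j) of (\<delta>, j) \<Rightarrow> (take j \<delta> @ drop (Suc j) \<delta>, j)) = a"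
      using len by (simp add: a ins_def)
    have "set (ins j b \<epsilon>) \<subseteq> {0, 1}"
      using a(2) b set_take_subset[of j \<epsilon>] set_drop_subset[of j \<epsilon>] unfolding ins_def bits_def by auto
    then show "(case a of (\<epsilon>, j) \<Rightarrow> (ins j b \<epsilon>, j)) \<in> (SIGMA \<delta>:bits n. {j. j < n \<and> \<delta> ! j = b})"
    proof -
      have "length (ins j b \<epsilon>) = n" "ins j b \<epsilon> ! j = b" using len n a(3) by (simp_all add: ins_def nth_append)
      then show ?thesis using \<open>set (ins j b \<epsilon>) \<subseteq> {0, 1}\<close> a(3) by (simp add: a bits_def)
    qed
    have "sum_list (ins j b \<epsilon>) = sum_list (take j \<epsilon> @ drop j \<epsilon>) + b" unfolding ins_def sum_list_append by simp
    then show "(case case a of (\<epsilon>, j) \<Rightarrow> (ins j b \<epsilon>, j) of (\<delta>, j) \<Rightarrow> w (sum_list \<delta> - b) * Q \<delta>) =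
        (case a of (\<epsilon>, j) \<Rightarrow> w (sum_list \<epsilon>) * Q (ins j b \<epsilon>))"
      by (simp add: a)
  next
    fix a assume "a \<in> (SIGMA \<delta>:bits n. {j. j < n \<and> \<delta> ! j = b})"
    then obtain \<delta> j where a: "a = (\<delta>, j)" "\<delta> \<in> bits n" "j < n" "\<delta> ! j = b" by auto
    then have len: "length \<delta> = n" by (simp add: bits_def)
    have "take j \<delta> @ b # drop (Suc j) \<delta> = \<delta>"
      using id_take_nth_drop[of j \<delta>] a len by simp
    then show "(case case a of (\<delta>, j) \<Rightarrow> (take j \<delta> @ drop (Suc j) \<delta>, j) of (\<epsilon>, j) \<Rightarrow> (ins j b \<epsilon>, j)) = a"
      using a(3) len by (simp add: a ins_def)
    have "set (take j \<delta> @ drop (Suc j) \<delta>) \<subseteq> {0, 1}"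
      using a(2) set_take_subset[of j \<delta>] set_drop_subset[of "Suc j" \<delta>] unfolding bits_def by auto
    then show "(case a of (\<delta>, j) \<Rightarrow> (take j \<delta> @ drop (Suc j) \<delta>, j)) \<in> bits (n - 1) \<times> {..<n}"
    proof -
      have "length (take j \<delta> @ drop (Suc j) \<delta>) = n - 1" using a(3) len by simp
      then show ?thesis using \<open>set (take j \<delta> @ drop (Suc j) \<delta>) \<subseteq> {0, 1}\<close> a(3) by (simp only: a prod.case bits_def mem_Sigma_iff mem_Collect_eq lessThan_iff simp_thms)
    qed
  qed
  also have "\<dots> = (\<Sum>\<delta>\<in>bits n. \<Sum>j\<in>{j. j < n \<and> \<delta> ! j = b}. w (sum_list \<delta> - b) * Q \<delta>)"
    by (subst sum.Sigma) (auto simp: finite_bits)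
  finally show ?thesis by simp
qed

lemma bits_count:
  assumes "\<delta> \<in> bits n"
  shows "card {j. j < n \<and> \<delta> ! j = 1} = sum_list \<delta>" "card {j. j < n \<and> \<delta> ! j = 0} = n - sum_list \<delta>" "sum_list \<delta> \<le> n"
proof -
  have b: "\<delta> ! j \<in> {0, 1}" if "j < n" for j
    using assms that nth_mem[of j \<delta>] unfolding bits_def by blast
  have len: "length \<delta> = n" using assms by (simp add: bits_def)
  have "sum_list \<delta> = (\<Sum>j<n. \<delta> ! j)" by (simp add: sum_list_sum_nth len atLeast0LessThan)
  also have "\<dots> = (\<Sum>j<n. if \<delta> ! j = 1 then 1 else 0)" using b by (intro sum.cong) auto
  also have "\<dots> = card {j. j < n \<and> \<delta> ! j = 1}" by (simp add: sum.If_cases lessThan_def Int_def)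
  finally show 1: "card {j. j < n \<and> \<delta> ! j = 1} = sum_list \<delta>" by simp
  have "{j. j < n \<and> \<delta> ! j = 0} = {..<n} - {j. j < n \<and> \<delta> ! j = 1}" using b by auto
  then have "card {j. j < n \<and> \<delta> ! j = 0} = card {..<n} - card {j. j < n \<and> \<delta> ! j = 1}"
    by (simp only:) (rule card_Diff_subset, auto)
  then show "card {j. j < n \<and> \<delta> ! j = 0} = n - sum_list \<delta>" using 1 by simp
  have "card {j. j < n \<and> \<delta> ! j = 1} \<le> card {..<n}" by (rule card_mono) auto
  then show "sum_list \<delta> \<le> n" using 1 by simp
qed

text \<open>A word \<open>\<delta>\<close> with \<open>r\<close> ones arises by inserting a \<open>0\<close> in \<open>n - r\<close> ways with weight \<open>C\<^bsub>r,n\<^esub>\<close> and by inserting a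
  \<open>1\<close> in \<open>r\<close> ways with weight \<open>C\<^bsub>r-1,n\<^esub>\<close>; since \<open>(n - r) C\<^bsub>r,n\<^esub> = r C\<^bsub>r-1,n\<^esub>\<close> for \<open>0 < r < n\<close>, only the constant words
  survive.\<close>

lemma sum_telescope_bits:
  fixes Q :: "nat list \<Rightarrow> real"
  assumes n: "1 \<le> n"
  shows "(\<Sum>\<epsilon>\<in>bits (n - 1). \<Sum>j<n. C_coeff (sum_list \<epsilon>) n * (Q (ins j 0 \<epsilon>) - Q (ins j 1 \<epsilon>))) =
    fact n * (Q (replicate n 0) - Q (replicate n 1))"
proof -
  \<comment> \<open>The truncated subtractions are harmless: \<open>m - 1\<close> at
    \<open>m = 0\<close> is multiplied by \<open>real m = 0\<close>, and \<open>n - 1 - m\<close> at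
    \<open>m = n\<close> by \<open>real (n - m) = 0\<close>.\<close>
  have c: "real (n - m) * (C_coeff m n * q) - real m * (C_coeff (m - 1) n * q) =
      (if m = 0 then fact n * q else 0) - (if m = n then fact n * q else 0)" if mn: "m \<le> n" for m q
  proof -
    consider "m = 0" | "m = n" "m \<noteq> 0" | "0 < m" "m < n" using mn le_neq_implies_less by blast
    then show ?thesis
    proof cases
      case 1
      then show ?thesis using n fact_reduce[of n, where 'a = real] by (simp add: C_coeff_def)
    next
      case 2
      then show ?thesis using n fact_reduce[of n, where 'a = real] by (simp add: C_coeff_def)
    next
      case 3
      have "real (n - m) * fact (n - 1 - m) = fact (n - m)" "real m * fact (m - 1) = fact m"
        using 3 fact_reduce[of "n - m", where 'a = real] fact_reduce[of m, where 'a = real] by simp_all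
      moreover have "n - 1 - (m - 1) = n - m" using 3 by simp
      moreover have "real (n - m) * C_coeff m n = fact m * (real (n - m) * fact (n - 1 - m))"
        "real m * C_coeff (m - 1) n = (real m * fact (m - 1)) * fact (n - 1 - (m - 1))"
        by (simp_all add: C_coeff_def)
      ultimately have "real (n - m) * C_coeff m n = real m * C_coeff (m - 1) n"
        by (simp only:)
      then show ?thesis using 3 by (simp flip: mult.assoc)
    qed
  qed
  have z: "\<delta> = replicate n 0 \<longleftrightarrow> sum_list \<delta> = 0" and o: "\<delta> = replicate n 1 \<longleftrightarrow> sum_list \<delta> = n" if d: "\<delta> \<in> bits n" for \<delta>
  proof -
    have len: "length \<delta> = n" and b: "set \<delta> \<subseteq> {0, 1}" using d by (auto simp: bits_def)
    show "\<delta> = replicate n 0 \<longleftrightarrow> sum_list \<delta> = 0"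
    proof
      assume "sum_list \<delta> = 0"
      then have "x = 0" if "x \<in> set \<delta>" for x using that by simp
      then show "\<delta> = replicate n 0" using len by (intro replicate_eqI) auto
    qed (simp add: sum_list_replicate)
    show "\<delta> = replicate n 1 \<longleftrightarrow> sum_list \<delta> = n"
    proof
      assume "sum_list \<delta> = n"
      then have "card {j. j < n \<and> \<delta> ! j = 1} = card {..<n}" using bits_count(1)[OF d] by simp
      then have "{j. j < n \<and> \<delta> ! j = 1} = {..<n}" by (intro card_subset_eq) auto
      then show "\<delta> = replicate n 1" using len by (intro nth_equalityI) auto
    qed (simp add: sum_list_replicate)
  qed
  have mem: "replicate n 0 \<in> bits n" "replicate n 1 \<in> bits n" by (auto simp: bits_def)
  have "(\<Sum>\<epsilon>\<in>bits (n - 1). \<Sum>j<n. C_coeff (sum_list \<epsilon>) n * (Q (ins j 0 \<epsilon>) - Q (ins j 1 \<epsilon>))) =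
    (\<Sum>\<epsilon>\<in>bits (n - 1). \<Sum>j<n. C_coeff (sum_list \<epsilon>) n * Q (ins j 0 \<epsilon>)) - (\<Sum>\<epsilon>\<in>bits (n - 1). \<Sum>j<n. C_coeff (sum_list \<epsilon>) n * Q (ins j 1 \<epsilon>))"
    by (simp add: right_diff_distrib sum_subtractf)
  also have "\<dots> = (\<Sum>\<delta>\<in>bits n. real (card {j. j < n \<and> \<delta> ! j = 0}) * (C_coeff (sum_list \<delta> - 0) n * Q \<delta>)
      - real (card {j. j < n \<and> \<delta> ! j = 1}) * (C_coeff (sum_list \<delta> - 1) n * Q \<delta>))"
    unfolding sum_subtractf using sum_ins[OF n, of 0 "\<lambda>m. C_coeff m n" Q] sum_ins[OF n, of 1 "\<lambda>m. C_coeff m n" Q] by simp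
  also have "\<dots> = (\<Sum>\<delta>\<in>bits n. (if \<delta> = replicate n 0 then fact n * Q \<delta> else 0) - (if \<delta> = replicate n 1 then fact n * Q \<delta> else 0))"
  proof (rule sum.cong[OF refl])
    fix \<delta> assume d: "\<delta> \<in> bits n"
    show "real (card {j. j < n \<and> \<delta> ! j = 0}) * (C_coeff (sum_list \<delta> - 0) n * Q \<delta>)
      - real (card {j. j < n \<and> \<delta> ! j = 1}) * (C_coeff (sum_list \<delta> - 1) n * Q \<delta>) =
      (if \<delta> = replicate n 0 then fact n * Q \<delta> else 0) - (if \<delta> = replicate n 1 then fact n * Q \<delta> else 0)"
      unfolding bits_count(1,2)[OF d] z[OF d] o[OF d] using c[OF bits_count(3)[OF d]] by simp
  qed
  also have "\<dots> = fact n * Q (replicate n 0) - fact n * Q (replicate n 1)"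
    unfolding sum_subtractf using mem by (simp add: sum.delta finite_bits)
  finally show ?thesis by (simp add: right_diff_distrib)
qed

section \<open>The Dupont homotopy as a weighted sum of tensor products\<close>

abbreviation WI_at :: "nat \<Rightarrow> nat \<Rightarrow> (pos \<Rightarrow> real) \<Rightarrow> (pos \<Rightarrow> real)" where
  "WI_at k \<equiv> at_pos k (W_star \<circ> I_star) (W_plain \<circ> I_plain)"

abbreviation s_at :: "nat \<Rightarrow> nat \<Rightarrow> (pos \<Rightarrow> real) \<Rightarrow> (pos \<Rightarrow> real)" where
  "s_at k \<equiv> at_pos k s_star s_plain"

text \<open>The index shift omits slot \<open>j\<close>; the value at \<open>i = j\<close> is a
  placeholder that an update always overwrites.\<close>

definition WI_pow :: "nat \<Rightarrow> nat list \<Rightarrow> nat \<Rightarrow> nat \<Rightarrow> (pos \<Rightarrow> real) \<Rightarrow> (pos \<Rightarrow> real)" where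
  "WI_pow k \<epsilon> j i = WI_at k i ^^ (\<epsilon> ! (if i < j then i else i - 1))"

definition s_term :: "nat \<Rightarrow> nat \<Rightarrow> nat list \<Rightarrow> nat \<Rightarrow> (pos list \<Rightarrow> real) \<Rightarrow> (pos list \<Rightarrow> real)" where
  "s_term n k \<epsilon> j = tens pos_deg n ((\<lambda>_. 0)(j := -1)) ((WI_pow k \<epsilon> j)(j := s_at k j))"

lemma s_cube_eq:
  "s_cube n k \<omega> = (\<lambda>xs. \<Sum>(\<epsilon>, j)\<in>bits (n - 1) \<times> {..<n}. C_coeff (sum_list \<epsilon>) n / fact n * s_term n k \<epsilon> j \<omega> xs)"
proof
  fix xs
  have "tensor pos_deg (map (s_factor k \<epsilon> j) [0..<n]) = s_term n k \<epsilon> j" for \<epsilon> j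
    unfolding s_term_def tens_def
    by (rule arg_cong[where f = "tensor pos_deg"]) (auto simp: s_factor_def WI_pow_def Let_def)
  then show "s_cube n k \<omega> xs = (\<Sum>(\<epsilon>, j)\<in>bits (n - 1) \<times> {..<n}. C_coeff (sum_list \<epsilon>) n / fact n * s_term n k \<epsilon> j \<omega> xs)"
    unfolding s_cube_def bits_def[symmetric] sum.cartesian_product[symmetric]
    by (simp add: scaleR_fun_def sum_fun_apply sum_distrib_left)
qed

lemma bits_nth: "\<epsilon> \<in> bits m \<Longrightarrow> i < m \<Longrightarrow> \<epsilon> ! i = 0 \<or> \<epsilon> ! i = 1"
  using nth_mem[of i \<epsilon>] unfolding bits_def by blast

lemma gop_WI_at: "gop pos_deg pos_deg 0 (WI_at k i) (pos_spaces k i) (pos_spaces k i)"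
  by (simp add: gop_WI_star gop_WI_plain)

lemma gop_s_at: "gop pos_deg pos_deg (-1) (s_at k i) (pos_spaces k i) (pos_spaces k i)"
  by (simp add: gop_s_star gop_s_plain)

lemma wf_pos_spaces: "wf_space pos_deg (pos_spaces k i)"
  by (simp add: wf_P0 wf_P1)

lemma WI_pow_cases:
  assumes "\<epsilon> \<in> bits (n - 1)" "i < n" "j < n" "i \<noteq> j"
  shows "WI_pow k \<epsilon> j i = id \<or> WI_pow k \<epsilon> j i = WI_at k i"
proof -
  have "(if i < j then i else i - 1) < n - 1" using assms(2-4) by auto
  from bits_nth[OF assms(1) this] show ?thesis unfolding WI_pow_def by auto
qed

lemma gop_WI_pow:
  assumes "\<epsilon> \<in> bits (n - 1)" "i < n" "j < n" "i \<noteq> j"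
  shows "gop pos_deg pos_deg 0 (WI_pow k \<epsilon> j i) (pos_spaces k i) (pos_spaces k i)"
  using WI_pow_cases[OF assms, of k]
proof (elim disjE)
  assume eq: "WI_pow k \<epsilon> j i = id"
  show ?thesis unfolding eq by (rule gop_id[OF wf_pos_spaces])
next
  assume eq: "WI_pow k \<epsilon> j i = WI_at k i"
  show ?thesis unfolding eq by (rule gop_WI_at)
qed

lemma dF_WI_pow:
  assumes "\<epsilon> \<in> bits (n - 1)" "i < n" "j < n" "i \<noteq> j" "fn (pos_spaces k i) f"
  shows "dF (WI_pow k \<epsilon> j i f) y = WI_pow k \<epsilon> j i (dF f) y"
proof -
  have "dF (WI_at k i f) y = WI_at k i (dF f) y"
    using assms(5) dF_WI_star[of f y] dF_WI_plain[of f y] by (cases "i < k") simp_all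
  with WI_pow_cases[OF assms(1-4), of k] show ?thesis by (elim disjE) simp_all
qed

lemma good_map_s:
  assumes "k \<le> n" shows "good_map n (pos_spaces k) pos_deg (pos_spaces k) pos_deg (-1) (s_cube n k)"
proof (rule good_map_sum[where A = "bits (n - 1) \<times> {..<n}" and F = "\<lambda>(\<epsilon>, j). s_term n k \<epsilon> j" and c = "\<lambda>(\<epsilon>, j). C_coeff (sum_list \<epsilon>) n / fact n"])
  show "finite (bits (n - 1) \<times> {..<n})" by (simp add: finite_bits)
  fix a assume "a \<in> bits (n - 1) \<times> {..<n}"
  then obtain \<epsilon> j where a: "a = (\<epsilon>, j)" "\<epsilon> \<in> bits (n - 1)" "j < n" by auto
  have "good_map n (pos_spaces k) pos_deg (pos_spaces k) pos_deg (-1) (s_term n k \<epsilon> j)"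
    unfolding s_term_def
  proof (rule good_map_tens)
    fix i assume i: "i < n"
    show "gop pos_deg pos_deg (((\<lambda>_. 0)(j := -1)) i) (((WI_pow k \<epsilon> j)(j := s_at k j)) i) (pos_spaces k i) (pos_spaces k i)"
      using gop_WI_pow[OF a(2) i a(3)] gop_s_at[where k = k and i = j] by (cases "i = j") simp_all
  next
    show "-1 = (\<Sum>i<n. ((\<lambda>_. 0)(j := -1)) i)" using a(3) by (simp add: fun_upd_def sum.delta)
  qed
  then show "good_map n (pos_spaces k) pos_deg (pos_spaces k) pos_deg (-1) (case a of (\<epsilon>, j) \<Rightarrow> s_term n k \<epsilon> j)" by (simp add: a)
qed (simp_all add: s_cube_eq split_beta)

lemma s_homotopy:
  assumes "1 \<le> n" "k \<le> n" and g: "good n (pos_spaces k) \<omega>"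
  shows "tensor_derivation pos_deg n (\<lambda>_. dF) (s_cube n k \<omega>) xs + s_cube n k (tensor_derivation pos_deg n (\<lambda>_. dF) \<omega>) xs =
    \<omega> xs - W_cube n k (I_cube n k \<omega>) xs"
proof -
  let ?D = "tensor_derivation pos_deg n (\<lambda>_. dF)"
  let ?A = "bits (n - 1) \<times> {..<n}"
  let ?c = "\<lambda>(\<epsilon>, j). C_coeff (sum_list \<epsilon>) n / fact n" and ?s = "\<lambda>(\<epsilon>, j). s_term n k \<epsilon> j"
  define Q where "Q \<delta> = tens pos_deg n (\<lambda>_. 0) (\<lambda>i. WI_at k i ^^ (\<delta> ! i)) \<omega> xs" for \<delta>
  have st: "?D (s_term n k \<epsilon> j \<omega>) xs + s_term n k \<epsilon> j (?D \<omega>) xs = Q (ins j 0 \<epsilon>) - Q (ins j 1 \<epsilon>)"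
    if e: "\<epsilon> \<in> bits (n - 1)" and j: "j < n" for \<epsilon> j
  proof -
    have con: "contraction pos_deg (pos_spaces k j) dF (s_at k j) (WI_at k j)"
      using contraction_s_star contraction_s_plain by simp
    \<comment> \<open>The exponents 0 and 1 in slot \<open>j\<close> are the identity and
      \<open>WI\<close>, the two endpoints in \<open>homotopy_tens\<close>, so its right side is a
      difference of two inserted words.\<close>
    have T: "(WI_pow k \<epsilon> j)(j := WI_at k j ^^ b) = (\<lambda>i. WI_at k i ^^ (ins j b \<epsilon> ! i))" for b
    proof
      fix i
      have "length \<epsilon> = n - 1" using e by (simp add: bits_def)
      then show "((WI_pow k \<epsilon> j)(j := WI_at k j ^^ b)) i = WI_at k i ^^ (ins j b \<epsilon> ! i)"
        using j ins_nth[of j \<epsilon> b i] by (auto simp: WI_pow_def)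
    qed
    have "?D (s_term n k \<epsilon> j \<omega>) xs + s_term n k \<epsilon> j (?D \<omega>) xs =
        tens pos_deg n (\<lambda>_. 0) ((WI_pow k \<epsilon> j)(j := id)) \<omega> xs - tens pos_deg n (\<lambda>_. 0) ((WI_pow k \<epsilon> j)(j := WI_at k j)) \<omega> xs"
      unfolding s_term_def
      by (rule homotopy_tens[where V = "pos_spaces k" and d = "\<lambda>_. dF", OF j g _ gop_s_at gop_WI_at gop_dF _ con])
        (rule gop_WI_pow[OF e _ j] dF_WI_pow[OF e _ j]; assumption)+
    then show ?thesis using T[of 0] T[of 1] by (simp add: Q_def)
  qed
  have good_s: "good n (pos_spaces k) (?s a \<omega>)" if aA: "a \<in> ?A" for a
  proof -
    obtain \<epsilon> j where a: "a = (\<epsilon>, j)" "\<epsilon> \<in> bits (n - 1)" "j < n" using aA by auto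
    have "good n (pos_spaces k) (s_term n k \<epsilon> j \<omega>)"
      unfolding s_term_def
    proof (rule good_tens[OF g])
      fix i assume i: "i < n"
      show "gop pos_deg pos_deg (((\<lambda>_. 0)(j := -1)) i) (((WI_pow k \<epsilon> j)(j := s_at k j)) i) (pos_spaces k i) (pos_spaces k i)"
        using gop_WI_pow[OF a(2) i a(3)] gop_s_at[where k = k and i = j] by (cases "i = j") simp_all
    qed
    then show ?thesis by (simp add: a)
  qed
  have "?D (\<lambda>xs. \<Sum>a\<in>?A. ?c a * ?s a \<omega> xs) = (\<lambda>ys. \<Sum>a\<in>?A. ?c a * ?D (?s a \<omega>) ys)"
    by (rule derivation_sum[OF _ good_s gop_dF]) (simp_all add: finite_bits)
  then have "?D (s_cube n k \<omega>) xs + s_cube n k (?D \<omega>) xs = (\<Sum>a\<in>?A. ?c a * (?D (?s a \<omega>) xs + ?s a (?D \<omega>) xs))"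
    unfolding s_cube_eq by (simp add: split_beta distrib_left sum.distrib)
  also have "\<dots> = (\<Sum>(\<epsilon>, j)\<in>?A. (1 / fact n) * (C_coeff (sum_list \<epsilon>) n * (Q (ins j 0 \<epsilon>) - Q (ins j 1 \<epsilon>))))"
    by (rule sum.cong) (auto simp: st)
  also have "\<dots> = (1 / fact n) * (\<Sum>\<epsilon>\<in>bits (n - 1). \<Sum>j<n. C_coeff (sum_list \<epsilon>) n * (Q (ins j 0 \<epsilon>) - Q (ins j 1 \<epsilon>)))"
    unfolding sum.cartesian_product[symmetric] by (simp only: sum_distrib_left)
  also have "\<dots> = Q (replicate n 0) - Q (replicate n 1)"
    unfolding sum_telescope_bits[OF assms(1)] by simp
  also have "Q (replicate n 0) = \<omega> xs"
  proof -
    have "Q (replicate n 0) = tens pos_deg n (\<lambda>_. 0) (\<lambda>_. id) \<omega> xs"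
      unfolding Q_def by (rule fun_cong[OF fun_cong[OF tens_cong]]) simp_all
    then show ?thesis using tens_id_good[OF g] by simp
  qed
  also have "Q (replicate n 1) = W_cube n k (I_cube n k \<omega>) xs"
    unfolding Q_def W_I_cube[OF assms(2) g] by (rule fun_cong[OF fun_cong[OF tens_cong]]) simp_all
  finally show ?thesis .
qed

section \<open>Permutations of tensor factors\<close>

lemma tensor_replicate_id: "length xs = m \<Longrightarrow> tensor dg (replicate m (0, id)) \<phi> xs = \<phi> xs"
  by (induction xs arbitrary: \<phi> m) (auto simp: sum_list_replicate)

text \<open>\<open>tau\<close> is not a tensor product of maps, so its compatibility with the
  differential is checked in coordinates. The entries before slot \<open>j\<close> are unchanged by
  the map, hence the sign can be read off from \<open>ys\<close>.\<close>

lemma tensor_single: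
  "length ys = j + 1 + m \<Longrightarrow> tensor dg (replicate j (0, id) @ [(1, D)] @ replicate m (0, id)) \<phi> ys =
     sgn1 (\<Sum>i<j. dg (ys ! i)) * D (\<lambda>x. \<phi> (ys[j := x])) (ys ! j)"
proof (induction j arbitrary: \<phi> ys)
  case 0
  then obtain y ys' where ys: "ys = y # ys'" "length ys' = m" by (cases ys) auto
  have "tensor dg (replicate m (0, id)) \<psi> ys' = \<psi> ys'" for \<psi> by (rule tensor_replicate_id[OF ys(2)])
  then show ?case by (simp add: ys sum_list_replicate del: id_apply)
next
  case (Suc j)
  then obtain y ys' where ys: "ys = y # ys'" "length ys' = j + 1 + m" by (cases ys) auto
  have "tensor dg (replicate (Suc j) (0, id) @ [(1, D)] @ replicate m (0, id)) \<phi> ys =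
      sgn1 (dg y) * tensor dg (replicate j (0, id) @ [(1, D)] @ replicate m (0, id)) (\<lambda>xs. \<phi> (y # xs)) ys'"
    by (simp add: ys sum_list_replicate sgn1_def)
  also have "\<dots> = sgn1 (dg y) * (sgn1 (\<Sum>i<j. dg (ys' ! i)) * D (\<lambda>x. \<phi> (y # ys'[j := x])) (ys' ! j))"
    by (subst Suc.IH[OF ys(2)]) simp
  also have "\<dots> = sgn1 (\<Sum>i<Suc j. dg (ys ! i)) * D (\<lambda>x. \<phi> (ys[Suc j := x])) (ys ! Suc j)"
    unfolding sum.lessThan_Suc_shift by (simp add: ys sgn1_add)
  finally show ?case .
qed

lemma dd_apply:
  assumes "j < n" "length ys = n"
  shows "dd dg n D j \<phi> ys = sgn1 (\<Sum>i<j. dg (ys ! i)) * D j (\<lambda>x. \<phi> (ys[j := x])) (ys ! j)"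
  using tensor_single[of ys j "n - 1 - j" dg "D j" \<phi>] assms unfolding dd_def tens_def list_single[OF assms(1), symmetric] by simp

lemma koszul_sign_sum:
  "koszul_sign dg \<sigma> xs = sgn1 (\<Sum>i<length xs. \<Sum>l<length xs. if i < l \<and> \<sigma> l < \<sigma> i then dg (xs ! i) * dg (xs ! l) else 0)"
proof -
  let ?n = "length xs"
  have "(\<Sum>i<?n. \<Sum>l<?n. if i < l \<and> \<sigma> l < \<sigma> i then dg (xs ! i) * dg (xs ! l) else 0) =
      (\<Sum>(i, l)\<in>{..<?n} \<times> {..<?n}. if i < l \<and> \<sigma> l < \<sigma> i then dg (xs ! i) * dg (xs ! l) else 0)"
    by (rule sum.cartesian_product)
  also have "\<dots> = (\<Sum>(i, l)\<in>{(i, l). i < l \<and> l < ?n \<and> \<sigma> l < \<sigma> i}. dg (xs ! i) * dg (xs ! l))"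
    by (rule sum.mono_neutral_cong_right) (auto split: if_splits)
  finally show ?thesis by (simp add: koszul_sign_def sgn1_def)
qed

lemma koszul_sign_cong:
  "length xs = length ys \<Longrightarrow> (\<And>i. i < length xs \<Longrightarrow> dg (xs ! i) = dg (ys ! i)) \<Longrightarrow> koszul_sign dg \<sigma> xs = koszul_sign dg \<sigma> ys"
  unfolding koszul_sign_sum by (intro arg_cong[where f = sgn1] sum.cong) auto

text \<open>Lowering one degree by 1 changes the exponent, a sum of products over inversions, by the
  degrees of the entries inverted with position \<open>j\<close>.\<close>

lemma koszul_sign_update:
  assumes "length zs = n" "j < n" "dg (zs ! j) = dg x + 1"
  shows "koszul_sign dg \<sigma> (zs[j := x]) = koszul_sign dg \<sigma> zs *
    sgn1 (\<Sum>i<n. if j < i \<and> \<sigma> i < \<sigma> j \<or> i < j \<and> \<sigma> j < \<sigma> i then dg (zs ! i) else 0)"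
proof -
  define f where "f i = dg (zs ! i)" for i
  define g where "g i = dg (zs[j := x] ! i)" for i
  define P where "P i l \<longleftrightarrow> i < l \<and> \<sigma> l < \<sigma> i" for i l
  have fg: "f i = g i + (if i = j then 1 else 0)" if "i < n" for i
    using that assms by (auto simp: f_def g_def)
  have "(\<Sum>i<n. \<Sum>l<n. if P i l then f i * f l else 0) =
      (\<Sum>i<n. \<Sum>l<n. (if P i l then g i * g l else 0) + ((if i = j then if P j l then f l else 0 else 0) + (if l = j then if P i j then f i else 0 else 0)))"
  proof (intro sum.cong refl)
    fix i l assume "i \<in> {..<n}" "l \<in> {..<n}"
    then have "i < n" "l < n" by auto
    then show "(if P i l then f i * f l else 0) = (if P i l then g i * g l else 0) + ((if i = j then if P j l then f l else 0 else 0) + (if l = j then if P i j then f i else 0 else 0))"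
      unfolding fg[OF \<open>i < n\<close>] fg[OF \<open>l < n\<close>] by (auto simp: P_def algebra_simps)
  qed
  also have "\<dots> = (\<Sum>i<n. \<Sum>l<n. if P i l then g i * g l else 0) +
      ((\<Sum>i<n. \<Sum>l<n. if i = j then if P j l then f l else 0 else 0) + (\<Sum>i<n. \<Sum>l<n. if l = j then if P i j then f i else 0 else 0))"
    by (simp only: sum.distrib)
  also have "(\<Sum>i<n. \<Sum>l<n. if i = j then if P j l then f l else 0 else 0) = (\<Sum>l<n. if P j l then f l else 0)"
    using assms(2) by (subst sum.swap) (simp add: sum.delta)
  also have "(\<Sum>i<n. \<Sum>l<n. if l = j then if P i j then f i else 0 else 0) = (\<Sum>i<n. if P i j then f i else 0)"
    using assms(2) by (simp add: sum.delta)
  also have "(\<Sum>l<n. if P j l then f l else 0) + (\<Sum>i<n. if P i j then f i else 0) =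
      (\<Sum>i<n. if j < i \<and> \<sigma> i < \<sigma> j \<or> i < j \<and> \<sigma> j < \<sigma> i then f i else 0)"
    unfolding sum.distrib[symmetric] by (rule sum.cong) (auto simp: P_def)
  finally have *: "(\<Sum>i<n. \<Sum>l<n. if P i l then f i * f l else 0) = (\<Sum>i<n. \<Sum>l<n. if P i l then g i * g l else 0) +
      (\<Sum>i<n. if j < i \<and> \<sigma> i < \<sigma> j \<or> i < j \<and> \<sigma> j < \<sigma> i then f i else 0)" .
  have "koszul_sign dg \<sigma> zs = sgn1 (\<Sum>i<n. \<Sum>l<n. if P i l then f i * f l else 0)"
    "koszul_sign dg \<sigma> (zs[j := x]) = sgn1 (\<Sum>i<n. \<Sum>l<n. if P i l then g i * g l else 0)"
    unfolding koszul_sign_sum by (simp_all only: assms(1) P_def f_def g_def length_list_update)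
  then show ?thesis unfolding * f_def[symmetric] by (simp add: sgn1_add mult.assoc)
qed

lemma permutes_le: "\<sigma> permutes {..<k} \<Longrightarrow> k \<le> n \<Longrightarrow> \<sigma> permutes {..<n}" for \<sigma> :: "nat \<Rightarrow> nat"
  by (rule permutes_subset) auto

lemma permute_list_update:
  assumes "\<sigma> permutes {..<length ys}" "j < length ys"
  shows "permute_list \<sigma> (ys[\<sigma> j := x]) = (permute_list \<sigma> ys)[j := x]"
proof (rule nth_equalityI)
  fix i assume "i < length (permute_list \<sigma> (ys[\<sigma> j := x]))"
  then have i: "i < length ys" by simp
  have "\<sigma> i < length ys" "\<sigma> j < length ys" using permutes_in_image[OF assms(1)] i assms(2) by auto
  moreover have "\<sigma> j = \<sigma> i \<longleftrightarrow> j = i" using permutes_inj[OF assms(1)] by (auto dest: injD)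
  ultimately show "permute_list \<sigma> (ys[\<sigma> j := x]) ! i = (permute_list \<sigma> ys)[j := x] ! i"
    using i assms by (simp add: permute_list_nth nth_list_update)
qed simp

text \<open>The sets \<open>\<sigma> i < \<sigma> j\<close> and \<open>i < j\<close> differ exactly
  in the \<open>i\<close> inverted with \<open>j\<close>, so modulo 2 the three sums
  balance.\<close>

lemma sgn1_permute:
  fixes \<sigma> :: "nat \<Rightarrow> nat" and f :: "nat \<Rightarrow> int"
  assumes p: "\<sigma> permutes {..<n}" and j: "j < n"
  shows "sgn1 (\<Sum>i<\<sigma> j. f i) * sgn1 (\<Sum>i<n. if j < i \<and> \<sigma> i < \<sigma> j \<or> i < j \<and> \<sigma> j < \<sigma> i then f (\<sigma> i) else 0) = sgn1 (\<Sum>i<j. f (\<sigma> i))"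
proof -
  have lt: "\<sigma> j < n" using permutes_in_image[OF p] j by auto
  have "(\<Sum>i<\<sigma> j. f i) = (\<Sum>i<n. if i < \<sigma> j then f i else 0)"
    by (rule sum.mono_neutral_cong_left) (use lt in auto)
  also have "\<dots> = (\<Sum>i<n. if \<sigma> i < \<sigma> j then f (\<sigma> i) else 0)"
    using sum.permute[OF p, of "\<lambda>i. if i < \<sigma> j then f i else 0"] by (simp add: comp_def)
  finally have 1: "(\<Sum>i<\<sigma> j. f i) = (\<Sum>i<n. if \<sigma> i < \<sigma> j then f (\<sigma> i) else 0)" .
  have 2: "(\<Sum>i<j. f (\<sigma> i)) = (\<Sum>i<n. if i < j then f (\<sigma> i) else 0)"
    by (rule sum.mono_neutral_cong_left) (use j in auto)
  have "(\<Sum>i<\<sigma> j. f i) + (\<Sum>i<n. if j < i \<and> \<sigma> i < \<sigma> j \<or> i < j \<and> \<sigma> j < \<sigma> i then f (\<sigma> i) else 0) =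
      (\<Sum>i<j. f (\<sigma> i)) + 2 * (\<Sum>i<n. if j < i \<and> \<sigma> i < \<sigma> j then f (\<sigma> i) else 0)"
    unfolding 1 2 sum_distrib_left sum.distrib[symmetric]
  proof (rule sum.cong[OF refl])
    fix i
    have "\<sigma> i = \<sigma> j \<longleftrightarrow> i = j" using permutes_inj[OF p] by (auto dest: injD)
    then show "(if \<sigma> i < \<sigma> j then f (\<sigma> i) else 0) + (if j < i \<and> \<sigma> i < \<sigma> j \<or> i < j \<and> \<sigma> j < \<sigma> i then f (\<sigma> i) else 0) =
        (if i < j then f (\<sigma> i) else 0) + 2 * (if j < i \<and> \<sigma> i < \<sigma> j then f (\<sigma> i) else 0)"
      by (cases i j rule: linorder_cases; cases "\<sigma> i" "\<sigma> j" rule: linorder_cases) auto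
  qed
  then have "sgn1 (\<Sum>i<\<sigma> j. f i) * sgn1 (\<Sum>i<n. if j < i \<and> \<sigma> i < \<sigma> j \<or> i < j \<and> \<sigma> j < \<sigma> i then f (\<sigma> i) else 0) =
      sgn1 ((\<Sum>i<j. f (\<sigma> i)) + 2 * (\<Sum>i<n. if j < i \<and> \<sigma> i < \<sigma> j then f (\<sigma> i) else 0))"
    by (simp only: sgn1_add[symmetric])
  also have "\<dots> = sgn1 (\<Sum>i<j. f (\<sigma> i))" by (simp add: sgn1_even_odd)
  finally show ?thesis .
qed

lemma cell_diff_scale: "cell_diff k j (\<lambda>x. c * f x) y = c * cell_diff k j f y"
  by (cases y) (auto simp: right_diff_distrib)

lemma permutes_at: "\<sigma> permutes {..<k} \<Longrightarrow> at_pos k x y (\<sigma> i) = at_pos k x y i"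
  using permutes_in_image[of \<sigma> "{..<k}" i] by simp

text \<open>For cochains goodness is a condition on the support, and \<open>\<sigma>\<close> only
  moves the first \<open>k\<close> slots, which share the same set of cells.\<close>

lemma good_tau:
  assumes g: "good n (cell_spaces k) \<alpha>" and p: "\<sigma> permutes {..<k}" and kn: "k \<le> n"
  shows "good n (cell_spaces k) (tau cell_deg \<sigma> \<alpha>)"
proof -
  have "length ys = n \<and> (\<forall>i<n. ys ! i \<in> at_pos k cells_star cells i)" if t: "tau cell_deg \<sigma> \<alpha> ys \<noteq> 0" for ys
  proof -
    have a: "\<alpha> (permute_list \<sigma> ys) \<noteq> 0" using t by (auto simp: tau_def)
    have "\<alpha> \<in> cochains n k" using g by (simp add: cochains_good)
    with a have z: "length ys = n" "\<And>i. i < n \<Longrightarrow> permute_list \<sigma> ys ! i \<in> at_pos k cells_star cells i"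
      by (auto simp: cochains_def)
    have p': "\<sigma> permutes {..<length ys}" using permutes_le[OF p kn] z(1) by simp
    have "ys ! i \<in> at_pos k cells_star cells i" if i: "i < n" for i
    proof -
      have lt: "inv \<sigma> i < n" using permutes_in_image[OF permutes_inv[OF permutes_le[OF p kn]], of i] i by simp
      have "permute_list \<sigma> ys ! inv \<sigma> i = ys ! i"
        using lt z(1) by (simp add: permute_list_nth[OF p'] permutes_inverses[OF p])
      then show ?thesis using z(2)[OF lt] permutes_at[OF permutes_inv[OF p], where x = cells_star and y = cells and i = i] by simp
    qed
    then show ?thesis using z(1) by simp
  qed
  then have "tau cell_deg \<sigma> \<alpha> \<in> cochains n k" by (simp add: cochains_def)
  then show ?thesis by (simp add: cochains_good)
qed

lemma tdeg_permute_list: "\<sigma> permutes {..<length ys} \<Longrightarrow> tdeg dg (permute_list \<sigma> ys) = tdeg dg ys"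
  unfolding tdeg_def by (simp add: permute_list_map[symmetric] sum_mset_sum_list[symmetric] del: sum_mset_sum_list)

lemma good_map_tau:
  assumes p: "\<sigma> permutes {..<k}" and kn: "k \<le> n"
  shows "good_map n (cell_spaces k) cell_deg (cell_spaces k) cell_deg 0 (tau cell_deg \<sigma>)"
  unfolding good_map_def
proof (intro conjI allI impI)
  fix \<alpha> q assume g: "good n (cell_spaces k) \<alpha>"
  show gt: "good n (cell_spaces k) (tau cell_deg \<sigma> \<alpha>)" by (rule good_tau[OF g p kn])
  assume h: "homog cell_deg q \<alpha>"
  show "homog cell_deg (q + 0) (tau cell_deg \<sigma> \<alpha>)"
    unfolding homog_def
  proof (intro allI impI)
    fix ys assume t: "tau cell_deg \<sigma> \<alpha> ys \<noteq> 0"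
    then have "length ys = n" using good_length[OF gt] by blast
    then have "tdeg cell_deg (permute_list \<sigma> ys) = tdeg cell_deg ys"
      using tdeg_permute_list permutes_le[OF p kn] by blast
    then show "tdeg cell_deg ys = q + 0" using t h by (auto simp: tau_def homog_def)
  qed
qed (simp add: tau_def fun_eq_iff algebra_simps)

text \<open>The differential in slot \<open>\<sigma> j\<close> before permuting corresponds to the
  one in slot \<open>j\<close> after it. Two signs have to match: the differential passes different
  entries (\<open>sgn1_permute\<close>), and the Koszul sign is evaluated at a list with one degree
  lowered (\<open>koszul_sign_update\<close>).\<close>

lemma tau_derivation:
  assumes g: "good n (cell_spaces k) \<alpha>" and p: "\<sigma> permutes {..<k}" and kn: "k \<le> n"
  shows "tensor_derivation cell_deg n (cell_diff k) (tau cell_deg \<sigma> \<alpha>) = tau cell_deg \<sigma> (tensor_derivation cell_deg n (cell_diff k) \<alpha>)"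
proof
  fix ys
  let ?D = "tensor_derivation cell_deg n (cell_diff k)"
  have gl: "good n (cell_spaces k) (?D (tau cell_deg \<sigma> \<alpha>))"
    by (rule good_derivation[OF good_tau[OF g p kn] gop_cell_diff])
  have gr: "good n (cell_spaces k) (tau cell_deg \<sigma> (?D \<alpha>))"
    by (rule good_tau[OF good_derivation[OF g gop_cell_diff] p kn])
  show "?D (tau cell_deg \<sigma> \<alpha>) ys = tau cell_deg \<sigma> (?D \<alpha>) ys"
  proof (cases "length ys = n")
    case False
    then show ?thesis using good_length[OF gl] good_length[OF gr] by simp
  next
    case len: True
    have pn: "\<sigma> permutes {..<n}" by (rule permutes_le[OF p kn])
    then have pl: "\<sigma> permutes {..<length ys}" using len by simp
    let ?zs = "permute_list \<sigma> ys"
    have z: "?zs ! i = ys ! \<sigma> i" if "i < n" for i using that len by (simp add: permute_list_nth[OF pl])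
    have tm: "dd cell_deg n (cell_diff k) (\<sigma> j) (tau cell_deg \<sigma> \<alpha>) ys =
        koszul_sign cell_deg \<sigma> ?zs * dd cell_deg n (cell_diff k) j \<alpha> ?zs" if j: "j < n" for j
    proof -
      let ?E = "\<Sum>i<n. if j < i \<and> \<sigma> i < \<sigma> j \<or> i < j \<and> \<sigma> j < \<sigma> i then cell_deg (?zs ! i) else 0"
      have sj: "\<sigma> j < n" using permutes_in_image[OF pn] j by simp
      have E: "?E = (\<Sum>i<n. if j < i \<and> \<sigma> i < \<sigma> j \<or> i < j \<and> \<sigma> j < \<sigma> i then cell_deg (ys ! \<sigma> i) else 0)"
        by (rule sum.cong) (auto simp: z)
      have "cell_diff k (\<sigma> j) (\<lambda>x. tau cell_deg \<sigma> \<alpha> (ys[\<sigma> j := x])) (ys ! \<sigma> j) =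
          cell_diff k j (\<lambda>x. tau cell_deg \<sigma> \<alpha> (ys[\<sigma> j := x])) (?zs ! j)"
        using permutes_at[OF p, where x = dC_star and y = dC and i = j] z[OF j] by simp
      also have "\<dots> = cell_diff k j (\<lambda>x. (koszul_sign cell_deg \<sigma> ?zs * sgn1 ?E) * \<alpha> (?zs[j := x])) (?zs ! j)"
      \<comment> \<open>The differential only reads cells \<open>x\<close> one degree lower than the
        current one, for which the change of the Koszul sign does not depend on
        \<open>x\<close>.\<close>
      proof (rule gop_local[OF gop_cell_diff])
        fix x assume "cell_deg (?zs ! j) = cell_deg x + 1"
        then have "koszul_sign cell_deg \<sigma> (?zs[j := x]) = koszul_sign cell_deg \<sigma> ?zs * sgn1 ?E"
          by (intro koszul_sign_update) (use len j in simp_all)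
        then show "tau cell_deg \<sigma> \<alpha> (ys[\<sigma> j := x]) = (koszul_sign cell_deg \<sigma> ?zs * sgn1 ?E) * \<alpha> (?zs[j := x])"
          using permute_list_update[OF pl, of j x] j len by (simp add: tau_def)
      qed
      also have "\<dots> = (koszul_sign cell_deg \<sigma> ?zs * sgn1 ?E) * cell_diff k j (\<lambda>x. \<alpha> (?zs[j := x])) (?zs ! j)"
        by (rule cell_diff_scale)
      finally have "dd cell_deg n (cell_diff k) (\<sigma> j) (tau cell_deg \<sigma> \<alpha>) ys =
          koszul_sign cell_deg \<sigma> ?zs * ((sgn1 (\<Sum>i<\<sigma> j. cell_deg (ys ! i)) * sgn1 ?E) * cell_diff k j (\<lambda>x. \<alpha> (?zs[j := x])) (?zs ! j))"
        unfolding dd_apply[OF sj len] by (simp only: mult_ac)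
      also have "sgn1 (\<Sum>i<\<sigma> j. cell_deg (ys ! i)) * sgn1 ?E = sgn1 (\<Sum>i<j. cell_deg (?zs ! i))"
        using sgn1_permute[OF pn j, where f = "\<lambda>i. cell_deg (ys ! i)"] z j unfolding E by simp
      finally show ?thesis using j len by (simp add: dd_apply)
    qed
    have "?D (tau cell_deg \<sigma> \<alpha>) ys = (\<Sum>j<n. dd cell_deg n (cell_diff k) (\<sigma> j) (tau cell_deg \<sigma> \<alpha>) ys)"
      unfolding tensor_derivation_eq
      using sum.permute[OF pn, of "\<lambda>j. dd cell_deg n (cell_diff k) j (tau cell_deg \<sigma> \<alpha>) ys"] by (simp add: comp_def)
    also have "\<dots> = koszul_sign cell_deg \<sigma> ?zs * ?D \<alpha> ?zs"
      unfolding tensor_derivation_eq sum_distrib_left by (rule sum.cong) (auto simp: tm)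
    finally show ?thesis by (simp add: tau_def)
  qed
qed

section \<open>Matrices of tensor products on cochains\<close>

lemma UNIV_cell: "(UNIV :: cell set) = {E0, E1, Estar, E01, E0star, Estar1}"
  using cell.exhaust by blast

text \<open>With all factors of degree 0 no Koszul sign occurs, and there are finitely many cells,
  so a tensor product is the matrix whose entries are products of entries of the factors.\<close>

lemma tensor_matrix:
  fixes M :: "'i \<Rightarrow> cell \<Rightarrow> cell \<Rightarrow> real"
  assumes "\<And>i f y. i \<in> set is \<Longrightarrow> T i f y = (\<Sum>x\<in>UNIV. M i y x * f x)"
  shows "length ys = length is \<Longrightarrow> tensor dg (map (\<lambda>i. (0, T i)) is) \<phi> ys =
    (\<Sum>xs | length xs = length is. (\<Prod>l<length is. M (is ! l) (ys ! l) (xs ! l)) * \<phi> xs)"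
  using assms
proof (induction "is" arbitrary: \<phi> ys)
  case Nil
  then show ?case by simp
next
  case (Cons i "is")
  then obtain y ys' where ys: "ys = y # ys'" "length ys' = length is" by (cases ys) auto
  let ?L = "{xs :: cell list. length xs = length is}"
  have set: "{xs :: cell list. length xs = length (i # is)} = (\<lambda>(x, xs). x # xs) ` (UNIV \<times> ?L)"
  proof (intro set_eqI iffI)
    fix xs :: "cell list" assume "xs \<in> {xs. length xs = length (i # is)}"
    then show "xs \<in> (\<lambda>(x, xs). x # xs) ` (UNIV \<times> ?L)" by (cases xs) auto
  qed auto
  have inj: "inj_on (\<lambda>(x, xs). x # xs) (UNIV \<times> ?L)" by (auto simp: inj_on_def)
  have fst0: "sum_list (map fst (map (\<lambda>i. (0 :: int, T i)) is)) = 0" by (induction "is") auto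
  have "tensor dg (map (\<lambda>i. (0, T i)) (i # is)) \<phi> ys =
      T i (\<lambda>x. tensor dg (map (\<lambda>i. (0, T i)) is) (\<lambda>xs. \<phi> (x # xs)) ys') y"
    unfolding ys list.map tensor.simps fst0 by simp
  also have "\<dots> = (\<Sum>x\<in>UNIV. M i y x * (\<Sum>xs\<in>?L. (\<Prod>l<length is. M (is ! l) (ys' ! l) (xs ! l)) * \<phi> (x # xs)))"
    using Cons.prems(2)[of i] Cons.IH[OF ys(2)] Cons.prems(2) by simp
  also have "\<dots> = (\<Sum>(x, xs)\<in>UNIV \<times> ?L. M i y x * ((\<Prod>l<length is. M (is ! l) (ys' ! l) (xs ! l)) * \<phi> (x # xs)))"
    by (simp only: sum_distrib_left sum.cartesian_product)
  also have "\<dots> = (\<Sum>xs | length xs = length (i # is). (\<Prod>l<length (i # is). M ((i # is) ! l) (ys ! l) (xs ! l)) * \<phi> xs)"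
    unfolding set sum.reindex[OF inj] by (rule sum.cong) (auto simp: ys prod.lessThan_Suc_shift mult.assoc simp del: prod.lessThan_Suc)
  finally show ?case .
qed

lemma tens_matrix:
  fixes M :: "nat \<Rightarrow> cell \<Rightarrow> cell \<Rightarrow> real"
  assumes "\<And>i f y. i < n \<Longrightarrow> T i f y = (\<Sum>x\<in>UNIV. M i y x * f x)" "length ys = n"
  shows "tens dg n (\<lambda>_. 0) T \<phi> ys = (\<Sum>xs | length xs = n. (\<Prod>l<n. M l (ys ! l) (xs ! l)) * \<phi> xs)"
  using tensor_matrix[of "[0..<n]" T M ys dg \<phi>] assms unfolding tens_def by simp

lemma permute_list_inverse:
  assumes "\<sigma> permutes {..<length xs}"
  shows "permute_list (inv \<sigma>) (permute_list \<sigma> xs) = xs" "permute_list \<sigma> (permute_list (inv \<sigma>) xs) = xs"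
  using permute_list_compose[OF assms, of "inv \<sigma>"] permute_list_compose[OF permutes_inv[OF assms], of \<sigma>]
  by (simp_all add: permutes_inv_o[OF assms])

text \<open>Only the equality of the factors \<open>M i\<close> along the orbits of \<open>\<sigma>\<close> matters: the Koszul signs agree because \<open>M\<close> preserves degrees.\<close>

lemma tau_tens:
  fixes M :: "nat \<Rightarrow> cell \<Rightarrow> cell \<Rightarrow> real"
  assumes M: "\<And>i f y. T i f y = (\<Sum>x\<in>UNIV. M i y x * f x)" and deg: "\<And>i x y. M i y x \<noteq> 0 \<Longrightarrow> dg x = dg y"
    and p: "\<sigma> permutes {..<n}" and inv: "\<And>i. M (\<sigma> i) = M i" and len: "length ys = n"
  shows "tens dg n (\<lambda>_. 0) T (tau dg \<sigma> \<phi>) ys = tau dg \<sigma> (tens dg n (\<lambda>_. 0) T \<phi>) ys"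
proof -
  let ?L = "{xs :: cell list. length xs = n}"
  let ?zs = "permute_list \<sigma> ys"
  have pl: "\<sigma> permutes {..<length xs}" if "length xs = n" for xs :: "cell list" using p that by simp
  have z: "permute_list \<sigma> xs ! i = xs ! \<sigma> i" if "i < n" "length xs = n" for i and xs :: "cell list"
    using that by (simp add: permute_list_nth[OF pl])
  have "tens dg n (\<lambda>_. 0) T (tau dg \<sigma> \<phi>) ys = (\<Sum>xs\<in>?L. (\<Prod>l<n. M l (ys ! l) (xs ! l)) * tau dg \<sigma> \<phi> xs)"
    by (rule tens_matrix[OF M len])
  also have "\<dots> = (\<Sum>xs\<in>?L. koszul_sign dg \<sigma> ?zs * ((\<Prod>l<n. M l (?zs ! l) (permute_list \<sigma> xs ! l)) * \<phi> (permute_list \<sigma> xs)))"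
  proof (rule sum.cong[OF refl])
    fix xs assume "xs \<in> ?L"
    then have xs: "length xs = n" by simp
    have pr: "(\<Prod>l<n. M l (?zs ! l) (permute_list \<sigma> xs ! l)) = (\<Prod>l<n. M l (ys ! l) (xs ! l))"
    proof -
      have "(\<Prod>l<n. M l (?zs ! l) (permute_list \<sigma> xs ! l)) = (\<Prod>l<n. M (\<sigma> l) (ys ! \<sigma> l) (xs ! \<sigma> l))"
        by (rule prod.cong) (simp_all add: z len xs inv)
      also have "\<dots> = (\<Prod>l<n. M l (ys ! l) (xs ! l))"
        using prod.permute[OF p, of "\<lambda>l. M l (ys ! l) (xs ! l)"] by (simp add: comp_def)
      finally show ?thesis .
    qed
    have "koszul_sign dg \<sigma> (permute_list \<sigma> xs) = koszul_sign dg \<sigma> ?zs" if "(\<Prod>l<n. M l (?zs ! l) (permute_list \<sigma> xs ! l)) \<noteq> 0"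
      by (rule koszul_sign_cong) (use that xs len deg in \<open>auto simp: prod_zero_iff\<close>)
    then show "(\<Prod>l<n. M l (ys ! l) (xs ! l)) * tau dg \<sigma> \<phi> xs =
        koszul_sign dg \<sigma> ?zs * ((\<Prod>l<n. M l (?zs ! l) (permute_list \<sigma> xs ! l)) * \<phi> (permute_list \<sigma> xs))"
      unfolding pr tau_def by (cases "(\<Prod>l<n. M l (ys ! l) (xs ! l)) = 0") simp_all
  qed
  also have "\<dots> = (\<Sum>xs\<in>?L. koszul_sign dg \<sigma> ?zs * ((\<Prod>l<n. M l (?zs ! l) (xs ! l)) * \<phi> xs))"
    by (rule sum.reindex_bij_witness[where i = "permute_list (inv \<sigma>)" and j = "permute_list \<sigma>"])
      (auto simp: permute_list_inverse[OF pl])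
  also have "\<dots> = koszul_sign dg \<sigma> ?zs * tens dg n (\<lambda>_. 0) T \<phi> ?zs"
    using tens_matrix[where T = T and M = M and n = n and ys = ?zs and dg = dg and \<phi> = \<phi>, OF M] len by (simp add: sum_distrib_left)
  finally show ?thesis by (simp add: tau_def)
qed

section \<open>The cubical welding homotopy\<close>

text \<open>The intermediate stages of the telescoping sum: \<open>j = k\<close> is the identity,
  \<open>j = 0\<close> is \<open>ip\<close> in all subdivided slots, and lowering \<open>j\<close>
  by one replaces the identity by \<open>ip\<close> in one more slot.\<close>

definition ip_from :: "nat \<Rightarrow> nat \<Rightarrow> nat \<Rightarrow> (cell \<Rightarrow> real) \<Rightarrow> (cell \<Rightarrow> real)" where
  "ip_from k j i = (if j \<le> i \<and> i < k then i_weld \<circ> p_weld else id)"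

definition a_term :: "nat \<Rightarrow> nat \<Rightarrow> nat \<Rightarrow> (cell list \<Rightarrow> real) \<Rightarrow> (cell list \<Rightarrow> real)" where
  "a_term n k j = tens cell_deg n ((\<lambda>_. 0)(j := -1)) ((ip_from k (Suc j))(j := a_weld))"

definition a_sum :: "nat \<Rightarrow> nat \<Rightarrow> (cell list \<Rightarrow> real) \<Rightarrow> (cell list \<Rightarrow> real)" where
  "a_sum n k \<alpha> = (\<lambda>xs. \<Sum>j<k. 1 * a_term n k j \<alpha> xs)"

lemma a_term_eq:
  assumes "j < k" "k \<le> n"
  shows "tensor cell_deg (replicate j (0, id) @ [(-1, a_weld)] @ replicate (k - 1 - j) (0, i_weld \<circ> p_weld) @ replicate (n - k) (0, id)) = a_term n k j"
  unfolding a_term_def tens_def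
proof (rule arg_cong[where f = "tensor cell_deg"], rule nth_equalityI)
  fix i assume "i < length (replicate j (0 :: int, id) @ [(-1, a_weld)] @ replicate (k - 1 - j) (0, i_weld \<circ> p_weld) @ replicate (n - k) (0, id))"
  then show "(replicate j (0 :: int, id) @ [(-1, a_weld)] @ replicate (k - 1 - j) (0, i_weld \<circ> p_weld) @ replicate (n - k) (0, id)) ! i =
      map (\<lambda>i. (((\<lambda>_. 0)(j := -1)) i, ((ip_from k (Suc j))(j := a_weld)) i)) [0..<n] ! i"
    using assms by (auto simp: nth_append nth_Cons' ip_from_def)
qed (use assms in simp)

lemma a_cube_eq:
  assumes "k \<le> n"
  shows "a_cube n k \<alpha> xs = (\<Sum>\<sigma> | \<sigma> permutes {..<k}. 1 / fact k * tau cell_deg \<sigma> (a_sum n k (tau cell_deg (inv \<sigma>) \<alpha>)) xs)"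
proof -
  have "(\<Sum>j<k. tensor cell_deg (replicate j (0, id) @ [(-1, a_weld)] @ replicate (k - 1 - j) (0, i_weld \<circ> p_weld) @ replicate (n - k) (0, id)) \<beta>) =
      a_sum n k \<beta>" for \<beta>
  proof
    fix xs
    show "(\<Sum>j<k. tensor cell_deg (replicate j (0, id) @ [(-1, a_weld)] @ replicate (k - 1 - j) (0, i_weld \<circ> p_weld) @ replicate (n - k) (0, id)) \<beta>) xs =
        a_sum n k \<beta> xs"
      unfolding a_sum_def sum_fun_apply mult_1 by (intro sum.cong refl) (simp only: lessThan_iff a_term_eq[OF _ assms])
  qed
  then show ?thesis unfolding a_cube_def by (simp only: scaleR_fun_def sum_fun_apply real_scaleR_def sum_distrib_left)
qed

lemma gop_ip_from: "gop cell_deg cell_deg 0 (ip_from k j i) (cell_spaces k i) (cell_spaces k i)"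
  unfolding ip_from_def by (simp add: gop_ip_weld gop_id[OF wf_cell] gop_id)

lemma gop_a_term:
  assumes "j < k"
  shows "gop cell_deg cell_deg (((\<lambda>_. 0)(j := -1)) i) (((ip_from k (Suc j))(j := a_weld)) i) (cell_spaces k i) (cell_spaces k i)"
  using assms gop_ip_from[of k "Suc j" i] gop_a_weld by (cases "i = j") simp_all

lemma good_map_a_sum:
  assumes "k \<le> n"
  shows "good_map n (cell_spaces k) cell_deg (cell_spaces k) cell_deg (-1) (a_sum n k)"
proof (rule good_map_sum[where A = "{..<k}" and F = "a_term n k" and c = "\<lambda>_. 1"])
  fix j assume j: "j \<in> {..<k}"
  show "good_map n (cell_spaces k) cell_deg (cell_spaces k) cell_deg (-1) (a_term n k j)"
    unfolding a_term_def
    by (rule good_map_tens, rule gop_a_term) (use j assms in \<open>simp_all add: fun_upd_def sum.delta\<close>)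
qed (simp_all add: a_sum_def)

lemma a_term_homotopy:
  assumes j: "j < k" and k: "k \<le> n" and g: "good n (cell_spaces k) \<alpha>"
  shows "tensor_derivation cell_deg n (cell_diff k) (a_term n k j \<alpha>) xs + a_term n k j (tensor_derivation cell_deg n (cell_diff k) \<alpha>) xs =
    tens cell_deg n (\<lambda>_. 0) (ip_from k (Suc j)) \<alpha> xs - tens cell_deg n (\<lambda>_. 0) (ip_from k j) \<alpha> xs"
proof -
  have upd: "(ip_from k (Suc j))(j := id) = ip_from k (Suc j)" "(ip_from k (Suc j))(j := i_weld \<circ> p_weld) = ip_from k j"
    using j by (auto simp: ip_from_def fun_eq_iff)
  have a: "gop cell_deg cell_deg (-1) a_weld (cell_spaces k j) (cell_spaces k j)"
    "gop cell_deg cell_deg 0 (i_weld \<circ> p_weld) (cell_spaces k j) (cell_spaces k j)"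
    "contraction cell_deg (cell_spaces k j) (cell_diff k j) a_weld (i_weld \<circ> p_weld)"
    using j by (simp_all add: gop_a_weld gop_ip_weld contraction_a del: comp_apply)
  have comm: "cell_diff k i (ip_from k (Suc j) i f) y = ip_from k (Suc j) i (cell_diff k i f) y" for i f y
    unfolding ip_from_def using dC_ip_weld[of f y] by simp
  have "j < n" using j k by simp
  from homotopy_tens[where V = "cell_spaces k" and d = "cell_diff k" and T = "ip_from k (Suc j)", OF this g gop_ip_from a(1,2) gop_cell_diff comm a(3)]
  show ?thesis unfolding upd a_term_def .
qed

lemma a_sum_homotopy:
  assumes k: "k \<le> n" and g: "good n (cell_spaces k) \<alpha>"
  shows "tensor_derivation cell_deg n (cell_diff k) (a_sum n k \<alpha>) xs + a_sum n k (tensor_derivation cell_deg n (cell_diff k) \<alpha>) xs =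
    \<alpha> xs - tens cell_deg n (\<lambda>_. 0) (at_pos k (i_weld \<circ> p_weld) id) \<alpha> xs"
proof -
  let ?D = "tensor_derivation cell_deg n (cell_diff k)"
  have "good n (cell_spaces k) (a_term n k j \<alpha>)" if "j \<in> {..<k}" for j
    unfolding a_term_def by (rule good_tens[OF g], rule gop_a_term) (use that in simp)
  then have "?D (a_sum n k \<alpha>) = (\<lambda>ys. \<Sum>j<k. 1 * ?D (a_term n k j \<alpha>) ys)"
    unfolding a_sum_def by (rule derivation_sum[OF finite_lessThan _ gop_cell_diff])
  then have "?D (a_sum n k \<alpha>) xs + a_sum n k (?D \<alpha>) xs = (\<Sum>j<k. ?D (a_term n k j \<alpha>) xs + a_term n k j (?D \<alpha>) xs)"
    by (simp add: a_sum_def sum.distrib)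
  also have "\<dots> = (\<Sum>j<k. tens cell_deg n (\<lambda>_. 0) (ip_from k (Suc j)) \<alpha> xs - tens cell_deg n (\<lambda>_. 0) (ip_from k j) \<alpha> xs)"
    by (rule sum.cong) (simp_all add: a_term_homotopy[OF _ k g])
  also have "\<dots> = tens cell_deg n (\<lambda>_. 0) (ip_from k k) \<alpha> xs - tens cell_deg n (\<lambda>_. 0) (ip_from k 0) \<alpha> xs"
    by (rule sum_lessThan_telescope)
  also have "ip_from k k = (\<lambda>_. id)" by (rule ext) (auto simp: ip_from_def)
  also have "ip_from k 0 = at_pos k (i_weld \<circ> p_weld) id" by (rule ext) (simp add: ip_from_def)
  finally show ?thesis unfolding tens_id_good[OF g] .
qed

text \<open>The dual basis of the cells; an operator applied to \<open>delta x\<close> and evaluated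
  at \<open>y\<close> is its matrix entry.\<close>

definition delta :: "cell \<Rightarrow> cell \<Rightarrow> real" where
  "delta x y = (if x = y then 1 else 0)"

text \<open>All of the first \<open>k\<close> slots carry the same factor, as
  \<open>tau_tens\<close> requires. This is why symmetrising the welding homotopy does not change
  its endpoints.\<close>

lemma tau_ip:
  assumes p: "\<sigma> permutes {..<k}" and kn: "k \<le> n" and len: "length ys = n"
  shows "tau cell_deg \<sigma> (tens cell_deg n (\<lambda>_. 0) (at_pos k (i_weld \<circ> p_weld) id) \<phi>) ys =
    tens cell_deg n (\<lambda>_. 0) (at_pos k (i_weld \<circ> p_weld) id) (tau cell_deg \<sigma> \<phi>) ys"
proof (rule sym, rule tau_tens[OF _ _ permutes_le[OF p kn] _ len, where M = "\<lambda>i y x. at_pos k (i_weld \<circ> p_weld) id i (delta x) y"])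
  fix i f y
  show "at_pos k (i_weld \<circ> p_weld) id i f y = (\<Sum>x\<in>UNIV. at_pos k (i_weld \<circ> p_weld) id i (delta x) y * f x)"
    unfolding UNIV_cell by (cases y) (simp_all add: delta_def field_simps)
next
  fix i x y assume "at_pos k (i_weld \<circ> p_weld) id i (delta x) y \<noteq> 0"
  then show "cell_deg x = cell_deg y"
    by (cases x; cases y) (auto simp: delta_def split: if_splits)
next
  fix i
  have "at_pos k (i_weld \<circ> p_weld) id (\<sigma> i) = at_pos k (i_weld \<circ> p_weld) id i" by (rule permutes_at[OF p])
  then show "(\<lambda>y x. at_pos k (i_weld \<circ> p_weld) id (\<sigma> i) (delta x) y) = (\<lambda>y x. at_pos k (i_weld \<circ> p_weld) id i (delta x) y)"
    by presburger
qed

lemma tau_tau_inv: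
  assumes g: "good n (cell_spaces k) \<alpha>" and p: "\<sigma> permutes {..<k}" and kn: "k \<le> n"
  shows "tau cell_deg \<sigma> (tau cell_deg (inv \<sigma>) \<alpha>) = \<alpha>"
proof
  fix ys
  have pi: "inv \<sigma> permutes {..<k}" by (rule permutes_inv[OF p])
  show "tau cell_deg \<sigma> (tau cell_deg (inv \<sigma>) \<alpha>) ys = \<alpha> ys"
  proof (cases "length ys = n")
    case True
    then have "inv \<sigma> permutes {..<length ys}" using permutes_le[OF pi kn] by simp
    from tau_inv[OF this, where \<phi> = \<alpha>] show ?thesis by (simp add: permutes_inv_inv[OF p])
  next
    case False
    then show ?thesis using good_length[OF good_tau[OF good_tau[OF g pi kn] p kn]] good_length[OF g] by simp
  qed
qed

lemma good_map_tau_a: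
  assumes "k \<le> n" "\<sigma> permutes {..<k}"
  shows "good_map n (cell_spaces k) cell_deg (cell_spaces k) cell_deg (-1) (\<lambda>\<alpha>. tau cell_deg \<sigma> (a_sum n k (tau cell_deg (inv \<sigma>) \<alpha>)))"
  by (rule good_map_comp[OF good_map_comp[OF good_map_tau[OF permutes_inv[OF assms(2)] assms(1)] good_map_a_sum[OF assms(1)] refl] good_map_tau[OF assms(2,1)]]) simp

lemma good_map_a:
  assumes "k \<le> n"
  shows "good_map n (cell_spaces k) cell_deg (cell_spaces k) cell_deg (-1) (a_cube n k)"
  by (rule good_map_sum[where A = "{\<sigma>. \<sigma> permutes {..<k}}" and c = "\<lambda>_. 1 / fact k" and F = "\<lambda>\<sigma> \<alpha>. tau cell_deg \<sigma> (a_sum n k (tau cell_deg (inv \<sigma>) \<alpha>))"])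
    (simp_all add: good_map_tau_a assms a_cube_eq finite_permutations)

text \<open>Conjugation by \<open>tau\<close>, which commutes with the differential, turns the
  commutator \<open>1 - ip\<close> of the unsymmetrised homotopy into its conjugate, and
  \<open>ip\<close> is invariant.\<close>

lemma tau_a_homotopy:
  assumes k: "k \<le> n" and g: "good n (cell_spaces k) \<alpha>" and p: "\<sigma> permutes {..<k}"
  shows "tensor_derivation cell_deg n (cell_diff k) (tau cell_deg \<sigma> (a_sum n k (tau cell_deg (inv \<sigma>) \<alpha>))) xs +
      tau cell_deg \<sigma> (a_sum n k (tau cell_deg (inv \<sigma>) (tensor_derivation cell_deg n (cell_diff k) \<alpha>))) xs =
    \<alpha> xs - i_cube n k (p_cube n k \<alpha>) xs"
proof -
  let ?D = "tensor_derivation cell_deg n (cell_diff k)" and ?P = "tens cell_deg n (\<lambda>_. 0) (at_pos k (i_weld \<circ> p_weld) id)"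
  let ?\<beta> = "tau cell_deg (inv \<sigma>) \<alpha>"
  have pi: "inv \<sigma> permutes {..<k}" by (rule permutes_inv[OF p])
  have gb: "good n (cell_spaces k) ?\<beta>" by (rule good_tau[OF g pi k])
  have ga: "good n (cell_spaces k) (a_sum n k ?\<beta>)" by (rule good_map_good[OF good_map_a_sum[OF k] gb])
  have "?D (tau cell_deg \<sigma> (a_sum n k ?\<beta>)) xs + tau cell_deg \<sigma> (a_sum n k (tau cell_deg (inv \<sigma>) (?D \<alpha>))) xs =
      koszul_sign cell_deg \<sigma> (permute_list \<sigma> xs) * (?D (a_sum n k ?\<beta>) (permute_list \<sigma> xs) + a_sum n k (?D ?\<beta>) (permute_list \<sigma> xs))"
    unfolding tau_derivation[OF ga p k] tau_derivation[OF g pi k] by (simp add: tau_def distrib_left)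
  also have "\<dots> = tau cell_deg \<sigma> ?\<beta> xs - tau cell_deg \<sigma> (?P ?\<beta>) xs"
    unfolding a_sum_homotopy[OF k gb] by (simp add: tau_def right_diff_distrib)
  also have "tau cell_deg \<sigma> ?\<beta> = \<alpha>" by (rule tau_tau_inv[OF g p k])
  also have "tau cell_deg \<sigma> (?P ?\<beta>) xs = ?P \<alpha> xs"
  proof (cases "length xs = n")
    case True
    then show ?thesis by (simp only: tau_ip[OF p k] tau_tau_inv[OF g p k])
  next
    case False
    have G: "gop cell_deg cell_deg 0 (at_pos k (i_weld \<circ> p_weld) id i) (cell_spaces k i) (cell_spaces k i)" for i
      using gop_ip_from[of k 0 i] by (simp add: ip_from_def)
    show ?thesis
      using False good_length[OF good_tau[OF good_tens[OF gb G] p k]] good_length[OF good_tens[OF g G]] by simp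
  qed
  finally show ?thesis unfolding i_p_cube[OF k g] .
qed

text \<open>All \<open>k!\<close> permuted summands satisfy the same identity, so their average does
  as well.\<close>

lemma a_homotopy:
  assumes k: "k \<le> n" and g: "good n (cell_spaces k) \<alpha>"
  shows "tensor_derivation cell_deg n (cell_diff k) (a_cube n k \<alpha>) xs + a_cube n k (tensor_derivation cell_deg n (cell_diff k) \<alpha>) xs =
    \<alpha> xs - i_cube n k (p_cube n k \<alpha>) xs"
proof -
  let ?D = "tensor_derivation cell_deg n (cell_diff k)" and ?S = "{\<sigma>. \<sigma> permutes {..<k}}"
  let ?a = "\<lambda>\<sigma> \<alpha>. tau cell_deg \<sigma> (a_sum n k (tau cell_deg (inv \<sigma>) \<alpha>))"
  have a: "a_cube n k \<beta> = (\<lambda>xs. \<Sum>\<sigma>\<in>?S. 1 / fact k * ?a \<sigma> \<beta> xs)" for \<beta>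
    using a_cube_eq[OF k] by blast
  have "?D (a_cube n k \<alpha>) = (\<lambda>ys. \<Sum>\<sigma>\<in>?S. 1 / fact k * ?D (?a \<sigma> \<alpha>) ys)"
    unfolding a by (rule derivation_sum[OF _ good_map_good[OF good_map_tau_a[OF k] g] gop_cell_diff]) (simp_all add: finite_permutations)
  then have "?D (a_cube n k \<alpha>) xs + a_cube n k (?D \<alpha>) xs = (\<Sum>\<sigma>\<in>?S. 1 / fact k * (?D (?a \<sigma> \<alpha>) xs + ?a \<sigma> (?D \<alpha>) xs))"
    unfolding a[of "?D \<alpha>"] by (simp only: sum.distrib distrib_left)
  also have "\<dots> = (\<Sum>\<sigma>\<in>?S. 1 / fact k * (\<alpha> xs - i_cube n k (p_cube n k \<alpha>) xs))"
    by (rule sum.cong) (simp_all only: mem_Collect_eq tau_a_homotopy[OF k g])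
  also have "\<dots> = \<alpha> xs - i_cube n k (p_cube n k \<alpha>) xs"
    by (simp add: card_permutations[OF refl])
  finally show ?thesis .
qed

section \<open>Assembly of the deformation retraction on the cube\<close>

lemma good_map_diff: "good_map n V dg V' dg' r F \<Longrightarrow> good n V \<phi> \<Longrightarrow> good n V \<psi> \<Longrightarrow> F (\<lambda>xs. \<phi> xs - \<psi> xs) = (\<lambda>ys. F \<phi> ys - F \<psi> ys)"
  using good_map_lin[of n V dg V' dg' r F \<phi> \<psi> 1 "-1"] by simp

lemma good_map_add: "good_map n V dg V' dg' r F \<Longrightarrow> good n V \<phi> \<Longrightarrow> good n V \<psi> \<Longrightarrow> F (\<lambda>xs. \<phi> xs + \<psi> xs) = (\<lambda>ys. F \<phi> ys + F \<psi> ys)"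
  using good_map_lin[of n V dg V' dg' r F \<phi> \<psi> 1 1] by simp

abbreviation Omega_diff :: "nat \<Rightarrow> (pos list \<Rightarrow> real) \<Rightarrow> (pos list \<Rightarrow> real)" where
  "Omega_diff n \<equiv> tensor_derivation pos_deg n (\<lambda>_. dF)"

lemma good_map_dF: "good_map n (pos_spaces k) pos_deg (pos_spaces k) pos_deg 1 (Omega_diff n)"
  by (rule good_map_derivation[OF gop_dF])

lemma good_map_WaI:
  assumes "k \<le> n"
  shows "good_map n (pos_spaces k) pos_deg (pos_spaces k) pos_deg (-1) (\<lambda>\<omega>. W_cube n k (a_cube n k (I_cube n k \<omega>)))"
  by (rule good_map_comp[OF good_map_comp[OF good_map_I[OF assms] good_map_a[OF assms] refl] good_map_W[OF assms]]) simp

lemma WaI_homotopy: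
  assumes k: "k \<le> n" and g: "good n (pos_spaces k) \<omega>"
  shows "Omega_diff n (W_cube n k (a_cube n k (I_cube n k \<omega>))) xs + W_cube n k (a_cube n k (I_cube n k (Omega_diff n \<omega>))) xs =
    W_cube n k (I_cube n k \<omega>) xs - W_cube n k (i_cube n k (p_cube n k (I_cube n k \<omega>))) xs"
proof -
  let ?D = "tensor_derivation cell_deg n (cell_diff k)"
  have gI: "good n (cell_spaces k) (I_cube n k \<omega>)" by (rule good_map_good[OF good_map_I[OF k] g])
  have ga: "good n (cell_spaces k) (a_cube n k (I_cube n k \<omega>))" by (rule good_map_good[OF good_map_a[OF k] gI])
  have gd: "good n (cell_spaces k) (?D (a_cube n k (I_cube n k \<omega>)))" by (rule good_derivation[OF ga gop_cell_diff])
  have gad: "good n (cell_spaces k) (a_cube n k (?D (I_cube n k \<omega>)))"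
    by (rule good_map_good[OF good_map_a[OF k] good_derivation[OF gI gop_cell_diff]])
  have gip: "good n (cell_spaces k) (i_cube n k (p_cube n k (I_cube n k \<omega>)))"
    by (rule good_map_good[OF good_map_i[OF k] good_map_good[OF good_map_p[OF k] gI]])
  have eq: "(\<lambda>xs. ?D (a_cube n k (I_cube n k \<omega>)) xs + a_cube n k (?D (I_cube n k \<omega>)) xs) =
      (\<lambda>xs. I_cube n k \<omega> xs - i_cube n k (p_cube n k (I_cube n k \<omega>)) xs)"
    using a_homotopy[OF k gI] by blast
  show ?thesis
    unfolding W_cochain[OF k ga] I_cochain[OF k g, symmetric]
    using fun_cong[OF good_map_add[OF good_map_W[OF k] gd gad], of xs] fun_cong[OF good_map_diff[OF good_map_W[OF k] gI gip], of xs]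
    unfolding eq by simp
qed

lemma homotopy_star:
  assumes n: "1 \<le> n" and k: "k \<le> n" and g: "good n (pos_spaces k) \<omega>"
  shows "Omega_diff n (\<lambda>xs. s_cube n k \<omega> xs + W_cube n k (a_cube n k (I_cube n k \<omega>)) xs) xs +
      (s_cube n k (Omega_diff n \<omega>) xs + W_cube n k (a_cube n k (I_cube n k (Omega_diff n \<omega>))) xs) =
    \<omega> xs - W_cube n k (i_cube n k (p_cube n k (I_cube n k \<omega>))) xs"
  using fun_cong[OF good_map_add[OF good_map_dF good_map_good[OF good_map_s[OF k] g] good_map_good[OF good_map_WaI[OF k] g]], of xs]
    s_homotopy[OF n k g, of xs] WaI_homotopy[OF k g, of xs] by simp

lemma cochain_map_tensor:
  assumes "good_map n V dg V' dg' 0 F" "\<And>i. i < n \<Longrightarrow> cconv (V i)"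
    "\<And>\<phi>. good n V \<phi> \<Longrightarrow> F (tensor_derivation dg n d \<phi>) = tensor_derivation dg' n d' (F \<phi>)"
  shows "cochain_map (tensor_complex n V dg d) (tensor_complex n V' dg' d') F"
  unfolding cochain_map_def
proof (intro conjI ballI)
  show "graded_map 0 (tensor_complex n V dg d) (tensor_complex n V' dg' d') F"
    by (rule graded_map_tensor_complex[OF assms(1,2)])
  fix x assume "x \<in> total_space (tensor_complex n V dg d)"
  from assms(3)[OF total_space_good[OF assms(2) this]]
  show "F (diff (tensor_complex n V dg d) x) = diff (tensor_complex n V' dg' d') (F x)"
    by (simp add: tensor_complex_def)
qed

lemma good_C_cube: "\<alpha> \<in> total_space (C_cube n k) \<Longrightarrow> good n (cell_spaces k) \<alpha>"
  unfolding C_cube_eq by (rule total_space_good[rotated]) (auto split: if_splits)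

lemma good_Omega_cube: "k \<le> n \<Longrightarrow> \<omega> \<in> total_space (Omega_cube n k) \<Longrightarrow> good n (pos_spaces k) \<omega>"
  unfolding Omega_cube_eq by (rule total_space_good[rotated]) (auto split: if_splits)

lemma diff_Omega_cube: "diff (Omega_cube n k) = Omega_diff n"
  by (simp add: Omega_cube_def)

lemma deformation_retraction_cube:
  assumes n: "1 \<le> n" and k: "k \<le> n"
  shows "deformation_retraction (C_cube n 0) (Omega_cube n k)
           (\<lambda>\<alpha>. W_cube n k (i_cube n k \<alpha>))
           (\<lambda>\<omega>. p_cube n k (I_cube n k \<omega>))
           (\<lambda>\<omega>. s_cube n k \<omega> + W_cube n k (a_cube n k (I_cube n k \<omega>)))"
  unfolding deformation_retraction_def
proof (intro conjI ballI)
  have cc: "cconv (cell_spaces m i)" "cconv (pos_spaces m i)" for m i by simp_all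
  show "cochain_complex (C_cube n 0)" "cochain_complex (Omega_cube n k)"
    by (rule cochain_complex_C_cube cochain_complex_Omega_cube[OF k])+
  show "cochain_map (C_cube n 0) (Omega_cube n k) (\<lambda>\<alpha>. W_cube n k (i_cube n k \<alpha>))"
    unfolding C_cube_eq Omega_cube_eq[OF k]
  proof (rule cochain_map_tensor[OF good_map_comp[OF good_map_i[OF k] good_map_W[OF k]] cc(1)])
    fix \<alpha> assume g: "good n (cell_spaces 0) \<alpha>"
    show "W_cube n k (i_cube n k (tensor_derivation cell_deg n (cell_diff 0) \<alpha>)) = Omega_diff n (W_cube n k (i_cube n k \<alpha>))"
      by (simp only: W_cochain[OF k good_map_good[OF good_map_i[OF k] g]] i_cochain[OF k g])
  qed simp
  show "cochain_map (Omega_cube n k) (C_cube n 0) (\<lambda>\<omega>. p_cube n k (I_cube n k \<omega>))"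
    unfolding C_cube_eq Omega_cube_eq[OF k]
  proof (rule cochain_map_tensor[OF good_map_comp[OF good_map_I[OF k] good_map_p[OF k]] cc(2)])
    fix \<omega> assume g: "good n (pos_spaces k) \<omega>"
    show "p_cube n k (I_cube n k (Omega_diff n \<omega>)) = tensor_derivation cell_deg n (cell_diff 0) (p_cube n k (I_cube n k \<omega>))"
      by (simp only: p_cochain[OF k good_map_good[OF good_map_I[OF k] g]] I_cochain[OF k g])
  qed simp
  \<comment> \<open>The sum of two maps is read as a sum over \<open>bool\<close>, so that the rule
    for finite linear combinations covers it.\<close>
  have "good_map n (pos_spaces k) pos_deg (pos_spaces k) pos_deg (-1) (\<lambda>\<omega>. s_cube n k \<omega> + W_cube n k (a_cube n k (I_cube n k \<omega>)))"
    by (rule good_map_sum[where A = "UNIV :: bool set" and c = "\<lambda>_. 1" and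
        F = "\<lambda>b. if b then s_cube n k else (\<lambda>\<omega>. W_cube n k (a_cube n k (I_cube n k \<omega>)))"])
      (simp_all add: good_map_s[OF k] good_map_WaI[OF k] UNIV_bool)
  then show "graded_map (-1) (Omega_cube n k) (Omega_cube n k) (\<lambda>\<omega>. s_cube n k \<omega> + W_cube n k (a_cube n k (I_cube n k \<omega>)))"
    unfolding Omega_cube_eq[OF k] by (rule graded_map_tensor_complex[OF _ cc(2)])
next
  fix \<alpha> assume "\<alpha> \<in> total_space (C_cube n 0)"
  then have g: "good n (cell_spaces 0) \<alpha>" by (rule good_C_cube)
  show "p_cube n k (I_cube n k (W_cube n k (i_cube n k \<alpha>))) = \<alpha>"
    unfolding I_W_cube[OF k good_map_good[OF good_map_i[OF k] g]] by (rule p_i_cube[OF k g])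
next
  fix \<omega> assume "\<omega> \<in> total_space (Omega_cube n k)"
  then have g: "good n (pos_spaces k) \<omega>" by (rule good_Omega_cube[OF k])
  show "diff (Omega_cube n k) (s_cube n k \<omega> + W_cube n k (a_cube n k (I_cube n k \<omega>))) +
      (s_cube n k (diff (Omega_cube n k) \<omega>) + W_cube n k (a_cube n k (I_cube n k (diff (Omega_cube n k) \<omega>)))) =
      \<omega> - W_cube n k (i_cube n k (p_cube n k (I_cube n k \<omega>)))"
    using homotopy_star[OF n k g] by (simp add: diff_Omega_cube plus_fun_def fun_diff_def)
qed

lemma homotopy_difference_closed:
  assumes n: "1 \<le> n" and k: "k \<le> n" and g: "good n (pos_spaces 0) \<omega>"
  defines "X \<equiv> \<lambda>\<omega>. W_cube n k (a_cube n k (I_cube n k (incl_cube n k \<omega>))) + s_cube n k (incl_cube n k \<omega>) - incl_cube n k (s_cube n 0 \<omega>)"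
  shows "Omega_diff n (X \<omega>) + X (Omega_diff n \<omega>) = 0"
proof
  fix xs
  let ?\<omega> = "incl_cube n k \<omega>" and ?D = "Omega_diff n" and ?h = "\<lambda>\<omega>. W_cube n k (a_cube n k (I_cube n k \<omega>))"
  note incl = good_map_incl[OF k]
  have gi: "good n (pos_spaces k) ?\<omega>" by (rule good_map_good[OF incl g])
  have gs0: "good n (pos_spaces 0) (s_cube n 0 \<omega>)" by (rule good_map_good[OF good_map_s[OF le0] g])
  have gh: "good n (pos_spaces k) (?h ?\<omega>)" by (rule good_map_good[OF good_map_WaI[OF k] gi])
  have gs: "good n (pos_spaces k) (s_cube n k ?\<omega>)" by (rule good_map_good[OF good_map_s[OF k] gi])
  have ghs: "good n (pos_spaces k) (\<lambda>xs. s_cube n k ?\<omega> xs + ?h ?\<omega> xs)"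
    using good_lin[OF gs gh, of 1 1] by simp
  have gis: "good n (pos_spaces k) (incl_cube n k (s_cube n 0 \<omega>))" by (rule good_map_good[OF incl gs0])
  have gI: "good n (cell_spaces 0) (I_cube n 0 \<omega>)" by (rule good_map_good[OF good_map_I[OF le0] g])
  have X: "X \<omega> = (\<lambda>xs. (s_cube n k ?\<omega> xs + ?h ?\<omega> xs) - incl_cube n k (s_cube n 0 \<omega>) xs)"
    by (simp add: X_def fun_eq_iff)
  have DX: "?D (X \<omega>) xs = ?D (\<lambda>xs. s_cube n k ?\<omega> xs + ?h ?\<omega> xs) xs - incl_cube n k (?D (s_cube n 0 \<omega>)) xs"
    unfolding X using good_map_diff[OF good_map_dF ghs gis] incl_cochain[OF k gs0] by simp
  have XD: "X (?D \<omega>) xs = s_cube n k (?D ?\<omega>) xs + ?h (?D ?\<omega>) xs - incl_cube n k (s_cube n 0 (?D \<omega>)) xs"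
    by (simp add: X_def incl_cochain[OF k g])
  have gDs: "good n (pos_spaces 0) (?D (s_cube n 0 \<omega>))" by (rule good_map_good[OF good_map_dF gs0])
  have gsD: "good n (pos_spaces 0) (s_cube n 0 (?D \<omega>))" by (rule good_map_good[OF good_map_s[OF le0] good_map_good[OF good_map_dF g]])
  have gWI: "good n (pos_spaces 0) (W_cube n 0 (I_cube n 0 \<omega>))" by (rule good_map_good[OF good_map_W[OF le0] gI])
  have eq: "(\<lambda>xs. ?D (s_cube n 0 \<omega>) xs + s_cube n 0 (?D \<omega>) xs) = (\<lambda>xs. \<omega> xs - W_cube n 0 (I_cube n 0 \<omega>) xs)"
    using s_homotopy[OF n le0 g] by blast
  have "incl_cube n k (?D (s_cube n 0 \<omega>)) xs + incl_cube n k (s_cube n 0 (?D \<omega>)) xs =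
      ?\<omega> xs - incl_cube n k (W_cube n 0 (I_cube n 0 \<omega>)) xs"
    using fun_cong[OF good_map_add[OF incl gDs gsD], of xs] fun_cong[OF good_map_diff[OF incl g gWI], of xs] unfolding eq by simp
  \<comment> \<open>Restricted to forms of the unsubdivided cube, the two homotopies have the same
    endpoint: \<open>pI\<close> becomes the plain integration, and \<open>Wi\<close> the included
    plain Whitney map.\<close>
  moreover have "W_cube n k (i_cube n k (p_cube n k (I_cube n k ?\<omega>))) = incl_cube n k (W_cube n 0 (I_cube n 0 \<omega>))"
    unfolding p_I_incl_cube[OF k g] by (rule W_i_cube[OF k gI])
  ultimately show "(?D (X \<omega>) + X (?D \<omega>)) xs = (0 :: pos list \<Rightarrow> real) xs"
    using homotopy_star[OF n k gi, of xs] DX XD by simp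
qed

theorem mainTheorem4:
  fixes n k :: nat
  assumes "1 \<le> n" and "1 \<le> k" and "k \<le> n"
  shows "deformation_retraction (C_cube n 0) (Omega_cube n k)
           (\<lambda>\<alpha>. W_cube n k (i_cube n k \<alpha>))
           (\<lambda>\<omega>. p_cube n k (I_cube n k \<omega>))
           (\<lambda>\<omega>. s_cube n k \<omega> + W_cube n k (a_cube n k (I_cube n k \<omega>)))
    \<and> (\<forall>\<omega>\<in>total_space (Omega_cube n 0). p_cube n k (I_cube n k (incl_cube n k \<omega>)) = I_cube n 0 \<omega>)
    \<and> (\<forall>\<alpha>\<in>total_space (C_cube n 0). W_cube n k (i_cube n k \<alpha>) = incl_cube n k (W_cube n 0 \<alpha>))
    \<and> (let X = (\<lambda>\<omega>. W_cube n k (a_cube n k (I_cube n k (incl_cube n k \<omega>)))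
                     + s_cube n k (incl_cube n k \<omega>) - incl_cube n k (s_cube n 0 \<omega>))
       in \<forall>\<omega>\<in>total_space (Omega_cube n 0).
            diff (Omega_cube n k) (X \<omega>) + X (diff (Omega_cube n 0) \<omega>) = 0)"
  unfolding Let_def diff_Omega_cube
  by (intro conjI ballI deformation_retraction_cube[OF assms(1,3)] p_I_incl_cube[OF assms(3) good_Omega_cube[OF le0]]
      W_i_cube[OF assms(3) good_C_cube] homotopy_difference_closed[OF assms(1,3) good_Omega_cube[OF le0]])

end
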